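(* Let $k$ be a field, let $A_1,\dots,A_n$ be non-empty disjoint finite sets of cardinalities $\alpha_1,\dots,\alpha_n$, and let $A=\bigcup_i A_i$. Any full-dimensional Cohen-Macaulay (over $k$) proper subcomplex $X$ of the simplicial sphere $\partial\Delta(A_1)*\partial\Delta(A_2)*\cdots*\partial\Delta(A_n)$ is a constructible simplicial complex whose geometric realization is homeomorphic to a ball. Moreover, the Stanley-Reisner ideal of $X$ in $k[A]$ is a polarization of an Artin monomial ideal in $k[x_1,\dots,x_n]$ strictly containing $(x_1^{\alpha_1},\dots,x_n^{\alpha_n})$, with respect to the map $A\to\{x_1,\dots,x_n\}$ sending the elements of $A_i$ to $x_i$.
   Context: For a finite set $V$, $\Delta(V)$ is the full simplex on $V$ and $\partial\Delta(V)$ is its boundary, the complex of all proper subsets of $V$. The join $X*Y$ of complexes on disjoint vertex sets is $\{F\cup G: F\in X, G\in Y\}$. The join $\partial\Delta(A_1)*\cdots*\partial\Delta(A_n)$ is a simplicial sphere of dimension $\sum_i|A_i|-1-n$; a subcomplex is full-dimensional if it has this same dimension. A simplicial complex is Cohen-Macaulay over $k$ if its Stanley-Reisner ring over $k$ is Cohen-Macaulay; the Stanley-Reisner ideal of $X$ on $V$ is generated in $k[V]$ by the monomials $\prod_{v\in R}v$ for $R\subseteq V$, $R\notin X$. A simplicial complex $X$ of dimension $d$ is constructible if either $X$ is a simplex of dimension $d$, or $X=Y\cup Z$ where $Y,Z$ are constructible of dimension $d$ and $Y\cap Z$ is constructible of dimension $d-1$. An Artin monomial ideal is a (proper) monomial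 ideal containing a power of each variable. Polarization: Let $V'\to V$ be a surjection of finite sets with $|V'|=|V|+1$ and let $v_1\ne v_2$ in $V'$ be the two elements with the same image. A monomial ideal $J'\subseteq k[V']$ is a simple separation of a monomial ideal $J\subseteq k[V]$ if (i) $J$ is the image of $J'$ under $k[V']\to k[V]$; (ii) both $x_{v_1},x_{v_2}$ occur in some minimal generators of $J'$; (iii) $x_{v_1}-x_{v_2}$ is a non-zero divisor in $k[V']/J'$. A proper separation is obtained by a succession of simple separations; a separation is the extension of a proper separation to a polynomial ring with possibly more variables (equivalently, it is obtained by a sequence of simple separations in which (ii) is not required). A polarization is a squarefree separation. So a polarization in $k[A]$ with respect to $A\to\{x_1,\dots,x_n\}$ maps onto the given ideal under $k[A]\to k[x_1,\dots,x_n]$, and the differences of variables in common fibers give a regular sequence for its quotient ring. *)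

theory Defs
  imports
    "HOL-Library.Poly_Mapping"
    "HOL-Library.Extended_Nat"
    "HOL-Algebra.QuotRing"
    "HOL-Algebra.Ring_Divisibility"
    "HOL-Analysis.Analysis"
begin

section \<open>Simplicial complexes\<close>

text \<open>
  A simplicial complex on a finite set \<open>V\<close> contains the empty face; the void family of faces,
  which has no dimension, is not counted as a complex.  Elements of \<open>V\<close> need not be vertices
  of the complex.
\<close>

definition abstract_simplicial_complex :: "'v set \<Rightarrow> 'v set set \<Rightarrow> bool" where
  "abstract_simplicial_complex V X \<longleftrightarrow>
     finite V \<and> X \<subseteq> Pow V \<and> {} \<in> X \<and> (\<forall>F\<in>X. \<forall>G. G \<subseteq> F \<longrightarrow> G \<in> X)"

text \<open>The complex \<open>{{}}\<close> has dimension \<open>-1\<close>.\<close>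

definition complex_dim :: "'v set set \<Rightarrow> int" where
  "complex_dim X = int (Max (card ` X)) - 1"

definition simplex_boundary :: "'v set \<Rightarrow> 'v set set" where
  "simplex_boundary V = {F. F \<subset> V}"

definition complex_join :: "'i set \<Rightarrow> ('i \<Rightarrow> 'v set set) \<Rightarrow> 'v set set" where
  "complex_join I X = {\<Union>i\<in>I. F i |F. \<forall>i\<in>I. F i \<in> X i}"

text \<open>\<open>constructible d X\<close>: the complex \<open>X\<close> is constructible of dimension \<open>d\<close>.\<close>

inductive constructible :: "int \<Rightarrow> 'v set set \<Rightarrow> bool" where
  simplex: "finite F \<Longrightarrow> constructible (int (card F) - 1) (Pow F)"
| union: "constructible d Y \<Longrightarrow> constructible d Z \<Longrightarrow> constructible (d - 1) (Y \<inter> Z)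
    \<Longrightarrow> constructible d (Y \<union> Z)"

text \<open>
  Points of the geometric realization are given by their barycentric coordinates.  For a finite
  complex the topology inherited from the product topology is the usual one.
\<close>

definition geometric_realization :: "'v set set \<Rightarrow> ('v \<Rightarrow> real) topology" where
  "geometric_realization X = subtopology (powertop_real UNIV)
     {w. (\<forall>v. 0 \<le> w v) \<and> {v. w v \<noteq> 0} \<in> X \<and> (\<Sum>v | w v \<noteq> 0. w v) = 1}"

definition closed_nball :: "nat \<Rightarrow> (nat \<Rightarrow> real) topology" where
  "closed_nball m = subtopology (Euclidean_space m) {x. (\<Sum>i<m. (x i)\<^sup>2) \<le> 1}"


section \<open>Cohen-Macaulay rings\<close>

definition nonzerodivisor :: "('a, 'b) ring_scheme \<Rightarrow> 'a \<Rightarrow> bool" where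
  "nonzerodivisor R a \<longleftrightarrow>
     a \<in> carrier R \<and> (\<forall>b\<in>carrier R. a \<otimes>\<^bsub>R\<^esub> b = \<zero>\<^bsub>R\<^esub> \<longrightarrow> b = \<zero>\<^bsub>R\<^esub>)"

definition regular_sequence :: "('a, 'b) ring_scheme \<Rightarrow> 'a list \<Rightarrow> bool" where
  "regular_sequence R xs \<longleftrightarrow>
     set xs \<subseteq> carrier R \<and> Idl\<^bsub>R\<^esub> (set xs) \<noteq> carrier R \<and>
     (\<forall>i<length xs. nonzerodivisor (R Quot (Idl\<^bsub>R\<^esub> (set (take i xs))))
        ((Idl\<^bsub>R\<^esub> (set (take i xs))) +>\<^bsub>R\<^esub> (xs ! i)))"

definition ideal_depth :: "('a, 'b) ring_scheme \<Rightarrow> 'a set \<Rightarrow> enat" where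
  "ideal_depth R I = (SUP xs\<in>{xs. regular_sequence R xs \<and> set xs \<subseteq> I}. enat (length xs))"

text \<open>Codimension (height) of a prime ideal \<open>P\<close>: the supremum of the lengths \<open>r\<close> of chains
  \<open>P\<^sub>0 \<subset> \<dots> \<subset> P\<^sub>r = P\<close> of prime ideals.\<close>

definition prime_codim :: "('a, 'b) ring_scheme \<Rightarrow> 'a set \<Rightarrow> enat" where
  "prime_codim R P =
     (SUP Ps\<in>{Ps. Ps \<noteq> [] \<and> (\<forall>Q\<in>set Ps. primeideal Q R) \<and> sorted_wrt (\<subset>) Ps \<and> last Ps = P}.
        enat (length Ps - 1))"

text \<open>Cohen-Macaulay rings as in Eisenbud, Commutative Algebra, Section 18.2.\<close>

definition cohen_macaulay_ring :: "('a, 'b) ring_scheme \<Rightarrow> bool" where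
  "cohen_macaulay_ring R \<longleftrightarrow>
     cring R \<and> noetherian_ring R \<and> (\<forall>P. maximalideal P R \<longrightarrow> ideal_depth R P = prime_codim R P)"


section \<open>Polynomial rings and monomial ideals\<close>

text \<open>Monomials are identified with their exponent vectors.\<close>

type_synonym ('v, 'k) mpoly = "('v \<Rightarrow>\<^sub>0 nat) \<Rightarrow>\<^sub>0 'k"

definition mvar :: "'v \<Rightarrow> ('v, 'k::field) mpoly" where
  "mvar v = Poly_Mapping.single (Poly_Mapping.single v 1) 1"

definition monom_of :: "('v \<Rightarrow>\<^sub>0 nat) \<Rightarrow> ('v, 'k::field) mpoly" where
  "monom_of m = Poly_Mapping.single m 1"

text \<open>The polynomial ring \<open>k[V]\<close>, for any set \<open>V\<close> of variables from the ambient type.\<close>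

definition mpoly_ring :: "'v set \<Rightarrow> ('v, 'k::field) mpoly ring" where
  "mpoly_ring V = \<lparr>carrier = {f. \<forall>m\<in>Poly_Mapping.keys f. Poly_Mapping.keys m \<subseteq> V},
     mult = (*), one = 1, zero = 0, add = (+)\<rparr>"

text \<open>The homomorphism \<open>k[V'] \<rightarrow> k[V]\<close> induced by a map of variables \<open>p\<close>.\<close>

definition map_monom :: "('v \<Rightarrow> 'w) \<Rightarrow> ('v \<Rightarrow>\<^sub>0 nat) \<Rightarrow> ('w \<Rightarrow>\<^sub>0 nat)" where
  "map_monom p m =
     (\<Sum>v\<in>Poly_Mapping.keys m. Poly_Mapping.single (p v) (Poly_Mapping.lookup m v))"

definition map_vars :: "('v \<Rightarrow> 'w) \<Rightarrow> ('v, 'k::field) mpoly \<Rightarrow> ('w, 'k) mpoly" where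
  "map_vars p f =
     (\<Sum>m\<in>Poly_Mapping.keys f. Poly_Mapping.single (map_monom p m) (Poly_Mapping.lookup f m))"

definition monomial_ideal :: "'v set \<Rightarrow> ('v, 'k::field) mpoly set \<Rightarrow> bool" where
  "monomial_ideal V J \<longleftrightarrow>
     (\<exists>M. (\<forall>m\<in>M. Poly_Mapping.keys m \<subseteq> V) \<and> J = Idl\<^bsub>mpoly_ring V\<^esub> (monom_of ` M))"

definition squarefree_monomial_ideal :: "'v set \<Rightarrow> ('v, 'k::field) mpoly set \<Rightarrow> bool" where
  "squarefree_monomial_ideal V J \<longleftrightarrow>
     (\<exists>M. (\<forall>m\<in>M. Poly_Mapping.keys m \<subseteq> V \<and> (\<forall>v. Poly_Mapping.lookup m v \<le> 1)) \<and>
        J = Idl\<^bsub>mpoly_ring V\<^esub> (monom_of ` M))"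

definition minimal_generators :: "('v, 'k::field) mpoly set \<Rightarrow> ('v \<Rightarrow>\<^sub>0 nat) set" where
  "minimal_generators J =
     {m. monom_of m \<in> J \<and> (\<forall>m' c. monom_of m' \<in> J \<and> m = m' + c \<longrightarrow> m' = m)}"

definition artin_monomial_ideal :: "'v set \<Rightarrow> ('v, 'k::field) mpoly set \<Rightarrow> bool" where
  "artin_monomial_ideal V J \<longleftrightarrow>
     monomial_ideal V J \<and> J \<noteq> carrier (mpoly_ring V) \<and> (\<forall>v\<in>V. \<exists>e::nat. mvar v ^ e \<in> J)"

definition stanley_reisner_ideal :: "'v set \<Rightarrow> 'v set set \<Rightarrow> ('v, 'k::field) mpoly set" where
  "stanley_reisner_ideal V X =
     Idl\<^bsub>mpoly_ring V\<^esub> {\<Prod>v\<in>R. mvar v |R. R \<subseteq> V \<and> R \<notin> X}"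

definition cohen_macaulay_complex :: "'k::field itself \<Rightarrow> 'v set \<Rightarrow> 'v set set \<Rightarrow> bool" where
  "cohen_macaulay_complex k V X \<longleftrightarrow>
     cohen_macaulay_ring (mpoly_ring V Quot (stanley_reisner_ideal V X :: ('v, 'k) mpoly set))"


section \<open>Separations and polarizations\<close>

definition simple_separation ::
  "('v \<Rightarrow> 'w) \<Rightarrow> 'v set \<Rightarrow> ('v, 'k::field) mpoly set \<Rightarrow> 'w set \<Rightarrow> ('w, 'k) mpoly set \<Rightarrow> bool"
  where
  "simple_separation p V' J' V J \<longleftrightarrow>
     finite V' \<and> p ` V' = V \<and> card V' = card V + 1 \<and>
     monomial_ideal V' J' \<and> monomial_ideal V J \<and> J = map_vars p ` J' \<and>
     (\<exists>v1\<in>V'. \<exists>v2\<in>V'. v1 \<noteq> v2 \<and> p v1 = p v2 \<and>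
        (\<exists>m\<in>minimal_generators J'. v1 \<in> Poly_Mapping.keys m) \<and>
        (\<exists>m\<in>minimal_generators J'. v2 \<in> Poly_Mapping.keys m) \<and>
        nonzerodivisor (mpoly_ring V' Quot J') (J' +>\<^bsub>mpoly_ring V'\<^esub> (mvar v1 - mvar v2)))"

text \<open>
  \<open>proper_separation V J p V' J'\<close>: the ideal \<open>J'\<close> of \<open>k[V']\<close> is obtained from the ideal \<open>J\<close> of
  \<open>k[V]\<close> by a succession of simple separations, and \<open>p : V' \<rightarrow> V\<close> is the composed surjection.
  The empty succession is taken up to a bijective renaming of the variables, so all intermediate
  sets of variables may be taken inside the type of \<open>V'\<close>: none is larger than \<open>V'\<close>.  The values
  of \<open>p\<close> outside \<open>V'\<close> are irrelevant.
\<close>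

inductive proper_separation ::
  "'w set \<Rightarrow> ('w, 'k::field) mpoly set \<Rightarrow> ('v \<Rightarrow> 'w) \<Rightarrow> 'v set \<Rightarrow> ('v, 'k) mpoly set \<Rightarrow> bool"
  for V J where
  rename: "finite V' \<Longrightarrow> bij_betw p V' V \<Longrightarrow> monomial_ideal V' J' \<Longrightarrow> monomial_ideal V J \<Longrightarrow>
    J = map_vars p ` J' \<Longrightarrow> proper_separation V J p V' J'"
| step: "proper_separation V J p V1 J1 \<Longrightarrow> simple_separation q V2 J2 V1 J1 \<Longrightarrow>
    (\<forall>v\<in>V2. r v = p (q v)) \<Longrightarrow> proper_separation V J r V2 J2"

text \<open>A separation is the extension of a proper separation, with variables \<open>V\<^sub>0\<close>, to possibly
  more variables, which \<open>p\<close> may send anywhere in \<open>V\<close>.\<close>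

definition separation ::
  "'w set \<Rightarrow> ('w, 'k::field) mpoly set \<Rightarrow> ('v \<Rightarrow> 'w) \<Rightarrow> 'v set \<Rightarrow> ('v, 'k) mpoly set \<Rightarrow> bool"
  where
  "separation V J p V' J' \<longleftrightarrow>
     finite V' \<and> p ` V' \<subseteq> V \<and>
     (\<exists>V\<^sub>0 J\<^sub>0. V\<^sub>0 \<subseteq> V' \<and> proper_separation V J p V\<^sub>0 J\<^sub>0 \<and> J' = Idl\<^bsub>mpoly_ring V'\<^esub> J\<^sub>0)"

definition polarization ::
  "'w set \<Rightarrow> ('w, 'k::field) mpoly set \<Rightarrow> ('v \<Rightarrow> 'w) \<Rightarrow> 'v set \<Rightarrow> ('v, 'k) mpoly set \<Rightarrow> bool"
  where
  "polarization V J p V' J' \<longleftrightarrow> separation V J p V' J' \<and> squarefree_monomial_ideal V' J'"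

end

theory Submission
  imports Defs
begin

text \<open>
  Let \<open>d = \<Sum>\<^sub>i (|A\<^sub>i| - 1)\<close>, let \<open>X\<close> be a subcomplex of the sphere and call \<open>c \<in> \<Prod>\<^sub>i {0, \<dots>, |A\<^sub>i| - 1}\<close> a
  standard type of \<open>X\<close> if \<open>X\<close> contains every \<open>B\<close> with \<open>|B \<inter> A\<^sub>i| = c\<^sub>i\<close> for all \<open>i\<close>.  By induction on the
  number of vertices \<open>X\<close> has at most as many facets of the sphere as it has standard types.
  The standard types are the exponents of the standard monomials of the image of the Stanley-Reisner
  ideal in \<open>k[x\<^sub>1, \<dots>, x\<^sub>n]\<close>.  If \<open>X\<close> is Cohen-Macaulay and full-dimensional then the \<open>d\<close> differences
  of variables in common fibers form a regular sequence on its Stanley-Reisner ring, since some regular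
  sequence of length \<open>d\<close> exists and the quotient by the differences has finite length.  This gives the
  polarization, and comparing the growth of Hilbert functions it also gives the reverse inequality
  between facets and standard types.

  The complexes for which equality holds, called extremal below, are closed under taking links, deletions
  of a vertex from the join and complementary sets of facets.  Choosing a vertex \<open>a \<in> A\<^sub>i\<close>, an extremal \<open>X\<close>
  is the union of the cone over the link of \<open>a\<close> and of a complex obtained by induction, which yields
  constructibility; keeping track of \<open>X\<close> and its complement simultaneously, the fan of the sphere is
  mapped by a positively homogeneous homeomorphism onto \<open>\<real>\<^sup>d\<close> in such a way that the cone of \<open>X\<close> becomes
  a half space, which yields the ball.
\<close>

section \<open>Facets of subcomplexes and standard types\<close>

text \<open>Splitting at a vertex leads to the intersection of the link with the far side, and depth
  conditions do not pass to such pieces in an evident way. Equality of two counts does: an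
  inequality valid for all subcomplexes and additive over a splitting is an equality on each part
  once it is one on the whole, and inclusion-exclusion handles the intersection. So the
  Cohen-Macaulay hypothesis is applied once, to \<open>X\<close> itself at the irrelevant maximal
  ideal, and the topology is drawn from the counts alone. The regular sequence obtained there
  consists of arbitrary, possibly inhomogeneous elements. The Koszul complex of the differences of
  variables carries its length over to them: the homology vanishes in positive degrees, and for
  homogeneous forms vanishing in degree one already means regularity. Hilbert functions are then
  compared by injections between sets of monomials, without dimensions of vector spaces. Cones with
  positively homogeneous maps replace balls with identified boundaries because they have explicit
  coordinates.\<close>

definition blocks :: "'i set \<Rightarrow> ('i \<Rightarrow> 'v set) \<Rightarrow> bool" where
  "blocks I A \<longleftrightarrow> finite I \<and> (\<forall>i\<in>I. finite (A i) \<and> A i \<noteq> {}) \<and> disjoint_family_on A I"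

text \<open>The void family qualifies, in contrast to \<open>abstract_simplicial_complex\<close>:
  the link or the far link of a complex can be void, and the recursion must reach these
  cases.\<close>

definition join_subcomplex :: "'i set \<Rightarrow> ('i \<Rightarrow> 'v set) \<Rightarrow> 'v set set \<Rightarrow> bool" where
  "join_subcomplex I A X \<longleftrightarrow>
     (\<forall>F\<in>X. F \<subseteq> \<Union>(A ` I) \<and> (\<forall>G. G \<subseteq> F \<longrightarrow> G \<in> X) \<and> (\<forall>i\<in>I. \<not> A i \<subseteq> F))"

text \<open>These are the facets of the sphere: exactly one element of each block is left
  out.\<close>

definition full_faces :: "'i set \<Rightarrow> ('i \<Rightarrow> 'v set) \<Rightarrow> 'v set set" where
  "full_faces I A = {F. F \<subseteq> \<Union>(A ` I) \<and> (\<forall>i\<in>I. card (A i - F) = 1)}"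

definition of_type :: "'i set \<Rightarrow> ('i \<Rightarrow> 'v set) \<Rightarrow> ('i \<Rightarrow> nat) \<Rightarrow> 'v set \<Rightarrow> bool" where
  "of_type I A c B \<longleftrightarrow> B \<subseteq> \<Union>(A ` I) \<and> (\<forall>i\<in>I. card (B \<inter> A i) = c i)"

text \<open>The bound on the entries reflects that the block \<open>A i\<close> itself is a nonface,
  which forces the power of \<open>x_i\<close> with exponent \<open>card (A i)\<close> into the
  image ideal. Below this bound smaller sets can be enlarged to sets of type exactly
  \<open>c\<close>, so testing those suffices.\<close>

definition std_types :: "'i set \<Rightarrow> ('i \<Rightarrow> 'v set) \<Rightarrow> 'v set set \<Rightarrow> ('i \<Rightarrow> nat) set" where
  "std_types I A X = {c \<in> PiE I (\<lambda>i. {..<card (A i)}). \<forall>B. of_type I A c B \<longrightarrow> B \<in> X}"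

definition vertex_link :: "'v \<Rightarrow> 'v set set \<Rightarrow> 'v set set" where
  "vertex_link a X = {F. a \<notin> F \<and> insert a F \<in> X}"

text \<open>A facet of the sphere avoiding \<open>a\<close> contains the rest of the block, so the
  part of \<open>X\<close> away from \<open>a\<close> is governed by the link of the simplex
  \<open>Ai - {a}\<close>. This is that link.\<close>

definition far_link :: "'v set \<Rightarrow> 'v \<Rightarrow> 'v set set \<Rightarrow> 'v set set" where
  "far_link Ai a X = {F. F \<inter> Ai = {} \<and> F \<union> (Ai - {a}) \<in> X}"

text \<open>The join of the boundary of the simplex \<open>Ai - {a}\<close> with the far link: the
  portion of the equator, that is of the link of \<open>a\<close> in the sphere, along which the
  facets of \<open>X\<close> avoiding \<open>a\<close> border it.\<close>

definition far_join :: "'v set \<Rightarrow> 'v \<Rightarrow> 'v set set \<Rightarrow> 'v set set" where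
  "far_join Ai a X = {F. a \<notin> F \<and> \<not> Ai - {a} \<subseteq> F \<and> F \<union> (Ai - {a}) \<in> X}"

lemma blocksD:
  assumes "blocks I A"
  shows "finite I" "i \<in> I \<Longrightarrow> finite (A i)" "i \<in> I \<Longrightarrow> A i \<noteq> {}" "finite (\<Union>(A ` I))"
    "i \<in> I \<Longrightarrow> j \<in> I \<Longrightarrow> i \<noteq> j \<Longrightarrow> A i \<inter> A j = {}"
  using assms unfolding blocks_def disjoint_family_on_def by auto

lemma blocks_shrink:
  assumes "blocks I A" "i \<in> I" "C \<subseteq> A i" "C \<noteq> {}"
  shows "blocks I (A(i := C))"
proof -
  have "(A(i := C)) j \<inter> (A(i := C)) k \<subseteq> A j \<inter> A k" for j k
    using assms(3) by auto
  then have "disjoint_family_on (A(i := C)) I"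
    using assms(1) unfolding blocks_def disjoint_family_on_def by blast
  moreover have "finite C" using assms finite_subset unfolding blocks_def by blast
  ultimately show ?thesis using assms unfolding blocks_def by auto
qed

lemma join_subcomplexD:
  assumes "join_subcomplex I A X" "F \<in> X"
  shows "F \<subseteq> \<Union>(A ` I)" "G \<subseteq> F \<Longrightarrow> G \<in> X" "i \<in> I \<Longrightarrow> \<not> A i \<subseteq> F"
  using assms unfolding join_subcomplex_def by auto

lemma finite_std_types: "blocks I A \<Longrightarrow> finite (std_types I A X)"
  unfolding std_types_def
  by (rule finite_subset[OF _ finite_PiE[of I "\<lambda>i. {..<card (A i)}"]]) (auto dest: blocksD(1))

lemma finite_full_faces: "blocks I A \<Longrightarrow> finite (full_faces I A)"
  unfolding full_faces_def
  by (rule finite_subset[of _ "Pow (\<Union>(A ` I))"]) (use blocksD(4)[of I A] in auto)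

lemma of_type_extend:
  assumes "blocks I A" "B \<subseteq> \<Union>(A ` I)" "\<And>i. i \<in> I \<Longrightarrow> card (B \<inter> A i) \<le> c i \<and> c i \<le> card (A i)"
  shows "\<exists>B'. B \<subseteq> B' \<and> of_type I A c B'"
proof -
  have "\<exists>C. B \<inter> A i \<subseteq> C \<and> C \<subseteq> A i \<and> card C = c i" if "i \<in> I" for i
    using assms(3)[OF that] exists_subset_between[of "B \<inter> A i" "c i" "A i"]
      blocksD(2)[OF assms(1) that] by blast
  then obtain C where C: "\<And>i. i \<in> I \<Longrightarrow> B \<inter> A i \<subseteq> C i \<and> C i \<subseteq> A i \<and> card (C i) = c i"
    by metis
  have *: "(\<Union>(C ` I)) \<inter> A i = C i" if "i \<in> I" for i
  proof -
    have "C j \<inter> A i = {}" if "j \<in> I" "j \<noteq> i" for j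
      using C[OF that(1)] blocksD(5)[OF assms(1) \<open>i \<in> I\<close> that(1)] that(2) by blast
    then have "\<Union>(C ` (I - {i})) \<inter> A i = {}" by auto
    moreover have "\<Union>(C ` I) = C i \<union> \<Union>(C ` (I - {i}))" using that by auto
    ultimately show ?thesis using C[OF that] by auto
  qed
  have "B \<subseteq> \<Union>(C ` I)"
  proof
    fix x assume "x \<in> B"
    then obtain i where "i \<in> I" "x \<in> B \<inter> A i" using assms(2) by auto
    then show "x \<in> \<Union>(C ` I)" using C[of i] by auto
  qed
  moreover have "\<Union>(C ` I) \<subseteq> \<Union>(A ` I)" using C by (meson UN_mono subset_refl)
  moreover have "card (\<Union>(C ` I) \<inter> A i) = c i" if "i \<in> I" for i using *[OF that] C[OF that] by simp
  ultimately show ?thesis unfolding of_type_def by (intro exI[of _ "\<Union>(C ` I)"]) blast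
qed

text \<open>Block by block, a set of smaller type can be enlarged to one of type \<open>c\<close>,
  and \<open>X\<close> is closed under subsets.\<close>

lemma std_types_le:
  assumes "blocks I A" "join_subcomplex I A X" "c \<in> std_types I A X"
    "B \<subseteq> \<Union>(A ` I)" "\<And>i. i \<in> I \<Longrightarrow> card (B \<inter> A i) \<le> c i"
  shows "B \<in> X"
proof -
  have "c i \<le> card (A i)" if "i \<in> I" for i
    using assms(3) that unfolding std_types_def PiE_def Pi_def by (auto intro: less_imp_le)
  then obtain B' where "B \<subseteq> B'" "of_type I A c B'"
    using of_type_extend[OF assms(1,4), of c] assms(5) by auto
  then show ?thesis using assms(2,3) unfolding std_types_def join_subcomplex_def by blast
qed

section \<open>Splitting the sphere at a vertex of one block\<close>

locale split_block =
  fixes I :: "'i set" and A :: "'i \<Rightarrow> 'v set" and i :: 'i and a :: 'v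
  assumes bl: "blocks I A" and iI: "i \<in> I" and a: "a \<in> A i" and two: "2 \<le> card (A i)"
begin

text \<open>\<open>A1\<close> describes the link of \<open>a\<close> in the sphere. In
  \<open>A0\<close> the block is reduced to a point instead of being removed: the boundary of a
  point is \<open>{{}}\<close>, so it contributes nothing to the join, and the index set stays the
  same throughout the inductions.\<close>

abbreviation "A1 \<equiv> A(i := A i - {a})"
abbreviation "A0 \<equiv> A(i := {a})"

lemma fin: "finite (A i)" using bl iI blocksD by auto

lemma A1_ne: "A i - {a} \<noteq> {}"
proof
  assume "A i - {a} = {}"
  then have "A i = {a}" using a by auto
  then show False using two by simp
qed

lemma bl1: "blocks I A1" by (rule blocks_shrink[OF bl iI _ A1_ne]) auto
lemma bl0: "blocks I A0" by (rule blocks_shrink[OF bl iI]) (use a in auto)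

lemma dj: "j \<in> I \<Longrightarrow> j \<noteq> i \<Longrightarrow> A j \<inter> A i = {}"
  using blocksD(5)[OF bl] iI by auto

lemma a_notin: "j \<in> I \<Longrightarrow> j \<noteq> i \<Longrightarrow> a \<notin> A j"
  using dj a by auto

lemma V1: "\<Union>(A1 ` I) = \<Union>(A ` I) - {a}"
  using iI a_notin by (auto split: if_splits)

lemma V0: "\<Union>(A0 ` I) = \<Union>(A ` I) - (A i - {a})"
proof -
  have "\<Union>(A ` I) = A i \<union> \<Union>(A ` (I - {i}))" "\<Union>(A0 ` I) = A0 i \<union> \<Union>(A0 ` (I - {i}))"
    using iI by blast+
  moreover have "\<Union>(A0 ` (I - {i})) = \<Union>(A ` (I - {i}))" by (rule SUP_cong) auto
  moreover have "\<Union>(A ` (I - {i})) \<inter> A i = {}" using dj by (simp add: disjoint_iff) blast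
  ultimately show ?thesis using a by auto
qed

lemma card1: "card (A1 i) = card (A i) - 1" using a fin by simp

lemma sub_link:
  assumes "join_subcomplex I A X" shows "join_subcomplex I A1 (vertex_link a X)"
  unfolding join_subcomplex_def
proof (intro ballI conjI allI impI)
  fix F assume F: "F \<in> vertex_link a X"
  then have aF: "a \<notin> F" "insert a F \<in> X" by (auto simp: vertex_link_def)
  show "F \<subseteq> \<Union>(A1 ` I)" unfolding V1 using join_subcomplexD(1)[OF assms aF(2)] aF(1) by blast
  show "G \<in> vertex_link a X" if "G \<subseteq> F" for G
    using join_subcomplexD(2)[OF assms aF(2), of "insert a G"] aF that by (auto simp: vertex_link_def)
  show "\<not> A1 j \<subseteq> F" if "j \<in> I" for j
    using join_subcomplexD(3)[OF assms aF(2) that] a by (auto split: if_splits)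
qed

lemma sub_far:
  assumes "join_subcomplex I A X" shows "join_subcomplex I A0 (far_link (A i) a X)"
  unfolding join_subcomplex_def
proof (intro ballI conjI allI impI)
  fix F assume F: "F \<in> far_link (A i) a X"
  then have aF: "F \<inter> A i = {}" "F \<union> (A i - {a}) \<in> X" by (auto simp: far_link_def)
  show "F \<subseteq> \<Union>(A0 ` I)" unfolding V0 using join_subcomplexD(1)[OF assms aF(2)] aF(1) by blast
  show "G \<in> far_link (A i) a X" if "G \<subseteq> F" for G
    using join_subcomplexD(2)[OF assms aF(2), of "G \<union> (A i - {a})"] aF that
    by (auto simp: far_link_def)
  show "\<not> A0 j \<subseteq> F" if "j \<in> I" for j
    using join_subcomplexD(3)[OF assms aF(2) that] a aF(1) by (auto split: if_splits)
qed

lemma sub_far_join: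
  assumes "join_subcomplex I A X" shows "join_subcomplex I A1 (far_join (A i) a X)"
  unfolding join_subcomplex_def
proof (intro ballI conjI allI impI)
  fix F assume F: "F \<in> far_join (A i) a X"
  then have aF: "a \<notin> F" "\<not> A i - {a} \<subseteq> F" "F \<union> (A i - {a}) \<in> X" by (auto simp: far_join_def)
  show "F \<subseteq> \<Union>(A1 ` I)" unfolding V1 using join_subcomplexD(1)[OF assms aF(3)] aF(1) by blast
  show "G \<in> far_join (A i) a X" if "G \<subseteq> F" for G
    using join_subcomplexD(2)[OF assms aF(3), of "G \<union> (A i - {a})"] aF that
    by (auto simp: far_join_def)
  show "\<not> A1 j \<subseteq> F" if "j \<in> I" for j
    using join_subcomplexD(3)[OF assms aF(3) that] aF(2) by (auto split: if_splits)
qed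

lemma full_link:
  assumes "a \<in> F" shows "F \<in> full_faces I A \<longleftrightarrow> F - {a} \<in> full_faces I A1"
proof -
  have "card (A1 j - (F - {a})) = card (A j - F)" if "j \<in> I" for j
  proof -
    have "A1 j - (F - {a}) = A j - F" using a_notin[OF that] assms by auto
    then show ?thesis by simp
  qed
  moreover have "F \<subseteq> \<Union>(A ` I) \<longleftrightarrow> F - {a} \<subseteq> \<Union>(A1 ` I)" unfolding V1 using a iI by blast
  ultimately show ?thesis unfolding full_faces_def by auto
qed

lemma full_far_iff:
  assumes "F \<in> full_faces I A" shows "a \<notin> F \<longleftrightarrow> F \<inter> A i = A i - {a}"
proof -
  from assms iI have "card (A i - F) = 1" by (auto simp: full_faces_def)
  then obtain b where "A i - F = {b}" by (auto simp: card_1_singleton_iff)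
  then have b: "b \<in> A i" "x \<in> A i \<Longrightarrow> x \<noteq> b \<Longrightarrow> x \<in> F" "b \<notin> F" for x by blast+
  show ?thesis
  proof
    assume "a \<notin> F"
    then have "a = b" using b a by blast
    then show "F \<inter> A i = A i - {a}" using b by blast
  qed (use a in blast)
qed

lemma full_far:
  assumes "G \<inter> A i = {}" shows "G \<union> (A i - {a}) \<in> full_faces I A \<longleftrightarrow> G \<in> full_faces I A0"
proof -
  have "card (A0 j - G) = card (A j - (G \<union> (A i - {a})))" if "j \<in> I" for j
  proof (cases "j = i")
    case True
    then have "A j - (G \<union> (A i - {a})) = {a}" "A0 j - G = {a}" using assms a by auto
    then show ?thesis by simp
  next
    case False
    then have "A j - (G \<union> (A i - {a})) = A0 j - G" using dj[OF that] by auto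
    then show ?thesis by simp
  qed
  moreover have "G \<subseteq> \<Union>(A0 ` I) \<longleftrightarrow> G \<union> (A i - {a}) \<subseteq> \<Union>(A ` I)" unfolding V0 using a iI assms by blast
  ultimately show ?thesis unfolding full_faces_def by auto
qed

text \<open>Facets through \<open>a\<close> correspond to facets of the link. A facet missing
  \<open>a\<close> contains \<open>A i - {a}\<close>, and removing that simplex leaves a facet of
  the far link.\<close>

lemma card_full_split:
  assumes "join_subcomplex I A X"
  shows "card (X \<inter> full_faces I A) = card (vertex_link a X \<inter> full_faces I A1)
    + card (far_link (A i) a X \<inter> full_faces I A0)"
proof -
  let ?T = "X \<inter> full_faces I A"
  have fT: "finite ?T" using finite_full_faces[OF bl] by auto
  have 1: "bij_betw (\<lambda>F. F - {a}) {F\<in>?T. a \<in> F} (vertex_link a X \<inter> full_faces I A1)"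
    by (rule bij_betwI[where g = "insert a"])
      (auto simp: vertex_link_def full_link insert_absorb)
  have 2: "bij_betw (\<lambda>F. F - A i) {F\<in>?T. a \<notin> F} (far_link (A i) a X \<inter> full_faces I A0)"
  proof (rule bij_betwI[where g = "\<lambda>G. G \<union> (A i - {a})"])
    have *: "(F - A i) \<union> (A i - {a}) = F" if "F \<in> ?T" "a \<notin> F" for F
      using full_far_iff[of F] that by blast
    show "(\<lambda>F. F - A i) \<in> {F\<in>?T. a \<notin> F} \<rightarrow> far_link (A i) a X \<inter> full_faces I A0"
    proof
      fix F assume "F \<in> {F\<in>?T. a \<notin> F}"
      then show "F - A i \<in> far_link (A i) a X \<inter> full_faces I A0"
        using *[of F] full_far[of "F - A i"] by (auto simp: far_link_def)
    qed
    show "(F - A i) \<union> (A i - {a}) = F" if "F \<in> {F\<in>?T. a \<notin> F}" for F using * that by auto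
    show "(\<lambda>G. G \<union> (A i - {a})) \<in> far_link (A i) a X \<inter> full_faces I A0 \<rightarrow> {F\<in>?T. a \<notin> F}"
      using a by (auto simp: far_link_def full_far)
    show "G \<union> (A i - {a}) - A i = G" if "G \<in> far_link (A i) a X \<inter> full_faces I A0" for G
      using that by (auto simp: far_link_def)
  qed
  have "card ?T = card ({F\<in>?T. a \<in> F} \<union> {F\<in>?T. a \<notin> F})" by (rule arg_cong[of _ _ card]) auto
  also have "\<dots> = card {F\<in>?T. a \<in> F} + card {F\<in>?T. a \<notin> F}"
    by (rule card_Un_disjoint) (auto intro: finite_subset[OF _ fT])
  finally show ?thesis using bij_betw_same_card[OF 1] bij_betw_same_card[OF 2] by simp
qed

lemma full_far_join:
  assumes "b \<in> A i - {a}" "G \<inter> A i = {}"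
  shows "G \<union> (A i - {a,b}) \<in> full_faces I A1 \<longleftrightarrow> G \<in> full_faces I A0"
proof -
  have "card (A0 j - G) = card (A1 j - (G \<union> (A i - {a,b})))" if "j \<in> I" for j
  proof (cases "j = i")
    case True
    then have "A1 j - (G \<union> (A i - {a,b})) = {b}" "A0 j - G = {a}" using assms a by auto
    then show ?thesis by simp
  next
    case False
    then have "A1 j - (G \<union> (A i - {a,b})) = A0 j - G" using dj[OF that] by auto
    then show ?thesis by simp
  qed
  moreover have "G \<subseteq> \<Union>(A0 ` I) \<longleftrightarrow> G \<union> (A i - {a,b}) \<subseteq> \<Union>(A1 ` I)"
    unfolding V0 V1 using a iI assms by blast
  ultimately show ?thesis unfolding full_faces_def by auto
qed

lemma full_far_join_ex:
  assumes "F \<in> full_faces I A1" shows "\<exists>b\<in>A i - {a}. F \<inter> A i = A i - {a,b}"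
proof -
  have "card (A1 i - F) = 1" using assms iI unfolding full_faces_def by blast
  then obtain b where b: "(A i - {a}) - F = {b}" by (auto simp: card_1_singleton_iff)
  have "a \<notin> F" using assms V1 unfolding full_faces_def by blast
  then show ?thesis using b by (intro bexI[of _ b]) blast+
qed

text \<open>The boundary of the simplex \<open>A i - {a}\<close> has one facet for each omitted
  vertex \<open>b\<close>, which accounts for the factor.\<close>

lemma card_full_far_join:
  assumes "join_subcomplex I A X"
  shows "card (far_join (A i) a X \<inter> full_faces I A1) =
    (card (A i) - 1) * card (far_link (A i) a X \<inter> full_faces I A0)"
proof -
  let ?Q = "far_link (A i) a X \<inter> full_faces I A0"
  have "bij_betw (\<lambda>(b,G). G \<union> (A i - {a,b})) ((A i - {a}) \<times> ?Q) (far_join (A i) a X \<inter> full_faces I A1)"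
    unfolding bij_betw_def
  proof
    show "inj_on (\<lambda>(b,G). G \<union> (A i - {a,b})) ((A i - {a}) \<times> ?Q)"
      by (rule inj_onI) (auto simp: far_link_def)
    show "(\<lambda>(b,G). G \<union> (A i - {a,b})) ` ((A i - {a}) \<times> ?Q) = far_join (A i) a X \<inter> full_faces I A1"
    proof (intro equalityI subsetI)
      fix F assume "F \<in> (\<lambda>(b,G). G \<union> (A i - {a,b})) ` ((A i - {a}) \<times> ?Q)"
      then obtain b G where b: "b \<in> A i - {a}" "G \<in> ?Q" "F = G \<union> (A i - {a,b})" by auto
      then have "G \<inter> A i = {}" by (auto simp: far_link_def)
      moreover have "F \<union> (A i - {a}) = G \<union> (A i - {a})" using b by auto
      ultimately show "F \<in> far_join (A i) a X \<inter> full_faces I A1"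
        using b full_far_join[OF b(1), of G] a by (auto simp: far_link_def far_join_def)
    next
      fix F assume F: "F \<in> far_join (A i) a X \<inter> full_faces I A1"
      obtain b where b: "b\<in>A i - {a}" "F \<inter> A i = A i - {a,b}" using full_far_join_ex F by blast
      have eq: "(F - A i) \<union> (A i - {a,b}) = F" "(F - A i) \<union> (A i - {a}) = F \<union> (A i - {a})"
        using b F by (auto simp: far_join_def)
      then have "F - A i \<in> ?Q" using full_far_join[OF b(1), of "F - A i"] F
        by (auto simp: far_join_def far_link_def)
      then show "F \<in> (\<lambda>(b,G). G \<union> (A i - {a,b})) ` ((A i - {a}) \<times> ?Q)"
        using b(1) eq(1) by (intro image_eqI[of _ _ "(b, F - A i)"]) auto
    qed
  qed
  then have "card (far_join (A i) a X \<inter> full_faces I A1) = card ((A i - {a}) \<times> ?Q)"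
    by (simp add: bij_betw_same_card)
  then show ?thesis using a fin by (simp add: card_cartesian_product)
qed

end

section \<open>Standard types of the two sides, and the counting inequality\<close>

lemma of_type_grow:
  assumes "blocks I A" "of_type I A c' B" "c \<in> PiE I (\<lambda>i. {..<card (A i)})" "\<And>i. i \<in> I \<Longrightarrow> c' i \<le> c i"
  shows "\<exists>B'. B \<subseteq> B' \<and> of_type I A c B'"
proof (rule of_type_extend[OF assms(1)])
  show "B \<subseteq> \<Union>(A ` I)" using assms(2) by (simp add: of_type_def)
  show "card (B \<inter> A i) \<le> c i \<and> c i \<le> card (A i)" if "i \<in> I" for i
    using assms(2-4) that unfolding of_type_def PiE_iff by (metis lessThan_iff less_imp_le)
qed

lemma join_subcomplex_Un:
  "join_subcomplex I A X \<Longrightarrow> join_subcomplex I A Y \<Longrightarrow> join_subcomplex I A (X \<union> Y)"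
  unfolding join_subcomplex_def by (meson Un_iff)

lemma join_subcomplex_Int:
  "join_subcomplex I A X \<Longrightarrow> join_subcomplex I A Y \<Longrightarrow> join_subcomplex I A (X \<inter> Y)"
  unfolding join_subcomplex_def by (meson IntD1 IntD2 IntI)

context split_block
begin

abbreviation "P X \<equiv> vertex_link a X"
abbreviation "Qh X \<equiv> far_link (A i) a X"
abbreviation "Q X \<equiv> far_join (A i) a X"

lemma of_type_A1:
  assumes "a \<notin> B" shows "of_type I A1 c B \<longleftrightarrow> of_type I A c B"
proof -
  have "B \<inter> A1 j = B \<inter> A j" if "j \<in> I" for j using assms by auto
  then show ?thesis unfolding of_type_def V1 using assms by auto
qed

lemma of_type_A1_notin: "of_type I A1 c B \<Longrightarrow> a \<notin> B"
  unfolding of_type_def V1 by auto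

lemma of_type_remove:
  assumes "a \<in> B" "of_type I A c B" shows "of_type I A1 (c(i := c i - 1)) (B - {a})" "0 < c i"
proof -
  have "(B - {a}) \<inter> A1 j = B \<inter> A j" if "j \<in> I" "j \<noteq> i" for j using a_notin[OF that] that by auto
  moreover have "(B - {a}) \<inter> A1 i = (B \<inter> A i) - {a}" by auto
  moreover have "card ((B \<inter> A i) - {a}) = card (B \<inter> A i) - 1" using assms(1) a fin by simp
  ultimately show "of_type I A1 (c(i := c i - 1)) (B - {a})"
    using assms(2) iI unfolding of_type_def V1 by auto
  have "card (B \<inter> A i) \<noteq> 0" using assms(1) a fin by auto
  then show "0 < c i" using assms(2) iI unfolding of_type_def by auto
qed

lemma of_type_insert:
  assumes "of_type I A1 c B" shows "of_type I A (c(i := Suc (c i))) (insert a B)"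
proof -
  have aB: "a \<notin> B" using of_type_A1_notin[OF assms] .
  have "(insert a B) \<inter> A j = B \<inter> A1 j" if "j \<in> I" "j \<noteq> i" for j using a_notin[OF that] that by auto
  moreover have "(insert a B) \<inter> A i = insert a (B \<inter> A1 i)" using a aB by auto
  moreover have "card (insert a (B \<inter> A1 i)) = Suc (card (B \<inter> A1 i))" using aB fin by simp
  ultimately show ?thesis
    using assms a iI unfolding of_type_def V1 by auto
qed

lemma of_type_A0:
  assumes "c i = 0" shows "of_type I A0 c B \<longleftrightarrow> of_type I A c B"
proof -
  have "B \<inter> A0 j = B \<inter> A j" if "j \<in> I" "j \<noteq> i" for j using that by auto
  moreover have "card (B \<inter> A i) = 0 \<longleftrightarrow> B \<inter> A i = {}" "card (B \<inter> {a}) = 0 \<longleftrightarrow> B \<inter> {a} = {}"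
    using fin by auto
  ultimately show ?thesis using assms a iI unfolding of_type_def V0
    by (auto split: if_splits)
qed

lemma of_type_0_disj: "of_type I A c B \<Longrightarrow> c i = 0 \<Longrightarrow> B \<inter> A i = {}"
  using fin iI unfolding of_type_def by (metis card_eq_0_iff finite_Int)

lemma of_type_drop: "of_type I A c B \<Longrightarrow> of_type I A (c(i := 0)) (B - A i)"
proof -
  assume B: "of_type I A c B"
  have "(B - A i) \<inter> A j = B \<inter> A j" if "j \<in> I" "j \<noteq> i" for j using dj[OF that] by auto
  moreover have "(B - A i) \<inter> A i = {}" by auto
  ultimately show ?thesis using B unfolding of_type_def by auto
qed

lemma range1: "c \<in> PiE I (\<lambda>j. {..<card (A1 j)}) \<longleftrightarrow> c \<in> PiE I (\<lambda>j. {..<card (A j)}) \<and> c i < card (A i) - 1"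
proof -
  have "card (A1 j) \<le> card (A j)" for j using card1 by (cases "j = i") auto
  then show ?thesis using iI card1 unfolding PiE_iff by (auto intro: less_le_trans)
qed

lemma range0: "c \<in> PiE I (\<lambda>j. {..<card (A0 j)}) \<longleftrightarrow> c \<in> PiE I (\<lambda>j. {..<card (A j)}) \<and> c i = 0"
proof -
  have "card (A0 j) = (if j = i then 1 else card (A j))" for j by simp
  then have "(\<forall>j\<in>I. c j \<in> {..<card (A0 j)}) \<longleftrightarrow> (\<forall>j\<in>I. c j \<in> {..<card (A j)}) \<and> c i = 0"
    using iI two by (metis (no_types, lifting) lessThan_iff less_one less_le_trans zero_less_numeral)
  then show ?thesis unfolding PiE_iff by blast
qed

text \<open>A set through \<open>a\<close> loses one element of block \<open>i\<close> when
  \<open>a\<close> is removed, so its type only drops below \<open>c\<close>, and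
  \<open>std_types_le\<close> applies in the link.\<close>

lemma link_std_sub:
  assumes X: "join_subcomplex I A X" shows "std_types I A1 (P X) \<subseteq> std_types I A X"
proof
  fix c assume c: "c \<in> std_types I A1 (P X)"
  have "B \<in> X" if B: "of_type I A c B" for B
  proof (cases "a \<in> B")
    case False
    then have "B \<in> P X" using B c of_type_A1 unfolding std_types_def by auto
    then show ?thesis using join_subcomplexD(2)[OF X, of "insert a B" B] by (auto simp: vertex_link_def)
  next
    case True
    have "B - {a} \<in> P X"
      by (rule std_types_le[OF bl1 sub_link[OF X] c])
        (use of_type_remove[OF True B] in \<open>auto simp: of_type_def\<close>)
    then show ?thesis using True by (simp add: vertex_link_def insert_absorb)
  qed
  then show "c \<in> std_types I A X" using c range1 unfolding std_types_def by auto
qed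

text \<open>The first entry at \<open>i\<close> at which the column of \<open>c\<close> leaves the
  standard types of the link. It exists because entries from \<open>card (A i) - 1\<close> on are
  out of range for the smaller block.\<close>

definition height :: "'v set set \<Rightarrow> ('i \<Rightarrow> nat) \<Rightarrow> nat" where
  "height X c = (LEAST k. c(i := k) \<notin> std_types I A1 (P X))"

lemma height_notin: "c(i := height X c) \<notin> std_types I A1 (P X)"
  and height_le: "height X c \<le> card (A i) - 1"
proof -
  have "c(i := card (A i) - 1) \<notin> std_types I A1 (P X)"
    using range1 unfolding std_types_def by auto
  then show "c(i := height X c) \<notin> std_types I A1 (P X)" "height X c \<le> card (A i) - 1"
    unfolding height_def by (rule LeastI, rule Least_le)
qed

lemma below_height: "k < height X c \<Longrightarrow> c(i := k) \<in> std_types I A1 (P X)"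
  unfolding height_def using not_less_Least by blast

text \<open>Each standard type of the far link yields one further standard type of \<open>X\<close>,
  at the first free place of its column. A set of that type avoiding \<open>a\<close> lies in a face
  containing \<open>A i - {a}\<close>; one through \<open>a\<close> has, after removal of
  \<open>a\<close>, a standard type of the link by minimality of the height.\<close>

lemma far_std_image:
  assumes X: "join_subcomplex I A X" and c: "c \<in> std_types I A0 (Qh X)"
  shows "c(i := height X c) \<in> std_types I A X"
proof -
  have c0: "c i = 0" "c \<in> PiE I (\<lambda>j. {..<card (A j)})" using c range0 unfolding std_types_def by auto
  have "B \<in> X" if B: "of_type I A (c(i := height X c)) B" for B
  proof (cases "a \<in> B")
    case True
    have "of_type I A1 (c(i := height X c - 1)) (B - {a})" "0 < height X c"
      using of_type_remove[OF True B] by auto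
    moreover have "c(i := height X c - 1) \<in> std_types I A1 (P X)"
      using below_height calculation(2) by auto
    ultimately have "B - {a} \<in> P X" unfolding std_types_def by auto
    then show ?thesis using True by (simp add: vertex_link_def insert_absorb)
  next
    case False
    have "of_type I A0 c (B - A i)"
      using of_type_drop[OF B] c0(1) of_type_A0[of c] by (simp add: fun_upd_idem)
    then have "B - A i \<in> Qh X" using c unfolding std_types_def by auto
    then have "(B - A i) \<union> (A i - {a}) \<in> X" by (simp add: far_link_def)
    then show ?thesis using join_subcomplexD(2)[OF X, of _ B] False by blast
  qed
  moreover have "height X c < card (A i)" using height_le[of X c] two by auto
  ultimately show ?thesis using c0(2) iI unfolding std_types_def PiE_iff
    by (auto simp: extensional_def)
qed

definition far_std :: "'v set set \<Rightarrow> ('i \<Rightarrow> nat) set" where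
  "far_std X = (\<lambda>c. c(i := height X c)) ` std_types I A0 (Qh X)"

lemma far_std_disj: "std_types I A1 (P X) \<inter> far_std X = {}"
  using height_notin unfolding far_std_def by auto

lemma far_std_iff: "c \<in> far_std X \<longleftrightarrow> c(i := 0) \<in> std_types I A0 (Qh X) \<and> c i = height X (c(i := 0))"
proof
  assume "c \<in> far_std X"
  then obtain c0 where c0: "c0 \<in> std_types I A0 (Qh X)" "c = c0(i := height X c0)"
    unfolding far_std_def by auto
  then have "c0 i = 0" using range0 unfolding std_types_def by auto
  then have "c(i := 0) = c0" using c0 by auto
  then show "c(i := 0) \<in> std_types I A0 (Qh X) \<and> c i = height X (c(i := 0))" using c0 by auto
next
  assume "c(i := 0) \<in> std_types I A0 (Qh X) \<and> c i = height X (c(i := 0))"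
  then show "c \<in> far_std X" unfolding far_std_def
    by (intro image_eqI[of _ _ "c(i := 0)"]) auto
qed

lemma card_far_std: "card (far_std X) = card (std_types I A0 (Qh X))"
  unfolding far_std_def
proof (rule card_image, rule inj_onI)
  fix c c' assume *: "c \<in> std_types I A0 (Qh X)" "c' \<in> std_types I A0 (Qh X)"
    "c(i := height X c) = c'(i := height X c')"
  then have "c i = 0" "c' i = 0" using range0 unfolding std_types_def by auto
  moreover have "c j = c' j" if "j \<noteq> i" for j using fun_cong[OF *(3), of j] that by auto
  ultimately show "c = c'" by (intro ext) metis
qed

lemma std_split_sub:
  assumes "join_subcomplex I A X"
  shows "std_types I A1 (P X) \<union> far_std X \<subseteq> std_types I A X"
  using link_std_sub[OF assms] far_std_image[OF assms] unfolding far_std_def by auto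

lemma card_std_split:
  "card (std_types I A1 (P X) \<union> far_std X) = card (std_types I A1 (P X)) + card (std_types I A0 (Qh X))"
  using card_Un_disjoint[OF _ _ far_std_disj[of X]] finite_std_types[OF bl1] finite_std_types[OF bl0]
    card_far_std[of X] by (simp add: far_std_def)

lemma smaller1: "card (\<Union>(A1 ` I)) < card (\<Union>(A ` I))"
  unfolding V1 by (rule psubset_card_mono) (use blocksD(4)[OF bl] a iI in auto)

lemma smaller0: "card (\<Union>(A0 ` I)) < card (\<Union>(A ` I))"
  unfolding V0
proof (rule psubset_card_mono)
  show "finite (\<Union>(A ` I))" using blocksD(4)[OF bl] .
  obtain b where "b \<in> A i - {a}" using A1_ne by blast
  then show "\<Union>(A ` I) - (A i - {a}) \<subset> \<Union>(A ` I)" using iI by blast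
qed

end

lemma singleton_blocks:
  assumes "blocks I A" "\<not> (\<exists>i\<in>I. 2 \<le> card (A i))" "i \<in> I" shows "card (A i) = 1"
proof -
  have "card (A i) \<noteq> 0" using blocksD[OF assms(1)] assms(3) by (simp add: card_eq_0_iff)
  then show ?thesis using assms(2,3) by force
qed

text \<open>The base of the inductions: with one-point blocks the sphere has no face except the
  empty one.\<close>

lemma singleton_subcomplex:
  assumes "blocks I A" "\<not> (\<exists>i\<in>I. 2 \<le> card (A i))" "join_subcomplex I A X"
  shows "X \<subseteq> {{}}" "full_faces I A = {{}}"
proof -
  have sing: "\<exists>x. A i = {x}" if "i \<in> I" for i
    using singleton_blocks[OF assms(1,2) that] by (auto simp: card_1_singleton_iff)
  have no: "F = {}" if F: "F \<subseteq> \<Union>(A ` I)" "\<And>i. i \<in> I \<Longrightarrow> \<not> A i \<subseteq> F" for F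
  proof (rule ccontr)
    assume "F \<noteq> {}"
    then obtain x i where "x \<in> F" "i \<in> I" "x \<in> A i" using F(1) by blast
    then show False using sing[of i] F(2)[of i] by auto
  qed
  show "X \<subseteq> {{}}"
  proof
    fix F assume "F \<in> X"
    then have "F = {}" using no[of F] join_subcomplexD(1,3)[OF assms(3)] by metis
    then show "F \<in> {{}}" by simp
  qed
  have "F = {}" if "F \<in> full_faces I A" for F
  proof (rule no)
    show "F \<subseteq> \<Union>(A ` I)" using that by (auto simp: full_faces_def)
    fix i assume i: "i \<in> I"
    then have "card (A i - F) = 1" using that by (auto simp: full_faces_def)
    then show "\<not> A i \<subseteq> F" by (metis Diff_eq_empty_iff card.empty zero_neq_one)
  qed
  then show "full_faces I A = {{}}"
    using singleton_blocks[OF assms(1,2)] by (auto simp: full_faces_def)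
qed

lemma zero_std_type:
  assumes "blocks I A" "{} \<in> X"
  shows "(\<lambda>i\<in>I. 0) \<in> std_types I A X"
proof -
  have "B \<in> X" if "of_type I A (\<lambda>i\<in>I. 0) B" for B
  proof -
    have "B \<inter> A i = {}" if "i \<in> I" for i
    proof -
      have "card (B \<inter> A i) = 0" using \<open>of_type I A (\<lambda>i\<in>I. 0) B\<close> \<open>i \<in> I\<close> by (auto simp: of_type_def)
      then show ?thesis using blocksD(2)[OF assms(1) \<open>i \<in> I\<close>] by (meson card_0_eq finite_Int)
    qed
    then have "B \<inter> \<Union>(A ` I) = {}" by auto
    then have "B = {}" using that unfolding of_type_def by blast
    then show ?thesis using assms(2) by simp
  qed
  then show ?thesis using blocksD(2,3)[OF assms(1)]
    by (auto simp: std_types_def PiE_iff card_gt_0_iff)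
qed

text \<open>Both counts split at \<open>a\<close>: the facets exactly, while the standard types
  contain those of the link and, disjointly, one for each standard type of the far link.\<close>

theorem card_full_le_card_std:
  assumes "blocks I A" "join_subcomplex I A X"
  shows "card (X \<inter> full_faces I A) \<le> card (std_types I A X)"
  using assms
proof (induction "card (\<Union>(A ` I))" arbitrary: A X rule: less_induct)
  case less
  show ?case
  proof (cases "\<exists>i\<in>I. 2 \<le> card (A i)")
    case True
    then obtain i where i: "i \<in> I" "2 \<le> card (A i)" by auto
    then obtain a where "a \<in> A i" using blocksD(3)[OF less.prems(1)] by blast
    then interpret split_block I A i a using less.prems(1) i by unfold_locales
    have "card (X \<inter> full_faces I A) = card (P X \<inter> full_faces I A1) + card (Qh X \<inter> full_faces I A0)"
      by (rule card_full_split[OF less.prems(2)])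
    also have "\<dots> \<le> card (std_types I A1 (P X)) + card (std_types I A0 (Qh X))"
      using less.hyps[OF smaller1 bl1 sub_link[OF less.prems(2)]]
        less.hyps[OF smaller0 bl0 sub_far[OF less.prems(2)]] by simp
    also have "\<dots> \<le> card (std_types I A X)"
      unfolding card_std_split[symmetric]
      by (rule card_mono[OF finite_std_types[OF bl] std_split_sub[OF less.prems(2)]])
    finally show ?thesis .
  next
    case False
    note s = singleton_subcomplex[OF less.prems(1) False less.prems(2)]
    show ?thesis
    proof (cases "{} \<in> X")
      case True
      then have "std_types I A X \<noteq> {}" using zero_std_type[OF less.prems(1)] by auto
      then have "1 \<le> card (std_types I A X)"
        using finite_std_types[OF less.prems(1), of X] by (simp add: Suc_le_eq card_gt_0_iff)
      moreover have "card (X \<inter> full_faces I A) \<le> 1" using s(2) card_mono[of "{{}}" "X \<inter> {{}}"] by auto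
      ultimately show ?thesis by linarith
    next
      case False
      then show ?thesis using s by auto
    qed
  qed
qed

text \<open>Only one inequality is stated, as the opposite one holds for every subcomplex.\<close>

definition extremal :: "'i set \<Rightarrow> ('i \<Rightarrow> 'v set) \<Rightarrow> 'v set set \<Rightarrow> bool" where
  "extremal I A X \<longleftrightarrow> blocks I A \<and> join_subcomplex I A X \<and>
     card (std_types I A X) \<le> card (X \<inter> full_faces I A)"

lemma extremalD:
  assumes "extremal I A X"
  shows "blocks I A" "join_subcomplex I A X" "card (std_types I A X) = card (X \<inter> full_faces I A)"
  using assms card_full_le_card_std[of I A X] unfolding extremal_def by auto

context split_block
begin

text \<open>The inequalities for the link and the far link add up to an equality, so each of them is
  one. The inclusion \<open>std_split_sub\<close> then relates finite sets of the same
  cardinality.\<close>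

lemma extremal_split:
  assumes "extremal I A X"
  shows "extremal I A1 (P X)" "extremal I A0 (Qh X)" "std_types I A X = std_types I A1 (P X) \<union> far_std X"
proof -
  note X = extremalD[OF assms]
  have le: "card (std_types I A1 (P X) \<union> far_std X) \<le> card (std_types I A X)"
    by (rule card_mono[OF finite_std_types[OF bl] std_split_sub[OF X(2)]])
  have l1: "card (P X \<inter> full_faces I A1) \<le> card (std_types I A1 (P X))"
    by (rule card_full_le_card_std[OF bl1 sub_link[OF X(2)]])
  have l0: "card (Qh X \<inter> full_faces I A0) \<le> card (std_types I A0 (Qh X))"
    by (rule card_full_le_card_std[OF bl0 sub_far[OF X(2)]])
  note sum = card_full_split[OF X(2)] card_std_split[of X]
  show "extremal I A1 (P X)" "extremal I A0 (Qh X)"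
    unfolding extremal_def using bl1 bl0 sub_link[OF X(2)] sub_far[OF X(2)] le l1 l0 sum X(3) by auto
  show "std_types I A X = std_types I A1 (P X) \<union> far_std X"
    by (rule card_seteq[symmetric, OF finite_std_types[OF bl] std_split_sub[OF X(2)]])
      (use le l1 l0 sum X(3) in auto)
qed

text \<open>In block \<open>i\<close> the far join only forbids containing all of
  \<open>A i - {a}\<close>, so over each standard type of the far link it has a full column.\<close>

lemma std_far_join:
  assumes X: "join_subcomplex I A X"
  shows "c \<in> std_types I A1 (Q X) \<longleftrightarrow> c(i := 0) \<in> std_types I A0 (Qh X) \<and> c \<in> PiE I (\<lambda>j. {..<card (A1 j)})"
proof -
  have r: "c(i := 0) \<in> PiE I (\<lambda>j. {..<card (A0 j)})" if "c \<in> PiE I (\<lambda>j. {..<card (A1 j)})"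
    using that range1 range0 two iI unfolding PiE_iff by (auto simp: extensional_def)
  have "(\<forall>B. of_type I A1 c B \<longrightarrow> B \<in> Q X) \<longleftrightarrow> (\<forall>B. of_type I A0 (c(i:=0)) B \<longrightarrow> B \<in> Qh X)"
    if c: "c \<in> PiE I (\<lambda>j. {..<card (A1 j)})"
  proof (intro iffI allI impI)
    fix B assume *: "\<forall>B. of_type I A1 c B \<longrightarrow> B \<in> Q X" and B0: "of_type I A0 (c(i:=0)) B"
    have BA: "of_type I A (c(i:=0)) B" using B0 of_type_A0[of "c(i:=0)"] by simp
    then have d: "B \<inter> A i = {}" using of_type_0_disj[OF BA] by simp
    have "a \<notin> B" using d a by blast
    then have "of_type I A1 (c(i:=0)) B" using BA of_type_A1 by auto
    then have "\<exists>B'. B \<subseteq> B' \<and> of_type I A1 c B'"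
      by (rule of_type_grow[OF bl1 _ c]) simp
    then obtain B' where B': "B \<subseteq> B'" "of_type I A1 c B'" by blast
    then have "B' \<union> (A i - {a}) \<in> X" using * by (auto simp: far_join_def)
    then have "B \<union> (A i - {a}) \<in> X" by (rule join_subcomplexD(2)[OF X]) (use B' in auto)
    then show "B \<in> Qh X" using d by (simp add: far_link_def)
  next
    fix B assume *: "\<forall>B. of_type I A0 (c(i:=0)) B \<longrightarrow> B \<in> Qh X" and B: "of_type I A1 c B"
    have aB: "a \<notin> B" using of_type_A1_notin[OF B] .
    have BA: "of_type I A c B" using B of_type_A1 aB by auto
    have "of_type I A0 (c(i:=0)) (B - A i)" using of_type_drop[OF BA] of_type_A0[of "c(i:=0)"] by simp
    then have "(B - A i) \<union> (A i - {a}) \<in> X" using * by (auto simp: far_link_def)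
    moreover have "(B - A i) \<union> (A i - {a}) = B \<union> (A i - {a})" using aB by auto
    moreover have "\<not> A i - {a} \<subseteq> B"
    proof
      assume "A i - {a} \<subseteq> B"
      then have "B \<inter> A1 i = A1 i" by auto
      then have "c i = card (A1 i)" using B iI unfolding of_type_def by auto
      then show False using c iI unfolding PiE_iff by auto
    qed
    ultimately show "B \<in> Q X" using aB by (simp add: far_join_def)
  qed
  then show ?thesis using r unfolding std_types_def by blast
qed

lemma card_std_far_join:
  assumes X: "join_subcomplex I A X"
  shows "card (std_types I A1 (Q X)) = (card (A i) - 1) * card (std_types I A0 (Qh X))"
proof -
  have "bij_betw (\<lambda>(k,c). c(i := k)) ({..<card (A i) - 1} \<times> std_types I A0 (Qh X)) (std_types I A1 (Q X))"
  proof (rule bij_betwI[where g = "\<lambda>c. (c i, c(i := 0))"])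
    have z: "c i = 0" "c \<in> PiE I (\<lambda>j. {..<card (A j)})" if "c \<in> std_types I A0 (Qh X)" for c
      using that range0 unfolding std_types_def by auto
    show "(\<lambda>(k,c). c(i := k)) \<in> {..<card (A i) - 1} \<times> std_types I A0 (Qh X) \<rightarrow> std_types I A1 (Q X)"
    proof (clarify)
      fix k c assume k: "k < card (A i) - 1" and c: "c \<in> std_types I A0 (Qh X)"
      have "c(i := k) \<in> PiE I (\<lambda>j. {..<card (A1 j)})" unfolding range1
        using z[OF c] k iI unfolding PiE_iff by (auto simp: extensional_def)
      moreover have "c(i := 0) = c" using z[OF c] by (simp add: fun_upd_idem)
      ultimately show "c(i := k) \<in> std_types I A1 (Q X)" unfolding std_far_join[OF X] using c by simp
    qed
    show "(\<lambda>c. (c i, c(i := 0))) \<in> std_types I A1 (Q X) \<rightarrow> {..<card (A i) - 1} \<times> std_types I A0 (Qh X)"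
      using std_far_join[OF X] range1 by blast
    show "(\<lambda>c. (c i, c(i := 0))) ((\<lambda>(k,c). c(i := k)) kc) = kc"
      if "kc \<in> {..<card (A i) - 1} \<times> std_types I A0 (Qh X)" for kc
      using that z by (auto simp: fun_upd_idem)
  qed simp
  then have "card (std_types I A1 (Q X)) = card ({..<card (A i) - 1} \<times> std_types I A0 (Qh X))"
    by (simp add: bij_betw_same_card)
  then show ?thesis by (simp add: card_cartesian_product)
qed

lemma extremal_far_join:
  assumes "extremal I A X" shows "extremal I A1 (Q X)"
  using extremalD[OF assms] extremalD(3)[OF extremal_split(2)[OF assms]] bl1 sub_far_join
    card_std_far_join card_full_far_join unfolding extremal_def by auto

text \<open>Take \<open>c\<close> standard for the union but for neither part, and lower its entry
  at \<open>i\<close> to the height \<open>m\<close> of its column. By equality in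
  \<open>extremal_split\<close> the new type is not standard for \<open>X\<close>, so some
  \<open>B\<close> of this type is missing from \<open>X\<close>. But \<open>B\<close> does lie in
  \<open>X\<close>: if it contains \<open>a\<close>, by the choice of the height; otherwise because
  it extends to a set of type \<open>c\<close>, a face of the link or of the far join.\<close>

lemma std_union:
  assumes ext: "extremal I A X"
  shows "std_types I A1 (P X \<union> Q X) = std_types I A1 (P X) \<union> std_types I A1 (Q X)"
proof (intro equalityI subsetI)
  note X = extremalD(2)[OF ext]
  fix c assume c: "c \<in> std_types I A1 (P X \<union> Q X)"
  then have cr: "c \<in> PiE I (\<lambda>j. {..<card (A1 j)})" by (auto simp: std_types_def)
  show "c \<in> std_types I A1 (P X) \<union> std_types I A1 (Q X)"
  proof (rule ccontr)
    assume no: "c \<notin> std_types I A1 (P X) \<union> std_types I A1 (Q X)"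
    define m where "m = height X (c(i := 0))"
    have m: "c(i := m) \<notin> std_types I A1 (P X)" "m \<le> card (A i) - 1"
      using height_notin[of "c(i := 0)" X] height_le[of X "c(i := 0)"] unfolding m_def by auto
    have mc: "m \<le> c i"
    proof (rule ccontr)
      assume "\<not> m \<le> c i"
      then have "(c(i := 0))(i := c i) \<in> std_types I A1 (P X)" by (intro below_height) (simp add: m_def)
      then show False using no by simp
    qed
    have "c(i := 0) \<notin> std_types I A0 (Qh X)" using no cr std_far_join[OF X] by auto
    then have "c(i := m) \<notin> far_std X" unfolding far_std_iff by simp
    then have "c(i := m) \<notin> std_types I A X" using m extremal_split(3)[OF ext] by blast
    \<comment> \<open>The height may equal \<open>card (A i) - 1\<close>, which is out of range for
      the smaller block but still admissible for \<open>A i\<close>.\<close>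
    moreover have "c(i := m) \<in> PiE I (\<lambda>j. {..<card (A j)})"
    proof -
      have "c \<in> PiE I (\<lambda>j. {..<card (A j)})" "m < card (A i)" using cr range1 m(2) two by auto
      then show ?thesis using iI unfolding PiE_iff by (auto simp: extensional_def)
    qed
    ultimately obtain B where B: "of_type I A (c(i := m)) B" "B \<notin> X" unfolding std_types_def by auto
    show False
    proof (cases "a \<in> B")
      case True
      have "of_type I A1 (c(i := m - 1)) (B - {a})" "0 < m" using of_type_remove[OF True B(1)] by auto
      moreover have "(c(i := 0))(i := m - 1) \<in> std_types I A1 (P X)"
        using calculation(2) by (intro below_height) (simp add: m_def)
      ultimately have "B - {a} \<in> P X" unfolding std_types_def by auto
      then have "B \<in> X" using True by (simp add: vertex_link_def insert_absorb)
      then show False using B by simp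
    next
      case False
      then have Bm: "of_type I A1 (c(i := m)) B" using B of_type_A1 by auto
      have "\<exists>B'. B \<subseteq> B' \<and> of_type I A1 c B'"
        by (rule of_type_grow[OF bl1 Bm cr]) (use mc in simp)
      then obtain B' where B': "B \<subseteq> B'" "of_type I A1 c B'" by blast
      then have "B' \<in> P X \<union> Q X" using c unfolding std_types_def by auto
      then have "insert a B' \<in> X \<or> B' \<union> (A i - {a}) \<in> X" by (auto simp: vertex_link_def far_join_def)
      then have "B \<in> X"
        using join_subcomplexD(2)[OF X, of "insert a B'" B] join_subcomplexD(2)[OF X, of "B' \<union> (A i - {a})" B] B'
        by blast
      then show False using B by simp
    qed
  qed
qed (auto simp: std_types_def)

lemma std_inter: "std_types I A1 (P X \<inter> Q X) = std_types I A1 (P X) \<inter> std_types I A1 (Q X)"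
  unfolding std_types_def by auto

text \<open>Inclusion-exclusion holds for facets and, by \<open>std_union\<close>, also for standard
  types. The general inequality for the union therefore turns into the reverse inequality for the
  intersection.\<close>

lemma extremal_inter:
  assumes ext: "extremal I A X" shows "extremal I A1 (P X \<inter> Q X)"
proof -
  note X = extremalD(2)[OF ext]
  note sP = sub_link[OF X] and sQ = sub_far_join[OF X]
  have sW: "join_subcomplex I A1 (P X \<inter> Q X)" and sU: "join_subcomplex I A1 (P X \<union> Q X)"
    using join_subcomplex_Un join_subcomplex_Int sP sQ by auto
  let ?N = "std_types I A1" and ?T = "\<lambda>X. X \<inter> full_faces I A1"
  have "card (?N (P X \<union> Q X)) + card (?N (P X \<inter> Q X)) = card (?N (P X)) + card (?N (Q X))"
    unfolding std_union[OF ext] std_inter using card_Un_Int[of "?N (P X)" "?N (Q X)"] finite_std_types[OF bl1]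
    by simp
  moreover have "card (?T (P X \<union> Q X)) + card (?T (P X \<inter> Q X)) = card (?T (P X)) + card (?T (Q X))"
    using card_Un_Int[of "?T (P X)" "?T (Q X)"] finite_full_faces[OF bl1]
    by (simp add: Int_Un_distrib2 Int_ac)
  moreover have "card (?T (P X \<union> Q X)) \<le> card (?N (P X \<union> Q X))"
    by (rule card_full_le_card_std[OF bl1 sU])
  ultimately show ?thesis unfolding extremal_def using bl1 sW
    extremalD(3)[OF extremal_split(1)[OF ext]] extremalD(3)[OF extremal_far_join[OF ext]] by auto
qed

end

section \<open>Purity, duality of types, and complementary sets of facets\<close>

definition facet_complement :: "'i set \<Rightarrow> ('i \<Rightarrow> 'v set) \<Rightarrow> 'v set set \<Rightarrow> 'v set set" where
  "facet_complement I A X = {F. \<exists>G\<in>full_faces I A. F \<subseteq> G \<and> G \<notin> X}"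

lemma of_type_cong: "(\<And>j. j \<in> I \<Longrightarrow> c j = c' j) \<Longrightarrow> of_type I A c B \<longleftrightarrow> of_type I A c' B"
  unfolding of_type_def by auto

lemma full_faces_nsub:
  assumes "F \<in> full_faces I A" "i \<in> I" shows "\<not> A i \<subseteq> F"
proof
  assume "A i \<subseteq> F"
  then have "A i - F = {}" by auto
  moreover have "card (A i - F) = 1" using assms by (auto simp: full_faces_def)
  ultimately show False by (metis card.empty zero_neq_one)
qed

lemma full_faces_antisym:
  assumes "F \<in> full_faces I A" "G \<in> full_faces I A" "F \<subseteq> G" shows "F = G"
proof (rule equalityI[OF assms(3)], rule subsetI)
  fix x assume x: "x \<in> G"
  then obtain i where i: "i \<in> I" "x \<in> A i" using assms(2) by (auto simp: full_faces_def)
  have "card (A i - F) = 1" using assms(1) i by (auto simp: full_faces_def)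
  then obtain b where b: "A i - F = {b}" by (auto simp: card_1_singleton_iff)
  show "x \<in> F"
  proof (rule ccontr)
    assume "x \<notin> F"
    then have "b = x" using b i by auto
    then have "A i \<subseteq> G" using b x assms(3) by auto
    then show False using full_faces_nsub[OF assms(2) i(1)] by simp
  qed
qed

text \<open>Passing to the link of a vertex of \<open>F\<close> reduces to the empty face. There the
  zero type is standard, so the number of standard types is positive and a facet exists.\<close>

theorem extremal_pure:
  assumes "extremal I A X" "F \<in> X"
  shows "\<exists>G\<in>X \<inter> full_faces I A. F \<subseteq> G"
  using assms
proof (induction "card (\<Union>(A ` I))" arbitrary: A X F rule: less_induct)
  case less
  note X = extremalD[OF less.prems(1)]
  show ?case
  proof (cases "F = {}")
    case True
    have "std_types I A X \<noteq> {}" using zero_std_type[OF X(1)] less.prems(2) True by auto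
    then have "0 < card (std_types I A X)" using finite_std_types[OF X(1), of X] by (simp add: card_gt_0_iff)
    then have "X \<inter> full_faces I A \<noteq> {}" using X(3) by auto
    then show ?thesis using True by auto
  next
    case False
    then obtain a i where aF: "a \<in> F" "i \<in> I" "a \<in> A i" using join_subcomplexD(1)[OF X(2) less.prems(2)] by blast
    have "card (A i) \<noteq> 1"
    proof
      assume "card (A i) = 1"
      then have "A i = {a}" using aF by (auto simp: card_1_singleton_iff)
      then show False using aF join_subcomplexD(3)[OF X(2) less.prems(2) aF(2)] by auto
    qed
    moreover have "card (A i) \<noteq> 0" using aF blocksD(2)[OF X(1) aF(2)] by auto
    ultimately have "2 \<le> card (A i)" by linarith
    then interpret split_block I A i a using X(1) aF by unfold_locales
    have "F - {a} \<in> P X" using less.prems(2) aF by (simp add: vertex_link_def insert_absorb)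
    then obtain G where G: "G \<in> P X \<inter> full_faces I A1" "F - {a} \<subseteq> G"
      using less.hyps[OF smaller1 extremal_split(1)[OF less.prems(1)]] by blast
    then have "a \<notin> G" "insert a G \<in> X" by (auto simp: vertex_link_def)
    moreover have "insert a G \<in> full_faces I A" using full_link[of "insert a G"] G \<open>a \<notin> G\<close> by simp
    ultimately show ?thesis using G by (intro bexI[of _ "insert a G"]) auto
  qed
qed

text \<open>A standard type \<open>c\<close> says that all sets of type \<open>c\<close> are faces.
  Dually, for extremal \<open>X\<close> it provides one set of the complementary type all of whose
  facets belong to \<open>X\<close>; this is what limits the standard types of the
  complement.\<close>

theorem std_type_box:
  assumes "extremal I A X" "c \<in> std_types I A X"
  shows "\<exists>B. of_type I A (\<lambda>j. card (A j) - 1 - c j) B \<and> (\<forall>G\<in>full_faces I A. B \<subseteq> G \<longrightarrow> G \<in> X)"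
  using assms
proof (induction "card (\<Union>(A ` I))" arbitrary: A X c rule: less_induct)
  case less
  note X = extremalD[OF less.prems(1)]
  show ?case
  proof (cases "\<exists>i\<in>I. 2 \<le> card (A i)")
    case False
    note s = singleton_blocks[OF X(1) False] singleton_subcomplex[OF X(1) False X(2)]
    have c: "c j = 0" if "j \<in> I" for j
    proof -
      have "c j < card (A j)" using less.prems(2) that by (auto simp: std_types_def PiE_iff)
      then show ?thesis using s(1)[OF that] by simp
    qed
    then have "of_type I A c {}" by (simp add: of_type_def)
    then have "{} \<in> X" using less.prems(2) by (auto simp: std_types_def)
    moreover have "of_type I A (\<lambda>j. card (A j) - 1 - c j) {}" using c s(1) by (simp add: of_type_def)
    ultimately show ?thesis using s(3) by auto
  next
    case True
    then obtain i where i: "i \<in> I" "2 \<le> card (A i)" by auto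
    then obtain a where "a \<in> A i" using blocksD(3)[OF X(1)] by blast
    then interpret split_block I A i a using X(1) i by unfold_locales
    consider "c \<in> std_types I A1 (P X)" | "c \<in> far_std X" "c i = 0" | "c \<in> far_std X" "0 < c i"
      using less.prems(2) unfolding extremal_split(3)[OF less.prems(1)] by blast
    then show ?thesis
    proof cases
      \<comment> \<open>The type comes from the link. In \<open>A\<close> the block has one more
        element, so the complementary entry grows by one, and \<open>a\<close> fills it.\<close>
      case 1
      obtain B where B: "of_type I A1 (\<lambda>j. card (A1 j) - 1 - c j) B"
        "\<And>G. G\<in>full_faces I A1 \<Longrightarrow> B \<subseteq> G \<Longrightarrow> G \<in> P X"
        using less.hyps[OF smaller1 extremal_split(1)[OF less.prems(1)] 1] by blast
      have "c i < card (A i) - 1" using 1 range1 by (auto simp: std_types_def)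
      then have "of_type I A (\<lambda>j. card (A j) - 1 - c j) (insert a B)"
        using of_type_insert[OF B(1)] card1
        by (subst of_type_cong[where c' = "(\<lambda>j. card (A1 j) - 1 - c j)(i := Suc (card (A1 i) - 1 - c i))"]) auto
      moreover have "G \<in> X" if G: "G \<in> full_faces I A" "insert a B \<subseteq> G" for G
      proof -
        have "G - {a} \<in> P X"
          by (rule B(2)) (use full_link[of G] G of_type_A1_notin[OF B(1)] in auto)
        then show ?thesis using G by (simp add: vertex_link_def insert_absorb)
      qed
      ultimately show ?thesis by blast
    next
      \<comment> \<open>With \<open>c i = 0\<close> the complementary entry is
        \<open>card (A i) - 1\<close>. It is filled by \<open>A i - {a}\<close>, and facets
        containing that simplex avoid \<open>a\<close>.\<close>
      case 2
      then have "c(i := 0) \<in> std_types I A0 (Qh X)" using far_std_iff by blast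
      then have cQ: "c \<in> std_types I A0 (Qh X)" using 2 by (simp add: fun_upd_idem)
      obtain B where B: "of_type I A0 (\<lambda>j. card (A0 j) - 1 - c j) B"
        "\<And>G. G\<in>full_faces I A0 \<Longrightarrow> B \<subseteq> G \<Longrightarrow> G \<in> Qh X"
        using less.hyps[OF smaller0 extremal_split(2)[OF less.prems(1)] cQ] by blast
      have BA: "of_type I A (\<lambda>j. card (A0 j) - 1 - c j) B"
        using B(1) of_type_A0[of "\<lambda>j. card (A0 j) - 1 - c j"] by simp
      then have d: "B \<inter> A i = {}" using of_type_0_disj[OF BA] by simp
      have "of_type I A (\<lambda>j. card (A j) - 1 - c j) (B \<union> (A i - {a}))"
        unfolding of_type_def
      proof (intro conjI ballI)
        show "B \<union> (A i - {a}) \<subseteq> \<Union>(A ` I)" using BA iI by (auto simp: of_type_def)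
        fix j assume j: "j \<in> I"
        show "card ((B \<union> (A i - {a})) \<inter> A j) = card (A j) - 1 - c j"
        proof (cases "j = i")
          case True
          have "(B \<union> (A i - {a})) \<inter> A i = A i - {a}" using d by auto
          then show ?thesis using True 2 a fin by simp
        next
          case False
          then have "(B \<union> (A i - {a})) \<inter> A j = B \<inter> A j" using dj[OF j] by auto
          then show ?thesis using BA j False by (auto simp: of_type_def)
        qed
      qed
      moreover have "G \<in> X" if G: "G \<in> full_faces I A" "B \<union> (A i - {a}) \<subseteq> G" for G
      proof -
        have "a \<notin> G" using full_faces_nsub[OF G(1) iI] G(2) by auto
        then have eq: "(G - A i) \<union> (A i - {a}) = G" using G by auto
        then have "G - A i \<in> full_faces I A0" using full_far[of "G - A i"] G(1) by auto
        then have "G - A i \<in> Qh X" by (rule B(2)) (use G d in auto)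
        then show ?thesis using eq by (simp add: far_link_def)
      qed
      ultimately show ?thesis by blast
    next
      \<comment> \<open>One place below the height, the type is standard both for the link and for
        the far join, hence for their intersection, which is again extremal. A set found there
        controls the facets on both sides of the equator.\<close>
      case 3
      let ?c = "c(i := c i - 1)"
      have q: "c(i := 0) \<in> std_types I A0 (Qh X)" "c i = height X (c(i := 0))" using 3 far_std_iff by blast+
      have p: "?c \<in> std_types I A1 (P X)" using below_height[of "c i - 1" X "c(i := 0)"] q(2) 3 by simp
      then have "?c \<in> std_types I A1 (Q X)"
        unfolding std_far_join[OF X(2)] using q(1) by (simp add: std_types_def)
      then have W: "?c \<in> std_types I A1 (P X \<inter> Q X)" using p std_inter by blast
      obtain B where B: "of_type I A1 (\<lambda>j. card (A1 j) - 1 - ?c j) B"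
        "\<And>G. G\<in>full_faces I A1 \<Longrightarrow> B \<subseteq> G \<Longrightarrow> G \<in> P X \<inter> Q X"
        using less.hyps[OF smaller1 extremal_inter[OF less.prems(1)] W] by blast
      have aB: "a \<notin> B" by (rule of_type_A1_notin[OF B(1)])
      have c_eq: "card (A1 j) - 1 - ?c j = card (A j) - 1 - c j" for j
        using 3 card1 by (cases "j = i") auto
      have BA: "of_type I A (\<lambda>j. card (A j) - 1 - c j) B"
        using B(1) unfolding of_type_A1[OF aB] c_eq .
      moreover have "G \<in> X" if G: "G \<in> full_faces I A" "B \<subseteq> G" for G
      proof (cases "a \<in> G")
        case True
        have "G - {a} \<in> P X \<inter> Q X" by (rule B(2)) (use full_link[OF True] G aB in auto)
        then show ?thesis using True by (simp add: vertex_link_def insert_absorb)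
      next
        case False
        then have GA: "G \<inter> A i = A i - {a}" using full_far_iff[OF G(1)] by simp
        have "card (B \<inter> A i) = card (A i) - 1 - c i" using BA iI by (auto simp: of_type_def)
        then have "card (B \<inter> A i) < card (A i - {a})" using 3 a fin two by simp
        then have "\<not> A i - {a} \<subseteq> B \<inter> A i" by (metis card_mono fin finite_Int leD)
        then obtain b where b: "b \<in> A i - {a}" "b \<notin> B" by blast
        have G_eq: "G - {b} = (G - A i) \<union> (A i - {a,b})" using GA False b by auto
        have "(G - A i) \<union> (A i - {a}) = G" using GA False by auto
        then have "G - A i \<in> full_faces I A0" using full_far[of "G - A i"] G(1) by auto
        then have "G - {b} \<in> full_faces I A1" unfolding G_eq using full_far_join[OF b(1)] by auto
        then have "G - {b} \<in> P X \<inter> Q X" by (rule B(2)) (use G b in auto)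
        moreover have "(G - {b}) \<union> (A i - {a}) = G" using GA b by auto
        ultimately show ?thesis by (simp add: far_join_def)
      qed
      ultimately show ?thesis by blast
    qed
  qed
qed

text \<open>A choice of the omitted vertex in every block gives a facet, and there are as many
  choices as types.\<close>

lemma card_types_le_full:
  assumes bl: "blocks I A"
  shows "card (PiE I (\<lambda>i. {..<card (A i)})) \<le> card (full_faces I A)"
proof -
  have "card (PiE I (\<lambda>i. {..<card (A i)})) = card (PiE I A)"
    using blocksD(1)[OF bl] by (simp add: card_PiE)
  also have "\<dots> \<le> card (full_faces I A)"
  proof (rule card_inj_on_le)
    have eq: "A i - (\<Union>(A ` I) - t ` I) = {t i}" if t: "t \<in> PiE I A" and i: "i \<in> I" for t i
    proof -
      have "t j \<notin> A i" if "j \<in> I" "j \<noteq> i" for j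
        using blocksD(5)[OF bl that(1) i that(2)] t that(1) by (auto simp: PiE_iff)
      then show ?thesis using t i by (auto simp: PiE_iff)
    qed
    show "inj_on (\<lambda>t. \<Union>(A ` I) - t ` I) (PiE I A)"
    proof (rule inj_onI)
      fix t t' assume t: "t \<in> PiE I A" "t' \<in> PiE I A" "\<Union>(A ` I) - t ` I = \<Union>(A ` I) - t' ` I"
      have "t i = t' i" if "i \<in> I" for i using eq[OF t(1) that] eq[OF t(2) that] t(3) by simp
      then show "t = t'" using t by (intro PiE_ext)
    qed
    show "(\<lambda>t. \<Union>(A ` I) - t ` I) ` PiE I A \<subseteq> full_faces I A"
    proof (rule image_subsetI)
      fix t assume t: "t \<in> PiE I A"
      show "\<Union>(A ` I) - t ` I \<in> full_faces I A"
        unfolding full_faces_def using eq[OF t] by simp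
    qed
    show "finite (full_faces I A)" by (rule finite_full_faces[OF bl])
  qed
  finally show ?thesis .
qed

lemma facet_complement_sub: "join_subcomplex I A (facet_complement I A X)"
  unfolding join_subcomplex_def
proof (intro ballI conjI allI impI)
  fix F assume "F \<in> facet_complement I A X"
  then obtain G where G: "G \<in> full_faces I A" "F \<subseteq> G" "G \<notin> X" by (auto simp: facet_complement_def)
  show "F \<subseteq> \<Union>(A ` I)" using G by (auto simp: full_faces_def)
  show "H \<in> facet_complement I A X" if "H \<subseteq> F" for H using that G by (auto simp: facet_complement_def)
  show "\<not> A i \<subseteq> F" if "i \<in> I" for i using full_faces_nsub[OF G(1) that] G(2) by blast
qed

lemma facet_complement_full: "facet_complement I A X \<inter> full_faces I A = full_faces I A - X"
  using full_faces_antisym[of _ I A] by (auto simp: facet_complement_def)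

text \<open>A type standard for the complement cannot be complementary to one standard for
  \<open>X\<close>, since the set from \<open>std_type_box\<close> would then lie in a facet outside
  \<open>X\<close>. There are no more types than facets, so the required bound follows by
  subtraction.\<close>

theorem extremal_facet_complement:
  assumes ext: "extremal I A X" shows "extremal I A (facet_complement I A X)"
proof -
  note X = extremalD[OF ext]
  let ?T = "PiE I (\<lambda>i. {..<card (A i)})"
  let ?d = "\<lambda>c. \<lambda>j\<in>I. card (A j) - 1 - c j"
  have fT: "finite ?T" by (rule finite_PiE[OF blocksD(1)[OF X(1)]]) simp
  have dT: "?d c \<in> ?T" if "c \<in> ?T" for c
    using that by (auto simp: PiE_iff)
  have dd: "?d (?d c) = c" if "c \<in> ?T" for c
  proof
    fix j show "?d (?d c) j = c j" using that by (cases "j \<in> I") (auto simp: PiE_iff extensional_def)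
  qed
  have sT: "std_types I A X \<subseteq> ?T" by (auto simp: std_types_def)
  have "inj_on ?d (std_types I A X)"
    by (rule inj_on_inverseI[of _ ?d]) (use dd sT in blast)
  then have "card (?d ` std_types I A X) = card (std_types I A X)" by (rule card_image)
  have "std_types I A (facet_complement I A X) \<subseteq> ?T - ?d ` std_types I A X"
  proof
    fix c assume c: "c \<in> std_types I A (facet_complement I A X)"
    then have cT: "c \<in> ?T" by (simp add: std_types_def)
    have "c \<notin> ?d ` std_types I A X"
    proof
      assume "c \<in> ?d ` std_types I A X"
      then obtain c' where c': "c' \<in> std_types I A X" "c = ?d c'" by auto
      obtain B where B: "of_type I A (\<lambda>j. card (A j) - 1 - c' j) B" "\<forall>G\<in>full_faces I A. B \<subseteq> G \<longrightarrow> G \<in> X"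
        using std_type_box[OF ext c'(1)] by blast
      have "of_type I A c B"
        by (rule iffD2[OF of_type_cong B(1)]) (simp add: c'(2))
      then have "B \<in> facet_complement I A X" using c by (auto simp: std_types_def)
      then show False using B(2) by (auto simp: facet_complement_def)
    qed
    then show "c \<in> ?T - ?d ` std_types I A X" using cT by blast
  qed
  then have "card (std_types I A (facet_complement I A X)) \<le> card (?T - ?d ` std_types I A X)"
    by (rule card_mono[rotated]) (use fT in simp)
  also have "\<dots> = card ?T - card (std_types I A X)"
    using card_Diff_subset[of "?d ` std_types I A X" ?T] dT sT finite_std_types[OF X(1), of X]
      \<open>card (?d ` std_types I A X) = card (std_types I A X)\<close> by (metis (no_types, lifting) finite_imageI image_subset_iff subsetD)
  also have "\<dots> \<le> card (full_faces I A) - card (X \<inter> full_faces I A)"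
    using card_types_le_full[OF X(1)] X(3) by simp
  also have "\<dots> = card (full_faces I A - X)"
    using finite_full_faces[OF X(1)] by (metis card_Diff_subset_Int finite_Int inf_commute)
  finally show ?thesis unfolding extremal_def using X(1) facet_complement_sub facet_complement_full[of I A X] by auto
qed

lemma facet_complement_Int: "facet_complement I A (X \<inter> Y) = facet_complement I A X \<union> facet_complement I A Y"
  by (auto simp: facet_complement_def)

text \<open>By purity \<open>X\<close> is recovered from its facets.\<close>

lemma facet_complement_involutive:
  assumes "extremal I A X" shows "facet_complement I A (facet_complement I A X) = X"
proof (intro equalityI subsetI)
  fix F assume "F \<in> facet_complement I A (facet_complement I A X)"
  then obtain G where G: "G \<in> full_faces I A" "F \<subseteq> G" "G \<notin> facet_complement I A X"
    by (auto simp: facet_complement_def)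
  then have "G \<in> X" by (auto simp: facet_complement_def)
  then show "F \<in> X" using join_subcomplexD(2)[OF extremalD(2)[OF assms]] G by blast
next
  fix F assume "F \<in> X"
  then obtain G where "G \<in> X \<inter> full_faces I A" "F \<subseteq> G" using extremal_pure[OF assms] by blast
  moreover have "G \<notin> facet_complement I A X" using calculation facet_complement_full[of I A X] by auto
  ultimately show "F \<in> facet_complement I A (facet_complement I A X)"
    by (auto simp: facet_complement_def[of I A "facet_complement I A X"])
qed

context split_block
begin

text \<open>Link and far join commute with complements, so that one induction can follow
  \<open>X\<close> and its complement simultaneously.\<close>

lemma link_facet_complement: "P (facet_complement I A X) = facet_complement I A1 (P X)"
proof (intro equalityI subsetI)
  fix F assume "F \<in> P (facet_complement I A X)"
  then obtain G where G: "a \<notin> F" "G \<in> full_faces I A" "insert a F \<subseteq> G" "G \<notin> X"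
    by (auto simp: vertex_link_def facet_complement_def)
  then have "G - {a} \<in> full_faces I A1" "F \<subseteq> G - {a}" "G - {a} \<notin> P X"
    using full_link[of G] by (auto simp: vertex_link_def insert_absorb)
  then show "F \<in> facet_complement I A1 (P X)" by (auto simp: facet_complement_def)
next
  fix F assume "F \<in> facet_complement I A1 (P X)"
  then obtain G where G: "G \<in> full_faces I A1" "F \<subseteq> G" "G \<notin> P X" by (auto simp: facet_complement_def)
  have "a \<notin> G" using G(1) V1 unfolding full_faces_def by blast
  then have "insert a G \<in> full_faces I A" "insert a G \<notin> X" "insert a F \<subseteq> insert a G" "a \<notin> F"
    using full_link[of "insert a G"] G by (auto simp: vertex_link_def)
  then show "F \<in> P (facet_complement I A X)" by (auto simp: vertex_link_def facet_complement_def)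
qed

lemma far_join_facet_complement: "Q (facet_complement I A X) = facet_complement I A1 (Q X)"
proof (intro equalityI subsetI)
  fix F assume "F \<in> Q (facet_complement I A X)"
  then obtain G where G: "a \<notin> F" "\<not> A i - {a} \<subseteq> F" "G \<in> full_faces I A" "F \<union> (A i - {a}) \<subseteq> G" "G \<notin> X"
    by (auto simp: far_join_def facet_complement_def)
  then obtain b where b: "b \<in> A i - {a}" "b \<notin> F" by blast
  have aG: "a \<notin> G" using full_faces_nsub[OF G(3) iI] G(4) by auto
  have eq: "(G - A i) \<union> (A i - {a}) = G" "G - {b} = (G - A i) \<union> (A i - {a,b})"
    using G(4) aG b by auto
  then have "G - A i \<in> full_faces I A0" using full_far[of "G - A i"] G(3) by auto
  then have "G - {b} \<in> full_faces I A1" unfolding eq(2) using full_far_join[OF b(1)] by auto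
  moreover have "(G - {b}) \<union> (A i - {a}) = G" using G(4) b by blast
  then have "G - {b} \<notin> Q X" using G(5) by (auto simp: far_join_def)
  moreover have "F \<subseteq> G - {b}" using G b by auto
  ultimately show "F \<in> facet_complement I A1 (Q X)" by (auto simp: facet_complement_def)
next
  fix F assume "F \<in> facet_complement I A1 (Q X)"
  then obtain G where G: "G \<in> full_faces I A1" "F \<subseteq> G" "G \<notin> Q X" by (auto simp: facet_complement_def)
  obtain b where b: "b \<in> A i - {a}" "G \<inter> A i = A i - {a,b}" using full_far_join_ex[OF G(1)] by blast
  have aG: "a \<notin> G" using G(1) V1 unfolding full_faces_def by blast
  have eq: "(G - A i) \<union> (A i - {a,b}) = G" "(G - A i) \<union> (A i - {a}) = G \<union> (A i - {a})" using b aG by auto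
  have "G - A i \<in> full_faces I A0" using full_far_join[OF b(1), of "G - A i"] G(1) eq(1) by auto
  then have "G \<union> (A i - {a}) \<in> full_faces I A" using full_far[of "G - A i"] eq(2) by auto
  moreover have "\<not> A i - {a} \<subseteq> G" using b by auto
  then have "G \<union> (A i - {a}) \<notin> X" using G(3) aG by (auto simp: far_join_def)
  ultimately have "F \<union> (A i - {a}) \<in> facet_complement I A X"
    using G(2) unfolding facet_complement_def by blast
  moreover have "\<not> A i - {a} \<subseteq> F" using \<open>\<not> A i - {a} \<subseteq> G\<close> G(2) by blast
  moreover have "a \<notin> F" using G(2) aG by blast
  ultimately show "F \<in> Q (facet_complement I A X)" by (simp add: far_join_def)
qed

text \<open>By purity a face of \<open>X\<close> lies in a facet, which contains either
  \<open>a\<close> or all of \<open>A i - {a}\<close>.\<close>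

lemma extremal_equator:
  assumes "extremal I A X" "a \<notin> F" "\<not> A i - {a} \<subseteq> F"
  shows "F \<in> X \<longleftrightarrow> F \<in> P X \<or> F \<in> Q X"
proof
  note X = extremalD(2)[OF assms(1)]
  assume "F \<in> X"
  then obtain G where G: "G \<in> X" "G \<in> full_faces I A" "F \<subseteq> G" using extremal_pure[OF assms(1)] by blast
  show "F \<in> P X \<or> F \<in> Q X"
  proof (cases "a \<in> G")
    case True
    then have "insert a F \<in> X" using join_subcomplexD(2)[OF X G(1)] G(3) by auto
    then show ?thesis using assms(2) by (simp add: vertex_link_def)
  next
    case False
    then have "F \<union> (A i - {a}) \<subseteq> G" using full_far_iff[OF G(2)] G(3) by auto
    then have "F \<union> (A i - {a}) \<in> X" using join_subcomplexD(2)[OF X G(1)] by auto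
    then show ?thesis using assms(2,3) by (simp add: far_join_def)
  qed
next
  note X = extremalD(2)[OF assms(1)]
  assume "F \<in> P X \<or> F \<in> Q X"
  then show "F \<in> X" using join_subcomplexD(2)[OF X] by (auto simp: vertex_link_def far_join_def)
qed

end

section \<open>Conic homeomorphisms and half spaces\<close>

definition dilate :: "real \<Rightarrow> ('a \<Rightarrow> real) \<Rightarrow> ('a \<Rightarrow> real)" where
  "dilate c x = (\<lambda>i. c * x i)"

definition conic_homeo ::
  "('a \<Rightarrow> real) set \<Rightarrow> ('b \<Rightarrow> real) set \<Rightarrow> (('a \<Rightarrow> real) \<Rightarrow> ('b \<Rightarrow> real)) \<Rightarrow> (('b \<Rightarrow> real) \<Rightarrow> ('a \<Rightarrow> real)) \<Rightarrow> bool"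
  where "conic_homeo A B f g \<longleftrightarrow> homeomorphism A B f g \<and>
    (\<forall>c>0. \<forall>x\<in>A. dilate c x \<in> A \<and> f (dilate c x) = dilate c (f x))"

lemma conic_homeoI:
  assumes "continuous_on A f" "continuous_on B g" "\<And>x. x \<in> A \<Longrightarrow> f x \<in> B" "\<And>y. y \<in> B \<Longrightarrow> g y \<in> A"
    "\<And>x. x \<in> A \<Longrightarrow> g (f x) = x" "\<And>y. y \<in> B \<Longrightarrow> f (g y) = y"
    "\<And>c x. 0 < c \<Longrightarrow> x \<in> A \<Longrightarrow> dilate c x \<in> A" "\<And>c x. 0 < c \<Longrightarrow> x \<in> A \<Longrightarrow> f (dilate c x) = dilate c (f x)"
  shows "conic_homeo A B f g"
proof -
  have "f ` A = B" "g ` B = A" using assms(3-6) by force+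
  then show ?thesis using assms unfolding conic_homeo_def homeomorphism_def by auto
qed

lemma conic_homeoD:
  assumes "conic_homeo A B f g"
  shows "continuous_on A f" "continuous_on B g" "f ` A = B" "g ` B = A"
    "x \<in> A \<Longrightarrow> f x \<in> B" "y \<in> B \<Longrightarrow> g y \<in> A"
    "x \<in> A \<Longrightarrow> g (f x) = x" "y \<in> B \<Longrightarrow> f (g y) = y"
    "0 < c \<Longrightarrow> x \<in> A \<Longrightarrow> dilate c x \<in> A" "0 < c \<Longrightarrow> x \<in> A \<Longrightarrow> f (dilate c x) = dilate c (f x)"
  using assms unfolding conic_homeo_def homeomorphism_def by auto

lemma conic_homeo_sym:
  assumes "conic_homeo A B f g" shows "conic_homeo B A g f"
proof -
  note h = conic_homeoD[OF assms]
  show ?thesis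
  proof (rule conic_homeoI)
    fix c :: real and x assume c: "0 < c" and x: "x \<in> B"
    have eq: "f (dilate c (g x)) = dilate c x" using h(10)[OF c h(6)[OF x]] h(8)[OF x] by simp
    then show "dilate c x \<in> B" using h(5)[OF h(9)[OF c h(6)[OF x]]] by simp
    show "g (dilate c x) = dilate c (g x)" using h(7)[OF h(9)[OF c h(6)[OF x]]] eq by simp
  qed (use h in auto)
qed

lemma conic_homeo_trans:
  assumes "conic_homeo A B f g" "conic_homeo B C f' g'"
  shows "conic_homeo A C (f' \<circ> f) (g \<circ> g')"
proof -
  note h = conic_homeoD[OF assms(1)] and k = conic_homeoD[OF assms(2)]
  show ?thesis
  proof (rule conic_homeoI)
    show "continuous_on A (f' \<circ> f)" using continuous_on_compose[OF h(1)] h(3) k(1) by simp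
    show "continuous_on C (g \<circ> g')" using continuous_on_compose[OF k(2)] k(4) h(2) by simp
  qed (use h k in simp_all)
qed

lemma conic_homeo_subset:
  assumes "conic_homeo A B f g" "A' \<subseteq> A" "f ` A' = B'" "\<And>c x. 0 < c \<Longrightarrow> x \<in> A' \<Longrightarrow> dilate c x \<in> A'"
  shows "conic_homeo A' B' f g"
proof -
  note h = conic_homeoD[OF assms(1)]
  have "B' \<subseteq> B" using assms(2,3) h(3) by blast
  show ?thesis
  proof (rule conic_homeoI)
    show "continuous_on A' f" "continuous_on B' g"
      using h(1,2) assms(2) \<open>B' \<subseteq> B\<close> continuous_on_subset by blast+
    show "g y \<in> A'" if "y \<in> B'" for y using that assms(2,3) h(7) by auto
  qed (use assms h \<open>B' \<subseteq> B\<close> in auto)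
qed

lemma conic_homeo_id: "(\<And>c x. 0 < c \<Longrightarrow> x \<in> A \<Longrightarrow> dilate c x \<in> A) \<Longrightarrow> conic_homeo A A (\<lambda>x. x) (\<lambda>x. x)"
  by (rule conic_homeoI) auto

text \<open>The condition on the image of the overlap makes the two inverses agree on
  \<open>B1 \<inter> B2\<close> and prevents the images from meeting anywhere else. Closedness gives
  continuity of both glued maps.\<close>

lemma conic_homeo_glue:
  assumes 1: "conic_homeo A1 B1 f1 g1" and 2: "conic_homeo A2 B2 f2 g2"
    and cl: "closed A1" "closed A2" "closed B1" "closed B2"
    and eq: "\<And>x. x \<in> A1 \<inter> A2 \<Longrightarrow> f1 x = f2 x" and im: "f1 ` (A1 \<inter> A2) = B1 \<inter> B2"
  shows "conic_homeo (A1 \<union> A2) (B1 \<union> B2) (\<lambda>x. if x \<in> A1 then f1 x else f2 x)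
    (\<lambda>y. if y \<in> B1 then g1 y else g2 y)"
proof -
  note h = conic_homeoD[OF 1] and k = conic_homeoD[OF 2]
  have eqg: "g1 y = g2 y" if y: "y \<in> B1 \<inter> B2" for y
  proof -
    have "y \<in> f1 ` (A1 \<inter> A2)" using im y by simp
    then obtain x where "x \<in> A1 \<inter> A2" "y = f1 x" by blast
    then have "g1 y = x" "y = f2 x" "x \<in> A2" using eq[of x] h(7)[of x] by auto
    then show ?thesis using k(7)[of x] by simp
  qed
  have f2: "f2 x \<in> B1 \<Longrightarrow> x \<in> A1" if "x \<in> A2" for x
  proof -
    assume "f2 x \<in> B1"
    then have "f2 x \<in> f1 ` (A1 \<inter> A2)" using im k(5) that by auto
    then obtain x' where "x' \<in> A1 \<inter> A2" "f2 x = f1 x'" by blast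
    then have "f2 x = f2 x'" "x' \<in> A2" "x' \<in> A1" using eq by auto
    then show ?thesis using k(7) that by metis
  qed
  have g2: "g2 y \<in> A1 \<Longrightarrow> y \<in> B1" if "y \<in> B2" for y
    using eq[of "g2 y"] h(5)[of "g2 y"] k(6,8) that by auto
  show ?thesis
  proof (rule conic_homeoI)
    show "continuous_on (A1 \<union> A2) (\<lambda>x. if x \<in> A1 then f1 x else f2 x)"
      by (rule continuous_on_cases) (use cl h k eq in auto)
    show "continuous_on (B1 \<union> B2) (\<lambda>y. if y \<in> B1 then g1 y else g2 y)"
      by (rule continuous_on_cases) (use cl h k eqg in auto)
    fix c :: real and x assume c: "0 < c" and x: "x \<in> A1 \<union> A2"
    show "dilate c x \<in> A1 \<union> A2" using h(9)[OF c] k(9)[OF c] x by auto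
    show "(if dilate c x \<in> A1 then f1 (dilate c x) else f2 (dilate c x)) = dilate c (if x \<in> A1 then f1 x else f2 x)"
    proof (cases "x \<in> A1")
      case True then show ?thesis using h(9,10)[OF c] by auto
    next
      case False
      have "dilate c x \<notin> A1"
      proof
        assume "dilate c x \<in> A1"
        then have "dilate (1/c) (dilate c x) \<in> A1" using h(9) c by auto
        moreover have "dilate (1/c) (dilate c x) = x" using c by (simp add: dilate_def)
        ultimately show False using False by simp
      qed
      then show ?thesis using False x k(10)[OF c] by auto
    qed
  next
    fix x assume x: "x \<in> A1 \<union> A2"
    show "(if x \<in> A1 then f1 x else f2 x) \<in> B1 \<union> B2"
      using x h(5)[of x] k(5)[of x] by auto
    show "(if (if x \<in> A1 then f1 x else f2 x) \<in> B1 then g1 (if x \<in> A1 then f1 x else f2 x)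
       else g2 (if x \<in> A1 then f1 x else f2 x)) = x"
      using x h(5,7)[of x] k(7)[of x] f2[of x] by auto
  next
    fix y assume y: "y \<in> B1 \<union> B2"
    show "(if y \<in> B1 then g1 y else g2 y) \<in> A1 \<union> A2"
      using y h(6)[of y] k(6)[of y] by auto
    show "(if (if y \<in> B1 then g1 y else g2 y) \<in> A1 then f1 (if y \<in> B1 then g1 y else g2 y)
       else f2 (if y \<in> B1 then g1 y else g2 y)) = y"
      using y h(6,8)[of y] k(8)[of y] g2[of y] by auto
  qed
qed

section \<open>Euclidean spaces and pairs of half spaces\<close>

definition eucl :: "nat \<Rightarrow> (nat \<Rightarrow> real) set" where
  "eucl m = {x. \<forall>i\<ge>m. x i = 0}"

text \<open>All Euclidean spaces live in one type of sequences, as the dimension varies along the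
  induction. Prepending a coordinate presents the space of dimension \<open>m + 1\<close> as a line
  times the one of dimension \<open>m\<close>, with the new coordinate at index 0.\<close>

definition scons :: "real \<Rightarrow> (nat \<Rightarrow> real) \<Rightarrow> (nat \<Rightarrow> real)" where
  "scons t x = (\<lambda>i. case i of 0 \<Rightarrow> t | Suc j \<Rightarrow> x j)"

definition stail :: "(nat \<Rightarrow> real) \<Rightarrow> (nat \<Rightarrow> real)" where
  "stail x = (\<lambda>i. x (Suc i))"

lemma scons_simps [simp]:
  "scons t x 0 = t" "scons t x (Suc i) = x i" "stail (scons t x) = x" "scons (x 0) (stail x) = x"
  "stail x i = x (Suc i)"
  by (auto simp: scons_def stail_def split: nat.splits)

lemma dilate_apply [simp]: "dilate c x v = c * x v"
  by (simp add: dilate_def)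

lemma dilate_scons [simp]: "stail (dilate c x) = dilate c (stail x)"
  "dilate c (scons t x) = scons (c * t) (dilate c x)"
  by (auto simp: dilate_def scons_def split: nat.splits)

lemma stail_eucl [simp]: "stail x \<in> eucl m \<longleftrightarrow> x \<in> eucl (Suc m)"
  unfolding eucl_def by (auto; metis Suc_le_D Suc_le_mono)

lemma scons_eucl [simp]: "scons t x \<in> eucl (Suc m) \<longleftrightarrow> x \<in> eucl m"
  using stail_eucl[of "scons t x" m] by simp

lemma dilate_eucl [simp]: "x \<in> eucl m \<Longrightarrow> dilate c x \<in> eucl m" by (auto simp: eucl_def)

lemma continuous_on_funI:
  "(\<And>i. continuous_on S (\<lambda>x. f x i)) \<Longrightarrow> continuous_on S (f :: 'a::topological_space \<Rightarrow> ('b \<Rightarrow> real))"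
  by (rule continuous_on_coordinatewise_then_product)

lemma continuous_on_coord:
  "continuous_on S f \<Longrightarrow> continuous_on S (\<lambda>x. (f x :: 'b \<Rightarrow> real) i)"
  by (rule continuous_on_product_then_coordinatewise)

lemma continuous_on_scons [continuous_intros]:
  assumes "continuous_on S f" "continuous_on S g" shows "continuous_on S (\<lambda>x. scons (f x) (g x))"
proof (rule continuous_on_funI)
  fix i show "continuous_on S (\<lambda>x. scons (f x) (g x) i)"
    using assms by (cases i) (auto intro: continuous_on_coord)
qed

lemma continuous_on_stail [continuous_intros]:
  "continuous_on S f \<Longrightarrow> continuous_on S (\<lambda>x. stail (f x))"
  by (rule continuous_on_funI) (simp add: continuous_on_coord)

lemma closed_coord [simp]: "closed {x. x (i::'a) = (0::real)}" "closed {x. (0::real) \<le> x (i::'a)}" "closed {x. x (i::'a) \<le> (0::real)}"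
proof -
  have c: "continuous_on UNIV (\<lambda>x::'a \<Rightarrow> real. x i)" by (intro continuous_on_coord continuous_on_id)
  show "closed {x. x (i::'a) = (0::real)}" "closed {x. (0::real) \<le> x (i::'a)}" "closed {x. x (i::'a) \<le> (0::real)}"
    by (rule closed_Collect_eq[OF c continuous_on_const] closed_Collect_le[OF continuous_on_const c]
        closed_Collect_le[OF c continuous_on_const])+
qed

lemma closed_eucl: "closed (eucl m)"
proof -
  have "eucl m = (\<Inter>i\<in>{m..}. {x. x i = 0})" by (auto simp: eucl_def)
  then show ?thesis by (simp add: closed_INT)
qed

lemma closed_stail: assumes "closed P" shows "closed {x. stail x \<in> P}"
proof -
  have "continuous_on UNIV stail" by (intro continuous_on_stail continuous_on_id)
  then have "closed (stail -` P)" using continuous_on_closed_vimage[OF closed_UNIV] assms by fastforce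
  then show ?thesis by (simp add: vimage_def)
qed

text \<open>A single homeomorphism straightens both sets, so their common frontier becomes the
  bounding hyperplane. In dimension 0 the conditions on \<open>x 0\<close> would be vacuous, hence
  \<open>0 < m\<close>.\<close>

definition flat :: "nat \<Rightarrow> (nat \<Rightarrow> real) set \<Rightarrow> (nat \<Rightarrow> real) set \<Rightarrow> bool" where
  "flat m P P' \<longleftrightarrow> 0 < m \<and> P \<subseteq> eucl m \<and> P' \<subseteq> eucl m \<and> (\<exists>h k. conic_homeo (eucl m) (eucl m) h k \<and>
     h ` P = {x\<in>eucl m. 0 \<le> x 0} \<and> h ` P' = {x\<in>eucl m. x 0 \<le> 0})"

text \<open>The degenerate pairs come from the whole sphere and the void family.\<close>

definition flat_pair :: "nat \<Rightarrow> (nat \<Rightarrow> real) set \<Rightarrow> (nat \<Rightarrow> real) set \<Rightarrow> bool" where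
  "flat_pair m P P' \<longleftrightarrow> flat m P P' \<or> P = eucl m \<and> P' = {} \<or> P = {} \<and> P' = eucl m"

lemma flatD:
  assumes "flat m P P'"
  obtains h k where "conic_homeo (eucl m) (eucl m) h k" "\<And>x. x \<in> eucl m \<Longrightarrow> x \<in> P \<longleftrightarrow> 0 \<le> h x 0"
    "\<And>x. x \<in> eucl m \<Longrightarrow> x \<in> P' \<longleftrightarrow> h x 0 \<le> 0"
proof -
  obtain h k where h: "conic_homeo (eucl m) (eucl m) h k"
    "h ` P = {x\<in>eucl m. 0 \<le> x 0}" "h ` P' = {x\<in>eucl m. x 0 \<le> 0}"
    and sub: "P \<subseteq> eucl m" "P' \<subseteq> eucl m"
    using assms unfolding flat_def by blast
  note hh = conic_homeoD[OF h(1)]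
  show ?thesis
  proof (rule that[OF h(1)])
    fix x assume x: "x \<in> eucl m"
    show "x \<in> P \<longleftrightarrow> 0 \<le> h x 0"
    proof
      assume "0 \<le> h x 0"
      then have "h x \<in> h ` P" using h(2) hh(5)[OF x] by simp
      then obtain y where "y \<in> P" "h x = h y" by auto
      then show "x \<in> P" using hh(7)[OF x] hh(7)[of y] sub by auto
    qed (use h(2) in auto)
    show "x \<in> P' \<longleftrightarrow> h x 0 \<le> 0"
    proof
      assume "h x 0 \<le> 0"
      then have "h x \<in> h ` P'" using h(3) hh(5)[OF x] by simp
      then obtain y where "y \<in> P'" "h x = h y" by auto
      then show "x \<in> P'" using hh(7)[OF x] hh(7)[of y] sub by auto
    qed (use h(3) in auto)
  qed
qed

lemma flat_pair_sub: "flat_pair m P P' \<Longrightarrow> P \<subseteq> eucl m \<and> P' \<subseteq> eucl m"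
  unfolding flat_pair_def flat_def by auto

lemma flat_pair_Un: assumes "flat_pair m P P'" shows "P \<union> P' = eucl m"
proof (cases "flat m P P'")
  case True
  obtain h k where hk: "conic_homeo (eucl m) (eucl m) h k"
    and h: "\<And>x. x \<in> eucl m \<Longrightarrow> x \<in> P \<longleftrightarrow> 0 \<le> h x 0" "\<And>x. x \<in> eucl m \<Longrightarrow> x \<in> P' \<longleftrightarrow> h x 0 \<le> 0"
    using flatD[OF True] by metis
  show ?thesis
  proof (intro equalityI subsetI)
    fix x assume "x \<in> eucl m"
    then show "x \<in> P \<union> P'" using h[of x] linear[of 0 "h x 0"] by blast
  qed (use flat_pair_sub[OF assms] in auto)
qed (use assms in \<open>auto simp: flat_pair_def\<close>)

lemma flat_pair_closed: assumes "flat_pair m P P'" shows "closed P" "closed P'"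
proof -
  have "closed P \<and> closed P'"
  proof (cases "flat m P P'")
    case True
    obtain h k where h: "conic_homeo (eucl m) (eucl m) h k" "\<And>x. x \<in> eucl m \<Longrightarrow> x \<in> P \<longleftrightarrow> 0 \<le> h x 0"
      "\<And>x. x \<in> eucl m \<Longrightarrow> x \<in> P' \<longleftrightarrow> h x 0 \<le> 0"
      using flatD[OF True] by metis
    have c: "continuous_on (eucl m) (\<lambda>x. h x 0)"
      by (intro continuous_on_coord conic_homeoD(1)[OF h(1)])
    have "P = {x\<in>eucl m. 0 \<le> h x 0}" "P' = {x\<in>eucl m. h x 0 \<le> 0}"
      using h flat_pair_sub[OF assms] by blast+
    then show ?thesis
      using continuous_on_closed_Collect_le[OF continuous_on_const c closed_eucl, of 0]
        continuous_on_closed_Collect_le[OF c continuous_on_const closed_eucl, of 0] by simp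
  qed (use assms closed_eucl in \<open>auto simp: flat_pair_def\<close>)
  then show "closed P" "closed P'" by auto
qed

lemma flat_pair_scale: assumes "flat_pair m P P'" "0 < c" shows "x \<in> P \<Longrightarrow> dilate c x \<in> P" "x \<in> P' \<Longrightarrow> dilate c x \<in> P'"
proof -
  have "(x \<in> P \<longrightarrow> dilate c x \<in> P) \<and> (x \<in> P' \<longrightarrow> dilate c x \<in> P')"
  proof (cases "flat m P P'")
    case True
    obtain h k where h: "conic_homeo (eucl m) (eucl m) h k" "\<And>x. x \<in> eucl m \<Longrightarrow> x \<in> P \<longleftrightarrow> 0 \<le> h x 0"
      "\<And>x. x \<in> eucl m \<Longrightarrow> x \<in> P' \<longleftrightarrow> h x 0 \<le> 0"
      using flatD[OF True] by metis
    have "h (dilate c x) 0 = c * h x 0" if "x \<in> eucl m" using conic_homeoD(10)[OF h(1) assms(2) that] by simp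
    then show ?thesis using h(2,3) flat_pair_sub[OF assms(1)] dilate_eucl[of x m c] assms(2)
      by (auto simp: zero_le_mult_iff mult_le_0_iff)
  qed (use assms in \<open>auto simp: flat_pair_def\<close>)
  then show "x \<in> P \<Longrightarrow> dilate c x \<in> P" "x \<in> P' \<Longrightarrow> dilate c x \<in> P'" by auto
qed

section \<open>Prisms over a half space and their unfolding\<close>

definition upper :: "nat \<Rightarrow> (nat \<Rightarrow> real) set \<Rightarrow> (nat \<Rightarrow> real) set" where
  "upper m P = {x\<in>eucl (Suc m). 0 \<le> x 0 \<and> stail x \<in> P}"

definition lower :: "nat \<Rightarrow> (nat \<Rightarrow> real) set \<Rightarrow> (nat \<Rightarrow> real) set" where
  "lower m P = {x\<in>eucl (Suc m). x 0 \<le> 0 \<and> stail x \<in> P}"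

definition level :: "(nat \<Rightarrow> real) set \<Rightarrow> (nat \<Rightarrow> real) set" where
  "level P = scons 0 ` P"

definition flip :: "(nat \<Rightarrow> real) \<Rightarrow> (nat \<Rightarrow> real)" where
  "flip x = scons (- x 0) (stail x)"

definition lift_tail :: "((nat \<Rightarrow> real) \<Rightarrow> (nat \<Rightarrow> real)) \<Rightarrow> (nat \<Rightarrow> real) \<Rightarrow> (nat \<Rightarrow> real)" where
  "lift_tail h x = scons (x 0) (h (stail x))"

lemma in_level: "x \<in> level P \<longleftrightarrow> x 0 = 0 \<and> stail x \<in> P"
proof
  assume "x 0 = 0 \<and> stail x \<in> P"
  then have "x = scons 0 (stail x)" "stail x \<in> P" using scons_simps(4)[of x] by auto
  then show "x \<in> level P" unfolding level_def by (rule image_eqI)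
qed (auto simp: level_def)

lemma closed_upper: "closed P \<Longrightarrow> closed (upper m P)"
  and closed_lower: "closed P \<Longrightarrow> closed (lower m P)"
proof -
  have "upper m P = eucl (Suc m) \<inter> ({x. 0 \<le> x 0} \<inter> {x. stail x \<in> P})"
    "lower m P = eucl (Suc m) \<inter> ({x. x 0 \<le> 0} \<inter> {x. stail x \<in> P})"
    by (auto simp: upper_def lower_def)
  then show "closed P \<Longrightarrow> closed (upper m P)" "closed P \<Longrightarrow> closed (lower m P)"
    using closed_eucl closed_stail by (auto intro!: closed_Int)
qed

lemma conic_homeo_lift:
  assumes "conic_homeo A B h k"
  shows "conic_homeo {x. stail x \<in> A} {x. stail x \<in> B} (lift_tail h) (lift_tail k)"
proof -
  note hh = conic_homeoD[OF assms]
  show ?thesis unfolding lift_tail_def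
  proof (rule conic_homeoI)
    have st: "continuous_on S stail" for S by (intro continuous_on_stail continuous_on_id)
    have c1: "continuous_on {x. stail x \<in> A} (\<lambda>x. h (stail x))" and c2: "continuous_on {x. stail x \<in> B} (\<lambda>x. k (stail x))"
      by (rule continuous_on_compose2[OF hh(1) st] continuous_on_compose2[OF hh(2) st]; blast)+
    show "continuous_on {x. stail x \<in> A} (\<lambda>x. scons (x 0) (h (stail x)))"
      "continuous_on {x. stail x \<in> B} (\<lambda>x. scons (x 0) (k (stail x)))"
      by (intro continuous_on_scons continuous_on_coord continuous_on_id c1 c2)+
  qed (use hh in auto)
qed

lemma flip_flip [simp]: "flip (flip x) = x" "flip x 0 = - x 0" "stail (flip x) = stail x"
  by (simp_all add: flip_def)

lemma flip_dilate: "flip (dilate c x) = dilate c (flip x)"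
  by (simp add: flip_def)

lemma conic_homeo_flip: "(\<And>c x. 0 < c \<Longrightarrow> x \<in> A \<Longrightarrow> dilate c x \<in> A) \<Longrightarrow> conic_homeo A (flip ` A) flip flip"
proof (rule conic_homeoI)
  have "continuous_on S flip" for S unfolding flip_def
    by (intro continuous_on_scons continuous_on_stail continuous_on_minus continuous_on_coord continuous_on_id)
  then show "continuous_on A flip" "continuous_on (flip ` A) flip" by auto
qed (auto simp: flip_dilate)

lemma flip_eucl [simp]: "flip x \<in> eucl (Suc m) \<longleftrightarrow> x \<in> eucl (Suc m)"
  unfolding flip_def by simp

lemma flip_upper: "flip ` upper m P = lower m P" "flip ` lower m P = upper m P"
proof -
  have "flip x \<in> lower m P \<longleftrightarrow> x \<in> upper m P" "flip x \<in> upper m P \<longleftrightarrow> x \<in> lower m P" for x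
    unfolding lower_def upper_def by auto
  then show "flip ` upper m P = lower m P" "flip ` lower m P = upper m P"
    using flip_flip(1) by (metis (no_types, lifting) image_eqI image_subsetI subset_antisym subsetI)+
qed

lemma flip_level: "x 0 = 0 \<Longrightarrow> flip x = x" unfolding flip_def by (metis minus_zero scons_simps(4))

lemma upper_dilate: "(\<And>c x. 0 < c \<Longrightarrow> x \<in> P \<Longrightarrow> dilate c x \<in> P) \<Longrightarrow> 0 < c \<Longrightarrow> x \<in> upper m P \<Longrightarrow> dilate c x \<in> upper m P"
  by (simp add: upper_def)

lemma lower_dilate: "(\<And>c x. 0 < c \<Longrightarrow> x \<in> P \<Longrightarrow> dilate c x \<in> P) \<Longrightarrow> 0 < c \<Longrightarrow> x \<in> lower m P \<Longrightarrow> dilate c x \<in> lower m P"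
  by (simp add: lower_def mult_le_0_iff)

lemma level_upper: "P \<subseteq> eucl m \<Longrightarrow> level P \<subseteq> upper m P"
  unfolding upper_def using stail_eucl by (auto simp: in_level)

lemma upper_Int_lower: "P \<subseteq> eucl m \<Longrightarrow> upper m P \<inter> lower m Q = level (P \<inter> Q)"
  unfolding upper_def lower_def using stail_eucl by (fastforce simp: in_level)

lemma upper_empty [simp]: "upper m {} = {}" "lower m {} = {}" "level {} = {}"
  by (auto simp: upper_def lower_def level_def)

text \<open>A quadrant is mapped onto a half plane, fixing one of its sides.\<close>

definition unfold_quadrant :: "(nat \<Rightarrow> real) \<Rightarrow> (nat \<Rightarrow> real)" where
  "unfold_quadrant x = x(0 := min (x 0) (x 1), 1 := x 1 - x 0)"

definition fold_quadrant :: "(nat \<Rightarrow> real) \<Rightarrow> (nat \<Rightarrow> real)" where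
  "fold_quadrant x = x(0 := x 0 + max 0 (- x 1), 1 := x 0 + max 0 (x 1))"

lemma continuous_on_eval: "continuous_on S (\<lambda>x::nat \<Rightarrow> real. x i)"
  by (rule continuous_on_coord[OF continuous_on_id])

lemma conic_homeo_quadrant:
  assumes "0 < m"
  shows "conic_homeo {x \<in> eucl (Suc m). 0 \<le> x 0 \<and> 0 \<le> x 1} {x \<in> eucl (Suc m). 0 \<le> x 0}
    unfold_quadrant fold_quadrant"
proof (rule conic_homeoI)
  have "continuous_on S (\<lambda>x. unfold_quadrant x i)" "continuous_on S (\<lambda>x. fold_quadrant x i)" for S i
    unfolding unfold_quadrant_def fold_quadrant_def fun_upd_def
    by (cases "i = 0"; cases "i = 1"; auto intro!: continuous_on_add continuous_on_diff continuous_on_max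
        continuous_on_min continuous_on_minus continuous_on_eval continuous_on_const)+
  then show "continuous_on {x \<in> eucl (Suc m). 0 \<le> x 0 \<and> 0 \<le> x 1} unfold_quadrant"
    "continuous_on {x \<in> eucl (Suc m). 0 \<le> x 0} fold_quadrant"
    by (auto intro: continuous_on_funI)
  fix x :: "nat \<Rightarrow> real" and c :: real
  show "fold_quadrant (unfold_quadrant x) = x"
    by (auto simp: unfold_quadrant_def fold_quadrant_def fun_eq_iff)
  show "x \<in> {x \<in> eucl (Suc m). 0 \<le> x 0 \<and> 0 \<le> x 1} \<Longrightarrow> unfold_quadrant x \<in> {x \<in> eucl (Suc m). 0 \<le> x 0}"
    using assms by (auto simp: unfold_quadrant_def eucl_def)
  show "x \<in> {x \<in> eucl (Suc m). 0 \<le> x 0} \<Longrightarrow> fold_quadrant x \<in> {x \<in> eucl (Suc m). 0 \<le> x 0 \<and> 0 \<le> x 1}"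
    using assms by (auto simp: fold_quadrant_def eucl_def)
  show "x \<in> {x \<in> eucl (Suc m). 0 \<le> x 0} \<Longrightarrow> unfold_quadrant (fold_quadrant x) = x"
    by (auto simp: unfold_quadrant_def fold_quadrant_def fun_eq_iff)
  assume c: "0 < c"
  show "x \<in> {x \<in> eucl (Suc m). 0 \<le> x 0 \<and> 0 \<le> x 1} \<Longrightarrow> dilate c x \<in> {x \<in> eucl (Suc m). 0 \<le> x 0 \<and> 0 \<le> x 1}"
    using c by auto
  show "unfold_quadrant (dilate c x) = dilate c (unfold_quadrant x)"
    using c by (auto simp: unfold_quadrant_def fun_eq_iff min_mult_distrib_left algebra_simps)
qed

text \<open>Once \<open>P\<close> is straightened to a half space, the prism over it is a quadrant
  times a linear space. Opening the quadrant fixes the floor over \<open>P\<close> and lays the wall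
  over the frontier of \<open>P\<close> down onto the other part \<open>P'\<close> of the
  floor.\<close>

lemma cone_over_half_space:
  assumes fp: "flat_pair m P P'" and ne: "P \<noteq> {}"
  obtains f g where "conic_homeo (upper m P) (upper m (eucl m)) f g" "\<And>x. x \<in> level P \<Longrightarrow> f x = x"
    "f ` upper m (P \<inter> P') = level P'"
proof (cases "P = eucl m \<and> P' = {}")
  case True
  have "conic_homeo (upper m P) (upper m (eucl m)) (\<lambda>x. x) (\<lambda>x. x)"
    using True by (auto intro!: conic_homeo_id upper_dilate)
  then show ?thesis using that[of "\<lambda>x. x" "\<lambda>x. x"] True by simp
next
  case False
  then have fl: "flat m P P'" using fp ne unfolding flat_pair_def by auto
  then have m: "0 < m" by (simp add: flat_def)
  note sub = flat_pair_sub[OF fp]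
  obtain h k where hk: "conic_homeo (eucl m) (eucl m) h k"
    and h: "\<And>x. x \<in> eucl m \<Longrightarrow> x \<in> P \<longleftrightarrow> 0 \<le> h x 0" "\<And>x. x \<in> eucl m \<Longrightarrow> x \<in> P' \<longleftrightarrow> h x 0 \<le> 0"
    using flatD[OF fl] by metis
  note hd = conic_homeoD[OF hk]
  let ?Q = "{x \<in> eucl (Suc m). 0 \<le> x 0 \<and> 0 \<le> x 1}" and ?U = "{x \<in> eucl (Suc m). 0 \<le> x 0}"
  have L: "conic_homeo (eucl (Suc m)) (eucl (Suc m)) (lift_tail h) (lift_tail k)"
    using conic_homeo_lift[OF hk] by simp
  note Ld = conic_homeoD[OF L]
  have U: "upper m (eucl m) = ?U" by (auto simp: upper_def)
  have inQ: "lift_tail h x \<in> ?Q \<longleftrightarrow> x \<in> upper m P" if "x \<in> eucl (Suc m)" for x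
    using that h(1)[of "stail x"] Ld(5)[OF that] by (auto simp: upper_def lift_tail_def)
  have "conic_homeo (upper m P) ?Q (lift_tail h) (lift_tail k)"
  proof (rule conic_homeo_subset[OF L])
    show "upper m P \<subseteq> eucl (Suc m)" by (auto simp: upper_def)
    show "lift_tail h ` upper m P = ?Q"
    proof (intro equalityI subsetI)
      fix y assume y: "y \<in> ?Q"
      then have yE: "y \<in> eucl (Suc m)" by simp
      then have "lift_tail k y \<in> upper m P" using inQ[OF Ld(6)[OF yE]] Ld(8)[OF yE] y by simp
      then show "y \<in> lift_tail h ` upper m P" using Ld(8)[OF yE] by (metis image_eqI)
    qed (use inQ in \<open>auto simp: upper_def\<close>)
    show "\<And>c x. 0 < c \<Longrightarrow> x \<in> upper m P \<Longrightarrow> dilate c x \<in> upper m P"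
      by (rule upper_dilate) (use flat_pair_scale[OF fp] in auto)
  qed
  moreover have "conic_homeo ?U ?U (lift_tail k) (lift_tail h)"
  proof (rule conic_homeo_subset[OF conic_homeo_sym[OF L]])
    show "lift_tail k ` ?U = ?U"
    proof (intro equalityI subsetI)
      fix y assume y: "y \<in> ?U"
      then have "lift_tail h y \<in> ?U" using Ld(5)[of y] by (auto simp: lift_tail_def)
      moreover have "y = lift_tail k (lift_tail h y)" using Ld(7)[of y] y by simp
      ultimately show "y \<in> lift_tail k ` ?U" by blast
    qed (use Ld(6) in \<open>auto simp: lift_tail_def\<close>)
  qed auto
  \<comment> \<open>Straighten, open the quadrant, undo the straightening. The last move brings the
    points of \<open>level P\<close>, which the opening leaves in place, back to themselves.\<close>
  ultimately have f: "conic_homeo (upper m P) ?U (lift_tail k \<circ> (unfold_quadrant \<circ> lift_tail h))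
    ((lift_tail k \<circ> fold_quadrant) \<circ> lift_tail h)" (is "conic_homeo _ _ ?f ?g")
    using conic_homeo_trans[OF conic_homeo_trans[OF _ conic_homeo_quadrant[OF m]]] by blast
  note fd = conic_homeoD[OF f]
  show ?thesis
  proof (rule that)
    show "conic_homeo (upper m P) (upper m (eucl m)) ?f ?g" using f U by simp
    show "?f x = x" if x: "x \<in> level P" for x
    proof -
      have xE: "x \<in> eucl (Suc m)" "x 0 = 0" "stail x \<in> P" using x sub by (auto simp: in_level simp flip: stail_eucl)
      have "unfold_quadrant (lift_tail h x) = lift_tail h x"
        using h(1)[of "stail x"] xE sub by (auto simp: unfold_quadrant_def lift_tail_def fun_eq_iff)
      then show ?thesis using Ld(7)[OF xE(1)] by simp
    qed
    show "?f ` upper m (P \<inter> P') = level P'"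
    proof (intro equalityI subsetI)
      fix y assume "y \<in> ?f ` upper m (P \<inter> P')"
      then obtain x where x: "x \<in> upper m (P \<inter> P')" "y = ?f x" by blast
      then have xE: "x \<in> eucl (Suc m)" "0 \<le> x 0" "stail x \<in> P" "stail x \<in> P'" "stail x \<in> eucl m"
        using sub by (auto simp: upper_def)
      have h0: "h (stail x) 0 = 0" using h[of "stail x"] xE by auto
      let ?z = "unfold_quadrant (lift_tail h x)"
      have z: "?z 0 = 0" "stail ?z 0 \<le> 0" "?z \<in> eucl (Suc m)"
        using h0 xE Ld(5)[OF xE(1)] m by (auto simp: unfold_quadrant_def lift_tail_def eucl_def)
      then have "h (k (stail ?z)) 0 \<le> 0" using hd(8)[of "stail ?z"] by simp
      then have "k (stail ?z) \<in> P'" using h(2)[of "k (stail ?z)"] hd(6)[of "stail ?z"] z by simp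
      then show "y \<in> level P'" using z(1) x(2) by (simp add: in_level lift_tail_def)
    next
      fix y assume y: "y \<in> level P'"
      then have yE: "y \<in> eucl (Suc m)" "y 0 = 0" "stail y \<in> P'" "stail y \<in> eucl m"
        using sub by (auto simp: in_level simp flip: stail_eucl)
      have h0: "h (stail y) 0 \<le> 0" using h(2)[of "stail y"] yE by simp
      let ?z = "fold_quadrant (lift_tail h y)"
      have z: "0 \<le> ?z 0" "stail ?z 0 = 0" "?z \<in> eucl (Suc m)"
        using h0 yE Ld(5)[OF yE(1)] m by (auto simp: fold_quadrant_def lift_tail_def eucl_def)
      then have "h (k (stail ?z)) 0 = 0" using hd(8)[of "stail ?z"] by simp
      then have "k (stail ?z) \<in> P \<inter> P'" using h[of "k (stail ?z)"] hd(6)[of "stail ?z"] z by simp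
      moreover have "lift_tail k ?z \<in> eucl (Suc m)" using Ld(6) z by simp
      ultimately have "?g y \<in> upper m (P \<inter> P')" using z(1) by (simp add: upper_def lift_tail_def)
      moreover have "?f (?g y) = y" by (rule fd(8)) (use yE in simp)
      ultimately show "y \<in> ?f ` upper m (P \<inter> P')" by (metis image_eqI)
    qed
  qed
qed

text \<open>Both prisms open onto the same half space with their floors fixed, so one opening can be
  followed by the inverse of the other. As the floor over \<open>W\<close> remains fixed, a prism
  above and a prism below can afterwards be glued along it.\<close>

lemma upper_shrink:
  assumes fP: "flat_pair m P P'" and fW: "flat_pair m W W'" and ne: "W \<noteq> {}"
    and sub: "W \<subseteq> P" "P' \<subseteq> W'"
  obtains f g where "conic_homeo (upper m P) (upper m W) f g" "\<And>x. x \<in> level W \<Longrightarrow> f x = x"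
    "f ` (upper m (P \<inter> P') \<union> level (P \<inter> W')) = upper m (W \<inter> W')"
proof -
  note sP = flat_pair_sub[OF fP] and sW = flat_pair_sub[OF fW]
  obtain f g where f: "conic_homeo (upper m P) (upper m (eucl m)) f g" "\<And>x. x \<in> level P \<Longrightarrow> f x = x"
    "f ` upper m (P \<inter> P') = level P'" using cone_over_half_space[OF fP] ne sub by blast
  obtain f' g' where f': "conic_homeo (upper m W) (upper m (eucl m)) f' g'" "\<And>x. x \<in> level W \<Longrightarrow> f' x = x"
    "f' ` upper m (W \<inter> W') = level W'" using cone_over_half_space[OF fW ne] by blast
  note fd = conic_homeoD[OF f(1)] and fd' = conic_homeoD[OF f'(1)]
  show ?thesis
  proof (rule that)
    show "conic_homeo (upper m P) (upper m W) (g' \<circ> f) (g \<circ> f')"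
      by (rule conic_homeo_trans[OF f(1) conic_homeo_sym[OF f'(1)]])
    show "(g' \<circ> f) x = x" if x: "x \<in> level W" for x
    proof -
      have "x \<in> level P" using x sub(1) by (auto simp: in_level)
      moreover have "x \<in> upper m W" using level_upper x sW by blast
      then have "g' (f' x) = x" by (rule fd'(7))
      ultimately show ?thesis using f(2) f'(2)[OF x] by simp
    qed
    have "f ` level (P \<inter> W') = level (P \<inter> W')"
      using f(2) by (auto simp: in_level image_def)
    then have "f ` (upper m (P \<inter> P') \<union> level (P \<inter> W')) = level P' \<union> level (P \<inter> W')"
      using f(3) by (simp add: image_Un)
    also have "\<dots> = level (P' \<union> (P \<inter> W'))" by (auto simp: in_level)
    also have "P' \<union> (P \<inter> W') = W'" using flat_pair_Un[OF fP] sub(2) sW by blast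
    finally have 1: "f ` (upper m (P \<inter> P') \<union> level (P \<inter> W')) = level W'" .
    have "g' ` level W' = (\<lambda>x. g' (f' x)) ` upper m (W \<inter> W')" unfolding f'(3)[symmetric] by (simp add: image_image)
    also have "\<dots> = (\<lambda>x. x) ` upper m (W \<inter> W')"
      by (rule image_cong) (use fd'(7) in \<open>auto simp: upper_def\<close>)
    finally show "(g' \<circ> f) ` (upper m (P \<inter> P') \<union> level (P \<inter> W')) = upper m (W \<inter> W')"
      unfolding image_comp[symmetric] 1 by simp
  qed
qed

text \<open>Transported from \<open>upper_shrink\<close> by the reflection \<open>flip\<close>,
  which fixes the floor.\<close>

lemma lower_shrink:
  assumes fP: "flat_pair m P P'" and fW: "flat_pair m W W'" and ne: "W \<noteq> {}"
    and sub: "W \<subseteq> P" "P' \<subseteq> W'"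
  obtains f g where "conic_homeo (lower m P) (lower m W) f g" "\<And>x. x \<in> level W \<Longrightarrow> f x = x"
    "f ` (lower m (P \<inter> P') \<union> level (P \<inter> W')) = lower m (W \<inter> W')"
proof -
  obtain f g where f: "conic_homeo (upper m P) (upper m W) f g" "\<And>x. x \<in> level W \<Longrightarrow> f x = x"
    "f ` (upper m (P \<inter> P') \<union> level (P \<inter> W')) = upper m (W \<inter> W')"
    using upper_shrink[OF assms] by blast
  have 1: "conic_homeo (lower m P) (upper m P) flip flip"
    using conic_homeo_flip[of "lower m P"] lower_dilate[OF flat_pair_scale(1)[OF fP]]
    by (simp add: flip_upper)
  have 2: "conic_homeo (upper m W) (lower m W) flip flip"
    using conic_homeo_flip[of "upper m W"] upper_dilate[OF flat_pair_scale(1)[OF fW]]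
    by (simp add: flip_upper)
  have lev: "flip ` level S = level S" for S using flip_level by (auto simp: in_level image_def)
  show ?thesis
  proof (rule that)
    show "conic_homeo (lower m P) (lower m W) (flip \<circ> (f \<circ> flip)) ((flip \<circ> g) \<circ> flip)"
      by (rule conic_homeo_trans[OF conic_homeo_trans[OF 1 f(1)] 2])
    show "(flip \<circ> (f \<circ> flip)) x = x" if "x \<in> level W" for x
      using f(2)[OF that] flip_level[of x] that by (simp add: in_level)
    show "(flip \<circ> (f \<circ> flip)) ` (lower m (P \<inter> P') \<union> level (P \<inter> W')) = lower m (W \<inter> W')"
      unfolding image_comp[symmetric] image_Un[of flip "lower m (P \<inter> P')"] flip_upper lev f(3) ..
  qed
qed

definition swap01 :: "(nat \<Rightarrow> real) \<Rightarrow> (nat \<Rightarrow> real)" where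
  "swap01 x = x(0 := x 1, 1 := x 0)"

text \<open>The prisms above and below \<open>W\<close> make up a line times \<open>W\<close>. After
  straightening, this is the half space on which coordinate 1 is nonnegative, and exchanging
  coordinates 0 and 1 brings it into standard position.\<close>

lemma double_half_space:
  assumes fl: "flat m W W'"
  obtains f g where "conic_homeo (upper m W \<union> lower m W) (upper m (eucl m)) f g"
    "f ` (upper m (W \<inter> W') \<union> lower m (W \<inter> W')) = level (eucl m)"
proof -
  have m: "0 < m" and sub: "W \<subseteq> eucl m" "W' \<subseteq> eucl m" using fl by (auto simp: flat_def)
  obtain h k where hk: "conic_homeo (eucl m) (eucl m) h k"
    and h: "\<And>x. x \<in> eucl m \<Longrightarrow> x \<in> W \<longleftrightarrow> 0 \<le> h x 0" "\<And>x. x \<in> eucl m \<Longrightarrow> x \<in> W' \<longleftrightarrow> h x 0 \<le> 0"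
    using flatD[OF fl] by metis
  have L: "conic_homeo (eucl (Suc m)) (eucl (Suc m)) (lift_tail h) (lift_tail k)"
    using conic_homeo_lift[OF hk] by simp
  have S: "conic_homeo (eucl (Suc m)) (eucl (Suc m)) swap01 swap01"
  proof (rule conic_homeoI)
    have "continuous_on S (\<lambda>x. swap01 x i)" for S i
      unfolding swap01_def fun_upd_def
      by (cases "i = 0"; cases "i = 1"; auto intro!: continuous_on_eval)
    then show "continuous_on (eucl (Suc m)) swap01" "continuous_on (eucl (Suc m)) swap01"
      by (auto intro: continuous_on_funI)
  qed (use m in \<open>auto simp: swap01_def eucl_def fun_eq_iff\<close>)
  have LS: "conic_homeo (eucl (Suc m)) (eucl (Suc m)) (swap01 \<circ> lift_tail h) (lift_tail k \<circ> swap01)"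
    (is "conic_homeo _ _ ?f ?g") by (rule conic_homeo_trans[OF L S])
  note fd = conic_homeoD[OF LS]
  have U: "upper m W \<union> lower m W = {x \<in> eucl (Suc m). stail x \<in> W}" for W
    by (auto simp: upper_def lower_def)
  have f0: "?f x 0 = h (stail x) 0" for x by (simp add: swap01_def lift_tail_def)
  have im: "?f ` {x \<in> eucl (Suc m). R (h (stail x) 0)} = {y \<in> eucl (Suc m). R (y 0)}" for R
  proof (intro equalityI subsetI)
    fix y assume y: "y \<in> {y \<in> eucl (Suc m). R (y 0)}"
    then have "?f (?g y) = y" "?g y \<in> eucl (Suc m)" using fd(6,8)[of y] by auto
    then show "y \<in> ?f ` {x \<in> eucl (Suc m). R (h (stail x) 0)}"
      using y f0[of "?g y"] by (intro image_eqI[of _ _ "?g y"]) auto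
  next
    fix y assume "y \<in> ?f ` {x \<in> eucl (Suc m). R (h (stail x) 0)}"
    then obtain x where x: "x \<in> eucl (Suc m)" "R (h (stail x) 0)" "y = ?f x" by blast
    then show "y \<in> {y \<in> eucl (Suc m). R (y 0)}" using f0[of x] fd(5)[of x] by simp
  qed
  have W: "{x \<in> eucl (Suc m). stail x \<in> W} = {x \<in> eucl (Suc m). 0 \<le> h (stail x) 0}"
    "{x \<in> eucl (Suc m). stail x \<in> W \<inter> W'} = {x \<in> eucl (Suc m). h (stail x) 0 = 0}"
    using h stail_eucl by fastforce+
  show ?thesis
  proof (rule that)
    show "conic_homeo (upper m W \<union> lower m W) (upper m (eucl m)) ?f ?g"
    proof (rule conic_homeo_subset[OF LS])
      show "?f ` (upper m W \<union> lower m W) = upper m (eucl m)"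
        unfolding U W im[of "\<lambda>t. 0 \<le> t"] by (auto simp: upper_def)
      have "flat_pair m W W'" using fl by (simp add: flat_pair_def)
      then show "dilate c x \<in> upper m W \<union> lower m W" if "0 < c" "x \<in> upper m W \<union> lower m W" for c x
        using that flat_pair_scale(1) unfolding U by auto
    qed (auto simp: U)
    show "?f ` (upper m (W \<inter> W') \<union> lower m (W \<inter> W')) = level (eucl m)"
      unfolding U W im[of "\<lambda>t. t = 0"] by (auto simp: in_level)
  qed
qed

text \<open>If \<open>P\<close> and \<open>Q\<close> meet, both prisms are shrunk onto the common
  floor \<open>P \<inter> Q\<close>, and the resulting double prism is a half space. Otherwise one
  of the two is empty and the other prism is opened alone. The second conclusion follows the set
  shared with the complementary cone, along which two half spaces will be joined.\<close>

lemma join_cone_half_space: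
  assumes fP: "flat_pair m P P'" and fQ: "flat_pair m Q Q'" and fW: "flat_pair m (P \<inter> Q) (P' \<union> Q')"
    and meet: "P \<inter> Q = {} \<Longrightarrow> P = {} \<or> Q = {}" and ne: "P \<noteq> {} \<or> Q \<noteq> {}" "P' \<noteq> {} \<or> Q' \<noteq> {}"
  obtains f g where "conic_homeo (upper m P \<union> lower m Q) (upper m (eucl m)) f g"
    "f ` ((upper m P \<union> lower m Q) \<inter> (upper m P' \<union> lower m Q')) = level (eucl m)"
proof -
  note sP = flat_pair_sub[OF fP] and sQ = flat_pair_sub[OF fQ]
  \<comment> \<open>The shared set consists of the walls over the frontiers of \<open>P\<close> and
    of \<open>Q\<close>, and of the parts of the floor where the cone lies on one side and its
    complement on the other. Floor points belonging to a wall are counted on both sides of each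
    union.\<close>
  have int: "(upper m P \<union> lower m Q) \<inter> (upper m P' \<union> lower m Q') =
    (upper m (P \<inter> P') \<union> level (P \<inter> (P' \<union> Q'))) \<union> (lower m (Q \<inter> Q') \<union> level (Q \<inter> (P' \<union> Q')))"
    using sP sQ stail_eucl by (fastforce simp: upper_def lower_def in_level)
  have lev: "flip ` level S = level S" for S using flip_level by (auto simp: in_level image_def)
  have levP: "level (P \<union> P') = level P \<union> level P'" for P P' by (auto simp: in_level)
  consider "P \<inter> Q \<noteq> {}" | "P = {}" "Q \<noteq> {}" | "Q = {}" "P \<noteq> {}" using meet ne by blast
  then show ?thesis
  proof cases
    case 1
    let ?W = "P \<inter> Q" and ?W' = "P' \<union> Q'"
    obtain u u' where u: "conic_homeo (upper m P) (upper m ?W) u u'" "\<And>x. x \<in> level ?W \<Longrightarrow> u x = x"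
      "u ` (upper m (P \<inter> P') \<union> level (P \<inter> ?W')) = upper m (?W \<inter> ?W')"
      using upper_shrink[OF fP fW 1] by blast
    obtain v v' where v: "conic_homeo (lower m Q) (lower m ?W) v v'" "\<And>x. x \<in> level ?W \<Longrightarrow> v x = x"
      "v ` (lower m (Q \<inter> Q') \<union> level (Q \<inter> ?W')) = lower m (?W \<inter> ?W')"
      using lower_shrink[OF fQ fW 1] by blast
    have AI: "upper m P \<inter> lower m Q = level ?W" "upper m ?W \<inter> lower m ?W = level ?W"
      using upper_Int_lower sP by (metis, metis Int_absorb le_infI1)
    let ?f = "\<lambda>x. if x \<in> upper m P then u x else v x" and ?g = "\<lambda>y. if y \<in> upper m ?W then u' y else v' y"
    have g: "conic_homeo (upper m P \<union> lower m Q) (upper m ?W \<union> lower m ?W) ?f ?g"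
    proof (rule conic_homeo_glue[OF u(1) v(1)])
      show "u x = v x" if "x \<in> upper m P \<inter> lower m Q" for x using that u(2) v(2) unfolding AI by simp
      show "u ` (upper m P \<inter> lower m Q) = upper m ?W \<inter> lower m ?W"
        unfolding AI using u(2) by (simp add: image_def)
    qed (use closed_upper closed_lower flat_pair_closed fP fQ fW in auto)
    have fv: "?f x = v x" if "x \<in> lower m Q" for x
    proof (cases "x \<in> upper m P")
      case True
      then have "x \<in> level ?W" using that AI(1) by blast
      then show ?thesis using u(2) v(2) by simp
    qed simp
    have "level (P \<inter> ?W') \<subseteq> upper m P" "level (Q \<inter> ?W') \<subseteq> lower m Q"
      using sP sQ stail_eucl by (auto simp: in_level upper_def lower_def)
    then have "?f ` (upper m (P \<inter> P') \<union> level (P \<inter> ?W')) = u ` (upper m (P \<inter> P') \<union> level (P \<inter> ?W'))"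
      by (intro image_cong) (auto simp: upper_def)
    moreover have "?f ` (lower m (Q \<inter> Q') \<union> level (Q \<inter> ?W')) = v ` (lower m (Q \<inter> Q') \<union> level (Q \<inter> ?W'))"
    proof (intro image_cong refl fv)
      fix x assume "x \<in> lower m (Q \<inter> Q') \<union> level (Q \<inter> ?W')"
      then show "x \<in> lower m Q" using \<open>level (Q \<inter> ?W') \<subseteq> lower m Q\<close> by (auto simp: lower_def)
    qed
    ultimately have im: "?f ` ((upper m P \<union> lower m Q) \<inter> (upper m P' \<union> lower m Q'))
        = upper m (?W \<inter> ?W') \<union> lower m (?W \<inter> ?W')"
      unfolding int image_Un[of ?f "upper m (P \<inter> P') \<union> level (P \<inter> (P' \<union> Q'))"] u(3) v(3) by simp
    have "?W \<noteq> eucl m \<or> ?W' \<noteq> {}" using ne by blast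
    then have "flat m ?W ?W'" using fW 1 unfolding flat_pair_def by blast
    then obtain f' g' where f': "conic_homeo (upper m ?W \<union> lower m ?W) (upper m (eucl m)) f' g'"
      "f' ` (upper m (?W \<inter> ?W') \<union> lower m (?W \<inter> ?W')) = level (eucl m)"
      using double_half_space by blast
    show ?thesis
    proof (rule that[OF conic_homeo_trans[OF g f'(1)]])
      show "(f' \<circ> ?f) ` ((upper m P \<union> lower m Q) \<inter> (upper m P' \<union> lower m Q')) = level (eucl m)"
        unfolding image_comp[symmetric] im f'(2) ..
    qed
  next
    case 2
    then have P': "P' = eucl m" using flat_pair_Un[OF fP] by simp
    obtain f g where f: "conic_homeo (upper m Q) (upper m (eucl m)) f g" "\<And>x. x \<in> level Q \<Longrightarrow> f x = x"
      "f ` upper m (Q \<inter> Q') = level Q'" using cone_over_half_space[OF fQ 2(2)] by blast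
    have 1: "conic_homeo (lower m Q) (upper m Q) flip flip"
      using conic_homeo_flip[of "lower m Q"] lower_dilate[OF flat_pair_scale(1)[OF fQ]]
      by (simp add: flip_upper)
    have fl: "f ` level Q = level Q" using f(2) by (simp add: image_def)
    have i2: "P \<inter> P' = {}" "P \<inter> (P' \<union> Q') = {}" "Q \<inter> (P' \<union> Q') = Q" using 2 P' sQ by auto
    show ?thesis
    proof (rule that)
      show "conic_homeo (upper m P \<union> lower m Q) (upper m (eucl m)) (f \<circ> flip) (flip \<circ> g)"
        using conic_homeo_trans[OF 1 f(1)] 2 by simp
      have "(f \<circ> flip) ` (lower m (Q \<inter> Q') \<union> level Q) = level Q' \<union> level Q"
        unfolding image_comp[symmetric] image_Un flip_upper lev f(3) fl ..
      also have "\<dots> = level (eucl m)" using flat_pair_Un[OF fQ] levP[of Q Q'] by auto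
      finally show "(f \<circ> flip) ` ((upper m P \<union> lower m Q) \<inter> (upper m P' \<union> lower m Q')) = level (eucl m)"
        unfolding int i2 by simp
    qed
  next
    case 3
    then have Q': "Q' = eucl m" using flat_pair_Un[OF fQ] by simp
    obtain f g where f: "conic_homeo (upper m P) (upper m (eucl m)) f g" "\<And>x. x \<in> level P \<Longrightarrow> f x = x"
      "f ` upper m (P \<inter> P') = level P'" using cone_over_half_space[OF fP 3(2)] by blast
    have fl: "f ` level P = level P" using f(2) by (simp add: image_def)
    have i3: "Q \<inter> Q' = {}" "Q \<inter> (P' \<union> Q') = {}" "P \<inter> (P' \<union> Q') = P" using 3 Q' sP by auto
    show ?thesis
    proof (rule that)
      show "conic_homeo (upper m P \<union> lower m Q) (upper m (eucl m)) f g"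
        using f(1) 3 by simp
      have "f ` (upper m (P \<inter> P') \<union> level P) = level P' \<union> level P"
        using f(3) fl by (simp add: image_Un)
      also have "\<dots> = level (eucl m)" using flat_pair_Un[OF fP] levP[of P P'] by auto
      finally show "f ` ((upper m P \<union> lower m Q) \<inter> (upper m P' \<union> lower m Q')) = level (eucl m)"
        unfolding int i3 by simp
    qed
  qed
qed

text \<open>Positively homogeneous maps make the Alexander trick trivial: a homeomorphism of the bounding
  hyperplane extends to the half space by acting on all but the first coordinate.\<close>

lemma flat_of_half_spaces:
  assumes g: "conic_homeo X (upper m (eucl m)) g k" "g ` (X \<inter> X') = level (eucl m)"
    and g': "conic_homeo X' (upper m (eucl m)) g' k'" "g' ` (X \<inter> X') = level (eucl m)"
    and X: "X \<union> X' = eucl (Suc m)" "closed X" "closed X'"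
  shows "flat (Suc m) X X'"
proof -
  note gd = conic_homeoD[OF g(1)] and gd' = conic_homeoD[OF g'(1)]
  let ?L = "level (eucl m)"
  have dil: "dilate c x \<in> X \<inter> X'" if "0 < c" "x \<in> X \<inter> X'" for c x using gd(9) gd'(9) that by blast
  have gL: "conic_homeo (X \<inter> X') ?L g k"
    by (rule conic_homeo_subset[OF g(1) _ g(2)]) (use dil in auto)
  have gL': "conic_homeo (X \<inter> X') ?L g' k'"
    by (rule conic_homeo_subset[OF g'(1) _ g'(2)]) (use dil in auto)
  have psi: "conic_homeo ?L ?L (g \<circ> k') (g' \<circ> k)"
    by (rule conic_homeo_trans[OF conic_homeo_sym[OF gL'] gL])
  note pd = conic_homeoD[OF psi]
  have inL: "scons 0 x \<in> ?L \<longleftrightarrow> x \<in> eucl m" for x by (simp add: in_level)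
  have tl: "conic_homeo (eucl m) (eucl m) (\<lambda>x. stail ((g \<circ> k') (scons 0 x))) (\<lambda>x. stail ((g' \<circ> k) (scons 0 x)))"
    (is "conic_homeo _ _ ?a ?b")
  proof (rule conic_homeoI)
    have sc: "continuous_on S (scons 0)" for S
      by (intro continuous_on_scons continuous_on_const continuous_on_id)
    show "continuous_on (eucl m) ?a" "continuous_on (eucl m) ?b"
      by (intro continuous_on_stail continuous_on_compose2[OF pd(1) sc] continuous_on_compose2[OF pd(2) sc];
          use inL in blast)+
    fix x assume x: "x \<in> eucl m"
    have s0: "scons 0 (stail y) = y" if "y \<in> ?L" for y using that scons_simps(4)[of y] by (simp add: in_level)
    note y = pd(5)[OF iffD2[OF inL x]] pd(6)[OF iffD2[OF inL x]]
    show "?a x \<in> eucl m" "?b x \<in> eucl m" using y by (simp_all add: in_level)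
    show "?b (?a x) = x" using s0[OF y(1)] pd(7)[OF iffD2[OF inL x]] by simp
    show "?a (?b x) = x" using s0[OF y(2)] pd(8)[OF iffD2[OF inL x]] by simp
    show "?a (dilate c x) = dilate c (?a x)" if "0 < c" for c :: real
      using pd(10)[OF that iffD2[OF inL x]] by simp
  qed simp
  have lift: "conic_homeo (eucl (Suc m)) (eucl (Suc m)) (lift_tail ?a) (lift_tail ?b)"
    using conic_homeo_lift[OF tl] by simp
  note ld = conic_homeoD[OF lift]
  let ?D = "lower m (eucl m)"
  have inD: "lift_tail ?a x \<in> ?D" "lift_tail ?b x \<in> ?D" if "x \<in> ?D" for x
    using that ld(5)[of x] ld(6)[of x] by (auto simp: lower_def) (auto simp: lift_tail_def)
  have "conic_homeo ?D ?D (lift_tail ?a) (lift_tail ?b)"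
  proof (rule conic_homeo_subset[OF lift])
    show DE: "?D \<subseteq> eucl (Suc m)" by (auto simp: lower_def)
    show "lift_tail ?a ` ?D = ?D"
    proof (intro equalityI subsetI)
      fix y assume y: "y \<in> ?D"
      then have "lift_tail ?a (lift_tail ?b y) = y" using ld(8) DE by blast
      then show "y \<in> lift_tail ?a ` ?D" using inD(2)[OF y] by (metis image_eqI)
    qed (use inD in auto)
    show "\<And>c x. 0 < c \<Longrightarrow> x \<in> ?D \<Longrightarrow> dilate c x \<in> ?D" by (rule lower_dilate) auto
  qed
  moreover have "conic_homeo (upper m (eucl m)) ?D flip flip"
    using conic_homeo_flip[of "upper m (eucl m)"] upper_dilate[of "eucl m"] by (simp add: flip_upper)
  ultimately have f2: "conic_homeo X' ?D (lift_tail ?a \<circ> (flip \<circ> g')) ((k' \<circ> flip) \<circ> lift_tail ?b)"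
    (is "conic_homeo _ _ ?f2 ?g2") using conic_homeo_trans[OF conic_homeo_trans[OF g'(1)]] by blast
  have UD: "upper m (eucl m) \<inter> ?D = ?L" "upper m (eucl m) \<union> ?D = eucl (Suc m)"
    using upper_Int_lower[of "eucl m" m "eucl m"] by simp (auto simp: upper_def lower_def)
  have eq: "g x = ?f2 x" if x: "x \<in> X \<inter> X'" for x
  proof -
    have L: "g x \<in> ?L" "g' x \<in> ?L" using g(2) g'(2) x by blast+
    have s0: "scons 0 (stail (g' x)) = g' x" "scons 0 (stail (g x)) = g x" "g' x 0 = 0" "flip (g' x) = g' x"
      using L scons_simps(4)[of "g' x"] scons_simps(4)[of "g x"] flip_level[of "g' x"] by (simp_all add: in_level)
    then show ?thesis using gd'(7)[of x] x by (simp add: lift_tail_def)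
  qed
  let ?f = "\<lambda>x. if x \<in> X then g x else ?f2 x" and ?h = "\<lambda>y. if y \<in> upper m (eucl m) then k y else ?g2 y"
  have "conic_homeo (X \<union> X') (upper m (eucl m) \<union> ?D) ?f ?h"
    by (rule conic_homeo_glue[OF g(1) f2 X(2,3) _ _ eq])
      (use closed_upper closed_lower closed_eucl UD g(2) in auto)
  then have glob: "conic_homeo (eucl (Suc m)) (eucl (Suc m)) ?f ?h" using X UD by simp
  have "?f ` X = g ` X" by (intro image_cong) auto
  then have fX: "?f ` X = {x\<in>eucl (Suc m). 0 \<le> x 0}" using gd(3) by (auto simp: upper_def)
  have "?f ` X' = ?f2 ` X'" by (intro image_cong refl) (use eq in auto)
  then have fX': "?f ` X' = {x\<in>eucl (Suc m). x 0 \<le> 0}" using conic_homeoD(3)[OF f2] by (auto simp: lower_def)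
  show ?thesis unfolding flat_def using X(1) glob fX fX' by blast
qed

text \<open>Both complementary cones are half spaces by \<open>join_cone_half_space\<close>, with
  the same frontier. Each needs its own meeting set to be flat, \<open>P \<inter> Q\<close> for the
  first and \<open>P' \<inter> Q'\<close> for the second, which explains \<open>fW\<close> and
  \<open>fU\<close>.\<close>

theorem flat_join:
  assumes fP: "flat_pair m P P'" and fQ: "flat_pair m Q Q'"
    and fW: "flat_pair m (P \<inter> Q) (P' \<union> Q')" and fU: "flat_pair m (P' \<inter> Q') (P \<union> Q)"
    and meet: "P \<inter> Q = {} \<Longrightarrow> P = {} \<or> Q = {}" "P' \<inter> Q' = {} \<Longrightarrow> P' = {} \<or> Q' = {}"
    and ne: "P \<noteq> {} \<or> Q \<noteq> {}" "P' \<noteq> {} \<or> Q' \<noteq> {}"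
  shows "flat (Suc m) (upper m P \<union> lower m Q) (upper m P' \<union> lower m Q')"
proof -
  \<comment> \<open>Reflection in coordinate 0 exchanges the two half spaces, so the construction
    applies to the complementary cone as well.\<close>
  have sym: "flat_pair m P' P" if "flat_pair m P P'" for P P'
  proof (cases "flat m P P'")
    case True
    then have m: "0 < m" "P \<subseteq> eucl m" "P' \<subseteq> eucl m" by (auto simp: flat_def)
    obtain h k where hk: "conic_homeo (eucl m) (eucl m) h k"
      and h: "h ` P = {x\<in>eucl m. 0 \<le> x 0}" "h ` P' = {x\<in>eucl m. x 0 \<le> 0}"
      using True unfolding flat_def by blast
    have fE: "flip ` eucl m = eucl m"
    proof -
      obtain j where j: "m = Suc j" using m(1) gr0_implies_Suc by blast
      show ?thesis unfolding j
      proof (intro equalityI subsetI)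
        fix x assume "x \<in> eucl (Suc j)"
        then show "x \<in> flip ` eucl (Suc j)" by (intro image_eqI[of _ _ "flip x"]) simp_all
      qed auto
    qed
    have "conic_homeo (eucl m) (eucl m) flip flip" using conic_homeo_flip[of "eucl m"] fE by simp
    from conic_homeo_trans[OF hk this] have c: "conic_homeo (eucl m) (eucl m) (flip \<circ> h) (k \<circ> flip)" .
    have "flip ` {x\<in>eucl m. 0 \<le> x 0} = {x\<in>eucl m. x 0 \<le> 0}" "flip ` {x\<in>eucl m. x 0 \<le> 0} = {x\<in>eucl m. 0 \<le> x 0}"
    proof -
      have *: "flip x \<in> eucl m" if "x \<in> eucl m" for x using fE that by blast
      have "y \<in> flip ` {x\<in>eucl m. R (x 0)} \<longleftrightarrow> y \<in> eucl m \<and> R (- y 0)" for y R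
      proof
        assume "y \<in> eucl m \<and> R (- y 0)"
        then show "y \<in> flip ` {x\<in>eucl m. R (x 0)}" using * by (intro image_eqI[of _ _ "flip y"]) simp_all
      qed (use * in auto)
      from this[of _ "\<lambda>t. 0 \<le> t"] this[of _ "\<lambda>t. t \<le> 0"]
      show "flip ` {x\<in>eucl m. 0 \<le> x 0} = {x\<in>eucl m. x 0 \<le> 0}" "flip ` {x\<in>eucl m. x 0 \<le> 0} = {x\<in>eucl m. 0 \<le> x 0}"
        by (simp_all add: set_eq_iff)
    qed
    then show ?thesis unfolding flat_pair_def flat_def using m c h
      by (metis image_comp)
  qed (use that in \<open>auto simp: flat_pair_def\<close>)
  obtain g k where g: "conic_homeo (upper m P \<union> lower m Q) (upper m (eucl m)) g k"
    "g ` ((upper m P \<union> lower m Q) \<inter> (upper m P' \<union> lower m Q')) = level (eucl m)"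
    using join_cone_half_space[OF fP fQ fW meet(1) ne] by blast
  obtain g' k' where g': "conic_homeo (upper m P' \<union> lower m Q') (upper m (eucl m)) g' k'"
    "g' ` ((upper m P' \<union> lower m Q') \<inter> (upper m P \<union> lower m Q)) = level (eucl m)"
    using join_cone_half_space[OF sym[OF fP] sym[OF fQ] fU meet(2) ne(2,1)] by blast
  show ?thesis
  proof (rule flat_of_half_spaces[OF g g'(1)])
    show "g' ` ((upper m P \<union> lower m Q) \<inter> (upper m P' \<union> lower m Q')) = level (eucl m)"
      using g'(2) by (simp add: Int_commute)
    have "x \<in> eucl (Suc m) \<Longrightarrow> (stail x \<in> P \<or> stail x \<in> P') \<and> (stail x \<in> Q \<or> stail x \<in> Q')" for x
      using flat_pair_Un[OF fP] flat_pair_Un[OF fQ] stail_eucl by blast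
    then show "(upper m P \<union> lower m Q) \<union> (upper m P' \<union> lower m Q') = eucl (Suc m)"
      by (force simp: upper_def lower_def)
  qed (use closed_upper closed_lower flat_pair_closed[OF fP] flat_pair_closed[OF fQ] in auto)
qed

section \<open>Extremal subcomplexes are balls\<close>

definition join_sphere :: "'i set \<Rightarrow> ('i \<Rightarrow> 'v set) \<Rightarrow> 'v set set" where
  "join_sphere I A = {F. F \<subseteq> \<Union>(A ` I) \<and> (\<forall>i\<in>I. \<not> A i \<subseteq> F)}"

definition join_rank :: "'i set \<Rightarrow> ('i \<Rightarrow> 'v set) \<Rightarrow> nat" where
  "join_rank I A = (\<Sum>i\<in>I. card (A i) - 1)"

text \<open>The cone over the geometric realization. The origin belongs to it exactly if the empty
  face belongs to \<open>X\<close>, so the void family has the empty cone.\<close>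

definition cone_of :: "'v set set \<Rightarrow> ('v \<Rightarrow> real) set" where
  "cone_of X = {w. (\<forall>v. 0 \<le> w v) \<and> {v. w v \<noteq> 0} \<in> X}"

lemma join_sphere_sub: "join_subcomplex I A X \<Longrightarrow> X \<subseteq> join_sphere I A"
  by (auto simp: join_subcomplex_def join_sphere_def)

lemma join_subcomplex_sphere: "join_subcomplex I A (join_sphere I A)"
  by (auto simp: join_subcomplex_def join_sphere_def)

lemma cone_of_mono: "X \<subseteq> Y \<Longrightarrow> cone_of X \<subseteq> cone_of Y"
  by (auto simp: cone_of_def)

lemma cone_of_Int: "cone_of (X \<inter> Y) = cone_of X \<inter> cone_of Y"
  and cone_of_Un: "cone_of (X \<union> Y) = cone_of X \<union> cone_of Y"
  by (auto simp: cone_of_def)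

lemma cone_of_empty_iff: assumes "join_subcomplex I A X" shows "cone_of X = {} \<longleftrightarrow> X = {}"
proof
  assume c: "cone_of X = {}"
  show "X = {}"
  proof (rule ccontr)
    assume "X \<noteq> {}"
    then obtain F where "F \<in> X" by blast
    then have "{} \<in> X" by (rule join_subcomplexD(2)[OF assms]) simp
    then have "(\<lambda>_. 0) \<in> cone_of X" by (simp add: cone_of_def)
    then show False using c by simp
  qed
qed (simp add: cone_of_def)

lemma cone_of_dilate: "0 < c \<Longrightarrow> w \<in> cone_of X \<Longrightarrow> dilate c w \<in> cone_of X"
  by (simp add: cone_of_def)

lemma facet_complement_empty:
  assumes bl: "blocks I A" shows "facet_complement I A {} = join_sphere I A"
proof (intro equalityI subsetI)
  fix F assume "F \<in> facet_complement I A {}"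
  then show "F \<in> join_sphere I A" using join_sphere_sub[OF facet_complement_sub] by blast
next
  fix F assume F: "F \<in> join_sphere I A"
  then have "\<forall>i\<in>I. \<exists>v. v \<in> A i \<and> v \<notin> F" by (auto simp: join_sphere_def)
  then obtain t where t: "\<And>i. i \<in> I \<Longrightarrow> t i \<in> A i \<and> t i \<notin> F" by metis
  have "A i - (\<Union>(A ` I) - t ` I) = {t i}" if i: "i \<in> I" for i
  proof -
    have "t j \<notin> A i" if "j \<in> I" "j \<noteq> i" for j
      using blocksD(5)[OF bl that(1) i that(2)] t[OF that(1)] by auto
    then show ?thesis using t i by auto
  qed
  then have "\<Union>(A ` I) - t ` I \<in> full_faces I A" by (auto simp: full_faces_def)
  moreover have "F \<subseteq> \<Union>(A ` I) - t ` I" using F t by (auto simp: join_sphere_def)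
  ultimately show "F \<in> facet_complement I A {}" by (auto simp: facet_complement_def)
qed

lemma continuous_on_Min_finite:
  fixes f :: "'b \<Rightarrow> 'c::topological_space \<Rightarrow> real"
  assumes "finite B" "B \<noteq> {}" "\<And>v. v \<in> B \<Longrightarrow> continuous_on S (f v)"
  shows "continuous_on S (\<lambda>w. Min ((\<lambda>v. f v w) ` B))"
  using assms
proof (induction B rule: finite_ne_induct)
  case (insert v B)
  then have "Min ((\<lambda>v. f v w) ` insert v B) = min (f v w) (Min ((\<lambda>v. f v w) ` B))" for w by simp
  then show ?case using insert by (simp add: continuous_on_min)
qed simp

section \<open>The fan of the sphere as a line times a smaller fan\<close>

context split_block
begin

text \<open>On one block, nonnegative vectors with a zero entry represent the vectors modulo the
  all-ones vector. With \<open>w a - low w\<close> as a new coordinate, and \<open>low w\<close>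
  subtracted from the other entries of the block, such a vector is described by a real number and a
  vector of the same kind for \<open>A i - {a}\<close>.\<close>

definition low :: "('v \<Rightarrow> real) \<Rightarrow> real" where
  "low w = Min (w ` (A i - {a}))"

definition residue_vec :: "('v \<Rightarrow> real) \<Rightarrow> ('v \<Rightarrow> real)" where
  "residue_vec w = (\<lambda>v. if v = a then 0 else if v \<in> A i then w v - low w else w v)"

definition rebuild :: "real \<Rightarrow> ('v \<Rightarrow> real) \<Rightarrow> ('v \<Rightarrow> real)" where
  "rebuild t x = (\<lambda>v. if v = a then max t 0 else if v \<in> A i then x v + max (- t) 0 else x v)"

lemma low_le: "v \<in> A i - {a} \<Longrightarrow> low w \<le> w v"
  using fin by (simp add: low_def)

lemma low_attained: obtains v where "v \<in> A i - {a}" "w v = low w"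
proof -
  have "low w \<in> w ` (A i - {a})" unfolding low_def by (rule Min_in) (use fin A1_ne in auto)
  then obtain v where "v \<in> A i - {a}" "low w = w v" by blast
  then show ?thesis using that by simp
qed

text \<open>Some element of the block has weight zero; it is \<open>a\<close>, or else it makes the
  minimum over the other elements vanish.\<close>

lemma sphere_cases:
  assumes w: "w \<in> cone_of (join_sphere I A)" shows "low w = 0 \<or> w a = 0" "0 \<le> low w"
proof -
  obtain v where v: "v \<in> A i - {a}" "w v = low w" by (rule low_attained)
  then show "0 \<le> low w" using w by (metis (mono_tags, lifting) cone_of_def mem_Collect_eq)
  have "\<not> A i \<subseteq> {v. w v \<noteq> 0}" using w iI by (auto simp: cone_of_def join_sphere_def)
  then obtain u where u: "u \<in> A i" "w u = 0" by auto
  then show "low w = 0 \<or> w a = 0" using low_le[of u w] \<open>0 \<le> low w\<close> by (cases "u = a") auto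
qed

lemma sphere_A1D:
  assumes x: "x \<in> cone_of (join_sphere I A1)"
  shows "x a = 0" "\<exists>v\<in>A i - {a}. x v = 0" "0 \<le> x v"
proof -
  have s: "{v. x v \<noteq> 0} \<subseteq> \<Union>(A ` I) - {a}" "\<And>j. j \<in> I \<Longrightarrow> \<not> A1 j \<subseteq> {v. x v \<noteq> 0}"
    using x unfolding cone_of_def join_sphere_def V1 by auto
  show "x a = 0" using s(1) by auto
  show "\<exists>v\<in>A i - {a}. x v = 0" using s(2)[OF iI] by auto
  show "0 \<le> x v" using x by (simp add: cone_of_def)
qed

lemma residue_in:
  assumes w: "w \<in> cone_of (join_sphere I A)" shows "residue_vec w \<in> cone_of (join_sphere I A1)"
proof -
  note lw = sphere_cases[OF w]
  have w0: "0 \<le> w v" for v using w by (simp add: cone_of_def)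
  have sup: "{v. w v \<noteq> 0} \<subseteq> \<Union>(A ` I)" "\<And>j. j \<in> I \<Longrightarrow> \<not> A j \<subseteq> {v. w v \<noteq> 0}"
    using w by (auto simp: cone_of_def join_sphere_def)
  have "0 \<le> residue_vec w v" for v using low_le[of v w] w0 by (simp add: residue_vec_def)
  moreover have "{v. residue_vec w v \<noteq> 0} \<subseteq> \<Union>(A1 ` I)"
  proof
    fix v assume "v \<in> {v. residue_vec w v \<noteq> 0}"
    then have "v \<noteq> a" "v \<in> A i \<or> w v \<noteq> 0" by (auto simp: residue_vec_def split: if_splits)
    then show "v \<in> \<Union>(A1 ` I)" unfolding V1 using sup(1) iI by blast
  qed
  moreover have "\<not> A1 j \<subseteq> {v. residue_vec w v \<noteq> 0}" if j: "j \<in> I" for j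
  proof (cases "j = i")
    case True
    obtain v where "v \<in> A i - {a}" "w v = low w" by (rule low_attained)
    then show ?thesis using True by (auto simp: residue_vec_def)
  next
    case False
    obtain v where v: "v \<in> A j" "w v = 0" using sup(2)[OF j] by blast
    then have "v \<notin> A i" "v \<noteq> a" using dj[OF j False] a by auto
    then show ?thesis using v False by (auto simp: residue_vec_def)
  qed
  ultimately show ?thesis by (auto simp: cone_of_def join_sphere_def)
qed

lemma rebuild_in:
  assumes x: "x \<in> cone_of (join_sphere I A1)" shows "rebuild t x \<in> cone_of (join_sphere I A)"
proof -
  note xD = sphere_A1D[OF x]
  have sup: "{v. x v \<noteq> 0} \<subseteq> \<Union>(A ` I) - {a}" "\<And>j. j \<in> I \<Longrightarrow> \<not> A1 j \<subseteq> {v. x v \<noteq> 0}"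
    using x unfolding cone_of_def join_sphere_def V1 by auto
  have "0 \<le> rebuild t x v" for v using xD(3)[of v] by (simp add: rebuild_def)
  moreover have "{v. rebuild t x v \<noteq> 0} \<subseteq> \<Union>(A ` I)"
  proof
    fix v assume "v \<in> {v. rebuild t x v \<noteq> 0}"
    then have "v \<in> A i \<or> x v \<noteq> 0" using a by (auto simp: rebuild_def split: if_splits)
    then show "v \<in> \<Union>(A ` I)" using sup(1) iI by blast
  qed
  moreover have "\<not> A j \<subseteq> {v. rebuild t x v \<noteq> 0}" if j: "j \<in> I" for j
  proof (cases "j = i")
    case True
    obtain v where v: "v \<in> A i - {a}" "x v = 0" using xD(2) by blast
    show ?thesis
    proof (cases "t \<le> 0")
      case True
      then have "rebuild t x a = 0" by (simp add: rebuild_def)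
      then show ?thesis using \<open>j = i\<close> a by blast
    next
      case False
      then have "rebuild t x v = 0" using v by (simp add: rebuild_def)
      then show ?thesis using \<open>j = i\<close> v by blast
    qed
  next
    case False
    obtain v where v: "v \<in> A j" "x v = 0" using sup(2)[OF j] False by auto
    then have "v \<notin> A i" "v \<noteq> a" using dj[OF j False] a by auto
    then show ?thesis using v by (auto simp: rebuild_def)
  qed
  ultimately show ?thesis by (auto simp: cone_of_def join_sphere_def)
qed

lemma low_rebuild:
  assumes x: "x \<in> cone_of (join_sphere I A1)" shows "low (rebuild t x) = max (- t) 0"
proof -
  note xD = sphere_A1D[OF x]
  obtain v where v: "v \<in> A i - {a}" "x v = 0" using xD(2) by blast
  show ?thesis unfolding low_def
  proof (rule Min_eqI)
    show "max (- t) 0 \<in> rebuild t x ` (A i - {a})"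
      by (rule image_eqI[OF _ v(1)]) (use v in \<open>simp add: rebuild_def\<close>)
    show "max (- t) 0 \<le> y" if y: "y \<in> rebuild t x ` (A i - {a})" for y
    proof -
      obtain u where u: "u \<in> A i - {a}" "y = rebuild t x u" using y by blast
      have "y = x u + max (- t) 0" using u by (simp add: rebuild_def)
      then show ?thesis using xD(3)[of u] by simp
    qed
  qed (use fin in simp)
qed

lemma residue_rebuild:
  assumes x: "x \<in> cone_of (join_sphere I A1)" shows "residue_vec (rebuild t x) = x"
proof
  fix v show "residue_vec (rebuild t x) v = x v"
    using low_rebuild[OF x, of t] sphere_A1D(1)[OF x] by (simp add: residue_vec_def) (simp add: rebuild_def)
qed

lemma rebuild_residue:
  assumes w: "w \<in> cone_of (join_sphere I A)" shows "rebuild (w a - low w) (residue_vec w) = w"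
proof
  fix v
  have w0: "0 \<le> w a" using w by (simp add: cone_of_def)
  have "max (w a - low w) 0 = w a" "max (- (w a - low w)) 0 = low w"
    using sphere_cases[OF w] w0 by auto
  then show "rebuild (w a - low w) (residue_vec w) v = w v" by (simp add: rebuild_def residue_vec_def)
qed

lemma low_dilate: "0 < c \<Longrightarrow> low (dilate c w) = c * low w"
proof -
  assume c: "0 < c"
  obtain v where v: "v \<in> A i - {a}" "w v = low w" by (rule low_attained)
  show ?thesis unfolding low_def[of "dilate c w"]
  proof (rule Min_eqI)
    show "c * low w \<in> dilate c w ` (A i - {a})" by (rule image_eqI[OF _ v(1)]) (simp add: v)
    show "c * low w \<le> y" if y: "y \<in> dilate c w ` (A i - {a})" for y
    proof -
      obtain u where "u \<in> A i - {a}" "y = dilate c w u" using y by blast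
      then show ?thesis using low_le[of u w] c by simp
    qed
  qed (use fin in simp)
qed

lemma conic_homeo_split:
  assumes e: "conic_homeo (cone_of (join_sphere I A1)) (eucl m) e e'"
  shows "conic_homeo (cone_of (join_sphere I A)) (eucl (Suc m))
    (\<lambda>w. scons (w a - low w) (e (residue_vec w))) (\<lambda>y. rebuild (y 0) (e' (stail y)))"
proof -
  note ed = conic_homeoD[OF e]
  have clow: "continuous_on S low" for S unfolding low_def
    by (rule continuous_on_Min_finite) (use fin A1_ne in \<open>auto intro: continuous_on_coord[OF continuous_on_id]\<close>)
  have cres: "continuous_on S residue_vec" for S
  proof (rule continuous_on_funI)
    fix v show "continuous_on S (\<lambda>w. residue_vec w v)"
      unfolding residue_vec_def using clow
      by (cases "v = a"; cases "v \<in> A i"; auto intro!: continuous_on_diff continuous_on_coord[OF continuous_on_id])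
  qed
  have creb: "continuous_on S (\<lambda>y. rebuild (y 0) (e' (stail y)))" if "S \<subseteq> eucl (Suc m)" for S
  proof (rule continuous_on_funI)
    fix v
    have "continuous_on S (\<lambda>y. e' (stail y))"
      by (rule continuous_on_compose2[OF ed(2) continuous_on_stail[OF continuous_on_id]])
        (use that in auto)
    then have "continuous_on S (\<lambda>y. e' (stail y) v)" by (rule continuous_on_coord)
    moreover have "continuous_on S (\<lambda>y::nat \<Rightarrow> real. y 0)" by (rule continuous_on_eval)
    ultimately show "continuous_on S (\<lambda>y. rebuild (y 0) (e' (stail y)) v)"
      unfolding rebuild_def
      by (cases "v = a"; cases "v \<in> A i"; auto intro!: continuous_on_max continuous_on_add continuous_on_minus)
  qed
  show ?thesis
  proof (rule conic_homeoI)
    show "continuous_on (cone_of (join_sphere I A)) (\<lambda>w. scons (w a - low w) (e (residue_vec w)))"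
      by (intro continuous_on_scons continuous_on_diff clow continuous_on_coord[OF continuous_on_id]
          continuous_on_compose2[OF ed(1) cres]) (use residue_in in blast)
    show "continuous_on (eucl (Suc m)) (\<lambda>y. rebuild (y 0) (e' (stail y)))" by (rule creb) simp
    fix w assume w: "w \<in> cone_of (join_sphere I A)"
    show "scons (w a - low w) (e (residue_vec w)) \<in> eucl (Suc m)" using ed(5)[OF residue_in[OF w]] by simp
    show "rebuild (scons (w a - low w) (e (residue_vec w)) 0) (e' (stail (scons (w a - low w) (e (residue_vec w))))) = w"
      using ed(7)[OF residue_in[OF w]] rebuild_residue[OF w] by simp
    fix c :: real assume c: "0 < c"
    show "dilate c w \<in> cone_of (join_sphere I A)" using cone_of_dilate[OF c w] .
    have "residue_vec (dilate c w) = dilate c (residue_vec w)"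
      using low_dilate[OF c] by (auto simp: residue_vec_def fun_eq_iff algebra_simps)
    then show "scons (dilate c w a - low (dilate c w)) (e (residue_vec (dilate c w))) =
      dilate c (scons (w a - low w) (e (residue_vec w)))"
      using ed(10)[OF c residue_in[OF w]] low_dilate[OF c] by (simp add: algebra_simps)
  next
    fix y assume y: "y \<in> eucl (Suc m)"
    then have x: "e' (stail y) \<in> cone_of (join_sphere I A1)" using ed(6) by simp
    show "rebuild (y 0) (e' (stail y)) \<in> cone_of (join_sphere I A)" by (rule rebuild_in[OF x])
    have "rebuild (y 0) (e' (stail y)) a - low (rebuild (y 0) (e' (stail y))) = y 0"
      unfolding low_rebuild[OF x] by (simp add: rebuild_def)
    then show "scons (rebuild (y 0) (e' (stail y)) a - low (rebuild (y 0) (e' (stail y))))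
          (e (residue_vec (rebuild (y 0) (e' (stail y))))) = y"
      using residue_rebuild[OF x] ed(8)[of "stail y"] y by simp
  qed
qed

text \<open>Where the new coordinate is positive, \<open>a\<close> is in the support and the link
  decides about membership. Where it is negative, the support contains \<open>A i - {a}\<close> and
  the far join decides. On the equator itself either may decide, by
  \<open>extremal_equator\<close>.\<close>

lemma cone_of_split_iff:
  assumes ext: "extremal I A X" and w: "w \<in> cone_of (join_sphere I A)"
  shows "w \<in> cone_of X \<longleftrightarrow> (0 \<le> w a - low w \<and> residue_vec w \<in> cone_of (P X)) \<or>
    (w a - low w \<le> 0 \<and> residue_vec w \<in> cone_of (Q X))"
proof -
  let ?F = "{v. residue_vec w v \<noteq> 0}"
  note r = residue_in[OF w]
  have aF: "a \<notin> ?F" "\<not> A i - {a} \<subseteq> ?F" using sphere_A1D(1,2)[OF r] by auto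
  have nn: "0 \<le> w v" "0 \<le> residue_vec w v" for v using w sphere_A1D(3)[OF r] by (auto simp: cone_of_def)
  note lw = sphere_cases[OF w]
  consider "low w = 0" "0 < w a" | "w a = 0" "0 < low w" | "w a = 0" "low w = 0"
    using lw nn(1)[of a] by linarith
  then show ?thesis
  proof cases
    case 1
    have "{v. w v \<noteq> 0} = insert a ?F" using 1 by (auto simp: residue_vec_def)
    then show ?thesis using 1 aF nn by (simp add: cone_of_def vertex_link_def)
  next
    case 2
    have "{v. w v \<noteq> 0} = ?F \<union> (A i - {a})"
    proof -
      have "w v \<noteq> 0" if "v \<in> A i - {a}" for v using low_le[OF that, of w] 2 by simp
      then show ?thesis using 2 by (auto simp: residue_vec_def split: if_splits)
    qed
    then show ?thesis using 2 aF nn by (simp add: cone_of_def far_join_def)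
  next
    case 3
    have "{v. w v \<noteq> 0} = ?F" using 3 by (auto simp: residue_vec_def)
    then show ?thesis using 3 nn extremal_equator[OF ext aF] by (simp add: cone_of_def)
  qed
qed

lemma image_cone_of_split:
  assumes ext: "extremal I A X" and e: "conic_homeo (cone_of (join_sphere I A1)) (eucl m) e e'"
  shows "(\<lambda>w. scons (w a - low w) (e (residue_vec w))) ` cone_of X =
    upper m (e ` cone_of (P X)) \<union> lower m (e ` cone_of (Q X))" (is "?f ` _ = _")
proof -
  note ed = conic_homeoD[OF e] and fd = conic_homeoD[OF conic_homeo_split[OF e]]
  note X = extremalD(2)[OF ext]
  have XS: "cone_of X \<subseteq> cone_of (join_sphere I A)" by (rule cone_of_mono[OF join_sphere_sub[OF X]])
  have PS: "cone_of (P X) \<subseteq> cone_of (join_sphere I A1)" by (rule cone_of_mono[OF join_sphere_sub[OF sub_link[OF X]]])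
  have QS: "cone_of (Q X) \<subseteq> cone_of (join_sphere I A1)" by (rule cone_of_mono[OF join_sphere_sub[OF sub_far_join[OF X]]])
  have inj: "e x \<in> e ` C \<longleftrightarrow> x \<in> C" if "x \<in> cone_of (join_sphere I A1)" "C \<subseteq> cone_of (join_sphere I A1)" for x C
    using ed(7) that by (metis image_iff subsetD)
  have key: "w \<in> cone_of X \<longleftrightarrow> ?f w \<in> upper m (e ` cone_of (P X)) \<union> lower m (e ` cone_of (Q X))"
    if w: "w \<in> cone_of (join_sphere I A)" for w
    using cone_of_split_iff[OF ext w] inj[OF residue_in[OF w] PS] inj[OF residue_in[OF w] QS]
      ed(5)[OF residue_in[OF w]] by (simp add: upper_def lower_def)
  show ?thesis
  proof (intro equalityI subsetI)
    fix y assume "y \<in> ?f ` cone_of X"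
    then show "y \<in> upper m (e ` cone_of (P X)) \<union> lower m (e ` cone_of (Q X))" using key XS by blast
  next
    fix y assume y: "y \<in> upper m (e ` cone_of (P X)) \<union> lower m (e ` cone_of (Q X))"
    then have yE: "y \<in> eucl (Suc m)" by (auto simp: upper_def lower_def)
    obtain w where w: "w \<in> cone_of (join_sphere I A)" "y = ?f w" using fd(3) yE by blast
    then have "w \<in> cone_of X" using key[OF w(1)] y by simp
    then show "y \<in> ?f ` cone_of X" using w(2) by blast
  qed
qed

lemma join_rank_A1: "join_rank I A = Suc (join_rank I A1)"
proof -
  have "join_rank I A = (card (A i) - 1) + (\<Sum>j\<in>I - {i}. card (A j) - 1)"
    unfolding join_rank_def using blocksD(1)[OF bl] iI by (simp add: sum.remove)
  moreover have "join_rank I A1 = (card (A1 i) - 1) + (\<Sum>j\<in>I - {i}. card (A1 j) - 1)"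
    unfolding join_rank_def using blocksD(1)[OF bl] iI by (intro sum.remove)
  moreover have "(\<Sum>j\<in>I - {i}. card (A1 j) - 1) = (\<Sum>j\<in>I - {i}. card (A j) - 1)"
    by (rule sum.cong) auto
  ultimately show ?thesis using card1 two by simp
qed

end

lemma flat_pair_sphere:
  assumes bl: "blocks I A" and ext: "extremal I A X" and e: "conic_homeo (cone_of (join_sphere I A)) (eucl m) e e'"
    and X: "X = {} \<or> facet_complement I A X = {}"
  shows "flat_pair m (e ` cone_of X) (e ` cone_of (facet_complement I A X))"
proof -
  have "e ` cone_of (join_sphere I A) = eucl m" using conic_homeoD(3)[OF e] .
  moreover have "cone_of {} = {}" by (simp add: cone_of_def)
  moreover have "facet_complement I A X = {} \<Longrightarrow> X = join_sphere I A"
    using facet_complement_involutive[OF ext] facet_complement_empty[OF bl] by simp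
  ultimately show ?thesis using X facet_complement_empty[OF bl] unfolding flat_pair_def by auto
qed

text \<open>The chart \<open>e\<close> is chosen before \<open>X\<close>: in the induction the link,
  the far join and their intersection have to be compared inside one Euclidean space. Only the
  straightening hidden in \<open>flat_pair\<close> depends on \<open>X\<close>.\<close>

theorem sphere_fan_flat:
  assumes "blocks I A"
  shows "\<exists>e e'. conic_homeo (cone_of (join_sphere I A)) (eucl (join_rank I A)) e e' \<and>
    (\<forall>X. extremal I A X \<longrightarrow> flat_pair (join_rank I A) (e ` cone_of X) (e ` cone_of (facet_complement I A X)))"
  using assms
proof (induction "card (\<Union>(A ` I))" arbitrary: A rule: less_induct)
  case less
  show ?case
  proof (cases "\<exists>i\<in>I. 2 \<le> card (A i)")
    case False
    note s = singleton_blocks[OF less.prems False]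
    note sub = singleton_subcomplex[OF less.prems False]
    have "join_sphere I A = {{}}"
    proof
      show "join_sphere I A \<subseteq> {{}}" by (rule sub(1)[OF join_subcomplex_sphere])
      show "{{}} \<subseteq> join_sphere I A" using blocksD(3)[OF less.prems] by (auto simp: join_sphere_def)
    qed
    then have C: "cone_of (join_sphere I A) = {\<lambda>_. 0}" by (auto simp: cone_of_def fun_eq_iff)
    have d: "join_rank I A = 0" using s by (simp add: join_rank_def)
    have e: "conic_homeo (cone_of (join_sphere I A)) (eucl (join_rank I A)) (\<lambda>_ _. 0) (\<lambda>_ _. 0)"
      unfolding C d by (rule conic_homeoI) (auto simp: eucl_def dilate_def fun_eq_iff)
    moreover have "X = {} \<or> facet_complement I A X = {}" if "extremal I A X" for X
      using sub[OF extremalD(2)[OF that]] by (auto simp: facet_complement_def)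
    ultimately show ?thesis
      by (intro exI[of _ "\<lambda>_ _. 0"] conjI allI impI flat_pair_sphere[OF less.prems _ e])
  next
    case True
    then obtain i where i: "i \<in> I" "2 \<le> card (A i)" by auto
    then obtain a where "a \<in> A i" using blocksD(3)[OF less.prems(1)] by blast
    then interpret split_block I A i a using less.prems(1) i by unfold_locales
    let ?m = "join_rank I A1" and ?c = "facet_complement I A" and ?c1 = "facet_complement I A1"
    obtain e e' where e: "conic_homeo (cone_of (join_sphere I A1)) (eucl ?m) e e'"
      and IH: "\<And>X. extremal I A1 X \<Longrightarrow> flat_pair ?m (e ` cone_of X) (e ` cone_of (?c1 X))"
      using less.hyps[OF smaller1 bl1] by blast
    note ed = conic_homeoD[OF e]
    let ?f = "\<lambda>w. scons (w a - low w) (e (residue_vec w))"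
    have f: "conic_homeo (cone_of (join_sphere I A)) (eucl (join_rank I A)) ?f (\<lambda>y. rebuild (y 0) (e' (stail y)))"
      using conic_homeo_split[OF e] join_rank_A1 by simp
    have imI: "e ` cone_of X \<inter> e ` cone_of Y = e ` cone_of (X \<inter> Y)"
      if "join_subcomplex I A1 X" "join_subcomplex I A1 Y" for X Y
    proof -
      have "inj_on e (cone_of (join_sphere I A1))" by (rule inj_on_inverseI[of _ e']) (rule ed(7))
      then show ?thesis unfolding cone_of_Int
        by (rule inj_on_image_Int[symmetric]) (rule cone_of_mono[OF join_sphere_sub[OF that(1)]]
            cone_of_mono[OF join_sphere_sub[OF that(2)]])+
    qed
    have imU: "e ` cone_of X \<union> e ` cone_of Y = e ` cone_of (X \<union> Y)" for X Y
      by (simp add: cone_of_Un image_Un)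
    have half: "flat_pair ?m (e ` cone_of (P X) \<inter> e ` cone_of (Q X))
        (e ` cone_of (P (?c X)) \<union> e ` cone_of (Q (?c X)))"
      "e ` cone_of (P X) \<inter> e ` cone_of (Q X) = {} \<Longrightarrow> e ` cone_of (P X) = {} \<or> e ` cone_of (Q X) = {}"
      "X \<noteq> {} \<Longrightarrow> e ` cone_of (P X) \<noteq> {} \<or> e ` cone_of (Q X) \<noteq> {}"
      "flat_pair ?m (e ` cone_of (P X)) (e ` cone_of (P (?c X)))"
      "flat_pair ?m (e ` cone_of (Q X)) (e ` cone_of (Q (?c X)))"
      if ext: "extremal I A X" for X
    proof -
      note X = extremalD(2)[OF ext]
      note sP = sub_link[OF X] and sQ = sub_far_join[OF X]
      note sPQ = join_subcomplex_Int[OF sP sQ]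
      show "flat_pair ?m (e ` cone_of (P X) \<inter> e ` cone_of (Q X))
        (e ` cone_of (P (?c X)) \<union> e ` cone_of (Q (?c X)))"
        unfolding imI[OF sP sQ] imU link_facet_complement far_join_facet_complement
          facet_complement_Int[symmetric] by (rule IH[OF extremal_inter[OF ext]])
      show "flat_pair ?m (e ` cone_of (P X)) (e ` cone_of (P (?c X)))"
        unfolding link_facet_complement by (rule IH[OF extremal_split(1)[OF ext]])
      show "flat_pair ?m (e ` cone_of (Q X)) (e ` cone_of (Q (?c X)))"
        unfolding far_join_facet_complement by (rule IH[OF extremal_far_join[OF ext]])
      show "e ` cone_of (P X) = {} \<or> e ` cone_of (Q X) = {}"
        if *: "e ` cone_of (P X) \<inter> e ` cone_of (Q X) = {}"
      proof -
        have PQ: "P X \<inter> Q X = {}" using * unfolding imI[OF sP sQ] using cone_of_empty_iff[OF sPQ] by simp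
        \<comment> \<open>Nonvoid subcomplexes share the empty face.\<close>
        have "P X = {} \<or> Q X = {}"
        proof (rule ccontr)
          assume "\<not> (P X = {} \<or> Q X = {})"
          then obtain F G where "F \<in> P X" "G \<in> Q X" by blast
          then have "{} \<in> P X" "{} \<in> Q X" using join_subcomplexD(2)[OF sP] join_subcomplexD(2)[OF sQ] by blast+
          then show False using PQ by blast
        qed
        then show ?thesis using cone_of_empty_iff[OF sP] cone_of_empty_iff[OF sQ] by auto
      qed
      show "e ` cone_of (P X) \<noteq> {} \<or> e ` cone_of (Q X) \<noteq> {}" if nX: "X \<noteq> {}"
      proof -
        obtain F where "F \<in> X" using nX by blast
        then have "{} \<in> X" by (rule join_subcomplexD(2)[OF X]) simp
        then have "{} \<in> P X \<or> {} \<in> Q X" using extremal_equator[OF ext, of "{}"] A1_ne by blast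
        then show ?thesis using cone_of_empty_iff[OF sP] cone_of_empty_iff[OF sQ] by auto
      qed
    qed
    have "flat_pair (join_rank I A) (?f ` cone_of X) (?f ` cone_of (?c X))" if ext: "extremal I A X" for X
    proof (cases "X = {} \<or> ?c X = {}")
      case True
      then show ?thesis by (rule flat_pair_sphere[OF less.prems ext f])
    next
      case False
      note ext' = extremal_facet_complement[OF ext]
      \<comment> \<open>The facts for the complement are those for \<open>X\<close> with the roles
        exchanged, because the complement of the complement is \<open>X\<close>.\<close>
      note h = half[OF ext] and h' = half[OF ext', unfolded facet_complement_involutive[OF ext]]
      have "flat (Suc ?m) (upper ?m (e ` cone_of (P X)) \<union> lower ?m (e ` cone_of (Q X)))
        (upper ?m (e ` cone_of (P (?c X))) \<union> lower ?m (e ` cone_of (Q (?c X))))"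
        using False by (intro flat_join h h') auto
      then show ?thesis
        unfolding image_cone_of_split[OF ext e] image_cone_of_split[OF ext' e] join_rank_A1 flat_pair_def by blast
    qed
    then show ?thesis using f by blast
  qed
qed

section \<open>From a half space to a ball\<close>

lemma homeomorphic_space_top_of_set:
  fixes f :: "'a::topological_space \<Rightarrow> 'b::topological_space"
  assumes "homeomorphism S T f g" shows "top_of_set S homeomorphic_space top_of_set T"
  unfolding homeomorphic_space_def homeomorphic_maps_def
  using assms by (intro exI[of _ f] exI[of _ g]) (auto simp: homeomorphism_def)

text \<open>A homogeneous map takes the cone of \<open>X\<close> onto a closed half space, so its
  rays correspond to the points of a closed hemisphere, which projects onto a ball when coordinate 0
  is dropped. On the other side every ray meets the realization exactly once, where the total weight
  is 1.\<close>

theorem extremal_ball: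
  assumes ext: "extremal I A X" and ne: "X \<noteq> {}" "facet_complement I A X \<noteq> {}"
  shows "geometric_realization X homeomorphic_space closed_nball (join_rank I A - 1)"
proof -
  note bl = extremalD(1)[OF ext] and X = extremalD(2)[OF ext]
  let ?V = "\<Union>(A ` I)"
  obtain e e' where e: "conic_homeo (cone_of (join_sphere I A)) (eucl (join_rank I A)) e e'"
    and fp: "flat_pair (join_rank I A) (e ` cone_of X) (e ` cone_of (facet_complement I A X))"
    using sphere_fan_flat[OF bl] ext by blast
  have neC: "e ` cone_of X \<noteq> {}" "e ` cone_of (facet_complement I A X) \<noteq> {}"
    using ne cone_of_empty_iff[OF X] cone_of_empty_iff[OF facet_complement_sub[of I A X]] by auto
  then have fl: "flat (join_rank I A) (e ` cone_of X) (e ` cone_of (facet_complement I A X))"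
    using fp unfolding flat_pair_def by blast
  have "0 < join_rank I A" using fl by (simp add: flat_def)
  then obtain m where m: "join_rank I A = Suc m" using gr0_implies_Suc by blast
  obtain h0 k0 where h0: "conic_homeo (eucl (Suc m)) (eucl (Suc m)) h0 k0"
    "h0 ` e ` cone_of X = {x\<in>eucl (Suc m). 0 \<le> x 0}"
    using fl unfolding flat_def m by (elim conjE exE) rule
  have "conic_homeo (cone_of (join_sphere I A)) (eucl (Suc m)) (h0 \<circ> e) (e' \<circ> k0)"
    using conic_homeo_trans[OF e[unfolded m] h0(1)] .
  from conic_homeo_subset[OF this cone_of_mono[OF join_sphere_sub[OF X]] _ cone_of_dilate]
  have "conic_homeo (cone_of X) {x\<in>eucl (Suc m). 0 \<le> x 0} (h0 \<circ> e) (e' \<circ> k0)"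
    using h0(2) by (simp only: image_comp[symmetric])
  then obtain h k where hk: "conic_homeo (cone_of X) {x\<in>eucl (Suc m). 0 \<le> x 0} h k" by metis
  note hd = conic_homeoD[OF hk]
  have fV: "finite ?V" using blocksD(4)[OF bl] .
  obtain F0 where "F0 \<in> X" using ne by blast
  then have "{} \<in> X" by (rule join_subcomplexD(2)[OF X]) simp
  then have zC: "(\<lambda>_. 0) \<in> cone_of X" by (simp add: cone_of_def)
  \<comment> \<open>The origin is fixed by dilation with factor 2, hence so is its image; no other
    vector is.\<close>
  have h_zero: "h (\<lambda>_. 0) = (\<lambda>_. 0)"
  proof
    fix j
    have "h (dilate 2 (\<lambda>_. 0)) = dilate 2 (h (\<lambda>_. 0))" by (rule hd(10)) (use zC in auto)
    moreover have "dilate 2 (\<lambda>_::'b. 0) = (\<lambda>_. 0)" by (simp add: dilate_def)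
    ultimately have "h (\<lambda>_. 0) j = 2 * h (\<lambda>_. 0) j" by (metis dilate_apply)
    then show "h (\<lambda>_. 0) j = 0" by simp
  qed
  define nrm where "nrm y = sqrt (\<Sum>i<Suc m. (y i)\<^sup>2)" for y :: "nat \<Rightarrow> real"
  define tot where "tot w = (\<Sum>v\<in>?V. w v)" for w :: "'b \<Rightarrow> real"
  define B where "B = {z\<in>eucl m. (\<Sum>i<m. (z i)\<^sup>2) \<le> 1}"
  define R where "R = {w\<in>cone_of X. tot w = 1}"
  have supV: "w v = 0" if "w \<in> cone_of X" "v \<notin> ?V" for w v
    using that join_subcomplexD(1)[OF X] unfolding cone_of_def by blast
  have realn: "geometric_realization X = top_of_set R"
  proof -
    have "{w. (\<forall>v. 0 \<le> w v) \<and> {v. w v \<noteq> 0} \<in> X \<and> (\<Sum>v | w v \<noteq> 0. w v) = 1} = R"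
    proof (rule Collect_cong[of _ "\<lambda>w. w \<in> cone_of X \<and> tot w = 1", folded R_def])
      fix w :: "'b \<Rightarrow> real"
      have "(\<Sum>v | w v \<noteq> 0. w v) = tot w" if "w \<in> cone_of X" unfolding tot_def
        by (rule sum.mono_neutral_left[OF fV]) (use supV[OF that] in auto)
      then show "((\<forall>v. 0 \<le> w v) \<and> {v. w v \<noteq> 0} \<in> X \<and> (\<Sum>v | w v \<noteq> 0. w v) = 1) \<longleftrightarrow> w \<in> cone_of X \<and> tot w = 1"
        unfolding cone_of_def by auto
    qed
    then show ?thesis unfolding geometric_realization_def euclidean_product_topology by simp
  qed
  have balln: "closed_nball m = top_of_set B"
    unfolding closed_nball_def Euclidean_space_def euclidean_product_topology subtopology_subtopology B_def eucl_def
    by (rule arg_cong[of _ _ top_of_set]) auto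
  have nrm_pos: "0 < nrm y" if y: "y \<in> eucl (Suc m)" "y \<noteq> (\<lambda>_. 0)" for y
  proof -
    obtain j where "y j \<noteq> 0" using y(2) by auto
    then have "j < Suc m" using y(1) by (auto simp: eucl_def not_less[symmetric])
    then have "0 < (\<Sum>i<Suc m. (y i)\<^sup>2)" using \<open>y j \<noteq> 0\<close> by (intro sum_pos2[of _ j]) auto
    then show ?thesis by (simp add: nrm_def)
  qed
  have tot_pos: "0 < tot w" if w: "w \<in> cone_of X" "w \<noteq> (\<lambda>_. 0)" for w
  proof -
    obtain j where "w j \<noteq> 0" using w(2) by auto
    moreover have "0 \<le> w v" for v using w by (simp add: cone_of_def)
    ultimately show ?thesis unfolding tot_def using supV[OF w(1), of j] fV
      by (intro sum_pos2[of _ j]) (auto simp: less_le)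
  qed
  have tot_dil: "tot (dilate c w) = c * tot w" for c w by (simp add: tot_def sum_distrib_left)
  have nrm_dil: "nrm (dilate c y) = c * nrm y" if "0 < c" for c y
    using that by (simp add: nrm_def power_mult_distrib sum_distrib_left[symmetric] real_sqrt_mult del: sum.lessThan_Suc)
  have dil1: "dilate 1 x = x" for x :: "'c \<Rightarrow> real" by (simp add: dilate_def)
  have dild: "dilate c (dilate d x) = dilate (c * d) x" for c d and x :: "'c \<Rightarrow> real" by (simp add: dilate_def mult.assoc)
  \<comment> \<open>\<open>f\<close> scales to norm 1 and forgets coordinate 0; \<open>q\<close>
    restores that coordinate as a nonnegative square root; \<open>g\<close> returns to the cone of
    \<open>X\<close> and scales to total weight 1.\<close>
  define f where "f w = stail (dilate (1 / nrm (h w)) (h w))" for w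
  define q where "q z = scons (sqrt (1 - (\<Sum>i<m. (z i)\<^sup>2))) z" for z
  define g where "g z = dilate (1 / tot (k (q z))) (k (q z))" for z
  have sumS: "(\<Sum>i<Suc m. (y i)\<^sup>2) = (y 0)\<^sup>2 + (\<Sum>i<m. (stail y i)\<^sup>2)" for y :: "nat \<Rightarrow> real"
    unfolding sum.lessThan_Suc_shift by simp
  have nz: "w \<noteq> (\<lambda>_. 0)" if "w \<in> R" for w using that by (auto simp: R_def tot_def)
  have hw: "h w \<in> eucl (Suc m)" "0 \<le> h w 0" "0 < nrm (h w)" if w: "w \<in> R" for w
  proof -
    have wC: "w \<in> cone_of X" using w by (simp add: R_def)
    show 1: "h w \<in> eucl (Suc m)" "0 \<le> h w 0" using hd(5)[OF wC] by auto
    have "h w \<noteq> (\<lambda>_. 0)"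
      using hd(7)[OF wC] hd(7)[OF zC] h_zero nz[OF w] by metis
    then show "0 < nrm (h w)" by (rule nrm_pos[OF 1(1)])
  qed
  have qz: "q z \<in> {x\<in>eucl (Suc m). 0 \<le> x 0}" "nrm (q z) = 1" "stail (q z) = z" if z: "z \<in> B" for z
  proof -
    have s: "(\<Sum>i<m. (z i)\<^sup>2) \<le> 1" "z \<in> eucl m" using z by (auto simp: B_def)
    then show "q z \<in> {x\<in>eucl (Suc m). 0 \<le> x 0}" by (simp add: q_def)
    show "nrm (q z) = 1" unfolding nrm_def sumS using s by (simp add: q_def)
  qed (simp add: q_def)
  have kq: "k (q z) \<in> cone_of X" "0 < tot (k (q z))" if z: "z \<in> B" for z
  proof -
    show 1: "k (q z) \<in> cone_of X" by (rule hd(6)[OF qz(1)[OF z]])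
    have "k (q z) \<noteq> (\<lambda>_. 0)"
    proof
      assume "k (q z) = (\<lambda>_. 0)"
      then have "q z = (\<lambda>_. 0)" using hd(8)[OF qz(1)[OF z]] h_zero by simp
      then show False using qz(2)[OF z] by (simp add: nrm_def)
    qed
    then show "0 < tot (k (q z))" by (rule tot_pos[OF 1])
  qed
  have cdil: "continuous_on S (\<lambda>x. dilate (u x) (y x))" if "continuous_on S u" "continuous_on S y"
    for S :: "'c::topological_space set" and u and y :: "'c \<Rightarrow> 'd \<Rightarrow> real"
    unfolding dilate_def
    by (rule continuous_on_funI) (intro continuous_on_mult that(1) continuous_on_coord[OF that(2)])
  have homeo: "homeomorphism R B f g"
  proof (rule homeomorphismI)
    have RC: "R \<subseteq> cone_of X" by (auto simp: R_def)
    have ch: "continuous_on R h" using hd(1) RC continuous_on_subset by blast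
    have "continuous_on R (\<lambda>w. nrm (h w))" unfolding nrm_def
      by (intro continuous_on_real_sqrt continuous_on_sum continuous_on_power continuous_on_coord[OF ch])
    then have "continuous_on R (\<lambda>w. 1 / nrm (h w))"
      by (intro continuous_on_divide continuous_on_const) (use hw(3) in force)+
    then show "continuous_on R f" unfolding f_def by (intro continuous_on_stail cdil ch)
    have id: "continuous_on B (\<lambda>z. z i)" for i by (rule continuous_on_coord[OF continuous_on_id])
    have cq: "continuous_on B q" unfolding q_def
      by (intro continuous_on_scons continuous_on_real_sqrt continuous_on_diff continuous_on_const
          continuous_on_sum continuous_on_power id continuous_on_id)
    have ck: "continuous_on B (\<lambda>z. k (q z))"
      by (rule continuous_on_compose2[OF hd(2) cq]) (use qz(1) in blast)
    have "continuous_on B (\<lambda>z. tot (k (q z)))" unfolding tot_def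
      by (intro continuous_on_sum continuous_on_coord[OF ck])
    then have "continuous_on B (\<lambda>z. 1 / tot (k (q z)))"
      by (intro continuous_on_divide continuous_on_const) (use kq(2) in force)+
    then show "continuous_on B g" unfolding g_def by (intro cdil ck)
    show "f ` R \<subseteq> B"
    proof (rule image_subsetI)
      fix w assume w: "w \<in> R"
      let ?y = "dilate (1 / nrm (h w)) (h w)"
      have "nrm ?y = 1" using nrm_dil[of "1 / nrm (h w)"] hw(3)[OF w] by simp
      then have "(?y 0)\<^sup>2 + (\<Sum>i<m. (stail ?y i)\<^sup>2) = 1" unfolding nrm_def sumS by simp
      then have "(\<Sum>i<m. (stail ?y i)\<^sup>2) \<le> 1" using zero_le_power2[of "?y 0"] by linarith
      then show "f w \<in> B" unfolding B_def f_def using hw(1)[OF w] by simp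
    qed
    show "g ` B \<subseteq> R"
    proof (rule image_subsetI)
      fix z assume z: "z \<in> B"
      show "g z \<in> R" unfolding R_def g_def using cone_of_dilate[OF _ kq(1)[OF z]] kq(2)[OF z] tot_dil by simp
    qed
    show "g (f w) = w" if w: "w \<in> R" for w
    proof -
      have wC: "w \<in> cone_of X" "tot w = 1" using w by (auto simp: R_def)
      let ?c = "1 / nrm (h w)"
      have c: "0 < ?c" using hw(3)[OF w] by simp
      let ?y = "dilate ?c (h w)"
      have "nrm ?y = 1" using nrm_dil[OF c] hw(3)[OF w] by simp
      then have "(?y 0)\<^sup>2 + (\<Sum>i<m. (stail ?y i)\<^sup>2) = 1" unfolding nrm_def sumS by simp
      then have "1 - (\<Sum>i<m. (stail ?y i)\<^sup>2) = (?y 0)\<^sup>2" by linarith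
      moreover have "0 \<le> ?y 0" using hw(2)[OF w] c by simp
      ultimately have "sqrt (1 - (\<Sum>i<m. (stail ?y i)\<^sup>2)) = ?y 0" by (metis real_sqrt_abs abs_of_nonneg)
      then have q: "q (f w) = ?y" unfolding q_def f_def by (metis scons_simps(4))
      have "?y = h (dilate ?c w)" using hd(10)[OF c wC(1)] by simp
      then have kq': "k (q (f w)) = dilate ?c w" using hd(7)[OF hd(9)[OF c wC(1)]] q by simp
      show ?thesis unfolding g_def kq' tot_dil wC(2) dild using c by (simp add: dil1)
    qed
    show "f (g z) = z" if z: "z \<in> B" for z
    proof -
      let ?c = "1 / tot (k (q z))"
      have c: "0 < ?c" using kq(2)[OF z] by simp
      have "h (g z) = dilate ?c (q z)"
        unfolding g_def using hd(10)[OF c kq(1)[OF z]] hd(8)[OF qz(1)[OF z]] by simp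
      moreover have "nrm (dilate ?c (q z)) = ?c" using nrm_dil[OF c] qz(2)[OF z] by simp
      ultimately show ?thesis unfolding f_def using kq(2)[OF z] qz(3)[OF z] by (simp add: dild dil1)
    qed
  qed
  show ?thesis unfolding realn m diff_Suc_1 balln by (rule homeomorphic_space_top_of_set[OF homeo])
qed

section \<open>Extremal subcomplexes are constructible\<close>

text \<open>As \<open>v\<close> is a new vertex, coning commutes with intersections, so a
  construction of \<open>X\<close> can be coned step by step.\<close>

lemma constructible_cone:
  assumes "constructible d X" "\<And>F. F \<in> X \<Longrightarrow> v \<notin> F"
  shows "constructible (d + 1) (X \<union> insert v ` X)"
  using assms
proof (induction rule: constructible.induct)
  case (simplex F)
  then have v: "v \<notin> F" by blast
  have "constructible (int (card (insert v F)) - 1) (Pow (insert v F))"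
    using simplex by (intro constructible.simplex) simp
  then show ?case using v simplex by (simp add: Pow_insert)
next
  case (union d Y Z)
  have "(Y \<union> insert v ` Y) \<inter> (Z \<union> insert v ` Z) = (Y \<inter> Z) \<union> insert v ` (Y \<inter> Z)"
  proof (intro equalityI subsetI)
    fix H assume H: "H \<in> (Y \<union> insert v ` Y) \<inter> (Z \<union> insert v ` Z)"
    show "H \<in> (Y \<inter> Z) \<union> insert v ` (Y \<inter> Z)"
    proof (cases "v \<in> H")
      case True
      then obtain F G where FG: "F \<in> Y" "H = insert v F" "G \<in> Z" "H = insert v G" using H union.prems by blast
      then have "v \<notin> F" "v \<notin> G" using union.prems by blast+
      then have "F = G" using FG(2,4) by (metis insert_ident)
      then show ?thesis using FG by blast
    next
      case False then show ?thesis using H by blast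
    qed
  qed auto
  then have cI: "constructible (d + 1 - 1) ((Y \<union> insert v ` Y) \<inter> (Z \<union> insert v ` Z))"
    using union.IH(3) union.prems by simp
  have "constructible (d + 1) (Y \<union> insert v ` Y)" "constructible (d + 1) (Z \<union> insert v ` Z)"
    using union.IH(1,2) union.prems by simp_all
  then have "constructible (d + 1) ((Y \<union> insert v ` Y) \<union> (Z \<union> insert v ` Z))"
    by (rule constructible.union[OF _ _ cI])
  moreover have "(Y \<union> insert v ` Y) \<union> (Z \<union> insert v ` Z) = Y \<union> Z \<union> insert v ` (Y \<union> Z)" by blast
  ultimately show ?case by simp
qed

text \<open>A join with a simplex is an iterated cone, one for each vertex.\<close>

lemma constructible_simplex_join:
  assumes "finite B" "constructible d X" "\<And>F. F \<in> X \<Longrightarrow> F \<inter> B = {}"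
  shows "constructible (d + int (card B)) {F \<union> G |F G. F \<in> X \<and> G \<subseteq> B}"
  using assms
proof (induction B rule: finite_induct)
  case (insert v B)
  let ?X = "{F \<union> G |F G. F \<in> X \<and> G \<subseteq> B}"
  have "constructible (d + int (card B) + 1) (?X \<union> insert v ` ?X)"
    by (rule constructible_cone) (use insert in blast)+
  moreover have "?X \<union> insert v ` ?X = {F \<union> G |F G. F \<in> X \<and> G \<subseteq> insert v B}"
  proof (intro equalityI subsetI)
    fix H assume "H \<in> {F \<union> G |F G. F \<in> X \<and> G \<subseteq> insert v B}"
    then obtain F G where H: "H = F \<union> G" "F \<in> X" "G \<subseteq> insert v B" by blast
    show "H \<in> ?X \<union> insert v ` ?X"
    proof (cases "v \<in> G")
      case True
      then have "H = insert v (F \<union> (G - {v}))" "G - {v} \<subseteq> B" using H by auto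
      then show ?thesis using H(2) by blast
    next
      case False then show ?thesis using H by blast
    qed
  next
    fix H assume "H \<in> ?X \<union> insert v ` ?X"
    then consider F G where "H = F \<union> G" "F \<in> X" "G \<subseteq> B" | F G where "H = F \<union> insert v G" "F \<in> X" "G \<subseteq> B"
      by blast
    then show "H \<in> {F \<union> G |F G. F \<in> X \<and> G \<subseteq> insert v B}"
      by cases (blast, metis (mono_tags, lifting) insert_mono mem_Collect_eq)
  qed
  ultimately show ?case using insert.hyps by (simp add: algebra_simps)
qed simp

context split_block
begin

lemma join_rank_A0: "join_rank I A = join_rank I A0 + card (A i - {a})"
proof -
  have "join_rank I A = (card (A i) - 1) + (\<Sum>j\<in>I - {i}. card (A j) - 1)"
    unfolding join_rank_def using blocksD(1)[OF bl] iI by (simp add: sum.remove)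
  moreover have "join_rank I A0 = (card (A0 i) - 1) + (\<Sum>j\<in>I - {i}. card (A0 j) - 1)"
    unfolding join_rank_def using blocksD(1)[OF bl] iI by (intro sum.remove)
  moreover have "(\<Sum>j\<in>I - {i}. card (A0 j) - 1) = (\<Sum>j\<in>I - {i}. card (A j) - 1)"
    by (rule sum.cong) auto
  ultimately show ?thesis using a fin by simp
qed

text \<open>By purity a face lies in a facet through \<open>a\<close>, hence in the cone
  \<open>Z\<close> over the link, or in a facet through \<open>A i - {a}\<close>, hence in the join
  \<open>Y\<close> of the far link with that simplex. A face in both avoids \<open>a\<close>, and as
  a face of the link it does not contain \<open>A i - {a}\<close>.\<close>

lemma extremal_decomposition:
  assumes ext: "extremal I A X"
  defines "Y \<equiv> {F \<union> G |F G. F \<in> Qh X \<and> G \<subseteq> A i - {a}}" and "Z \<equiv> P X \<union> insert a ` P X"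
  shows "X = Y \<union> Z" "Y \<inter> Z = P X \<inter> Q X"
proof -
  note X = extremalD(2)[OF ext]
  show "X = Y \<union> Z"
  proof (intro equalityI subsetI)
    fix F assume "F \<in> X"
    then obtain G where G: "G \<in> X" "G \<in> full_faces I A" "F \<subseteq> G" using extremal_pure[OF ext] by blast
    show "F \<in> Y \<union> Z"
    proof (cases "a \<in> G")
      case True
      then have "insert a (F - {a}) \<in> X" using join_subcomplexD(2)[OF X G(1)] G(3) by auto
      then have "F - {a} \<in> P X" by (simp add: vertex_link_def)
      then show ?thesis unfolding Z_def by (cases "a \<in> F") (auto intro: image_eqI[of _ _ "F - {a}"])
    next
      case False
      then have "(F - A i) \<union> (A i - {a}) \<subseteq> G" using full_far_iff[OF G(2)] G(3) by auto
      then have "F - A i \<in> Qh X" using join_subcomplexD(2)[OF X G(1)] by (auto simp: far_link_def)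
      moreover have "F = (F - A i) \<union> (F \<inter> A i)" "F \<inter> A i \<subseteq> A i - {a}" using False G(3) by auto
      ultimately have "F \<in> Y" unfolding Y_def by blast
      then show ?thesis by blast
    qed
  next
    fix H assume "H \<in> Y \<union> Z"
    then consider F G where "H = F \<union> G" "F \<in> Qh X" "G \<subseteq> A i - {a}" | "H \<in> P X" | F where "H = insert a F" "F \<in> P X"
      unfolding Y_def Z_def by blast
    then show "H \<in> X"
    proof cases
      case 1
      then have "F \<union> (A i - {a}) \<in> X" by (simp add: far_link_def)
      then show ?thesis by (rule join_subcomplexD(2)[OF X]) (use 1 in auto)
    next
      case 2
      then have "insert a H \<in> X" by (simp add: vertex_link_def)
      then show ?thesis by (rule join_subcomplexD(2)[OF X]) auto
    next
      case 3 then show ?thesis by (simp add: vertex_link_def)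
    qed
  qed
  show "Y \<inter> Z = P X \<inter> Q X"
  proof (intro equalityI subsetI)
    fix H assume H: "H \<in> Y \<inter> Z"
    then obtain F G where FG: "H = F \<union> G" "F \<in> Qh X" "G \<subseteq> A i - {a}" unfolding Y_def by blast
    then have aH: "a \<notin> H" using a by (auto simp: far_link_def)
    then have HP: "H \<in> P X" using H unfolding Z_def by blast
    have "H \<union> (A i - {a}) = F \<union> (A i - {a})" using FG by auto
    then have "H \<union> (A i - {a}) \<in> X" using FG by (simp add: far_link_def)
    moreover have "\<not> A i - {a} \<subseteq> H" using join_subcomplexD(3)[OF sub_link[OF X] HP iI] by simp
    ultimately show "H \<in> P X \<inter> Q X" using HP aH by (simp add: far_join_def)
  next
    fix H assume H: "H \<in> P X \<inter> Q X"
    then have "a \<notin> H" "H \<union> (A i - {a}) \<in> X" by (auto simp: far_join_def)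
    moreover have "(H - A i) \<union> (A i - {a}) = H \<union> (A i - {a})" using calculation by auto
    ultimately have "H - A i \<in> Qh X" "H = (H - A i) \<union> (H \<inter> A i)" "H \<inter> A i \<subseteq> A i - {a}"
      by (auto simp: far_link_def)
    then have "H \<in> Y" unfolding Y_def by blast
    then show "H \<in> Y \<inter> Z" using H by (simp add: Z_def)
  qed
qed

end

text \<open>The decomposition at \<open>a\<close> is a union as required, because the intersection
  is extremal again and of rank one less. The void family is not constructible, so a void link or
  far link is treated apart.\<close>

theorem extremal_constructible:
  assumes "extremal I A X" "X \<noteq> {}"
  shows "constructible (int (join_rank I A) - 1) X"
  using assms
proof (induction "card (\<Union>(A ` I))" arbitrary: A X rule: less_induct)
  case less
  note ext = less.prems(1)
  note bl' = extremalD(1)[OF ext] and X = extremalD(2)[OF ext]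
  show ?case
  proof (cases "\<exists>i\<in>I. 2 \<le> card (A i)")
    case False
    have "X = {{}}" using singleton_subcomplex(1)[OF bl' False X] less.prems(2) by blast
    moreover have "join_rank I A = 0" using singleton_blocks[OF bl' False] by (simp add: join_rank_def)
    moreover have "constructible (int (card ({} :: 'b set)) - 1) (Pow ({} :: 'b set))" by (rule constructible.simplex) simp
    ultimately show ?thesis by simp
  next
    case True
    then obtain i where i: "i \<in> I" "2 \<le> card (A i)" by auto
    then obtain a where "a \<in> A i" using blocksD(3)[OF bl'] by blast
    then interpret split_block I A i a using bl' i by unfold_locales
    let ?Y = "{F \<union> G |F G. F \<in> Qh X \<and> G \<subseteq> A i - {a}}" and ?Z = "P X \<union> insert a ` P X"
    note dec = extremal_decomposition[OF ext]
    have cZ: "constructible (int (join_rank I A) - 1) ?Z" if "P X \<noteq> {}"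
    proof -
      have "constructible (int (join_rank I A1) - 1 + 1) ?Z"
        by (rule constructible_cone[OF less.hyps[OF smaller1 extremal_split(1)[OF ext] that]])
          (simp add: vertex_link_def)
      then show ?thesis by (simp add: join_rank_A1)
    qed
    have cY: "constructible (int (join_rank I A) - 1) ?Y" if "Qh X \<noteq> {}"
    proof -
      have "constructible (int (join_rank I A0) - 1 + int (card (A i - {a}))) ?Y"
        by (rule constructible_simplex_join[OF _ less.hyps[OF smaller0 extremal_split(2)[OF ext] that]])
          (use fin in \<open>auto simp: far_link_def\<close>)
      moreover have "int (join_rank I A0) - 1 + int (card (A i - {a})) = int (join_rank I A) - 1"
        by (simp add: join_rank_A0)
      ultimately show ?thesis by simp
    qed
    consider "P X = {}" | "Qh X = {}" | "P X \<noteq> {}" "Qh X \<noteq> {}" by blast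
    then show ?thesis
    proof cases
      case 1
      then have XY: "X = ?Y" using dec(1) by simp
      then have "Qh X \<noteq> {}" using less.prems(2) by blast
      then show ?thesis using cY XY by simp
    next
      case 2
      then have XZ: "X = ?Z" using dec(1) by simp
      then have "P X \<noteq> {}" using less.prems(2) by blast
      then show ?thesis using cZ XZ by simp
    next
      case 3
      obtain F G where FG: "F \<in> P X" "G \<in> Qh X" using 3 by blast
      have "{} \<in> P X" by (rule join_subcomplexD(2)[OF sub_link[OF X] FG(1)]) simp
      moreover have "{} \<in> Qh X" by (rule join_subcomplexD(2)[OF sub_far[OF X] FG(2)]) simp
      then have "{} \<in> Q X" using A1_ne by (auto simp: far_link_def far_join_def)
      ultimately have "P X \<inter> Q X \<noteq> {}" by blast
      then have "constructible (int (join_rank I A1) - 1) (P X \<inter> Q X)"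
        by (rule less.hyps[OF smaller1 extremal_inter[OF ext]])
      then have "constructible (int (join_rank I A) - 1 - 1) (?Y \<inter> ?Z)"
        unfolding dec(2) by (simp add: join_rank_A1)
      then have "constructible (int (join_rank I A) - 1) (?Y \<union> ?Z)"
        by (rule constructible.union[OF cY[OF 3(2)] cZ[OF 3(1)]])
      then show ?thesis using dec(1) by simp
    qed
  qed
qed

section \<open>Dimensions of faces and full-dimensional subcomplexes\<close>

lemma card_face_sum:
  assumes bl: "blocks I A" and F: "F \<subseteq> \<Union>(A ` I)"
  shows "card F = (\<Sum>i\<in>I. card (F \<inter> A i))"
proof -
  have "F = (\<Union>i\<in>I. F \<inter> A i)" using F by blast
  then have "card F = card (\<Union>i\<in>I. F \<inter> A i)" by simp
  also have "\<dots> = (\<Sum>i\<in>I. card (F \<inter> A i))"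
  proof (rule card_UN_disjoint)
    show "\<forall>i\<in>I. \<forall>j\<in>I. i \<noteq> j \<longrightarrow> F \<inter> A i \<inter> (F \<inter> A j) = {}" using blocksD(5)[OF bl] by blast
  qed (use blocksD[OF bl] in auto)
  finally show ?thesis .
qed

lemma card_sphere_face:
  assumes bl: "blocks I A" and F: "F \<in> join_sphere I A"
  shows "card F \<le> join_rank I A" "card F = join_rank I A \<longleftrightarrow> F \<in> full_faces I A"
proof -
  have FV: "F \<subseteq> \<Union>(A ` I)" and ns: "\<And>i. i \<in> I \<Longrightarrow> \<not> A i \<subseteq> F" using F by (auto simp: join_sphere_def)
  have lt: "card (F \<inter> A i) < card (A i)" if "i \<in> I" for i
    by (rule psubset_card_mono) (use blocksD(2)[OF bl that] ns[OF that] in auto)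
  have le: "card (F \<inter> A i) \<le> card (A i) - 1" if "i \<in> I" for i using lt[OF that] by simp
  note cF = card_face_sum[OF bl FV]
  show "card F \<le> join_rank I A" unfolding cF join_rank_def by (rule sum_mono) (rule le)
  have cd: "card (A i - F) = card (A i) - card (F \<inter> A i)" if "i \<in> I" for i
    using blocksD(2)[OF bl that] by (metis card_Diff_subset_Int finite_Int inf_commute)
  show "card F = join_rank I A \<longleftrightarrow> F \<in> full_faces I A"
  proof
    assume "card F = join_rank I A"
    then have "(\<Sum>i\<in>I. card (F \<inter> A i)) = (\<Sum>i\<in>I. card (A i) - 1)" unfolding cF join_rank_def .
    then have eq: "card (F \<inter> A i) = card (A i) - 1" if "i \<in> I" for i
      by (rule sum_mono_inv) (use le that blocksD(1)[OF bl] in auto)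
    have "card (A i - F) = 1" if "i \<in> I" for i using cd[OF that] lt[OF that] eq[OF that] by simp
    then show "F \<in> full_faces I A" using FV by (simp add: full_faces_def)
  next
    assume f: "F \<in> full_faces I A"
    have "card (F \<inter> A i) = card (A i) - 1" if "i \<in> I" for i
      using f that cd[OF that] lt[OF that] by (auto simp: full_faces_def)
    then show "card F = join_rank I A" unfolding cF join_rank_def by simp
  qed
qed

lemma full_faces_nonempty:
  assumes "blocks I A" shows "full_faces I A \<noteq> {}"
proof -
  have "{} \<in> facet_complement I A {}" unfolding facet_complement_empty[OF assms]
    using blocksD(3)[OF assms] by (auto simp: join_sphere_def)
  then show ?thesis by (auto simp: facet_complement_def)
qed

lemma full_faces_sphere: "full_faces I A \<subseteq> join_sphere I A"
proof
  fix F assume F: "F \<in> full_faces I A"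
  then show "F \<in> join_sphere I A"
    using full_faces_nsub[OF F] by (auto simp: join_sphere_def full_faces_def)
qed

lemma finite_join_sphere: "blocks I A \<Longrightarrow> finite (join_sphere I A)"
  by (rule finite_subset[of _ "Pow (\<Union>(A ` I))"]) (use blocksD(4)[of I A] in \<open>auto simp: join_sphere_def\<close>)

lemma complex_dim_subcomplex:
  assumes bl: "blocks I A" and X: "X \<subseteq> join_sphere I A" "X \<inter> full_faces I A \<noteq> {}"
  shows "complex_dim X = int (join_rank I A) - 1"
proof -
  obtain F where F: "F \<in> X" "F \<in> full_faces I A" using X by blast
  have fX: "finite X" using finite_subset[OF X(1) finite_join_sphere[OF bl]] .
  have "Max (card ` X) = join_rank I A"
  proof (rule Max_eqI)
    show "join_rank I A \<in> card ` X" using F card_sphere_face(2)[OF bl, of F] X(1) by (metis image_eqI subsetD)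
  qed (use fX card_sphere_face(1)[OF bl] X(1) in auto)
  then show ?thesis by (simp add: complex_dim_def)
qed

lemma complex_dim_sphere: "blocks I A \<Longrightarrow> complex_dim (join_sphere I A) = int (join_rank I A) - 1"
  using complex_dim_subcomplex[of I A "join_sphere I A"] full_faces_nonempty[of I A] full_faces_sphere[of I A] by blast

lemma full_dim_has_full_face:
  assumes bl: "blocks I A" and X: "X \<subseteq> join_sphere I A" "X \<noteq> {}" "complex_dim X = complex_dim (join_sphere I A)"
  shows "X \<inter> full_faces I A \<noteq> {}"
proof -
  have fX: "finite X" using finite_subset[OF X(1) finite_join_sphere[OF bl]] .
  have "Max (card ` X) = join_rank I A" using X(3) complex_dim_sphere[OF bl] by (simp add: complex_dim_def)
  moreover have "Max (card ` X) \<in> card ` X" by (rule Max_in) (use fX X in auto)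
  ultimately obtain F where "F \<in> X" "card F = join_rank I A" by auto
  then show ?thesis using card_sphere_face(2)[OF bl, of F] X(1) by blast
qed

lemma complex_join_boundaries:
  assumes bl: "blocks I A"
  shows "complex_join I (\<lambda>i. simplex_boundary (A i)) = join_sphere I A"
proof (intro equalityI subsetI)
  fix F assume "F \<in> complex_join I (\<lambda>i. simplex_boundary (A i))"
  then obtain G where G: "F = (\<Union>i\<in>I. G i)" "\<And>i. i \<in> I \<Longrightarrow> G i \<subset> A i"
    by (auto simp: complex_join_def simplex_boundary_def)
  have "F \<inter> A i \<subseteq> G i" if "i \<in> I" for i
  proof
    fix x assume x: "x \<in> F \<inter> A i"
    then obtain j where j: "j \<in> I" "x \<in> G j" using G(1) by blast
    then have "x \<in> A j" using G(2) by blast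
    then have "j = i" using blocksD(5)[OF bl that j(1)] x by blast
    then show "x \<in> G i" using j by simp
  qed
  then have "\<not> A i \<subseteq> F" if "i \<in> I" for i using G(2)[OF that] that by blast
  moreover have "F \<subseteq> \<Union>(A ` I)" using G by blast
  ultimately show "F \<in> join_sphere I A" by (simp add: join_sphere_def)
next
  fix F assume F: "F \<in> join_sphere I A"
  then have "F = (\<Union>i\<in>I. F \<inter> A i)" "\<forall>i\<in>I. F \<inter> A i \<subset> A i" by (auto simp: join_sphere_def)
  then show "F \<in> complex_join I (\<lambda>i. simplex_boundary (A i))"
    unfolding complex_join_def simplex_boundary_def mem_Collect_eq by (intro exI[of _ "\<lambda>i. F \<inter> A i"] conjI)
qed

section \<open>Monomial ideals\<close>

abbreviation "supp \<equiv> Poly_Mapping.keys"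
abbreviation "coef \<equiv> Poly_Mapping.lookup"
abbreviation "mono_term \<equiv> Poly_Mapping.single"

lemma supp_add: "supp (m + n) = supp m \<union> supp (n :: 'v \<Rightarrow>\<^sub>0 nat)"
  by (auto simp: in_keys_iff lookup_add)

definition mdeg :: "('v \<Rightarrow>\<^sub>0 nat) \<Rightarrow> nat" where
  "mdeg m = (\<Sum>v\<in>supp m. coef m v)"

lemma sum_coef_superset:
  assumes "finite S" "supp m \<subseteq> S" "\<And>v. f v 0 = 0"
  shows "(\<Sum>v\<in>supp m. f v (coef m v)) = (\<Sum>v\<in>S. f v (coef m v))"
  by (rule sum.mono_neutral_left) (use assms in \<open>auto simp: in_keys_iff\<close>)

lemma mdeg_superset: "finite S \<Longrightarrow> supp m \<subseteq> S \<Longrightarrow> mdeg m = (\<Sum>v\<in>S. coef m v)"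
  unfolding mdeg_def by (rule sum_coef_superset) auto

lemma mdeg_add: "mdeg (m + n) = mdeg m + mdeg n"
proof -
  let ?S = "supp m \<union> supp n"
  have "mdeg (m + n) = (\<Sum>v\<in>?S. coef (m + n) v)" by (rule mdeg_superset) (auto simp: supp_add)
  also have "\<dots> = (\<Sum>v\<in>?S. coef m v) + (\<Sum>v\<in>?S. coef n v)" by (simp add: lookup_add sum.distrib)
  also have "\<dots> = mdeg m + mdeg n" by (simp add: mdeg_superset[of ?S])
  finally show ?thesis .
qed

lemma mdeg_single [simp]: "mdeg (mono_term v c) = c"
  by (auto simp: mdeg_def)

lemma mdeg_zero [simp]: "mdeg 0 = 0" by (simp add: mdeg_def)

lemma mdeg_eq_0: "mdeg m = 0 \<longleftrightarrow> m = 0"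
proof
  assume "mdeg m = 0"
  then have "coef m v = 0" for v by (cases "v \<in> supp m") (auto simp: mdeg_def in_keys_iff)
  then show "m = 0" by (intro poly_mapping_eqI) simp
qed simp

lemma coef_le_mdeg: "coef m v \<le> mdeg m"
proof (cases "v \<in> supp m")
  case True then show ?thesis unfolding mdeg_def by (intro member_le_sum) auto
next
  case False then show ?thesis by (simp add: in_keys_iff)
qed

lemma monomial_induct [case_names zero add]:
  assumes "P 0" "\<And>m v. P m \<Longrightarrow> P (m + mono_term v 1)"
  shows "P (m :: 'v \<Rightarrow>\<^sub>0 nat)"
proof (induction "mdeg m" arbitrary: m)
  case 0 then show ?case using assms(1) by (simp add: mdeg_eq_0)
next
  case (Suc d)
  then have "m \<noteq> 0" by auto
  then have "supp m \<noteq> {}" by simp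
  then obtain v where "v \<in> supp m" by blast
  then have v: "0 < coef m v" by (simp add: in_keys_iff)
  let ?m = "m - mono_term v 1"
  have eq: "m = ?m + mono_term v 1"
    using v by (auto simp: poly_mapping_eq_iff fun_eq_iff lookup_add lookup_minus lookup_single when_def)
  have "mdeg m = mdeg ?m + 1" by (subst eq) (simp add: mdeg_add)
  then have "P ?m" using Suc by simp
  then show ?case using assms(2)[of ?m v] eq by simp
qed

lemma map_monom_coef:
  assumes "finite S" "supp m \<subseteq> S"
  shows "coef (map_monom p m) w = (\<Sum>v\<in>S. if p v = w then coef m v else 0)"
proof -
  have "coef (map_monom p m) w = (\<Sum>v\<in>supp m. coef (mono_term (p v) (coef m v)) w)"
    unfolding map_monom_def by (simp add: lookup_sum)
  also have "\<dots> = (\<Sum>v\<in>supp m. if p v = w then coef m v else 0)"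
    by (rule sum.cong) (auto simp: lookup_single when_def)
  also have "\<dots> = (\<Sum>v\<in>S. if p v = w then coef m v else 0)"
    by (rule sum_coef_superset[OF assms, of "\<lambda>v c. if p v = w then c else 0"]) auto
  finally show ?thesis .
qed

lemma map_monom_add: "map_monom p (m + n) = map_monom p m + map_monom p n"
proof (rule poly_mapping_eqI)
  fix w
  let ?S = "supp m \<union> supp n"
  have "coef (map_monom p (m + n)) w = (\<Sum>v\<in>?S. if p v = w then coef (m + n) v else 0)"
    by (rule map_monom_coef) (auto simp: supp_add)
  also have "\<dots> = (\<Sum>v\<in>?S. (if p v = w then coef m v else 0) + (if p v = w then coef n v else 0))"
    by (rule sum.cong) (auto simp: lookup_add)
  also have "\<dots> = coef (map_monom p m + map_monom p n) w"
    by (simp add: sum.distrib lookup_add map_monom_coef[of ?S])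
  finally show "coef (map_monom p (m + n)) w = coef (map_monom p m + map_monom p n) w" .
qed

lemma map_monom_zero [simp]: "map_monom p 0 = 0" by (simp add: map_monom_def)

lemma map_monom_single [simp]: "map_monom p (mono_term v c) = mono_term (p v) c"
  by (simp add: map_monom_def)

lemma mdeg_map_monom [simp]: "mdeg (map_monom p m) = mdeg m"
  by (induction m rule: monomial_induct) (simp_all add: map_monom_add mdeg_add)

lemma supp_map_monom: "supp (map_monom p m) = p ` supp m"
  by (induction m rule: monomial_induct) (simp_all add: map_monom_add supp_add)

lemma map_monom_comp: "map_monom p (map_monom q m) = map_monom (p \<circ> q) m"
  by (induction m rule: monomial_induct) (simp_all add: map_monom_add)

lemma map_monom_cong: "(\<And>v. v \<in> supp m \<Longrightarrow> p v = q v) \<Longrightarrow> map_monom p m = map_monom q m"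
  unfolding map_monom_def by (rule sum.cong) auto

lemma map_monom_id: "(\<And>v. v \<in> supp m \<Longrightarrow> p v = v) \<Longrightarrow> map_monom p m = m"
proof -
  have "map_monom (\<lambda>v. v) m = m"
    by (induction m rule: monomial_induct) (simp_all add: map_monom_add)
  then show "(\<And>v. v \<in> supp m \<Longrightarrow> p v = v) \<Longrightarrow> map_monom p m = m"
    using map_monom_cong[of m p "\<lambda>v. v"] by simp
qed

lemma poly_sum_terms: "(f :: 'a \<Rightarrow>\<^sub>0 'b::comm_monoid_add) = (\<Sum>m\<in>supp f. mono_term m (coef f m))"
proof (rule poly_mapping_eqI)
  fix n
  have "coef (\<Sum>m\<in>supp f. mono_term m (coef f m)) n = (\<Sum>m\<in>supp f. if m = n then coef f m else 0)"
    by (simp add: lookup_sum lookup_single when_def)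
  also have "\<dots> = coef f n" by (simp add: in_keys_iff)
  finally show "coef f n = coef (\<Sum>m\<in>supp f. mono_term m (coef f m)) n" by simp
qed

section \<open>Polynomials in a set of variables, and ideals spanned by monomials\<close>

definition kpoly :: "'v set \<Rightarrow> ('v, 'k::field) mpoly set" where
  "kpoly V = {f. \<forall>m\<in>supp f. supp m \<subseteq> V}"

lemma supp_diff: "supp (f - g) \<subseteq> supp f \<union> supp (g :: 'a \<Rightarrow>\<^sub>0 'b::ab_group_add)"
  by (auto simp: in_keys_iff lookup_minus)

lemma kpoly_closed [simp]:
  "0 \<in> kpoly V" "1 \<in> kpoly V" "f \<in> kpoly V \<Longrightarrow> g \<in> kpoly V \<Longrightarrow> f + g \<in> kpoly V"
  "f \<in> kpoly V \<Longrightarrow> g \<in> kpoly V \<Longrightarrow> f - g \<in> kpoly V" "f \<in> kpoly V \<Longrightarrow> - f \<in> kpoly V"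
  "f \<in> kpoly V \<Longrightarrow> g \<in> kpoly V \<Longrightarrow> f * g \<in> kpoly V"
proof -
  show "0 \<in> kpoly V" "1 \<in> kpoly V" by (auto simp: kpoly_def)
  show "f \<in> kpoly V \<Longrightarrow> g \<in> kpoly V \<Longrightarrow> f + g \<in> kpoly V"
    using Poly_Mapping.keys_add[of f g] by (auto simp: kpoly_def)
  show "f \<in> kpoly V \<Longrightarrow> g \<in> kpoly V \<Longrightarrow> f - g \<in> kpoly V" using supp_diff[of f g] by (auto simp: kpoly_def)
  show "f \<in> kpoly V \<Longrightarrow> - f \<in> kpoly V" by (simp add: kpoly_def)
  assume fg: "f \<in> kpoly V" "g \<in> kpoly V"
  have "supp m \<subseteq> V" if "m \<in> supp (f * g)" for m
  proof -
    obtain a b where "a \<in> supp f" "b \<in> supp g" "m = a + b" using keys_mult[of f g] \<open>m \<in> supp (f * g)\<close> by blast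
    then show ?thesis using fg by (auto simp: kpoly_def supp_add)
  qed
  then show "f * g \<in> kpoly V" by (simp add: kpoly_def)
qed

lemma kpoly_sum [simp]: "(\<And>i. i \<in> S \<Longrightarrow> f i \<in> kpoly V) \<Longrightarrow> (\<Sum>i\<in>S. f i) \<in> kpoly V"
  by (induction S rule: infinite_finite_induct) auto

lemma kpoly_power [simp]: "f \<in> kpoly V \<Longrightarrow> f ^ n \<in> kpoly V"
  by (induction n) auto

lemma kpoly_term [simp]: "supp m \<subseteq> V \<Longrightarrow> mono_term m c \<in> kpoly V"
  by (auto simp: kpoly_def)

lemma kpoly_mvar [simp]: "v \<in> V \<Longrightarrow> mvar v \<in> kpoly V"
  by (auto simp: mvar_def)

lemma carrier_mpoly [simp]: "carrier (mpoly_ring V) = kpoly V"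
  by (simp add: mpoly_ring_def kpoly_def)

lemma mpoly_ring_simps [simp]:
  "f \<otimes>\<^bsub>mpoly_ring V\<^esub> g = f * g" "f \<oplus>\<^bsub>mpoly_ring V\<^esub> g = f + g"
  "\<zero>\<^bsub>mpoly_ring V\<^esub> = 0" "\<one>\<^bsub>mpoly_ring V\<^esub> = 1"
  by (auto simp: mpoly_ring_def)

lemma cring_mpoly: "cring (mpoly_ring V :: ('v, 'k::field) mpoly ring)"
proof (rule cringI)
  show "abelian_group (mpoly_ring V :: ('v, 'k) mpoly ring)"
  proof (rule abelian_groupI)
    fix x :: "('v, 'k) mpoly" assume "x \<in> carrier (mpoly_ring V)"
    then show "\<exists>y\<in>carrier (mpoly_ring V). y \<oplus>\<^bsub>mpoly_ring V\<^esub> x = \<zero>\<^bsub>mpoly_ring V\<^esub>"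
      by (intro bexI[of _ "- x"]) auto
  qed (auto simp: algebra_simps)
  show "comm_monoid (mpoly_ring V :: ('v, 'k) mpoly ring)"
    by (rule comm_monoidI) (auto simp: algebra_simps)
qed (auto simp: algebra_simps)

lemma ring_mpoly: "ring (mpoly_ring V)" using cring_mpoly by (rule cring.axioms(1))

lemma ideal_mpolyI:
  assumes "J \<subseteq> kpoly V" "0 \<in> J" "\<And>f g. f \<in> J \<Longrightarrow> g \<in> J \<Longrightarrow> f + g \<in> J"
    "\<And>f g. f \<in> J \<Longrightarrow> g \<in> kpoly V \<Longrightarrow> g * f \<in> J"
  shows "ideal J (mpoly_ring V)"
proof (rule idealI)
  show "ring (mpoly_ring V)" by (rule ring_mpoly)
  interpret R: ring "mpoly_ring V" by (rule ring_mpoly)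
  show "subgroup J (add_monoid (mpoly_ring V))"
  proof (rule R.add.subgroupI)
    fix f assume f: "f \<in> J"
    then have fk: "f \<in> kpoly V" using assms(1) by auto
    have "\<ominus>\<^bsub>mpoly_ring V\<^esub> f = - f"
      by (rule R.minus_equality) (use fk in auto)
    moreover have "(- 1) * f \<in> J" by (rule assms(4)[OF f]) simp
    ultimately show "\<ominus>\<^bsub>mpoly_ring V\<^esub> f \<in> J" by simp
  qed (use assms in auto)
qed (use assms in \<open>auto simp: mult.commute\<close>)

lemma ideal_mpolyD:
  assumes "ideal J (mpoly_ring V)"
  shows "J \<subseteq> kpoly V" "0 \<in> J" "f \<in> J \<Longrightarrow> g \<in> J \<Longrightarrow> f + g \<in> J"
    "f \<in> J \<Longrightarrow> g \<in> kpoly V \<Longrightarrow> g * f \<in> J" "f \<in> J \<Longrightarrow> g \<in> kpoly V \<Longrightarrow> f * g \<in> J"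
    "f \<in> J \<Longrightarrow> - f \<in> J" "f \<in> J \<Longrightarrow> g \<in> J \<Longrightarrow> f - g \<in> J"
proof -
  interpret ideal J "mpoly_ring V" by fact
  show 1: "J \<subseteq> kpoly V" "0 \<in> J"
    using additive_subgroup.a_subset[OF is_additive_subgroup]
      additive_subgroup.zero_closed[OF is_additive_subgroup] by auto
  show 2: "f \<in> J \<Longrightarrow> g \<in> J \<Longrightarrow> f + g \<in> J" for f g
    using additive_subgroup.a_closed[OF is_additive_subgroup, of f g] by simp
  show 3: "f \<in> J \<Longrightarrow> g \<in> kpoly V \<Longrightarrow> g * f \<in> J" for f g using I_l_closed[of f g] by auto
  then show "f \<in> J \<Longrightarrow> g \<in> kpoly V \<Longrightarrow> f * g \<in> J" by (simp add: mult.commute)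
  have 4: "f \<in> J \<Longrightarrow> - f \<in> J" for f using 3[of f "- 1"] by simp
  then show "f \<in> J \<Longrightarrow> - f \<in> J" .
  show "f \<in> J \<Longrightarrow> g \<in> J \<Longrightarrow> f - g \<in> J" using 2[of f "- g"] 4[of g] by simp
qed

lemma ideal_sum:
  assumes "ideal J (mpoly_ring V)" "\<And>i. i \<in> S \<Longrightarrow> f i \<in> J" shows "(\<Sum>i\<in>S. f i) \<in> J"
  using assms(2) by (induction S rule: infinite_finite_induct) (auto intro: ideal_mpolyD[OF assms(1)])

lemma genideal_mpoly_eqI:
  assumes "ideal J (mpoly_ring V)" "S \<subseteq> J" "\<And>J'. ideal J' (mpoly_ring V) \<Longrightarrow> S \<subseteq> J' \<Longrightarrow> J \<subseteq> J'"
  shows "Idl\<^bsub>mpoly_ring V\<^esub> S = J"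
  unfolding genideal_def using assms by blast

text \<open>For \<open>U\<close> closed under multiplication by monomials, this is the ideal spanned
  by the monomials in \<open>U\<close>. Membership is thereby a condition on each monomial of a
  polynomial separately.\<close>

definition mon_ideal :: "'v set \<Rightarrow> ('v \<Rightarrow>\<^sub>0 nat) set \<Rightarrow> ('v, 'k::field) mpoly set" where
  "mon_ideal V U = {f \<in> kpoly V. supp f \<subseteq> U}"

definition up_closed :: "'v set \<Rightarrow> ('v \<Rightarrow>\<^sub>0 nat) set \<Rightarrow> bool" where
  "up_closed V U \<longleftrightarrow> (\<forall>m\<in>U. supp m \<subseteq> V \<and> (\<forall>c. supp c \<subseteq> V \<longrightarrow> m + c \<in> U))"

lemma mon_ideal_ideal:
  assumes U: "up_closed V U" shows "ideal (mon_ideal V U) (mpoly_ring V)"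
proof (rule ideal_mpolyI)
  fix f g assume f: "f \<in> mon_ideal V U"
  show "f + g \<in> mon_ideal V U" if "g \<in> mon_ideal V U"
    using f that Poly_Mapping.keys_add[of f g] by (auto simp: mon_ideal_def)
  assume g: "g \<in> kpoly V"
  have "supp (g * f) \<subseteq> U"
  proof
    fix m assume "m \<in> supp (g * f)"
    then obtain a b where "a \<in> supp g" "b \<in> supp f" "m = a + b" using keys_mult[of g f] by blast
    moreover have "supp a \<subseteq> V" using g calculation by (auto simp: kpoly_def)
    moreover have "b \<in> U" using f calculation by (auto simp: mon_ideal_def)
    ultimately show "m \<in> U" using U unfolding up_closed_def by (metis add.commute)
  qed
  then show "g * f \<in> mon_ideal V U" using f g by (simp add: mon_ideal_def)
qed (auto simp: mon_ideal_def)

lemma mon_ideal_least: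
  fixes J :: "('v, 'k::field) mpoly set"
  assumes J: "ideal J (mpoly_ring V)" and U: "\<And>m. m \<in> U \<Longrightarrow> monom_of m \<in> J"
  shows "mon_ideal V U \<subseteq> J"
proof
  fix f :: "('v, 'k) mpoly" assume f: "f \<in> mon_ideal V U"
  have "mono_term m (coef f m) \<in> J" if m: "m \<in> supp f" for m
  proof -
    have "monom_of m \<in> J" using f m U by (auto simp: mon_ideal_def)
    then have "mono_term 0 (coef f m) * monom_of m \<in> J" by (rule ideal_mpolyD(4)[OF J]) simp
    then show ?thesis by (simp add: monom_of_def mult_single)
  qed
  then have "(\<Sum>m\<in>supp f. mono_term m (coef f m)) \<in> J" by (rule ideal_sum[OF J])
  then show "f \<in> J" using poly_sum_terms[of f] by simp
qed

lemma genideal_monomials: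
  assumes M: "\<And>m. m \<in> M \<Longrightarrow> supp m \<subseteq> V"
  shows "Idl\<^bsub>mpoly_ring V\<^esub> (monom_of ` M) =
    (mon_ideal V {m + c |m c. m \<in> M \<and> supp c \<subseteq> V} :: ('v, 'k::field) mpoly set)"
proof (rule genideal_mpoly_eqI)
  have "up_closed V {m + c |m c. m \<in> M \<and> supp c \<subseteq> V}"
    unfolding up_closed_def
  proof (intro ballI conjI allI impI)
    fix n assume "n \<in> {m + c |m c. m \<in> M \<and> supp c \<subseteq> V}"
    then obtain m c where n: "n = m + c" "m \<in> M" "supp c \<subseteq> V" by blast
    then show "supp n \<subseteq> V" using M[of m] by (auto simp: supp_add)
    fix c' :: "'v \<Rightarrow>\<^sub>0 nat" assume "supp c' \<subseteq> V"
    then have "supp (c + c') \<subseteq> V" using n by (simp add: supp_add)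
    then show "n + c' \<in> {m + c |m c. m \<in> M \<and> supp c \<subseteq> V}"
      using n by (intro CollectI exI[of _ m] exI[of _ "c + c'"]) (simp add: add.assoc)
  qed
  then show "ideal (mon_ideal V {m + c |m c. m \<in> M \<and> supp c \<subseteq> V} :: ('v, 'k) mpoly set) (mpoly_ring V)"
    by (rule mon_ideal_ideal)
  have "m \<in> {m + c |m c. m \<in> M \<and> supp c \<subseteq> V}" if "m \<in> M" for m
    using that by (intro CollectI exI[of _ m] exI[of _ 0]) simp
  then show "monom_of ` M \<subseteq> (mon_ideal V {m + c |m c. m \<in> M \<and> supp c \<subseteq> V} :: ('v, 'k) mpoly set)"
    using M by (auto simp: monom_of_def mon_ideal_def)
  fix J' :: "('v, 'k) mpoly set" assume J': "ideal J' (mpoly_ring V)" "monom_of ` M \<subseteq> J'"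
  show "mon_ideal V {m + c |m c. m \<in> M \<and> supp c \<subseteq> V} \<subseteq> J'"
  proof (rule mon_ideal_least[OF J'(1)])
    fix n assume "n \<in> {m + c |m c. m \<in> M \<and> supp c \<subseteq> V}"
    then obtain m c where mc: "m \<in> M" "supp c \<subseteq> V" "n = m + c" by blast
    have "monom_of m * monom_of c \<in> J'"
      by (rule ideal_mpolyD(5)[OF J'(1)]) (use J'(2) mc in \<open>auto simp: monom_of_def\<close>)
    then show "monom_of n \<in> J'" using mc by (simp add: monom_of_def mult_single)
  qed
qed

lemma mon_ideal_monom_iff: "monom_of m \<in> (mon_ideal V U :: ('v, 'k::field) mpoly set) \<longleftrightarrow> supp m \<subseteq> V \<and> m \<in> U"
  by (auto simp: mon_ideal_def kpoly_def monom_of_def)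

lemma mon_ideal_generated:
  assumes U: "up_closed V U" shows "mon_ideal V U = Idl\<^bsub>mpoly_ring V\<^esub> (monom_of ` U)"
proof -
  have "{m + c |m c. m \<in> U \<and> supp c \<subseteq> V} = U"
  proof (intro equalityI subsetI)
    fix m assume "m \<in> U"
    then show "m \<in> {m + c |m c. m \<in> U \<and> supp c \<subseteq> V}" by (intro CollectI exI[of _ m] exI[of _ 0]) simp
  qed (use U in \<open>auto simp: up_closed_def\<close>)
  moreover have "supp m \<subseteq> V" if "m \<in> U" for m using U that by (simp add: up_closed_def)
  ultimately show ?thesis by (simp add: genideal_monomials)
qed

lemma mon_ideal_monomial: assumes "up_closed V U" shows "monomial_ideal V (mon_ideal V U)"
  unfolding monomial_ideal_def using mon_ideal_generated[OF assms] assms by (auto simp: up_closed_def)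

lemma prod_mvar: "finite R \<Longrightarrow> (\<Prod>v\<in>R. mvar v) = monom_of (\<Sum>v\<in>R. mono_term v 1)"
  by (induction R rule: finite_induct) (auto simp: mvar_def monom_of_def mult_single)

lemma coef_indicator: "finite R \<Longrightarrow> coef (\<Sum>v\<in>R. mono_term v (1::nat)) w = (if w \<in> R then 1 else 0)"
  by (simp add: lookup_sum lookup_single when_def)

lemma supp_indicator: "finite R \<Longrightarrow> supp (\<Sum>v\<in>R. mono_term v (1::nat)) = R"
proof -
  assume R: "finite R"
  have "x \<in> supp (\<Sum>v\<in>R. mono_term v (1::nat)) \<longleftrightarrow> x \<in> R" for x
    unfolding in_keys_iff coef_indicator[OF R] by simp
  then show ?thesis by blast
qed

text \<open>A monomial is a multiple of the squarefree monomial on its support, and a support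
  containing a nonface is a nonface.\<close>

lemma stanley_reisner_mon_ideal:
  assumes V: "finite V" and X: "\<And>F G. F \<in> X \<Longrightarrow> G \<subseteq> F \<Longrightarrow> G \<in> X"
  shows "stanley_reisner_ideal V X = (mon_ideal V {m. supp m \<subseteq> V \<and> supp m \<notin> X} :: ('v, 'k::field) mpoly set)"
proof -
  let ?e = "\<lambda>R. \<Sum>v\<in>R. mono_term v (1::nat)"
  let ?M = "{?e R |R. R \<subseteq> V \<and> R \<notin> X}"
  have "{(\<Prod>v\<in>R. mvar v) :: ('v, 'k) mpoly |R. R \<subseteq> V \<and> R \<notin> X} = {monom_of (?e R) |R. R \<subseteq> V \<and> R \<notin> X}"
    using prod_mvar finite_subset[OF _ V] by metis
  also have "\<dots> = monom_of ` ?M" by blast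
  finally have "stanley_reisner_ideal V X = Idl\<^bsub>mpoly_ring V\<^esub> (monom_of ` ?M :: ('v, 'k) mpoly set)"
    by (simp add: stanley_reisner_ideal_def)
  also have "\<dots> = mon_ideal V {m + c |m c. m \<in> ?M \<and> supp c \<subseteq> V}"
  proof (rule genideal_monomials)
    fix m assume "m \<in> ?M"
    then obtain R where "R \<subseteq> V" "m = ?e R" by blast
    then show "supp m \<subseteq> V" using supp_indicator[OF finite_subset[OF _ V], of R] by simp
  qed
  also have "{m + c |m c. m \<in> ?M \<and> supp c \<subseteq> V} = {m. supp m \<subseteq> V \<and> supp m \<notin> X}"
  proof (intro equalityI subsetI)
    fix n assume "n \<in> {m + c |m c. m \<in> ?M \<and> supp c \<subseteq> V}"
    then obtain R c where R: "R \<subseteq> V" "R \<notin> X" "n = ?e R + c" "supp c \<subseteq> V" by blast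
    then have "supp n = R \<union> supp c" using supp_add supp_indicator[OF finite_subset[OF R(1) V]] by metis
    then show "n \<in> {m. supp m \<subseteq> V \<and> supp m \<notin> X}" using R X[of "supp n" R] by auto
  next
    fix n :: "'v \<Rightarrow>\<^sub>0 nat" assume n: "n \<in> {m. supp m \<subseteq> V \<and> supp m \<notin> X}"
    have "n = ?e (supp n) + (n - ?e (supp n))"
      by (intro poly_mapping_eqI) (simp add: lookup_add lookup_minus coef_indicator in_keys_iff del: One_nat_def)
    moreover have "supp (n - ?e (supp n)) \<subseteq> V" using n by (auto simp: in_keys_iff lookup_minus)
    ultimately show "n \<in> {m + c |m c. m \<in> ?M \<and> supp c \<subseteq> V}" using n by blast
  qed
  finally show ?thesis .
qed

section \<open>Substitution of variables\<close>

lemma map_vars_add: "map_vars p (f + g) = map_vars p f + map_vars p g"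
  unfolding map_vars_def by (rule setsum_keys_plus_distrib) (auto simp: single_add)

lemma map_vars_zero [simp]: "map_vars p 0 = 0" by (simp add: map_vars_def)

lemma map_vars_single [simp]: "map_vars p (mono_term m c) = mono_term (map_monom p m) c"
  by (simp add: map_vars_def)

lemma map_vars_sum: "map_vars p (\<Sum>i\<in>S. f i) = (\<Sum>i\<in>S. map_vars p (f i))"
  by (induction S rule: infinite_finite_induct) (auto simp: map_vars_add)

lemma map_vars_mult: "map_vars p (f * g) = map_vars p f * map_vars p g"
proof -
  have "f * g = (\<Sum>m\<in>supp f. \<Sum>n\<in>supp g. mono_term m (coef f m) * mono_term n (coef g n))"
    by (subst (1) poly_sum_terms[of f], subst (1) poly_sum_terms[of g]) (rule sum_product)
  then have "map_vars p (f * g) = (\<Sum>m\<in>supp f. \<Sum>n\<in>supp g. mono_term (map_monom p m) (coef f m) * mono_term (map_monom p n) (coef g n))"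
    by (simp add: map_vars_sum mult_single map_monom_add)
  also have "\<dots> = map_vars p f * map_vars p g" unfolding map_vars_def by (simp add: sum_product)
  finally show ?thesis .
qed

lemma map_vars_uminus: "map_vars p (- f) = - map_vars p f"
  using map_vars_add[of p f "- f"] by (simp add: eq_neg_iff_add_eq_0 add.commute)

lemma map_vars_diff: "map_vars p (f - g) = map_vars p f - map_vars p g"
  using map_vars_add[of p f "- g"] by (simp add: map_vars_uminus)

lemma map_vars_mvar [simp]: "map_vars p (mvar v) = mvar (p v)" by (simp add: mvar_def)

lemma supp_map_vars: "supp (map_vars p f) \<subseteq> map_monom p ` supp f"
proof -
  have "supp (map_vars p f) \<subseteq> (\<Union>m\<in>supp f. supp (mono_term (map_monom p m) (coef f m)))"
    unfolding map_vars_def by (rule keys_sum)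
  then show ?thesis by (auto split: if_splits)
qed

lemma map_vars_id: "(\<And>m. m \<in> supp f \<Longrightarrow> map_monom p m = m) \<Longrightarrow> map_vars p f = f"
  unfolding map_vars_def using poly_sum_terms[of f] by simp

text \<open>A preimage of \<open>g\<close> is found by lifting each of its monomials separately and
  keeping the coefficient.\<close>

lemma map_vars_mon_ideal:
  fixes U :: "('v \<Rightarrow>\<^sub>0 nat) set" and p :: "'v \<Rightarrow> 'w"
  assumes "p ` V' = V"
  shows "map_vars p ` mon_ideal V' U = (mon_ideal V (map_monom p ` {m\<in>U. supp m \<subseteq> V'}) :: ('w, 'k::field) mpoly set)"
proof (intro equalityI subsetI)
  fix g assume "g \<in> map_vars p ` (mon_ideal V' U :: ('v, 'k) mpoly set)"
  then obtain f :: "('v, 'k) mpoly" where f: "f \<in> mon_ideal V' U" "g = map_vars p f" by blast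
  have "\<forall>m\<in>supp g. supp m \<subseteq> V \<and> m \<in> map_monom p ` {m\<in>U. supp m \<subseteq> V'}"
  proof
    fix m assume "m \<in> supp g"
    then obtain n where n: "n \<in> supp f" "m = map_monom p n" using supp_map_vars f(2) by blast
    then have "n \<in> U" "supp n \<subseteq> V'" using f(1) by (auto simp: mon_ideal_def kpoly_def)
    then show "supp m \<subseteq> V \<and> m \<in> map_monom p ` {m\<in>U. supp m \<subseteq> V'}" using n assms by (auto simp: supp_map_monom)
  qed
  then show "g \<in> mon_ideal V (map_monom p ` {m\<in>U. supp m \<subseteq> V'})" by (auto simp: mon_ideal_def kpoly_def)
next
  fix g :: "('w, 'k) mpoly" assume g: "g \<in> mon_ideal V (map_monom p ` {m\<in>U. supp m \<subseteq> V'})"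
  then have "\<forall>m\<in>supp g. \<exists>n. n \<in> U \<and> supp n \<subseteq> V' \<and> map_monom p n = m" by (auto simp: mon_ideal_def)
  then obtain s where s: "\<And>m. m \<in> supp g \<Longrightarrow> s m \<in> U \<and> supp (s m) \<subseteq> V' \<and> map_monom p (s m) = m" by metis
  let ?f = "\<Sum>m\<in>supp g. mono_term (s m) (coef g m)"
  have "supp ?f \<subseteq> (\<Union>m\<in>supp g. supp (mono_term (s m) (coef g m)))" by (rule keys_sum)
  then have "supp ?f \<subseteq> s ` supp g" by (auto split: if_splits)
  then have f1: "?f \<in> mon_ideal V' U" using s by (auto simp: mon_ideal_def kpoly_def)
  have f2: "map_vars p ?f = g" using s poly_sum_terms[of g] by (simp add: map_vars_sum)
  show "g \<in> map_vars p ` (mon_ideal V' U :: ('v, 'k) mpoly set)" by (subst f2[symmetric]) (rule imageI[OF f1])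
qed

lemma nonzerodivisor_quot_iff:
  assumes "ideal J R" "a \<in> carrier R"
  shows "nonzerodivisor (R Quot J) (J +>\<^bsub>R\<^esub> a) \<longleftrightarrow> (\<forall>b\<in>carrier R. a \<otimes>\<^bsub>R\<^esub> b \<in> J \<longrightarrow> b \<in> J)"
proof -
  interpret ideal J R by fact
  have z: "J +>\<^bsub>R\<^esub> b = J \<longleftrightarrow> b \<in> J" if "b \<in> carrier R" for b
    using that a_rcos_const a_rcos_self by metis
  have car: "carrier (R Quot J) = {J +>\<^bsub>R\<^esub> b |b. b \<in> carrier R}"
    by (auto simp: FactRing_def A_RCOSETS_def' )
  have mult: "(J +>\<^bsub>R\<^esub> a) \<otimes>\<^bsub>R Quot J\<^esub> (J +>\<^bsub>R\<^esub> b) = J +>\<^bsub>R\<^esub> (a \<otimes>\<^bsub>R\<^esub> b)" if "b \<in> carrier R" for b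
    using rcoset_mult_add[OF assms(2) that] by (simp add: FactRing_def)
  have zero: "\<zero>\<^bsub>R Quot J\<^esub> = J" by (simp add: FactRing_def)
  have prod: "(J +>\<^bsub>R\<^esub> a) \<otimes>\<^bsub>R Quot J\<^esub> (J +>\<^bsub>R\<^esub> b) = J \<longleftrightarrow> a \<otimes>\<^bsub>R\<^esub> b \<in> J" if "b \<in> carrier R" for b
    unfolding mult[OF that] using z[OF m_closed[OF assms(2) that]] .
  show ?thesis unfolding nonzerodivisor_def zero
  proof (intro iffI conjI ballI impI)
    fix b assume *: "J +>\<^bsub>R\<^esub> a \<in> carrier (R Quot J) \<and>
      (\<forall>b\<in>carrier (R Quot J). (J +>\<^bsub>R\<^esub> a) \<otimes>\<^bsub>R Quot J\<^esub> b = J \<longrightarrow> b = J)"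
      and b: "b \<in> carrier R" "a \<otimes>\<^bsub>R\<^esub> b \<in> J"
    have "J +>\<^bsub>R\<^esub> b \<in> carrier (R Quot J)" unfolding car using b by blast
    then have "J +>\<^bsub>R\<^esub> b = J" using * prod[OF b(1)] b(2) by blast
    then show "b \<in> J" using z[OF b(1)] by simp
  next
    show "J +>\<^bsub>R\<^esub> a \<in> carrier (R Quot J)" unfolding car using assms(2) by blast
  next
    fix B assume *: "\<forall>b\<in>carrier R. a \<otimes>\<^bsub>R\<^esub> b \<in> J \<longrightarrow> b \<in> J" and B: "B \<in> carrier (R Quot J)"
      "(J +>\<^bsub>R\<^esub> a) \<otimes>\<^bsub>R Quot J\<^esub> B = J"
    then obtain b where b: "b \<in> carrier R" "B = J +>\<^bsub>R\<^esub> b" unfolding car by blast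
    then show "B = J" using * B(2) prod[OF b(1)] z[OF b(1)] by blast
  qed
qed

section \<open>Acyclicity of the Koszul complex\<close>

text \<open>\<open>K\<close> is a subring of an ambient ring, as the polynomials in the variables of
  \<open>V\<close> are inside all polynomials. Chains of degree \<open>p\<close> are the coordinate
  families of elements of the \<open>p\<close>-th exterior power of a free module of rank
  \<open>d\<close>; values at sets not of size \<open>p\<close> are ignored.\<close>

locale koszul =
  fixes K :: "'a::comm_ring_1 set" and \<theta> :: "nat \<Rightarrow> 'a" and d :: nat
  assumes K0: "0 \<in> K" and K1: "1 \<in> K" and Kadd: "\<And>a b. a \<in> K \<Longrightarrow> b \<in> K \<Longrightarrow> a + b \<in> K"
    and Kmult: "\<And>a b. a \<in> K \<Longrightarrow> b \<in> K \<Longrightarrow> a * b \<in> K" and Kuminus: "\<And>a. a \<in> K \<Longrightarrow> - a \<in> K"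
    and theta_K: "\<And>j. j < d \<Longrightarrow> \<theta> j \<in> K"
begin

definition is_ideal :: "'a set \<Rightarrow> bool" where
  "is_ideal J \<longleftrightarrow> J \<subseteq> K \<and> 0 \<in> J \<and> (\<forall>a\<in>J. \<forall>b\<in>J. a + b \<in> J) \<and> (\<forall>a\<in>J. \<forall>r\<in>K. r * a \<in> J)"

lemma is_idealD:
  assumes "is_ideal J"
  shows "a \<in> J \<Longrightarrow> a \<in> K" "0 \<in> J" "a \<in> J \<Longrightarrow> b \<in> J \<Longrightarrow> a + b \<in> J" "a \<in> J \<Longrightarrow> r \<in> K \<Longrightarrow> r * a \<in> J"
    "a \<in> J \<Longrightarrow> - a \<in> J" "a \<in> J \<Longrightarrow> b \<in> J \<Longrightarrow> a - b \<in> J"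
proof -
  note * = assms[unfolded is_ideal_def]
  show "a \<in> J \<Longrightarrow> a \<in> K" "0 \<in> J" "a \<in> J \<Longrightarrow> b \<in> J \<Longrightarrow> a + b \<in> J" "a \<in> J \<Longrightarrow> r \<in> K \<Longrightarrow> r * a \<in> J"
    using * by auto
  have neg: "- a \<in> J" if "a \<in> J" for a
  proof -
    have "(- 1) * a \<in> J" using * that Kuminus[OF K1] by blast
    then show ?thesis by simp
  qed
  then show "a \<in> J \<Longrightarrow> - a \<in> J" .
  show "a \<in> J \<Longrightarrow> b \<in> J \<Longrightarrow> a - b \<in> J" using neg[of b] * by (metis add_uminus_conv_diff)
qed

lemma ideal_sum_closed: "is_ideal J \<Longrightarrow> (\<And>i. i \<in> S \<Longrightarrow> f i \<in> J) \<Longrightarrow> (\<Sum>i\<in>S. f i) \<in> J"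
  by (induction S rule: infinite_finite_induct) (auto intro: is_idealD)

lemma Ksum: "(\<And>i. i \<in> S \<Longrightarrow> f i \<in> K) \<Longrightarrow> (\<Sum>i\<in>S. f i) \<in> K"
  by (induction S rule: infinite_finite_induct) (auto intro: K0 Kadd)

lemma Kdiff: "a \<in> K \<Longrightarrow> b \<in> K \<Longrightarrow> a - b \<in> K"
  using Kadd[of a "- b"] Kuminus[of b] by simp

lemma Kpower: "a \<in> K \<Longrightarrow> a ^ n \<in> K"
  by (induction n) (auto intro: K1 Kmult)

text \<open>The sign of moving the basis vector with index \<open>j\<close> to its place among those
  indexed by \<open>S\<close>.\<close>

definition sg :: "nat \<Rightarrow> nat set \<Rightarrow> 'a" where
  "sg j S = (- 1) ^ card {s\<in>S. s < j}"

text \<open>The Koszul differential in coordinates.\<close>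

definition bd :: "(nat set \<Rightarrow> 'a) \<Rightarrow> nat set \<Rightarrow> 'a" where
  "bd z S = (\<Sum>j\<in>{..<d} - S. sg j S * \<theta> j * z (insert j S))"

text \<open>Exterior multiplication by the basis vector with index \<open>l\<close>.\<close>

definition wedge :: "nat \<Rightarrow> (nat set \<Rightarrow> 'a) \<Rightarrow> nat set \<Rightarrow> 'a" where
  "wedge l z S = (if l \<in> S then sg l S * z (S - {l}) else 0)"

definition chain :: "nat \<Rightarrow> (nat set \<Rightarrow> 'a) \<Rightarrow> bool" where
  "chain p z \<longleftrightarrow> (\<forall>S. S \<subseteq> {..<d} \<and> card S = p \<longrightarrow> z S \<in> K)"

lemma sg_K: "sg j S \<in> K"
  unfolding sg_def by (intro Kpower Kuminus K1)

lemma sg_square: "sg j S * sg j S = 1"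
  unfolding sg_def by (simp add: power_add[symmetric] mult_2[symmetric])

lemma sg_insert:
  assumes "finite S" "l \<notin> S"
  shows "sg j (insert l S) = (if l < j then - sg j S else sg j S)"
proof (cases "l < j")
  case True
  then have "{s \<in> insert l S. s < j} = insert l {s\<in>S. s < j}" by auto
  then show ?thesis using assms True by (simp add: sg_def)
next
  case False
  then have "{s \<in> insert l S. s < j} = {s\<in>S. s < j}" by auto
  then show ?thesis using False by (simp add: sg_def)
qed

lemma sg_anti:
  assumes "finite S" "j \<notin> S" "l \<notin> S" "j \<noteq> l"
  shows "sg j S * sg l (insert j S) = - (sg l S * sg j (insert l S))"
  using assms by (cases "j < l") (auto simp: sg_insert)

lemma sum_antisymmetric:
  fixes f :: "nat \<Rightarrow> nat \<Rightarrow> 'a"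
  assumes "finite T" "\<And>j l. j \<in> T \<Longrightarrow> l \<in> T \<Longrightarrow> j \<noteq> l \<Longrightarrow> f j l = - f l j"
  shows "(\<Sum>j\<in>T. \<Sum>l\<in>T - {j}. f j l) = 0"
proof -
  let ?A = "{(j,l). j \<in> T \<and> l \<in> T \<and> j < l}" and ?B = "{(j,l). j \<in> T \<and> l \<in> T \<and> l < j}"
  have fin: "finite ?A" "finite ?B" by (rule finite_subset[of _ "T \<times> T"]; use assms(1) in auto)+
  have "(\<Sum>j\<in>T. \<Sum>l\<in>T - {j}. f j l) = (\<Sum>(j,l)\<in>Sigma T (\<lambda>j. T - {j}). f j l)"
    using assms(1) by (simp add: sum.Sigma)
  also have "Sigma T (\<lambda>j. T - {j}) = ?A \<union> ?B" by auto
  also have "(\<Sum>(j,l)\<in>?A \<union> ?B. f j l) = (\<Sum>(j,l)\<in>?A. f j l) + (\<Sum>(j,l)\<in>?B. f j l)"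
    by (rule sum.union_disjoint) (use fin in auto)
  also have "(\<Sum>(j,l)\<in>?B. f j l) = (\<Sum>(j,l)\<in>?A. f l j)"
    by (rule sum.reindex_bij_witness[of _ "\<lambda>(a,b). (b,a)" "\<lambda>(a,b). (b,a)"]) auto
  also have "\<dots> = (\<Sum>(j,l)\<in>?A. - f j l)"
    by (rule sum.cong) (use assms(2) in auto)
  also have "\<dots> = - (\<Sum>(j,l)\<in>?A. f j l)" by (simp add: sum_negf[symmetric] case_prod_unfold)
  finally show ?thesis by simp
qed

lemma bd_bd:
  assumes "finite S" shows "bd (bd z) S = 0"
proof -
  let ?T = "{..<d} - S"
  let ?f = "\<lambda>j l. sg j S * \<theta> j * (sg l (insert j S) * \<theta> l * z (insert l (insert j S)))"
  have "bd (bd z) S = (\<Sum>j\<in>?T. \<Sum>l\<in>?T - {j}. ?f j l)"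
    unfolding bd_def sum_distrib_left
  proof (rule sum.cong[OF refl])
    fix j assume "j \<in> ?T"
    have "{..<d} - insert j S = ?T - {j}" by auto
    then show "(\<Sum>l\<in>{..<d} - insert j S. ?f j l) = (\<Sum>l\<in>?T - {j}. ?f j l)" by simp
  qed
  also have "\<dots> = 0"
  proof (rule sum_antisymmetric)
    fix j l assume "j \<in> ?T" "l \<in> ?T" "j \<noteq> l"
    then have "sg j S * sg l (insert j S) = - (sg l S * sg j (insert l S))"
      by (intro sg_anti assms) auto
    moreover have "?f j l = (sg j S * sg l (insert j S)) * (\<theta> j * \<theta> l * z (insert l (insert j S)))"
      "?f l j = (sg l S * sg j (insert l S)) * (\<theta> j * \<theta> l * z (insert l (insert j S)))"
      by (simp_all add: insert_commute mult_ac)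
    ultimately show "?f j l = - ?f l j" by simp
  qed simp
  finally show ?thesis .
qed

text \<open>Exterior multiplication is a contracting homotopy for multiplication by
  \<open>\<theta> l\<close>, so every \<open>\<theta> l\<close> annihilates the Koszul homology. The
  terms omitting \<open>l\<close> cancel, because \<open>j\<close> and \<open>l\<close> are inserted
  in opposite orders.\<close>

lemma bd_wedge:
  assumes S: "S \<subseteq> {..<d}" and l: "l < d"
  shows "bd (wedge l z) S + wedge l (bd z) S = \<theta> l * z S"
proof -
  have fS: "finite S" using S finite_subset by blast
  show ?thesis
  proof (cases "l \<in> S")
    case False
    have "bd (wedge l z) S = (\<Sum>j\<in>{..<d} - S. if j = l then \<theta> l * z S else 0)"
      unfolding bd_def
    proof (rule sum.cong[OF refl])
      fix j assume j: "j \<in> {..<d} - S"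
      show "sg j S * \<theta> j * wedge l z (insert j S) = (if j = l then \<theta> l * z S else 0)"
      proof (cases "j = l")
        case True
        have "sg l (insert l S) = sg l S" using sg_insert[OF fS False, of l] by simp
        then have "sg j S * \<theta> j * wedge l z (insert j S) = (sg l S * sg l S) * (\<theta> l * z S)"
          using True False by (simp add: wedge_def mult_ac)
        then show ?thesis using True sg_square by simp
      next
        case jl: False
        then show ?thesis using False by (simp add: wedge_def)
      qed
    qed
    also have "\<dots> = \<theta> l * z S" using l False by simp
    finally show ?thesis using False by (simp add: wedge_def)
  next
    case True
    let ?R = "S - {l}"
    have fR: "finite ?R" and SR: "S = insert l ?R" and lR: "l \<notin> ?R" using fS True by auto
    have T: "{..<d} - ?R = insert l ({..<d} - S)" "l \<notin> {..<d} - S" using l True by auto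
    have "wedge l (bd z) S = sg l S * (\<Sum>j\<in>{..<d} - ?R. sg j ?R * \<theta> j * z (insert j ?R))"
      using True by (simp add: wedge_def bd_def)
    also have "\<dots> = sg l S * (sg l ?R * \<theta> l * z S) + (\<Sum>j\<in>{..<d} - S. sg l S * (sg j ?R * \<theta> j * z (insert j ?R)))"
      unfolding T(1) using T(2) SR by (simp add: distrib_left sum_distrib_left)
    also have "sg l S * (sg l ?R * \<theta> l * z S) = (sg l ?R * sg l ?R) * (\<theta> l * z S)"
    proof -
      have "sg l S = sg l ?R" using sg_insert[OF fR lR, of l] SR by simp
      then show ?thesis by (simp add: mult_ac)
    qed
    also have "\<dots> = \<theta> l * z S" using sg_square by simp
    finally have w: "wedge l (bd z) S = \<theta> l * z S + (\<Sum>j\<in>{..<d} - S. sg l S * (sg j ?R * \<theta> j * z (insert j ?R)))" .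
    have "bd (wedge l z) S = (\<Sum>j\<in>{..<d} - S. - (sg l S * (sg j ?R * \<theta> j * z (insert j ?R))))"
      unfolding bd_def
    proof (rule sum.cong[OF refl])
      fix j assume j: "j \<in> {..<d} - S"
      then have jl: "j \<noteq> l" "j \<notin> ?R" using True by auto
      have "insert j S - {l} = insert j ?R" using jl by auto
      then have 1: "sg j S * \<theta> j * wedge l z (insert j S) = (sg j S * sg l (insert j S)) * (\<theta> j * z (insert j ?R))"
        using True by (simp add: wedge_def mult_ac)
      have "sg l (insert j S) = sg l (insert j ?R)"
      proof -
        have "insert j S = insert l (insert j ?R)" using SR by auto
        moreover have "sg l (insert l (insert j ?R)) = sg l (insert j ?R)"
          using sg_insert[of "insert j ?R" l l] fR jl by auto
        ultimately show ?thesis by simp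
      qed
      moreover have "sg j S = sg j (insert l ?R)" using SR by simp
      moreover have "sg l S = sg l ?R" using sg_insert[OF fR lR, of l] SR by simp
      moreover have "sg j (insert l ?R) * sg l (insert j ?R) = - (sg l ?R * sg j ?R)"
      proof -
        have "sg j (insert l ?R) = (if l < j then - sg j ?R else sg j ?R)" by (rule sg_insert[OF fR lR])
        moreover have "sg l (insert j ?R) = (if j < l then - sg l ?R else sg l ?R)" by (rule sg_insert[OF fR jl(2)])
        ultimately show ?thesis using jl(1) by auto
      qed
      ultimately have "sg j S * sg l (insert j S) = - (sg l S * sg j ?R)" by simp
      then show "sg j S * \<theta> j * wedge l z (insert j S) = - (sg l S * (sg j ?R * \<theta> j * z (insert j ?R)))"
        unfolding 1 by (simp add: mult_ac)
    qed
    then show ?thesis using w by (simp add: sum_negf)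
  qed
qed

lemma bd_add: "bd (\<lambda>S. z S + w S) T = bd z T + bd w T"
  by (simp add: bd_def distrib_left sum.distrib)

lemma bd_diff: "bd (\<lambda>S. z S - w S) T = bd z T - bd w T"
  by (simp add: bd_def right_diff_distrib sum_subtractf)

lemma bd_cmult: "bd (\<lambda>S. r * z S) T = r * bd z T"
  unfolding bd_def sum_distrib_left by (rule sum.cong) (auto simp: mult_ac)

lemma bd_ideal:
  assumes J: "is_ideal J" and T: "T \<subseteq> {..<d}" and z: "\<And>S. S \<subseteq> {..<d} \<Longrightarrow> card S = Suc (card T) \<Longrightarrow> z S \<in> J"
  shows "bd z T \<in> J"
  unfolding bd_def
proof (rule ideal_sum_closed[OF J])
  fix j assume j: "j \<in> {..<d} - T"
  have "card (insert j T) = Suc (card T)" using j T finite_subset[OF T] by simp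
  then have "z (insert j T) \<in> J" using z[of "insert j T"] j T by auto
  then show "sg j T * \<theta> j * z (insert j T) \<in> J"
    using is_idealD(4)[OF J] Kmult[OF sg_K theta_K] j by auto
qed

lemma K_ideal: "is_ideal K"
  unfolding is_ideal_def using K0 Kadd Kmult by auto

lemma wedge_ideal:
  assumes J: "is_ideal J" and z: "\<And>T. T \<subseteq> {..<d} \<Longrightarrow> Suc (card T) = card S \<Longrightarrow> z T \<in> J" and S: "S \<subseteq> {..<d}"
  shows "wedge l z S \<in> J"
proof (cases "l \<in> S")
  case True
  have "Suc (card (S - {l})) = card S" using True finite_subset[OF S] by (intro card_Suc_Diff1) auto
  then have "z (S - {l}) \<in> J" using S by (intro z) auto
  then show ?thesis using True is_idealD(4)[OF J _ sg_K] by (simp add: wedge_def)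
next
  case False then show ?thesis using is_idealD(2)[OF J] by (simp add: wedge_def)
qed

text \<open>This and the next two notions describe the homology of the Koszul complex of
  \<open>K/J\<close> by congruences modulo \<open>J\<close>, so that no quotient ring has to be
  formed.\<close>

definition cycle :: "nat \<Rightarrow> 'a set \<Rightarrow> (nat set \<Rightarrow> 'a) \<Rightarrow> bool" where
  "cycle p J z \<longleftrightarrow> chain p z \<and> (\<forall>S. S \<subseteq> {..<d} \<and> Suc (card S) = p \<longrightarrow> bd z S \<in> J)"

definition boundary :: "nat \<Rightarrow> 'a set \<Rightarrow> (nat set \<Rightarrow> 'a) \<Rightarrow> bool" where
  "boundary p J z \<longleftrightarrow> (\<exists>w. chain (Suc p) w \<and> (\<forall>S. S \<subseteq> {..<d} \<and> card S = p \<longrightarrow> z S - bd w S \<in> J))"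

definition acyclic :: "nat \<Rightarrow> 'a set \<Rightarrow> bool" where
  "acyclic p J \<longleftrightarrow> (\<forall>z. cycle p J z \<longrightarrow> boundary p J z)"

text \<open>If \<open>f\<close> is a nonzerodivisor modulo \<open>J\<close> and \<open>f z\<close> is a boundary \<open>\<partial>w\<close> modulo \<open>J\<close>, then \<open>w\<close> is a
  cycle modulo \<open>J' = J + (f)\<close>.  Writing \<open>w = \<partial>u + f v\<close> modulo \<open>J\<close> gives \<open>f z = f \<partial>v\<close>, whence
  \<open>z = \<partial>v\<close>.\<close>

lemma boundary_cancel:
  assumes J: "is_ideal J" and J': "is_ideal J'" and f: "f \<in> J'" "f \<in> K"
    and JJ': "J \<subseteq> J'" "\<And>x. x \<in> J' \<Longrightarrow> \<exists>v\<in>K. x - f * v \<in> J"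
    and nz: "\<And>b. b \<in> K \<Longrightarrow> f * b \<in> J \<Longrightarrow> b \<in> J"
    and ac: "acyclic (Suc p) J'" and z: "chain p z" and b: "boundary p J (\<lambda>S. f * z S)"
  shows "boundary p J z"
proof -
  obtain w where w: "chain (Suc p) w" "\<And>S. S \<subseteq> {..<d} \<Longrightarrow> card S = p \<Longrightarrow> f * z S - bd w S \<in> J"
    using b unfolding boundary_def by blast
  have "bd w S \<in> J'" if S: "S \<subseteq> {..<d}" "Suc (card S) = Suc p" for S
  proof -
    have "z S \<in> K" using z S unfolding chain_def by blast
    then have "z S * f \<in> J'" using is_idealD(4)[OF J' f(1)] by blast
    moreover have "f * z S - bd w S \<in> J'" using w(2)[OF S(1)] S(2) JJ'(1) by auto
    ultimately have "z S * f - (f * z S - bd w S) \<in> J'" by (rule is_idealD(6)[OF J'])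
    then show ?thesis by (simp add: mult.commute)
  qed
  then have "cycle (Suc p) J' w" using w(1) unfolding cycle_def by blast
  then obtain u where u: "chain (Suc (Suc p)) u" "\<And>S. S \<subseteq> {..<d} \<Longrightarrow> card S = Suc p \<Longrightarrow> w S - bd u S \<in> J'"
    using ac unfolding acyclic_def boundary_def by blast
  have "\<forall>S. \<exists>v. S \<subseteq> {..<d} \<and> card S = Suc p \<longrightarrow> v \<in> K \<and> (w S - bd u S) - f * v \<in> J"
    using u(2) JJ'(2) by metis
  then obtain v where v: "\<And>S. S \<subseteq> {..<d} \<Longrightarrow> card S = Suc p \<Longrightarrow> v S \<in> K \<and> (w S - bd u S) - f * v S \<in> J"
    by metis
  have "z S - bd v S \<in> J" if S: "S \<subseteq> {..<d}" "card S = p" for S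
  proof -
    have fS: "finite S" using finite_subset[OF S(1)] by simp
    have "bd (\<lambda>S. (w S - bd u S) - f * v S) S \<in> J"
      by (rule bd_ideal[OF J S(1)]) (use v S in auto)
    moreover have "bd (\<lambda>S. (w S - bd u S) - f * v S) S = bd w S - f * bd v S"
      by (simp add: bd_diff bd_cmult bd_bd[OF fS])
    ultimately have "(f * z S - bd w S) + (bd w S - f * bd v S) \<in> J"
      using w(2)[OF S] is_idealD(3)[OF J] by metis
    then have "f * (z S - bd v S) \<in> J" by (simp add: right_diff_distrib)
    moreover have "bd v S \<in> K" by (rule bd_ideal[OF K_ideal S(1)]) (use v S in auto)
    moreover have "z S \<in> K" using z S unfolding chain_def by blast
    ultimately show ?thesis using nz Kdiff by blast
  qed
  moreover have "chain (Suc p) v" using v unfolding chain_def by blast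
  ultimately show ?thesis unfolding boundary_def by blast
qed

text \<open>A power of \<open>f\<close> lies in the ideal of the forms modulo \<open>J\<close>, so
  it annihilates homology and \<open>f ^ N * z\<close> is a boundary. Then
  \<open>boundary_cancel\<close> strips off the factors \<open>f\<close> one after another.\<close>

lemma acyclic_step:
  assumes J: "is_ideal J" and J': "is_ideal J'" and f: "f \<in> J'" "f \<in> K"
    and JJ': "J \<subseteq> J'" "\<And>x. x \<in> J' \<Longrightarrow> \<exists>v\<in>K. x - f * v \<in> J"
    and nz: "\<And>b. b \<in> K \<Longrightarrow> f * b \<in> J \<Longrightarrow> b \<in> J"
    and pow: "\<And>l. l < d \<Longrightarrow> r l \<in> K" "f ^ N - (\<Sum>l<d. r l * \<theta> l) \<in> J"
    and ac: "acyclic (Suc p) J'"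
  shows "acyclic p J"
  unfolding acyclic_def
proof (intro allI impI)
  fix z assume z: "cycle p J z"
  then have zc: "chain p z" by (simp add: cycle_def)
  have "boundary p J z" if "boundary p J (\<lambda>S. f ^ n * z S)" for n
    using that
  proof (induction n)
    case (Suc n)
    have c1: "chain p (\<lambda>S. f ^ n * z S)" using zc Kmult[OF Kpower[OF f(2)]] unfolding chain_def by blast
    have b1: "boundary p J (\<lambda>S. f * (f ^ n * z S))" using Suc.prems by (simp add: mult.assoc)
    have "boundary p J (\<lambda>S. f ^ n * z S)" by (rule boundary_cancel[OF J J' f JJ' nz ac c1 b1])
    then show ?case by (rule Suc.IH)
  qed simp
  moreover have "boundary p J (\<lambda>S. f ^ N * z S)"
  proof -
    \<comment> \<open>The homotopies of \<open>bd_wedge\<close>, combined with the coefficients that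
      express \<open>f ^ N\<close> by the forms.\<close>
    define w where "w S = (\<Sum>l<d. r l * wedge l z S)" for S
    have "chain (Suc p) w"
      unfolding chain_def w_def
    proof (intro allI impI, elim conjE)
      fix S assume S: "S \<subseteq> {..<d}" "card S = Suc p"
      have "wedge l z S \<in> K" for l
        by (rule wedge_ideal[OF K_ideal _ S(1)]) (use zc S in \<open>auto simp: chain_def\<close>)
      then show "(\<Sum>l<d. r l * wedge l z S) \<in> K" using pow(1) by (intro Ksum Kmult) auto
    qed
    moreover have "f ^ N * z S - bd w S \<in> J" if S: "S \<subseteq> {..<d}" "card S = p" for S
    proof -
      have zS: "z S \<in> K" using zc S by (auto simp: chain_def)
      have "bd w S = (\<Sum>l<d. r l * bd (wedge l z) S)"
      proof -
        have "bd (\<lambda>S. \<Sum>l\<in>L. r l * wedge l z S) S = (\<Sum>l\<in>L. r l * bd (wedge l z) S)" if "finite L" for L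
          using that by (induction L rule: finite_induct) (simp_all add: bd_add bd_cmult, simp add: bd_def)
        then show ?thesis unfolding w_def[abs_def] by simp
      qed
      also have "\<dots> = (\<Sum>l<d. r l * (\<theta> l * z S) - r l * wedge l (bd z) S)"
      proof (rule sum.cong[OF refl])
        fix l assume "l \<in> {..<d}"
        then have "bd (wedge l z) S = \<theta> l * z S - wedge l (bd z) S"
          using bd_wedge[OF S(1), of l z] by (simp add: eq_diff_eq)
        then show "r l * bd (wedge l z) S = r l * (\<theta> l * z S) - r l * wedge l (bd z) S"
          by (simp add: right_diff_distrib)
      qed
      finally have "bd w S = (\<Sum>l<d. r l * \<theta> l) * z S - (\<Sum>l<d. r l * wedge l (bd z) S)"
        by (simp add: sum_subtractf sum_distrib_right mult.assoc)
      then have "f ^ N * z S - bd w S = z S * (f ^ N - (\<Sum>l<d. r l * \<theta> l)) + (\<Sum>l<d. r l * wedge l (bd z) S)"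
        by (simp add: algebra_simps)
      moreover have "wedge l (bd z) S \<in> J" for l
        by (rule wedge_ideal[OF J _ S(1)]) (use z S in \<open>auto simp: cycle_def\<close>)
      then have "(\<Sum>l<d. r l * wedge l (bd z) S) \<in> J"
        by (intro ideal_sum_closed[OF J] is_idealD(4)[OF J]) (use pow(1) in auto)
      ultimately show ?thesis using is_idealD(3)[OF J is_idealD(4)[OF J pow(2) zS]] by metis
    qed
    ultimately show ?thesis unfolding boundary_def by blast
  qed
  ultimately show "boundary p J z" by blast
qed

text \<open>No subset of \<open>{..<d}\<close> has more than \<open>d\<close> elements.\<close>

lemma acyclic_large: assumes "is_ideal J" "d < p" shows "acyclic p J"
proof -
  have "card S \<le> d" if "S \<subseteq> {..<d}" for S using card_mono[OF _ that] by simp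
  moreover have "chain (Suc p) (\<lambda>_. 0)" by (simp add: chain_def K0)
  ultimately show ?thesis unfolding acyclic_def boundary_def using assms(2) by (metis leD)
qed

text \<open>The depth sensitivity of the Koszul complex: the homology of the forms modulo the first
  \<open>i\<close> members of a regular sequence of length \<open>d\<close> vanishes above degree
  \<open>i\<close>, provided that powers of these members lie in the ideal of the forms. The
  induction descends from \<open>i = d\<close>; going from \<open>i + 1\<close> back to
  \<open>i\<close> lowers the degree by one.\<close>

theorem koszul_acyclic:
  assumes J: "\<And>i. i \<le> d \<Longrightarrow> is_ideal (J i)" and f: "\<And>i. i < d \<Longrightarrow> f i \<in> J (Suc i)" "\<And>i. i < d \<Longrightarrow> f i \<in> K"
    and mono: "\<And>i. i < d \<Longrightarrow> J i \<subseteq> J (Suc i)"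
    and span: "\<And>i x. i < d \<Longrightarrow> x \<in> J (Suc i) \<Longrightarrow> \<exists>v\<in>K. x - f i * v \<in> J i"
    and nz: "\<And>i b. i < d \<Longrightarrow> b \<in> K \<Longrightarrow> f i * b \<in> J i \<Longrightarrow> b \<in> J i"
    and pow: "\<And>i. i < d \<Longrightarrow> \<exists>N r. (\<forall>l<d. r l \<in> K) \<and> f i ^ N - (\<Sum>l<d. r l * \<theta> l) \<in> J 0"
    and i: "i \<le> d" "i < p"
  shows "acyclic p (J i)"
  using i
proof (induction "d - i" arbitrary: i p)
  case 0
  then have "i = d" by simp
  then show ?case using acyclic_large J 0 by blast
next
  case (Suc n)
  then have id: "i < d" by simp
  have ac: "acyclic (Suc p) (J (Suc i))" by (rule Suc.hyps) (use Suc in auto)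
  have J0: "J 0 \<subseteq> J k" if "k \<le> d" for k
    using that
  proof (induction k)
    case (Suc k)
    then show ?case using mono[of k] by auto
  qed simp
  obtain N r where rN: "\<And>l. l < d \<Longrightarrow> r l \<in> K" "f i ^ N - (\<Sum>l<d. r l * \<theta> l) \<in> J i"
    using pow[OF id] J0[of i] id by auto
  show ?case
    by (rule acyclic_step[OF J[of i] J[of "Suc i"] f(1)[OF id] f(2)[OF id] mono[OF id] span[OF id] nz[OF id] rN ac])
      (use id in auto)
qed

text \<open>First homology in matrix form: a chain of degree 2 is an alternating matrix, and its
  boundary accounts for the given relation modulo \<open>J\<close>.\<close>

lemma acyclic_one:
  assumes J: "is_ideal J" and ac: "acyclic 1 J" and m: "\<And>l. l < d \<Longrightarrow> m l \<in> K" "(\<Sum>l<d. \<theta> l * m l) \<in> J"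
  obtains a where "\<And>l j. l < d \<Longrightarrow> j < d \<Longrightarrow> a l j \<in> K" "\<And>l j. a l j = - a j l" "\<And>l. a l l = 0"
    "\<And>l. l < d \<Longrightarrow> m l - (\<Sum>j<d. \<theta> j * a l j) \<in> J"
proof -
  define z where "z S = m (the_elem S)" for S
  have "chain 1 z"
    unfolding chain_def z_def using m(1) by (auto simp: card_1_singleton_iff)
  moreover have "bd z {} = (\<Sum>l<d. \<theta> l * m l)" by (simp add: bd_def z_def sg_def)
  then have "bd z S \<in> J" if "S \<subseteq> {..<d}" "Suc (card S) = 1" for S
    using that m(2) finite_subset[OF that(1)] by auto
  ultimately have "cycle 1 J z" by (simp add: cycle_def)
  then obtain w where w: "chain 2 w" "\<And>S. S \<subseteq> {..<d} \<Longrightarrow> card S = 1 \<Longrightarrow> z S - bd w S \<in> J"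
    using ac unfolding acyclic_def boundary_def by (auto simp: numeral_2_eq_2)
  \<comment> \<open>The sign makes the value at the unordered pair alternating, and it is the sign
    \<open>sg j {l}\<close> of the differential.\<close>
  define a where "a l j = (if j = l then 0 else if l < j then - w {l,j} else w {l,j})" for l j
  show ?thesis
  proof (rule that[of a])
    show "a l j \<in> K" if "l < d" "j < d" for l j
      using w(1) that K0 Kuminus unfolding a_def chain_def by auto
    show "a l j = - a j l" for l j by (auto simp: a_def insert_commute)
    show "a l l = 0" for l by (simp add: a_def)
    fix l assume l: "l < d"
    have "bd w {l} = (\<Sum>j\<in>{..<d} - {l}. \<theta> j * a l j)"
      unfolding bd_def
    proof (rule sum.cong[OF refl])
      fix j assume j: "j \<in> {..<d} - {l}"
      have "sg j {l} = (if l < j then - 1 else 1)" using sg_insert[of "{}" l j] by (simp add: sg_def)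
      then show "sg j {l} * \<theta> j * w (insert j {l}) = \<theta> j * a l j"
        using j by (auto simp: a_def insert_commute)
    qed
    also have "\<dots> = (\<Sum>j<d. \<theta> j * a l j)"
      by (rule sum.mono_neutral_left) (auto simp: a_def)
    finally have "bd w {l} = (\<Sum>j<d. \<theta> j * a l j)" .
    moreover have "z {l} - bd w {l} \<in> J" by (rule w(2)) (use l in auto)
    ultimately show "m l - (\<Sum>j<d. \<theta> j * a l j) \<in> J" by (simp add: z_def)
  qed
qed

end

section \<open>Regular sequences of linear forms\<close>

text \<open>Degrees are integers so that \<open>e - 1\<close> makes sense for \<open>e = 0\<close>;
  components of negative degree are zero.\<close>

definition hcomp :: "int \<Rightarrow> ('v, 'k::field) mpoly \<Rightarrow> ('v, 'k) mpoly" where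
  "hcomp e f = (\<Sum>m\<in>supp f. if int (mdeg m) = e then mono_term m (coef f m) else 0)"

definition homog :: "int \<Rightarrow> ('v, 'k::field) mpoly \<Rightarrow> bool" where
  "homog e f \<longleftrightarrow> (\<forall>m\<in>supp f. int (mdeg m) = e)"

lemma coef_hcomp: "coef (hcomp e f) n = (if int (mdeg n) = e then coef f n else 0)"
proof -
  have "coef (hcomp e f) n = (\<Sum>m\<in>supp f. if m = n then (if int (mdeg n) = e then coef f n else 0) else 0)"
    unfolding hcomp_def lookup_sum by (rule sum.cong) (auto simp: lookup_single when_def)
  also have "\<dots> = (if int (mdeg n) = e then coef f n else 0)" by (simp add: in_keys_iff)
  finally show ?thesis .
qed

lemma supp_hcomp: "supp (hcomp e f) = {m \<in> supp f. int (mdeg m) = e}"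
  by (auto simp: in_keys_iff coef_hcomp split: if_splits)

lemma homog_hcomp [simp]: "homog e (hcomp e f)"
  by (auto simp: homog_def supp_hcomp)

lemma hcomp_homog: "homog e f \<Longrightarrow> hcomp e f = f"
  by (rule poly_mapping_eqI) (auto simp: coef_hcomp homog_def in_keys_iff)

lemma hcomp_add: "hcomp e (f + g) = hcomp e f + hcomp e g"
  by (rule poly_mapping_eqI) (simp add: coef_hcomp lookup_add)

lemma hcomp_zero [simp]: "hcomp e 0 = 0"
  by (rule poly_mapping_eqI) (simp add: coef_hcomp)

lemma hcomp_uminus: "hcomp e (- f) = - hcomp e f"
  by (rule poly_mapping_eqI) (simp add: coef_hcomp)

lemma hcomp_diff: "hcomp e (f - g) = hcomp e f - hcomp e g"
  by (rule poly_mapping_eqI) (simp add: coef_hcomp lookup_minus)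

lemma hcomp_sum: "hcomp e (\<Sum>i\<in>S. f i) = (\<Sum>i\<in>S. hcomp e (f i))"
  by (induction S rule: infinite_finite_induct) (auto simp: hcomp_add)

lemma hcomp_term: "hcomp e (mono_term m c) = (if int (mdeg m) = e then mono_term m c else 0)"
  by (rule poly_mapping_eqI) (auto simp: coef_hcomp lookup_single when_def)

lemma hcomp_sum_all: "f = (\<Sum>e\<in>(\<lambda>m. int (mdeg m)) ` supp f. hcomp e f)"
proof (rule poly_mapping_eqI)
  fix n
  let ?E = "(\<lambda>m. int (mdeg m)) ` supp f"
  have "coef (\<Sum>e\<in>?E. hcomp e f) n = (\<Sum>e\<in>?E. if e = int (mdeg n) then coef f n else 0)"
    unfolding lookup_sum by (rule sum.cong) (auto simp: coef_hcomp)
  also have "\<dots> = coef f n" by (auto simp: in_keys_iff)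
  finally show "coef f n = coef (\<Sum>e\<in>?E. hcomp e f) n" by simp
qed

lemma hcomp_mult:
  assumes t: "homog 1 t" shows "hcomp e (t * f) = t * hcomp (e - 1) f"
proof -
  have "t * f = (\<Sum>m\<in>supp t. \<Sum>n\<in>supp f. mono_term m (coef t m) * mono_term n (coef f n))"
    by (subst (1) poly_sum_terms[of t], subst (1) poly_sum_terms[of f]) (rule sum_product)
  then have "hcomp e (t * f) = (\<Sum>m\<in>supp t. \<Sum>n\<in>supp f. hcomp e (mono_term m (coef t m) * mono_term n (coef f n)))"
    by (simp add: hcomp_sum)
  also have "\<dots> = (\<Sum>m\<in>supp t. \<Sum>n\<in>supp f. mono_term m (coef t m) * (if int (mdeg n) = e - 1 then mono_term n (coef f n) else 0))"
  proof (intro sum.cong refl)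
    fix m n assume "m \<in> supp t"
    then have "int (mdeg m) = 1" using t by (auto simp: homog_def)
    then show "hcomp e (mono_term m (coef t m) * mono_term n (coef f n)) =
      mono_term m (coef t m) * (if int (mdeg n) = e - 1 then mono_term n (coef f n) else 0)"
      by (auto simp: mult_single hcomp_term mdeg_add)
  qed
  also have "\<dots> = (\<Sum>m\<in>supp t. mono_term m (coef t m)) * hcomp (e - 1) f"
    unfolding hcomp_def by (rule sum_product[symmetric])
  finally show ?thesis using poly_sum_terms[of t] by simp
qed

lemma homog_diff: "homog e f \<Longrightarrow> homog e g \<Longrightarrow> homog e (f - g)"
  and homog_zero [simp]: "homog e 0" and homog_uminus: "homog e f \<Longrightarrow> homog e (- f)"
  unfolding homog_def using Poly_Mapping.keys_add[of f g] supp_diff[of f g] by auto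

lemma homog_neg: "homog e f \<Longrightarrow> e < 0 \<Longrightarrow> f = 0"
  unfolding homog_def by (metis Poly_Mapping.keys_eq_empty equals0I of_nat_less_0_iff)

lemma homog_mult_linear: "homog 1 t \<Longrightarrow> homog (e - 1) f \<Longrightarrow> homog e (t * f)"
  using hcomp_mult[of t e f] hcomp_homog[of "e - 1" f] homog_hcomp by metis

lemma hcomp_kpoly [simp]: "f \<in> kpoly V \<Longrightarrow> hcomp e f \<in> kpoly V"
  by (auto simp: kpoly_def supp_hcomp)

lemma hcomp_mon_ideal: "f \<in> mon_ideal V U \<Longrightarrow> hcomp e f \<in> mon_ideal V U"
  by (auto simp: mon_ideal_def kpoly_def supp_hcomp)

text \<open>For an ideal \<open>J\<close> this is the ideal generated by \<open>J\<close> and the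
  first \<open>j\<close> forms.\<close>

definition plus_forms :: "'v set \<Rightarrow> ('v, 'k::field) mpoly set \<Rightarrow> (nat \<Rightarrow> ('v, 'k) mpoly) \<Rightarrow> nat \<Rightarrow> ('v, 'k) mpoly set" where
  "plus_forms V J \<theta> j = {f \<in> kpoly V. \<exists>r. (\<forall>l<j. r l \<in> kpoly V) \<and> f - (\<Sum>l<j. \<theta> l * r l) \<in> J}"

lemma plus_forms_ideal:
  assumes J: "ideal J (mpoly_ring V)" and th: "\<And>l. l < j \<Longrightarrow> \<theta> l \<in> kpoly V"
  shows "ideal (plus_forms V J \<theta> j) (mpoly_ring V)" "J \<subseteq> plus_forms V J \<theta> j"
proof -
  note D = ideal_mpolyD[OF J]
  show "J \<subseteq> plus_forms V J \<theta> j"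
    unfolding plus_forms_def using D(1) by (auto intro!: exI[of _ "\<lambda>_. 0"])
  then have "0 \<in> plus_forms V J \<theta> j" using D(2) by blast
  then show "ideal (plus_forms V J \<theta> j) (mpoly_ring V)"
  proof (rule ideal_mpolyI[rotated])
    fix f g assume f: "f \<in> plus_forms V J \<theta> j"
    then obtain r where r: "\<forall>l<j. r l \<in> kpoly V" "f - (\<Sum>l<j. \<theta> l * r l) \<in> J" and fk: "f \<in> kpoly V"
      unfolding plus_forms_def by blast
    show "f + g \<in> plus_forms V J \<theta> j" if g: "g \<in> plus_forms V J \<theta> j"
    proof -
      obtain s where s: "\<forall>l<j. s l \<in> kpoly V" "g - (\<Sum>l<j. \<theta> l * s l) \<in> J" and gk: "g \<in> kpoly V"
        using g unfolding plus_forms_def by blast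
      have "(f + g) - (\<Sum>l<j. \<theta> l * (r l + s l)) = (f - (\<Sum>l<j. \<theta> l * r l)) + (g - (\<Sum>l<j. \<theta> l * s l))"
        by (simp add: distrib_left sum.distrib)
      then have "(f + g) - (\<Sum>l<j. \<theta> l * (r l + s l)) \<in> J" using D(3)[OF r(2) s(2)] by (simp only:)
      then show ?thesis using fk gk r(1) s(1) unfolding plus_forms_def
        by (intro CollectI conjI exI[of _ "\<lambda>l. r l + s l"]) auto
    qed
    show "g * f \<in> plus_forms V J \<theta> j" if g: "g \<in> kpoly V"
    proof -
      have "g * f - (\<Sum>l<j. \<theta> l * (g * r l)) = g * (f - (\<Sum>l<j. \<theta> l * r l))"
        by (simp add: right_diff_distrib sum_distrib_left mult_ac)
      then have "g * f - (\<Sum>l<j. \<theta> l * (g * r l)) \<in> J" using D(4)[OF r(2) g] by (simp only:)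
      then show ?thesis using fk g r(1) unfolding plus_forms_def
        by (intro CollectI conjI exI[of _ "\<lambda>l. g * r l"]) auto
    qed
  qed (auto simp: plus_forms_def)
qed

text \<open>\<open>H1\<close> is the vanishing of the first Koszul homology modulo \<open>I\<close>.
  Since the forms are homogeneous of degree 1, it implies that they form a regular sequence in the
  given order.\<close>

locale linear_forms =
  fixes V :: "'v set" and U :: "('v \<Rightarrow>\<^sub>0 nat) set" and \<theta> :: "nat \<Rightarrow> ('v, 'k::field) mpoly" and d :: nat
    and I :: "('v, 'k) mpoly set"
  defines "I \<equiv> mon_ideal V U"
  assumes U: "up_closed V U"
    and th: "\<And>l. l < d \<Longrightarrow> \<theta> l \<in> kpoly V" "\<And>l. l < d \<Longrightarrow> homog 1 (\<theta> l)"
    and H1: "\<And>m. (\<And>l. l < d \<Longrightarrow> m l \<in> kpoly V) \<Longrightarrow> (\<Sum>l<d. \<theta> l * m l) \<in> I \<Longrightarrow>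
      \<exists>a. (\<forall>l<d. \<forall>j<d. a l j \<in> kpoly V) \<and> (\<forall>l j. a l j = - a j l) \<and> (\<forall>l. a l l = 0) \<and>
        (\<forall>l<d. m l - (\<Sum>j<d. \<theta> j * a l j) \<in> I)"
begin

lemma I_ideal: "ideal I (mpoly_ring V)" unfolding I_def by (rule mon_ideal_ideal[OF U])

lemmas I_closed = ideal_mpolyD[OF I_ideal]

text \<open>Relations of degree \<open>e\<close> among the first \<open>j\<close> forms follow,
  modulo \<open>I\<close>, from commutativity of their products; the alternating matrix records
  how.\<close>

definition trivial_relations :: "nat \<Rightarrow> int \<Rightarrow> bool" where
  "trivial_relations j e \<longleftrightarrow> (\<forall>m. (\<forall>l<j. m l \<in> kpoly V \<and> homog e (m l)) \<longrightarrow> (\<Sum>l<j. \<theta> l * m l) \<in> I \<longrightarrow>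
    (\<exists>a. (\<forall>l<j. \<forall>k<j. a l k \<in> kpoly V \<and> homog (e - 1) (a l k)) \<and> (\<forall>l k. a l k = - a k l) \<and> (\<forall>l. a l l = 0) \<and>
      (\<forall>l<j. m l - (\<Sum>k<j. \<theta> k * a l k) \<in> I)))"

text \<open>Homogeneous components of the entries still form an alternating matrix, and the relation
  equals its own component of degree \<open>e\<close>.\<close>

lemma trivial_relations_all: "trivial_relations d e"
  unfolding trivial_relations_def
proof (intro allI impI)
  fix m assume m: "\<forall>l<d. m l \<in> kpoly V \<and> homog e (m l)" "(\<Sum>l<d. \<theta> l * m l) \<in> I"
  have mk: "m l \<in> kpoly V" if "l < d" for l using m(1) that by simp
  obtain a where aa: "\<forall>l<d. \<forall>j<d. a l j \<in> kpoly V" "\<forall>l j. a l j = - a j l" "\<forall>l. a l l = 0"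
    "\<forall>l<d. m l - (\<Sum>j<d. \<theta> j * a l j) \<in> I"
  proof -
    have "\<exists>a. (\<forall>l<d. \<forall>j<d. a l j \<in> kpoly V) \<and> (\<forall>l j. a l j = - a j l) \<and> (\<forall>l. a l l = 0) \<and>
        (\<forall>l<d. m l - (\<Sum>j<d. \<theta> j * a l j) \<in> I)"
      by (rule H1) (use mk m(2) in auto)
    then show ?thesis using that by (elim exE conjE)
  qed
  note a = aa[rule_format]
  let ?b = "\<lambda>l k. hcomp (e - 1) (a l k)"
  have "m l - (\<Sum>k<d. \<theta> k * ?b l k) \<in> I" if l: "l < d" for l
  proof -
    have "hcomp e (m l - (\<Sum>k<d. \<theta> k * a l k)) = m l - (\<Sum>k<d. \<theta> k * ?b l k)"
      using m(1) l by (simp add: hcomp_diff hcomp_sum hcomp_mult th hcomp_homog)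
    moreover have "hcomp e (m l - (\<Sum>k<d. \<theta> k * a l k)) \<in> I"
      using a(4)[OF l] unfolding I_def by (rule hcomp_mon_ideal)
    ultimately show ?thesis by simp
  qed
  moreover have "?b l k = - ?b k l" for l k using a(2)[of l k] by (metis hcomp_uminus)
  moreover have "?b l k \<in> kpoly V \<and> homog (e - 1) (?b l k)" if "l < d" "k < d" for l k
    using a(1)[OF that] by simp
  moreover have "?b l l = 0" for l using a(3) by simp
  ultimately show "\<exists>a. (\<forall>l<d. \<forall>k<d. a l k \<in> kpoly V \<and> homog (e - 1) (a l k)) \<and> (\<forall>l k. a l k = - a k l) \<and> (\<forall>l. a l l = 0) \<and>
      (\<forall>l<d. m l - (\<Sum>k<d. \<theta> k * a l k) \<in> I)"
    by (intro exI[of _ ?b]) blast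
qed

text \<open>A relation between \<open>\<theta>\<^sub>0, \<dots>, \<theta>\<^sub>j\<^sub>-\<^sub>1\<close> is one between \<open>\<theta>\<^sub>0, \<dots>, \<theta>\<^sub>j\<close>; the coefficients of \<open>\<theta>\<^sub>j\<close> in
  its expression by trivial relations form a relation of smaller degree, so the grading allows induction.\<close>

lemma trivial_relations_down:
  assumes j: "j < d" and R: "\<And>e. trivial_relations (Suc j) e"
  shows "trivial_relations j e"
proof (induction "nat (e + 1)" arbitrary: e)
  case 0
  show ?case unfolding trivial_relations_def
  proof (intro allI impI)
    fix m assume m: "\<forall>l<j. m l \<in> kpoly V \<and> homog e (m l)" "(\<Sum>l<j. \<theta> l * m l) \<in> I"
    have "m l = 0" if "l < j" for l using homog_neg[of e "m l"] m(1) that 0 by auto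
    then show "\<exists>a. (\<forall>l<j. \<forall>k<j. a l k \<in> kpoly V \<and> homog (e - 1) (a l k)) \<and> (\<forall>l k. a l k = - a k l) \<and> (\<forall>l. a l l = 0) \<and>
      (\<forall>l<j. m l - (\<Sum>k<j. \<theta> k * a l k) \<in> I)"
      using I_closed(2) by (intro exI[of _ "\<lambda>_ _. 0"]) auto
  qed
next
  case (Suc n)
  show ?case unfolding trivial_relations_def
  proof (intro allI impI)
    fix m assume m: "\<forall>l<j. m l \<in> kpoly V \<and> homog e (m l)" "(\<Sum>l<j. \<theta> l * m l) \<in> I"
    let ?m = "\<lambda>l. if l < j then m l else 0"
    have "(\<Sum>l<Suc j. \<theta> l * ?m l) = (\<Sum>l<j. \<theta> l * m l)" by simp
    then have "\<exists>a. (\<forall>l<Suc j. \<forall>k<Suc j. a l k \<in> kpoly V \<and> homog (e - 1) (a l k)) \<and> (\<forall>l k. a l k = - a k l) \<and> (\<forall>l. a l l = 0) \<and>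
      (\<forall>l<Suc j. ?m l - (\<Sum>k<Suc j. \<theta> k * a l k) \<in> I)"
      using R[of e, unfolded trivial_relations_def, rule_format, of ?m] m by auto
    then obtain a where aa: "\<forall>l<Suc j. \<forall>k<Suc j. a l k \<in> kpoly V \<and> homog (e - 1) (a l k)"
      "\<forall>l k. a l k = - a k l" "\<forall>l. a l l = 0" "\<forall>l<Suc j. ?m l - (\<Sum>k<Suc j. \<theta> k * a l k) \<in> I"
      by (elim exE conjE) (rule that)
    note a = aa[rule_format]
    have "0 - (\<Sum>k<j. \<theta> k * a j k) \<in> I" using a(4)[of j] a(3)[of j] by simp
    then have row: "(\<Sum>k<j. \<theta> k * a j k) \<in> I" using I_closed(6)[of "0 - (\<Sum>k<j. \<theta> k * a j k)"] by simp
    have "n = nat (e - 1 + 1)" using Suc(2) by linarith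
    then have "trivial_relations j (e - 1)" by (rule Suc(1))
    then have "\<exists>b. (\<forall>l<j. \<forall>k<j. b l k \<in> kpoly V \<and> homog (e - 1 - 1) (b l k)) \<and> (\<forall>l k. b l k = - b k l) \<and> (\<forall>l. b l l = 0) \<and>
      (\<forall>l<j. a j l - (\<Sum>k<j. \<theta> k * b l k) \<in> I)"
      unfolding trivial_relations_def using row a(1)[of j] by auto
    then obtain b where bb: "\<forall>l<j. \<forall>k<j. b l k \<in> kpoly V \<and> homog (e - 1 - 1) (b l k)"
      "\<forall>l k. b l k = - b k l" "\<forall>l. b l l = 0" "\<forall>l<j. a j l - (\<Sum>k<j. \<theta> k * b l k) \<in> I"
      by (elim exE conjE) (rule that)
    note b = bb[rule_format]
    let ?c = "\<lambda>l k. a l k - \<theta> j * b l k"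
    have "m l - (\<Sum>k<j. \<theta> k * ?c l k) \<in> I" if l: "l < j" for l
    proof -
      have 1: "m l - ((\<Sum>k<j. \<theta> k * a l k) + \<theta> j * a l j) \<in> I" using a(4)[of l] l by simp
      have 2: "\<theta> j * (a j l - (\<Sum>k<j. \<theta> k * b l k)) \<in> I" by (rule I_closed(4)[OF b(4)[OF l] th(1)[OF j]])
      have eq: "m l - (\<Sum>k<j. \<theta> k * ?c l k) =
        (m l - ((\<Sum>k<j. \<theta> k * a l k) + \<theta> j * (- a j l))) - \<theta> j * (a j l - (\<Sum>k<j. \<theta> k * b l k))"
        by (simp add: right_diff_distrib sum_subtractf sum_distrib_left algebra_simps)
      show ?thesis unfolding eq by (rule I_closed(7)[OF 1[unfolded a(2)[of l j]] 2])
    qed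
    moreover have "?c l k \<in> kpoly V \<and> homog (e - 1) (?c l k)" if "l < j" "k < j" for l k
      using a(1)[of l k] b(1)[OF that] that th[OF j] by (auto intro!: homog_diff homog_mult_linear)
    moreover have "?c l k = - ?c k l" for l k
    proof -
      have "a l k - \<theta> j * b l k = - a k l - \<theta> j * (- b k l)" using a(2)[of l k] b(2)[of l k] by simp
      then show ?thesis by simp
    qed
    moreover have "?c l l = 0" for l by (simp add: a(3) b(3))
    ultimately show "\<exists>a. (\<forall>l<j. \<forall>k<j. a l k \<in> kpoly V \<and> homog (e - 1) (a l k)) \<and> (\<forall>l k. a l k = - a k l) \<and> (\<forall>l. a l l = 0) \<and>
      (\<forall>l<j. m l - (\<Sum>k<j. \<theta> k * a l k) \<in> I)"
      by (intro exI[of _ ?c]) blast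
  qed
qed

lemma trivial_relations_le: "j \<le> d \<Longrightarrow> trivial_relations j e"
proof (induction "d - j" arbitrary: j e)
  case 0
  then show ?case using trivial_relations_all by simp
next
  case (Suc n)
  then have "j < d" by simp
  then show ?case by (rule trivial_relations_down) (rule Suc(1); use Suc in simp)
qed

text \<open>That \<open>\<theta> j * g\<close> lies in the ideal is a relation with last coefficient
  \<open>g\<close>. Row \<open>j\<close> of its alternating matrix vanishes at \<open>j\<close>, so
  it expresses \<open>g\<close> by the earlier forms. The argument is applied to each homogeneous
  component of \<open>g\<close>.\<close>

theorem linear_form_nonzerodivisor:
  assumes j: "j < d" and g: "g \<in> kpoly V" "\<theta> j * g \<in> plus_forms V I \<theta> j"
  shows "g \<in> plus_forms V I \<theta> j"
proof -
  obtain r where r: "\<And>l. l < j \<Longrightarrow> r l \<in> kpoly V" "\<theta> j * g - (\<Sum>l<j. \<theta> l * r l) \<in> I"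
    using g(2) unfolding plus_forms_def by blast
  have "hcomp e g \<in> plus_forms V I \<theta> j" for e
  proof -
    let ?m = "\<lambda>l. if l = j then hcomp e g else - hcomp e (r l)"
    have "hcomp (e + 1) (\<theta> j * g - (\<Sum>l<j. \<theta> l * r l)) = \<theta> j * hcomp e g - (\<Sum>l<j. \<theta> l * hcomp e (r l))"
    proof -
      have "hcomp (e + 1) (\<theta> l * f) = \<theta> l * hcomp e f" if "l < d" for l f
        using hcomp_mult[OF th(2)[OF that], of "e + 1" f] by simp
      then show ?thesis using j by (simp add: hcomp_diff hcomp_sum)
    qed
    moreover have "hcomp (e + 1) (\<theta> j * g - (\<Sum>l<j. \<theta> l * r l)) \<in> I"
      using r(2) unfolding I_def by (rule hcomp_mon_ideal)
    moreover have "(\<Sum>l<Suc j. \<theta> l * ?m l) = \<theta> j * hcomp e g - (\<Sum>l<j. \<theta> l * hcomp e (r l))"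
      by (simp add: sum_negf)
    ultimately have s: "(\<Sum>l<Suc j. \<theta> l * ?m l) \<in> I" by metis
    have mm: "\<forall>l<Suc j. ?m l \<in> kpoly V \<and> homog e (?m l)" using r(1) g(1) by (auto intro: homog_uminus)
    have "trivial_relations (Suc j) e" by (rule trivial_relations_le) (use j in simp)
    then have "\<exists>a. (\<forall>l<Suc j. \<forall>k<Suc j. a l k \<in> kpoly V \<and> homog (e - 1) (a l k)) \<and> (\<forall>l k. a l k = - a k l) \<and> (\<forall>l. a l l = 0) \<and>
      (\<forall>l<Suc j. ?m l - (\<Sum>k<Suc j. \<theta> k * a l k) \<in> I)"
      unfolding trivial_relations_def using mm s by (elim allE[of _ ?m]) (erule (1) impE, erule (1) impE)
    then obtain a where a: "\<forall>l<Suc j. \<forall>k<Suc j. a l k \<in> kpoly V \<and> homog (e - 1) (a l k)"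
      "\<forall>l k. a l k = - a k l" "\<forall>l. a l l = 0" "\<forall>l<Suc j. ?m l - (\<Sum>k<Suc j. \<theta> k * a l k) \<in> I"
      by (elim exE conjE) (rule that)
    have "hcomp e g - (\<Sum>k<j. \<theta> k * a j k) \<in> I"
      using a(4)[rule_format, of j] a(3)[rule_format, of j] by simp
    moreover have "\<forall>l<j. a j l \<in> kpoly V" using a(1) by simp
    ultimately show ?thesis using g(1) unfolding plus_forms_def by (intro CollectI conjI exI[of _ "a j"]) auto
  qed
  moreover have "ideal (plus_forms V I \<theta> j) (mpoly_ring V)" using plus_forms_ideal(1)[OF I_ideal] th(1) j by simp
  ultimately have "(\<Sum>e\<in>(\<lambda>m. int (mdeg m)) ` supp g. hcomp e g) \<in> plus_forms V I \<theta> j"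
    by (intro ideal_sum[of _ V])
  then show ?thesis using hcomp_sum_all[of g] by simp
qed

end

section \<open>Regular sequences in Stanley-Reisner rings\<close>

lemma map_vars_comp: "map_vars p (map_vars q f) = map_vars (p \<circ> q) f"
proof -
  have "map_vars p (map_vars q f) = (\<Sum>m\<in>supp f. map_vars p (map_vars q (mono_term m (coef f m))))"
    by (subst (1) poly_sum_terms[of f]) (simp add: map_vars_sum)
  also have "\<dots> = map_vars (p \<circ> q) f" by (simp add: map_vars_def[of "p \<circ> q"] map_monom_comp)
  finally show ?thesis .
qed

text \<open>Leading terms need an order on the variables, so the finitely many variables in
  \<open>G\<close> are renamed to natural numbers.\<close>

lemma kpoly_no_zero_divisors:
  assumes G: "finite G" and f: "f \<in> kpoly G" "f \<noteq> 0" and g: "g \<in> kpoly G" "g \<noteq> 0"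
  shows "f * g \<noteq> 0"
proof
  assume fg: "f * g = 0"
  obtain t :: "'a \<Rightarrow> nat" where t: "inj_on t G" using G finite_imp_inj_to_nat_seg by blast
  have inv: "map_vars (inv_into G t) (map_vars t h) = h" if "h \<in> kpoly G" for h :: "('a, 'b) mpoly"
    unfolding map_vars_comp
  proof (rule map_vars_id)
    fix m assume "m \<in> supp h"
    then have "supp m \<subseteq> G" using that by (auto simp: kpoly_def)
    then show "map_monom (inv_into G t \<circ> t) m = m" by (intro map_monom_id) (use t in \<open>auto simp: inv_into_f_f\<close>)
  qed
  have nz: "map_vars t f \<noteq> 0" "map_vars t g \<noteq> 0" using inv[OF f(1)] inv[OF g(1)] f(2) g(2) by auto
  have "map_vars t f * map_vars t g = map_vars t (f * g)" by (rule map_vars_mult[symmetric])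
  then have "map_vars t f * map_vars t g = 0" using fg by simp
  then show False using nz by simp
qed

text \<open>The ideal generated by the variables outside \<open>G\<close>. For a face
  \<open>G\<close> it contains the Stanley-Reisner ideal, and for \<open>G = {}\<close> it is the
  irrelevant ideal.\<close>

definition face_prime :: "'v set \<Rightarrow> 'v set \<Rightarrow> ('v, 'k::field) mpoly set" where
  "face_prime V G = mon_ideal V {m. supp m \<subseteq> V \<and> \<not> supp m \<subseteq> G}"

lemma face_prime_up: "up_closed V {m. supp m \<subseteq> V \<and> \<not> supp m \<subseteq> G}"
  by (auto simp: up_closed_def supp_add)

lemma face_prime_ideal: "ideal (face_prime V G) (mpoly_ring V)"
  unfolding face_prime_def by (rule mon_ideal_ideal[OF face_prime_up])

lemma face_prime_iff: "f \<in> face_prime V G \<longleftrightarrow> f \<in> kpoly V \<and> (\<forall>m\<in>supp f. \<not> supp m \<subseteq> G)"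
  by (auto simp: face_prime_def mon_ideal_def kpoly_def)

lemma face_prime_mono: "G \<subseteq> F \<Longrightarrow> face_prime V F \<subseteq> (face_prime V G :: ('v, 'k::field) mpoly set)"
  unfolding face_prime_def mon_ideal_def by blast

text \<open>\<open>res\<close> sets the variables outside \<open>G\<close> to zero, so modulo the
  ideal the product is computed in the domain \<open>kpoly G\<close>.\<close>

lemma face_prime_prime:
  fixes f g :: "('v, 'k::field) mpoly"
  assumes G: "finite G" "G \<subseteq> V" and f: "f \<in> kpoly V" and g: "g \<in> kpoly V" and fg: "f * g \<in> face_prime V G"
  shows "f \<in> face_prime V G \<or> g \<in> face_prime V G"
proof (rule ccontr)
  assume no: "\<not> (f \<in> face_prime V G \<or> g \<in> face_prime V G)"
  define res :: "('v, 'k) mpoly \<Rightarrow> ('v, 'k) mpoly"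
    where "res h = (\<Sum>m\<in>{m\<in>supp h. supp m \<subseteq> G}. mono_term m (coef h m))" for h
  have coef_res: "coef (res h) n = (if supp n \<subseteq> G then coef h n else 0)" for h n
  proof -
    have "coef (res h) n = (\<Sum>m\<in>{m\<in>supp h. supp m \<subseteq> G}. if m = n then coef h n else 0)"
      unfolding res_def lookup_sum by (rule sum.cong) (auto simp: lookup_single when_def)
    then show ?thesis by (auto simp: in_keys_iff)
  qed
  have supp_res: "supp (res h) = {m\<in>supp h. supp m \<subseteq> G}" for h
    by (rule Set.set_eqI) (simp add: in_keys_iff[of _ "res h"] in_keys_iff[of _ h] coef_res)
  have resK: "res h \<in> kpoly G" for h by (simp add: kpoly_def supp_res)
  have nz: "res h \<noteq> 0" if h: "h \<in> kpoly V" "h \<notin> face_prime V G" for h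
  proof -
    have "supp (res h) \<noteq> {}" using h by (auto simp: face_prime_iff supp_res)
    then show ?thesis by auto
  qed
  have "res f * res g \<noteq> 0"
    by (rule kpoly_no_zero_divisors[OF G(1) resK _ resK]) (use nz f g no in auto)
  then have "supp (res f * res g) \<noteq> {}" by simp
  then obtain n where n: "n \<in> supp (res f * res g)" by blast
  have nG: "supp n \<subseteq> G" using n kpoly_closed(6)[OF resK resK, of f g] by (auto simp: kpoly_def)
  have dec: "h - res h \<in> face_prime V G" if "h \<in> kpoly V" for h
  proof -
    have "\<not> supp m \<subseteq> G" if "m \<in> supp (h - res h)" for m
      using that by (auto simp: in_keys_iff lookup_minus coef_res)
    moreover have "h - res h \<in> kpoly V"
      using that resK[of h] G(2) by (intro kpoly_closed(4)) (auto simp: kpoly_def)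
    ultimately show ?thesis by (simp add: face_prime_iff)
  qed
  have rV: "res h \<in> kpoly V" for h using resK[of h] G(2) by (auto simp: kpoly_def)
  note D = ideal_mpolyD[OF face_prime_ideal[of V G]]
  have "f * g - res f * res g = (f - res f) * g + res f * (g - res g)" by (simp add: algebra_simps)
  also have "\<dots> \<in> face_prime V G" by (rule D(3)[OF D(5)[OF dec[OF f] g] D(4)[OF dec[OF g] rV]])
  finally have "f * g - (f * g - res f * res g) \<in> face_prime V G" by (rule D(7)[OF fg])
  then have "res f * res g \<in> face_prime V G" by simp
  then show False using n nG by (auto simp: face_prime_iff)
qed

lemma coset_eq_iff:
  assumes I: "ideal I (mpoly_ring V)" and f: "f \<in> kpoly V" and g: "g \<in> kpoly V"
  shows "I +>\<^bsub>mpoly_ring V\<^esub> f = I +>\<^bsub>mpoly_ring V\<^esub> g \<longleftrightarrow> f - g \<in> I"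
proof -
  interpret I: ideal I "mpoly_ring V" by (rule I)
  note D = ideal_mpolyD[OF I]
  have coset: "I +>\<^bsub>mpoly_ring V\<^esub> h = {i + h |i. i \<in> I}" for h
    by (auto simp: a_r_coset_def' )
  show ?thesis
  proof
    assume "I +>\<^bsub>mpoly_ring V\<^esub> f = I +>\<^bsub>mpoly_ring V\<^esub> g"
    moreover have "0 + f \<in> {i + f |i. i \<in> I}" using D(2) by blast
    ultimately have "f \<in> {i + g |i. i \<in> I}" unfolding coset by simp
    then show "f - g \<in> I" by auto
  next
    assume fg: "f - g \<in> I"
    show "I +>\<^bsub>mpoly_ring V\<^esub> f = I +>\<^bsub>mpoly_ring V\<^esub> g"
      unfolding coset
    proof (intro equalityI subsetI)
      fix h assume "h \<in> {i + f |i. i \<in> I}"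
      then obtain i where i: "i \<in> I" "h = i + f" by blast
      have "h = (i + (f - g)) + g" "i + (f - g) \<in> I" using i D(3)[OF i(1) fg] by simp_all
      then show "h \<in> {i + g |i. i \<in> I}" by blast
    next
      fix h assume "h \<in> {i + g |i. i \<in> I}"
      then obtain i where i: "i \<in> I" "h = i + g" by blast
      have "h = (i - (f - g)) + f" "i - (f - g) \<in> I" using i D(7)[OF i(1) fg] by simp_all
      then show "h \<in> {i + f |i. i \<in> I}" by blast
    qed
  qed
qed

section \<open>Depth and codimension at the irrelevant ideal\<close>

locale quotient_poly =
  fixes V :: "'v set" and I :: "('v, 'k::field) mpoly set"
  assumes I: "ideal I (mpoly_ring V)"
begin

abbreviation "cs f \<equiv> I +>\<^bsub>mpoly_ring V\<^esub> f"
abbreviation "Q \<equiv> mpoly_ring V Quot I"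
abbreviation "img J \<equiv> (+>\<^bsub>mpoly_ring V\<^esub>) I ` J"

lemma carrier_Q: "carrier Q = cs ` kpoly V"
  by (auto simp: FactRing_def A_RCOSETS_def')

lemma Q_zero: "\<zero>\<^bsub>Q\<^esub> = I" by (simp add: FactRing_def)

lemma Q_mult: "f \<in> kpoly V \<Longrightarrow> g \<in> kpoly V \<Longrightarrow> cs f \<otimes>\<^bsub>Q\<^esub> cs g = cs (f * g)"
  using ideal.rcoset_mult_add[OF I, of f g] by (simp add: FactRing_def)

lemma cs_I: "f \<in> kpoly V \<Longrightarrow> cs f = I \<longleftrightarrow> f \<in> I"
proof -
  assume f: "f \<in> kpoly V"
  interpret I: ideal I "mpoly_ring V" by (rule I)
  have "cs 0 = I" using I.a_rcos_zero[OF I] ideal_mpolyD(2)[OF I] I.a_rcos_const[of 0] by simp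
  then show ?thesis using coset_eq_iff[OF I f, of 0] by simp
qed

lemma img_ideal: "ideal J (mpoly_ring V) \<Longrightarrow> ideal (img J) Q"
  using ring.ring_ideal_imp_quot_ideal[OF ring_mpoly I] by blast

lemma img_iff:
  assumes J: "ideal J (mpoly_ring V)" "I \<subseteq> J" and f: "f \<in> kpoly V" shows "cs f \<in> img J \<longleftrightarrow> f \<in> J"
proof
  assume "cs f \<in> img J"
  then obtain g where g: "g \<in> J" "cs f = cs g" by blast
  then have "f - g \<in> J" using coset_eq_iff[OF I f] ideal_mpolyD(1)[OF J(1)] J(2) by blast
  then have "(f - g) + g \<in> J" using ideal_mpolyD(3)[OF J(1)] g(1) by blast
  then show "f \<in> J" by simp
qed blast

lemma preimage_ideal:
  assumes "ideal \<aa> Q" shows "ideal {f \<in> kpoly V. cs f \<in> \<aa>} (mpoly_ring V)" "I \<subseteq> {f \<in> kpoly V. cs f \<in> \<aa>}"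
proof -
  interpret h: ring_hom_ring "mpoly_ring V" Q "(+>\<^bsub>mpoly_ring V\<^esub>) I"
    using ideal.rcos_ring_hom_ring[OF I] .
  show "ideal {f \<in> kpoly V. cs f \<in> \<aa>} (mpoly_ring V)" using h.ideal_vimage[OF assms] by simp
  have "I \<in> \<aa>" using additive_subgroup.zero_closed[OF ideal.axioms(1)[OF assms]] Q_zero by simp
  moreover have "f \<in> kpoly V \<and> cs f = I" if "f \<in> I" for f using ideal_mpolyD(1)[OF I] cs_I that by blast
  ultimately show "I \<subseteq> {f \<in> kpoly V. cs f \<in> \<aa>}" by (intro subsetI CollectI conjI) simp_all
qed

lemma img_face_prime:
  assumes Q: "cring Q" and G: "finite G" "G \<subseteq> V" and IG: "I \<subseteq> face_prime V G"
  shows "primeideal (img (face_prime V G)) Q"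
proof (rule primeidealI[OF img_ideal[OF face_prime_ideal] Q])
  note iff = img_iff[OF face_prime_ideal IG]
  have "(1 :: ('v, 'k) mpoly) \<notin> face_prime V G" by (simp add: face_prime_iff)
  then have "cs 1 \<notin> img (face_prime V G)" using iff[of 1] by simp
  moreover have "cs 1 \<in> carrier Q" unfolding carrier_Q by (rule imageI) simp
  ultimately show "carrier Q \<noteq> img (face_prime V G)" by blast
  fix a b assume ab: "a \<in> carrier Q" "b \<in> carrier Q" "a \<otimes>\<^bsub>Q\<^esub> b \<in> img (face_prime V G)"
  then obtain f g where fg: "f \<in> kpoly V" "a = cs f" "g \<in> kpoly V" "b = cs g" unfolding carrier_Q by blast
  then have "cs (f * g) \<in> img (face_prime V G)" using ab(3) Q_mult by simp
  then have "f * g \<in> face_prime V G" using iff[of "f * g"] fg by simp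
  then have "f \<in> face_prime V G \<or> g \<in> face_prime V G" by (rule face_prime_prime[OF G fg(1,3)])
  then show "a \<in> img (face_prime V G) \<or> b \<in> img (face_prime V G)" using fg by blast
qed

text \<open>A strictly larger ideal contains a polynomial with nonzero constant term, hence also
  this constant, which is a unit.\<close>

lemma img_irrelevant_maximal:
  assumes Q: "cring Q" and I0: "I \<subseteq> face_prime V {}"
  shows "maximalideal (img (face_prime V {})) Q"
proof (rule maximalidealI[OF img_ideal[OF face_prime_ideal]])
  note iff = img_iff[OF face_prime_ideal I0]
  have "(1 :: ('v, 'k) mpoly) \<notin> face_prime V {}" by (simp add: face_prime_iff)
  then have "cs 1 \<notin> img (face_prime V {})" using iff[of 1] by simp
  moreover have "cs 1 \<in> carrier Q" unfolding carrier_Q by (rule imageI) simp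
  ultimately show "carrier Q \<noteq> img (face_prime V {})" by blast
  fix \<aa> assume a: "ideal \<aa> Q" "img (face_prime V {}) \<subseteq> \<aa>" "\<aa> \<subseteq> carrier Q"
  let ?J = "{f \<in> kpoly V. cs f \<in> \<aa>}"
  note J = preimage_ideal[OF a(1)]
  note D = ideal_mpolyD[OF J(1)]
  have sub: "face_prime V {} \<subseteq> ?J" using a(2) ideal_mpolyD(1)[OF face_prime_ideal] by blast
  show "\<aa> = img (face_prime V {}) \<or> \<aa> = carrier Q"
  proof (cases "?J \<subseteq> face_prime V {}")
    case True
    then have "\<aa> \<subseteq> img (face_prime V {})" using a(3) unfolding carrier_Q by blast
    then show ?thesis using a(2) by blast
  next
    case False
    then obtain f where f: "f \<in> ?J" "f \<notin> face_prime V {}" by blast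
    let ?c = "coef f 0"
    have c: "?c \<noteq> 0" using f by (auto simp: face_prime_iff in_keys_iff)
    have "f - mono_term 0 ?c \<in> face_prime V {}"
      using f(1) by (auto simp: face_prime_iff in_keys_iff lookup_minus lookup_single when_def split: if_splits)
    then have "f - (f - mono_term 0 ?c) \<in> ?J" using D(7) f(1) sub by blast
    then have "mono_term 0 (inverse ?c) * mono_term 0 ?c \<in> ?J" by (intro D(4)) auto
    then have one: "1 \<in> ?J" using c by (simp add: mult_single)
    have "\<aa> = carrier Q"
    proof (rule equalityI[OF a(3)])
      show "carrier Q \<subseteq> \<aa>" unfolding carrier_Q
      proof (rule image_subsetI)
        fix g :: "('v, 'k) mpoly" assume "g \<in> kpoly V"
        then have "g * 1 \<in> ?J" by (rule D(4)[OF one])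
        then show "cs g \<in> \<aa>" by simp
      qed
    qed
    then show ?thesis by blast
  qed
qed

text \<open>Removing the vertices of \<open>F\<close> one at a time gives a chain of
  \<open>card F\<close> strict inclusions of face primes, ending at the irrelevant ideal. A lower
  bound is enough for what follows, so no dimension theory enters.\<close>

lemma codim_irrelevant:
  assumes Q: "cring Q" and F: "finite F" "F \<subseteq> V" and IF: "I \<subseteq> face_prime V F"
  shows "enat (card F) \<le> prime_codim Q (img (face_prime V {}))"
proof -
  obtain h where h: "bij_betw h {0..<card F} F" using ex_bij_betw_nat_finite[OF F(1)] by blast
  let ?n = "card F"
  define G where "G j = h ` {0..<?n - j}" for j
  have GF: "G j \<subseteq> F" for j using h unfolding G_def bij_betw_def by auto
  have IG: "I \<subseteq> face_prime V (G j)" for j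
  proof -
    have "face_prime V F \<subseteq> (face_prime V (G j) :: ('v, 'k) mpoly set)" by (rule face_prime_mono[OF GF])
    then show ?thesis using IF by blast
  qed
  define Ps where "Ps = map (\<lambda>j. img (face_prime V (G j))) [0..<Suc ?n]"
  have strict: "img (face_prime V (G j)) \<subset> img (face_prime V (G k))" if jk: "j < k" "k \<le> ?n" for j k
  proof -
    have sub: "face_prime V (G j) \<subseteq> (face_prime V (G k) :: ('v, 'k) mpoly set)"
      unfolding G_def using jk by (intro face_prime_mono) auto
    let ?v = "h (?n - k)"
    have lt: "?n - k < ?n - j" using jk by linarith
    have "?v \<in> G j" using lt by (auto simp: G_def)
    moreover have "?v \<notin> G k"
    proof
      assume "?v \<in> G k"
      then obtain i where i: "i < ?n - k" "h i = ?v" by (auto simp: G_def)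
      have "?n - k < ?n" using lt by linarith
      then show False using h i unfolding bij_betw_def inj_on_def by (metis atLeastLessThan_iff less_le_trans nat_less_le zero_le diff_le_self)
    qed
    moreover have "?v \<in> V" using calculation(1) GF F(2) by blast
    ultimately have v: "mvar ?v \<in> (face_prime V (G k) :: ('v, 'k) mpoly set)" "mvar ?v \<notin> (face_prime V (G j) :: ('v, 'k) mpoly set)"
      "mvar ?v \<in> (kpoly V :: ('v, 'k) mpoly set)"
      by (auto simp: face_prime_iff mvar_def kpoly_def)
    have "cs (mvar ?v) \<in> img (face_prime V (G k))" "cs (mvar ?v) \<notin> img (face_prime V (G j))"
      using img_iff[OF face_prime_ideal IG v(3)] v by blast+
    then show ?thesis using sub by blast
  qed
  have G_last: "G ?n = {}" by (simp add: G_def)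
  have len: "length Ps = Suc ?n" by (simp add: Ps_def)
  have "Ps \<noteq> []" using len by auto
  moreover have "\<forall>P\<in>set Ps. primeideal P Q"
    using img_face_prime[OF Q finite_subset[OF GF F(1)] _ IG] GF F(2) by (auto simp: Ps_def)
  moreover have "sorted_wrt (\<subset>) Ps"
    unfolding sorted_wrt_iff_nth_less len
  proof (intro allI impI)
    fix j k assume jk: "j < k" "k < Suc ?n"
    then show "Ps ! j \<subset> Ps ! k" using strict[of j k] by (simp add: Ps_def del: upt_Suc)
  qed
  moreover have "last Ps = img (face_prime V {})"
    using G_last by (simp add: Ps_def last_map)
  ultimately have "Ps \<in> {Ps. Ps \<noteq> [] \<and> (\<forall>Q'\<in>set Ps. primeideal Q' Q) \<and> sorted_wrt (\<subset>) Ps \<and> last Ps = img (face_prime V {})}"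
    by blast
  then have "enat (length Ps - 1) \<le> prime_codim Q (img (face_prime V {}))"
    unfolding prime_codim_def by (rule SUP_upper)
  then show ?thesis using len by simp
qed

text \<open>The ideals generated by initial parts of the sequence are pulled back to the polynomial
  ring, which gives the data in the shape that \<open>koszul_acyclic\<close> takes.\<close>

lemma regular_sequence_lift:
  assumes Q: "cring Q" and rs: "regular_sequence Q xs" and xs: "set xs \<subseteq> img (face_prime V {})"
  obtains f J where "\<And>i. i \<le> length xs \<Longrightarrow> ideal (J i) (mpoly_ring V)" "J 0 = I"
    "\<And>i. i < length xs \<Longrightarrow> f i \<in> face_prime V {}" "\<And>i. i < length xs \<Longrightarrow> f i \<in> J (Suc i)"
    "\<And>i. i < length xs \<Longrightarrow> J i \<subseteq> J (Suc i)"
    "\<And>i x. i < length xs \<Longrightarrow> x \<in> J (Suc i) \<Longrightarrow> \<exists>v\<in>kpoly V. x - f i * v \<in> J i"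
    "\<And>i b. i < length xs \<Longrightarrow> b \<in> kpoly V \<Longrightarrow> f i * b \<in> J i \<Longrightarrow> b \<in> J i"
proof -
  interpret Q: cring Q by (rule Q)
  have "\<exists>g. i < length xs \<longrightarrow> g \<in> face_prime V {} \<and> xs ! i = cs g" for i
    using xs nth_mem[of i xs] by blast
  then obtain f where f: "\<And>i. i < length xs \<Longrightarrow> f i \<in> face_prime V {} \<and> xs ! i = cs (f i)" by metis
  have fk: "f i \<in> kpoly V" if "i < length xs" for i using f[OF that] by (auto simp: face_prime_iff)
  have car: "set ys \<subseteq> carrier Q" if "set ys \<subseteq> set xs" for ys
    using rs that unfolding regular_sequence_def by blast
  let ?A = "\<lambda>i. Idl\<^bsub>Q\<^esub> (set (take i xs))"
  have tk: "set (take i xs) \<subseteq> carrier Q" for i by (rule car) (rule set_take_subset)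
  have A: "ideal (?A i) Q" for i by (rule Q.genideal_ideal[OF tk])
  define J where "J i = {g \<in> kpoly V. cs g \<in> ?A i}" for i
  have J: "ideal (J i) (mpoly_ring V)" "I \<subseteq> J i" for i
    unfolding J_def by (rule preimage_ideal[OF A])+
  show ?thesis
  proof (rule that[of J f])
    show "ideal (J i) (mpoly_ring V)" for i by (rule J)
    have "?A 0 \<subseteq> {\<zero>\<^bsub>Q\<^esub>}" by (rule Q.genideal_minimal[OF Q.zeroideal]) simp
    then have "J 0 \<subseteq> I" unfolding J_def Q_zero using cs_I by auto
    then show "J 0 = I" using J(2) by blast
    fix i assume i: "i < length xs"
    show "f i \<in> face_prime V {}" using f[OF i] by blast
    have st: "set (take (Suc i) xs) = insert (cs (f i)) (set (take i xs))"
      using f[OF i] i by (simp add: take_Suc_conv_app_nth)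
    have sub: "set (take (Suc i) xs) \<subseteq> ?A (Suc i)" by (rule Q.genideal_self[OF tk])
    show "f i \<in> J (Suc i)" unfolding J_def using fk[OF i] sub st by blast
    have "?A i \<subseteq> ?A (Suc i)" by (rule Q.genideal_minimal[OF A]) (use sub st in blast)
    then show "J i \<subseteq> J (Suc i)" unfolding J_def by blast
    show "b \<in> J i" if b: "b \<in> kpoly V" "f i * b \<in> J i" for b
    proof -
      have fc: "cs (f i) \<in> carrier Q" "cs b \<in> carrier Q" unfolding carrier_Q using fk[OF i] b(1) by blast+
      have "nonzerodivisor (Q Quot ?A i) (?A i +>\<^bsub>Q\<^esub> cs (f i))"
        using rs i f[OF i] unfolding regular_sequence_def by auto
      then have nz: "\<forall>b\<in>carrier Q. cs (f i) \<otimes>\<^bsub>Q\<^esub> b \<in> ?A i \<longrightarrow> b \<in> ?A i"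
        using nonzerodivisor_quot_iff[OF A fc(1)] by blast
      have "cs (f i) \<otimes>\<^bsub>Q\<^esub> cs b \<in> ?A i" using b Q_mult[OF fk[OF i] b(1)] by (simp add: J_def)
      then have "cs b \<in> ?A i" using nz fc(2) by blast
      then show "b \<in> J i" using b(1) by (simp add: J_def)
    qed
    show "\<exists>v\<in>kpoly V. x - f i * v \<in> J i" if x: "x \<in> J (Suc i)" for x
    proof -
      \<comment> \<open>This is \<open>J i\<close> enlarged by the multiples of \<open>f i\<close>.
        Being an ideal whose image contains the first \<open>i + 1\<close> members of the sequence,
        it contains \<open>J (Suc i)\<close>.\<close>
      let ?S = "{g \<in> kpoly V. \<exists>v\<in>kpoly V. g - f i * v \<in> J i}"
      note D = ideal_mpolyD[OF J(1)[of i]]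
      have S: "ideal ?S (mpoly_ring V)"
      proof (rule ideal_mpolyI)
        show "0 \<in> ?S" using D(2) by (auto intro!: bexI[of _ 0])
        fix g1 g2 assume g1: "g1 \<in> ?S"
        then obtain v1 where v1: "g1 \<in> kpoly V" "v1 \<in> kpoly V" "g1 - f i * v1 \<in> J i" by blast
        show "g1 + g2 \<in> ?S" if "g2 \<in> ?S"
        proof -
          obtain v2 where v2: "g2 \<in> kpoly V" "v2 \<in> kpoly V" "g2 - f i * v2 \<in> J i" using \<open>g2 \<in> ?S\<close> by blast
          have "(g1 + g2) - f i * (v1 + v2) = (g1 - f i * v1) + (g2 - f i * v2)" by (simp add: algebra_simps)
          then have "(g1 + g2) - f i * (v1 + v2) \<in> J i" using D(3)[OF v1(3) v2(3)] by (simp only:)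
          moreover have "v1 + v2 \<in> kpoly V" using v1 v2 by simp
          ultimately show ?thesis using v1(1) v2(1) by (intro CollectI conjI bexI[of _ "v1 + v2"]) simp_all
        qed
        show "g2 * g1 \<in> ?S" if g2: "g2 \<in> kpoly V"
        proof -
          have "g2 * g1 - f i * (g2 * v1) = g2 * (g1 - f i * v1)" by (simp add: algebra_simps)
          then have "g2 * g1 - f i * (g2 * v1) \<in> J i" using D(4)[OF v1(3) g2] by (simp only:)
          moreover have "g2 * v1 \<in> kpoly V" "g2 * g1 \<in> kpoly V" using v1 g2 by simp_all
          ultimately show ?thesis by (intro CollectI conjI bexI[of _ "g2 * v1"])
        qed
      qed blast
      have JS: "J i \<subseteq> ?S"
      proof
        fix g assume "g \<in> J i"
        then show "g \<in> ?S" using D(1) by (auto intro!: bexI[of _ 0])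
      qed
      have IS: "I \<subseteq> ?S" using JS J(2) by blast
      have "set (take (Suc i) xs) \<subseteq> img ?S"
      proof
        fix y assume y: "y \<in> set (take (Suc i) xs)"
        then consider "y = cs (f i)" | "y \<in> set (take i xs)" using st by blast
        then show "y \<in> img ?S"
        proof cases
          case 1
          have "f i - f i * 1 \<in> J i" using D(2) by simp
          moreover have "(1 :: ('v, 'k) mpoly) \<in> kpoly V" by simp
          ultimately have "f i \<in> ?S" using fk[OF i] by blast
          then show ?thesis using 1 by blast
        next
          case 2
          then have "y \<in> ?A i" using Q.genideal_self[OF tk[of i]] by blast
          moreover obtain g where g: "g \<in> kpoly V" "y = cs g" using 2 tk[of i] unfolding carrier_Q by blast
          ultimately have "g \<in> J i" by (simp add: J_def)
          then show ?thesis using JS g(2) by blast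
        qed
      qed
      then have "?A (Suc i) \<subseteq> img ?S" by (rule Q.genideal_minimal[OF img_ideal[OF S]])
      then have "cs x \<in> img ?S" "x \<in> kpoly V" using x by (auto simp: J_def)
      then have "x \<in> ?S" using img_iff[OF S IS] by blast
      then show ?thesis by blast
    qed
  qed
qed

text \<open>At the irrelevant maximal ideal depth equals codimension, which is at least
  \<open>card F\<close> by the chain of face primes.\<close>

theorem cohen_macaulay_regular_sequence:
  assumes cm: "cohen_macaulay_ring Q" and F: "finite F" "F \<subseteq> V" "I \<subseteq> face_prime V F" "F \<noteq> {}"
  obtains f J where "\<And>i. i \<le> card F \<Longrightarrow> ideal (J i) (mpoly_ring V)" "J 0 = I"
    "\<And>i. i < card F \<Longrightarrow> f i \<in> face_prime V {}" "\<And>i. i < card F \<Longrightarrow> f i \<in> J (Suc i)"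
    "\<And>i. i < card F \<Longrightarrow> J i \<subseteq> J (Suc i)"
    "\<And>i x. i < card F \<Longrightarrow> x \<in> J (Suc i) \<Longrightarrow> \<exists>v\<in>kpoly V. x - f i * v \<in> J i"
    "\<And>i b. i < card F \<Longrightarrow> b \<in> kpoly V \<Longrightarrow> f i * b \<in> J i \<Longrightarrow> b \<in> J i"
proof -
  have Q: "cring Q" using cm by (simp add: cohen_macaulay_ring_def)
  have "face_prime V F \<subseteq> (face_prime V {} :: ('v, 'k) mpoly set)" by (rule face_prime_mono) simp
  then have I0: "I \<subseteq> face_prime V {}" using F(3) by blast
  let ?M = "img (face_prime V {})"
  have "ideal_depth Q ?M = prime_codim Q ?M"
    using cm img_irrelevant_maximal[OF Q I0] unfolding cohen_macaulay_ring_def by blast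
  then have dep: "enat (card F) \<le> ideal_depth Q ?M" using codim_irrelevant[OF Q F(1-3)] by simp
  have pos: "0 < card F" using F by (simp add: card_gt_0_iff)
  \<comment> \<open>The depth is a supremum. A strict inequality is needed to extract a member, and
    exceeding \<open>card F - 1\<close> means having length at least \<open>card F\<close>.\<close>
  then have "enat (card F - 1) < enat (card F)" by simp
  then have "enat (card F - 1) < ideal_depth Q ?M" using dep by (rule less_le_trans)
  then obtain xs where xs: "regular_sequence Q xs" "set xs \<subseteq> ?M" "enat (card F - 1) < enat (length xs)"
    unfolding ideal_depth_def less_SUP_iff by blast
  then have len: "card F \<le> length xs" using pos by simp
  show ?thesis
  proof (rule regular_sequence_lift[OF Q xs(1,2)])
    fix f J assume fJ: "\<And>i. i \<le> length xs \<Longrightarrow> ideal (J i) (mpoly_ring V)" "J 0 = I"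
    "\<And>i. i < length xs \<Longrightarrow> f i \<in> face_prime V {}" "\<And>i. i < length xs \<Longrightarrow> f i \<in> J (Suc i)"
    "\<And>i. i < length xs \<Longrightarrow> J i \<subseteq> J (Suc i)"
    "\<And>i x. i < length xs \<Longrightarrow> x \<in> J (Suc i) \<Longrightarrow> \<exists>v\<in>kpoly V. x - f i * v \<in> J i"
    "\<And>i b. i < length xs \<Longrightarrow> b \<in> kpoly V \<Longrightarrow> f i * b \<in> J i \<Longrightarrow> b \<in> J i"
    show thesis by (rule that[of J f]) (use fJ len in \<open>simp_all\<close>)
  qed
qed

end

section \<open>The differences of variables as a regular sequence\<close>

lemma is_ideal_kpoly:
  fixes J :: "('v, 'k::field) mpoly set" and \<theta> :: "nat \<Rightarrow> ('v, 'k) mpoly"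
  assumes "koszul (kpoly V) \<theta> d"
  shows "koszul.is_ideal (kpoly V) J \<longleftrightarrow> ideal J (mpoly_ring V)"
proof -
  interpret koszul "kpoly V" \<theta> d by fact
  show ?thesis
  proof
    assume "is_ideal J" then show "ideal J (mpoly_ring V)"
      unfolding is_ideal_def by (intro ideal_mpolyI) auto
  next
    assume "ideal J (mpoly_ring V)"
    note D = ideal_mpolyD[OF this]
    show "is_ideal J" unfolding is_ideal_def using D(1,2,3,4) by blast
  qed
qed

lemma supp_minus: "supp (m - n) \<subseteq> supp (m :: 'v \<Rightarrow>\<^sub>0 nat)"
  by (auto simp: in_keys_iff lookup_minus)

lemma map_monom_surj_lift:
  assumes fin: "finite V" and "supp n \<subseteq> q ` V" shows "\<exists>m. supp m \<subseteq> V \<and> map_monom q m = n"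
proof -
  have "\<forall>w\<in>supp n. \<exists>v. v \<in> V \<and> q v = w" using assms by blast
  then obtain s where s: "\<And>w. w \<in> supp n \<Longrightarrow> s w \<in> V \<and> q (s w) = w" by metis
  have "supp (map_monom s n) \<subseteq> V" using s by (auto simp: supp_map_monom)
  moreover have "map_monom q (map_monom s n) = n"
    unfolding map_monom_comp by (rule map_monom_id) (simp add: s)
  ultimately show ?thesis by blast
qed

text \<open>\<open>rep\<close> retracts \<open>V\<close> onto one representative of each fiber, and
  \<open>vs\<close> lists the other variables in the order in which they are identified with their
  representatives. Fibers being nonfaces makes the last quotient finite-dimensional.\<close>

locale separated_variables =
  fixes V :: "'v set" and X :: "'v set set" and rep :: "'v \<Rightarrow> 'v" and vs :: "nat \<Rightarrow> 'v" and d :: nat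
  assumes finV: "finite V" and down: "\<And>F G. F \<in> X \<Longrightarrow> G \<subseteq> F \<Longrightarrow> G \<in> X"
    and vs_inj: "inj_on vs {..<d}" and vs_V: "vs ` {..<d} \<subseteq> V"
    and rep_V: "\<And>v. v \<in> V \<Longrightarrow> rep v \<in> V - vs ` {..<d}" and rep_id: "\<And>v. v \<in> V - vs ` {..<d} \<Longrightarrow> rep v = v"
    and fiber: "\<And>r. r \<in> V - vs ` {..<d} \<Longrightarrow> {v\<in>V. rep v = r} \<notin> X"
begin

definition U :: "('v \<Rightarrow>\<^sub>0 nat) set" where
  "U = {m. supp m \<subseteq> V \<and> supp m \<notin> X}"

definition glue :: "nat \<Rightarrow> 'v \<Rightarrow> 'v" where
  "glue j v = (if v \<in> vs ` {..<j} then rep v else v)"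

definition vars :: "nat \<Rightarrow> 'v set" where
  "vars j = V - vs ` {..<j}"

definition form :: "nat \<Rightarrow> ('v, 'k::field) mpoly" where
  "form l = mvar (vs l) - mvar (rep (vs l))"

text \<open>The monomials of the ideal after \<open>j\<close> identifications. The ideal remains
  spanned by monomials, because identifying variables sends monomials to monomials.\<close>

definition nonstd :: "nat \<Rightarrow> ('v \<Rightarrow>\<^sub>0 nat) set" where
  "nonstd j = map_monom (glue j) ` U"

lemma U_up: "up_closed V U"
  using down by (auto simp: up_closed_def U_def supp_add)

lemma U_ideal: "ideal (mon_ideal V U) (mpoly_ring V)" by (rule mon_ideal_ideal[OF U_up])

lemma vsV: "l < d \<Longrightarrow> vs l \<in> V" using vs_V by auto

lemma form_kpoly: "l < d \<Longrightarrow> form l \<in> kpoly V"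
  unfolding form_def using vsV[of l] rep_V[of "vs l"] by (intro kpoly_closed(4) kpoly_mvar) auto

lemma form_homog: "homog 1 (form l)"
proof -
  have "homog 1 (mvar v :: ('v, 'k::field) mpoly)" for v by (auto simp: homog_def mvar_def)
  then show ?thesis unfolding form_def by (intro homog_diff)
qed

lemma glue_vars: "j \<le> d \<Longrightarrow> v \<in> V \<Longrightarrow> glue j v \<in> vars j"
proof -
  assume j: "j \<le> d" and v: "v \<in> V"
  have "vs ` {..<j} \<subseteq> vs ` {..<d}" using j by auto
  then show ?thesis using rep_V[OF v] v by (auto simp: glue_def vars_def)
qed

lemma glue_id: "v \<in> vars j \<Longrightarrow> glue j v = v" by (simp add: glue_def vars_def)

lemma nonstd_supp: "j \<le> d \<Longrightarrow> n \<in> nonstd j \<Longrightarrow> supp n \<subseteq> vars j"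
proof -
  assume j: "j \<le> d" and "n \<in> nonstd j"
  then obtain m where m: "supp m \<subseteq> V" "n = map_monom (glue j) m" by (auto simp: nonstd_def U_def)
  then show "supp n \<subseteq> vars j" using glue_vars[OF j] unfolding m(2) supp_map_monom by blast
qed

lemma vars_sub: "vars j \<subseteq> V" by (auto simp: vars_def)

lemma map_glue_id: "supp n \<subseteq> vars j \<Longrightarrow> map_monom (glue j) n = n"
  by (rule map_monom_id) (use glue_id in blast)

lemma nonstd_up: assumes "j \<le> d" shows "up_closed (vars j) (nonstd j)"
  unfolding up_closed_def
proof (intro ballI conjI allI impI)
  fix n assume n: "n \<in> nonstd j"
  show "supp n \<subseteq> vars j" by (rule nonstd_supp[OF assms n])
  fix c :: "'v \<Rightarrow>\<^sub>0 nat" assume c: "supp c \<subseteq> vars j"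
  obtain m where m: "m \<in> U" "n = map_monom (glue j) m" using n by (auto simp: nonstd_def)
  have "m + c \<in> U" using U_up m(1) c vars_sub[of j] by (auto simp: up_closed_def)
  moreover have "n + c = map_monom (glue j) (m + c)" using m(2) map_glue_id[OF c] by (simp add: map_monom_add)
  ultimately show "n + c \<in> nonstd j" by (auto simp: nonstd_def)
qed

text \<open>Modulo the first \<open>j\<close> differences the glued variables coincide with their
  representatives; this passes to products factor by factor.\<close>

lemma congruence:
  assumes j: "j \<le> d" and J: "ideal J (mpoly_ring V)" and m: "supp m \<subseteq> V"
  shows "monom_of m - monom_of (map_monom (glue j) m) \<in> (plus_forms V J form j :: ('v, 'k::field) mpoly set)"
  using m
proof (induction m rule: monomial_induct)
  case zero
  have "(0 :: ('v, 'k) mpoly) \<in> plus_forms V J form j"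
    by (rule ideal_mpolyD(2)[OF plus_forms_ideal(1)[OF J form_kpoly]]) (use j in simp)
  then show ?case by simp
next
  case (add m v)
  let ?P = "plus_forms V J form j :: ('v, 'k) mpoly set"
  note P = plus_forms_ideal[OF J form_kpoly, of j]
  have P1: "ideal ?P (mpoly_ring V)" by (rule P(1)) (use j in simp)
  note D = ideal_mpolyD[OF P1]
  have mv: "supp m \<subseteq> V" "v \<in> V" using add.prems by (auto simp: supp_add)
  have gv: "glue j v \<in> V" using glue_vars[OF j mv(2)] vars_sub by blast
  have gm: "supp (map_monom (glue j) m) \<subseteq> V" using mv(1) glue_vars[OF j] vars_sub by (auto simp: supp_map_monom)
  have "mvar v - mvar (glue j v) \<in> ?P"
  proof (cases "v \<in> vs ` {..<j}")
    case True
    then obtain l where l: "l < j" "v = vs l" by auto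
    then have eq: "mvar v - mvar (glue j v) = (form l :: ('v, 'k) mpoly)" by (auto simp: form_def glue_def)
    have "(\<Sum>i<j. form i * (if i = l then 1 else 0)) = (\<Sum>i<j. if i = l then form l else (0 :: ('v, 'k) mpoly))"
      by (rule sum.cong) auto
    also have "\<dots> = form l" using l by simp
    finally have "form l - (\<Sum>i<j. form i * (if i = l then 1 else 0)) = (0 :: ('v, 'k) mpoly)" by simp
    then have "form l - (\<Sum>i<j. form i * (if i = l then 1 else 0)) \<in> J" using ideal_mpolyD(2)[OF J] by (simp only:)
    then show ?thesis unfolding eq plus_forms_def using form_kpoly[of l] l j
      by (intro CollectI conjI exI[of _ "\<lambda>i. if i = l then 1 else 0"]) auto
  next
    case False
    then show ?thesis using D(2) by (simp add: glue_def)
  qed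
  then have "monom_of (map_monom (glue j) m) * (mvar v - mvar (glue j v)) \<in> ?P"
    by (rule D(4)) (use gm in \<open>simp add: monom_of_def\<close>)
  moreover have "mvar v * (monom_of m - monom_of (map_monom (glue j) m)) \<in> ?P"
    by (rule D(4)[OF add.IH[OF mv(1)]]) (use mv in simp)
  moreover have "monom_of (m + mono_term v 1) - monom_of (map_monom (glue j) (m + mono_term v 1)) =
    mvar v * (monom_of m - monom_of (map_monom (glue j) m)) + monom_of (map_monom (glue j) m) * (mvar v - mvar (glue j v) :: ('v, 'k) mpoly)"
    by (simp add: monom_of_def mvar_def map_monom_add right_diff_distrib mult_single add.commute)
  ultimately show ?case using D(3) by (metis (no_types, lifting))
qed

text \<open>Pigeonhole: \<open>card V\<close> is the sum of the sizes of the fibers, so some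
  representative \<open>r\<close> occurs with exponent at least the size of its fiber. That fiber is
  a nonface, so the corresponding power of \<open>r\<close> is the image of a monomial in
  \<open>U\<close>.\<close>

lemma large_degree_nonstd:
  assumes m: "supp m \<subseteq> V" and deg: "card V \<le> mdeg m" and V: "V \<noteq> {}"
  shows "map_monom (glue d) m \<in> nonstd d"
proof -
  let ?n = "map_monom (glue d) m" and ?R = "vars d"
  have nR: "supp ?n \<subseteq> ?R" using m glue_vars[of d] by (auto simp: supp_map_monom)
  have fR: "finite ?R" using finite_subset[OF vars_sub finV] .
  obtain v0 where "v0 \<in> V" using V by blast
  then have neR: "?R \<noteq> {}" using glue_vars[of d v0] by auto
  let ?f = "\<lambda>r. {v\<in>V. rep v = r}"
  have "V = (\<Union>r\<in>?R. ?f r)" using rep_V by (auto simp: vars_def)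
  then have "card V = card (\<Union>r\<in>?R. ?f r)" by simp
  also have "\<dots> = (\<Sum>r\<in>?R. card (?f r))" by (rule card_UN_disjoint) (use fR finV in auto)
  finally have "(\<Sum>r\<in>?R. card (?f r)) \<le> (\<Sum>r\<in>?R. coef ?n r)"
    using deg mdeg_superset[OF fR nR] by simp
  then have "\<exists>r\<in>?R. card (?f r) \<le> coef ?n r"
    using sum_strict_mono[OF fR neR, of "coef ?n" "\<lambda>r. card (?f r)"] by (meson leD leI)
  then obtain r where r: "r \<in> ?R" "card (?f r) \<le> coef ?n r" by blast
  have ff: "finite (?f r)" using finV by simp
  let ?e = "\<Sum>v\<in>?f r. mono_term v (1::nat)"
  have map_e: "map_monom (glue d) ?e = mono_term r (card (?f r))"
  proof -
    have "map_monom (glue d) (\<Sum>v\<in>S. mono_term v (1::nat)) = mono_term r (card S)" if "S \<subseteq> ?f r" for S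
    proof -
      have "finite S" using that ff finite_subset by blast
      then show ?thesis using that
      proof (induction S rule: finite_induct)
        case (insert v S)
        have "glue d v = r" using insert.prems r(1) rep_id[of v] by (auto simp: glue_def vars_def)
        then show ?case using insert by (simp add: map_monom_add single_add[symmetric] add.commute)
      qed simp
    qed
    then show ?thesis by simp
  qed
  \<comment> \<open>A preimage of the glued monomial that lies in \<open>U\<close>: part of the
    power of \<open>r\<close> is spread over the whole fiber.\<close>
  let ?m = "?e + (?n - mono_term r (card (?f r)))"
  have "map_monom (glue d) (?n - mono_term r (card (?f r))) = ?n - mono_term r (card (?f r))"
  proof (rule map_glue_id)
    show "supp (?n - mono_term r (card (?f r))) \<subseteq> vars d" using nR supp_minus[of ?n "mono_term r (card (?f r))"] by blast
  qed
  then have "map_monom (glue d) ?m = mono_term r (card (?f r)) + (?n - mono_term r (card (?f r)))"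
    using map_e by (simp add: map_monom_add)
  also have "\<dots> = ?n"
    by (rule poly_mapping_eqI) (use r(2) in \<open>auto simp: lookup_add lookup_minus lookup_single when_def\<close>)
  finally have eq: "map_monom (glue d) ?m = ?n" .
  have mem: "?m \<in> U"
  proof -
    have s: "supp ?m = ?f r \<union> supp (?n - mono_term r (card (?f r)))"
      unfolding supp_add supp_indicator[OF ff] ..
    have "supp (?n - mono_term r (card (?f r))) \<subseteq> V"
      using nR vars_sub[of d] supp_minus[of ?n "mono_term r (card (?f r))"] by blast
    moreover have "?f r \<notin> X" by (rule fiber) (use r in \<open>simp add: vars_def\<close>)
    then have "supp ?m \<notin> X" using down[of "supp ?m" "?f r"] s by blast
    ultimately have "supp ?m \<subseteq> V" "supp ?m \<notin> X" using s by blast+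
    then show ?thesis unfolding U_def by blast
  qed
  show ?thesis unfolding nonstd_def by (subst eq[symmetric], rule imageI, rule mem)
qed

text \<open>Without constant term, \<open>f\<close> has a \<open>card V\<close>-th power all of
  whose monomials have degree at least \<open>card V\<close>. By \<open>large_degree_nonstd\<close>
  each of them agrees with a monomial of \<open>U\<close> modulo the differences.\<close>

lemma power_in_forms:
  assumes f: "f \<in> face_prime V {}" and V: "V \<noteq> {}"
  shows "f ^ card V \<in> (plus_forms V (mon_ideal V U) form d :: ('v, 'k::field) mpoly set)"
proof -
  let ?P = "plus_forms V (mon_ideal V U) form d :: ('v, 'k) mpoly set"
  have P: "ideal ?P (mpoly_ring V)" "mon_ideal V U \<subseteq> ?P"
    by (rule plus_forms_ideal[OF U_ideal form_kpoly]; simp)+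
  have fk: "f \<in> kpoly V" "\<And>m. m \<in> supp f \<Longrightarrow> 1 \<le> mdeg m"
  proof -
    show "f \<in> kpoly V" using f by (simp add: face_prime_iff)
    fix m assume "m \<in> supp f"
    then have "supp m \<noteq> {}" using f by (auto simp: face_prime_iff)
    then have "m \<noteq> 0" by auto
    then show "1 \<le> mdeg m" using mdeg_eq_0[of m] by linarith
  qed
  have deg: "\<forall>m\<in>supp (f ^ e). e \<le> mdeg m" for e
  proof (induction e)
    case (Suc e)
    show ?case
    proof
      fix m assume "m \<in> supp (f ^ Suc e)"
      then obtain a b where "a \<in> supp f" "b \<in> supp (f ^ e)" "m = a + b" using keys_mult[of f "f ^ e"] by auto
      then show "Suc e \<le> mdeg m" using fk(2)[of a] Suc by (auto simp: mdeg_add)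
    qed
  qed simp
  have "mon_ideal V {m. supp m \<subseteq> V \<and> card V \<le> mdeg m} \<subseteq> ?P"
  proof (rule mon_ideal_least[OF P(1)])
    fix m :: "'v \<Rightarrow>\<^sub>0 nat" assume m: "m \<in> {m. supp m \<subseteq> V \<and> card V \<le> mdeg m}"
    then obtain m' where m': "m' \<in> U" "map_monom (glue d) m = map_monom (glue d) m'"
      using large_degree_nonstd V by (auto simp: nonstd_def)
    have mV: "supp m \<subseteq> V" "supp m' \<subseteq> V" using m m' by (auto simp: U_def)
    have "monom_of m' \<in> ?P" using P(2) m'(1) mV by (auto simp: mon_ideal_def monom_of_def)
    moreover have "monom_of m - monom_of (map_monom (glue d) m) \<in> ?P" "monom_of m' - monom_of (map_monom (glue d) m) \<in> ?P"
      using congruence[OF order_refl U_ideal mV(1)] congruence[OF order_refl U_ideal mV(2)] m'(2) by simp_all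
    ultimately have "(monom_of m - monom_of (map_monom (glue d) m)) - (monom_of m' - monom_of (map_monom (glue d) m)) + monom_of m' \<in> ?P"
      using ideal_mpolyD(3,7)[OF P(1)] by blast
    then show "monom_of m \<in> ?P" by simp
  qed
  moreover have "f ^ card V \<in> mon_ideal V {m. supp m \<subseteq> V \<and> card V \<le> mdeg m}"
    using deg[of "card V"] kpoly_power[OF fk(1), of "card V"] by (auto simp: mon_ideal_def kpoly_def)
  ultimately show ?thesis by blast
qed

text \<open>The facet \<open>F\<close> supplies a regular sequence of length \<open>d\<close> in the
  irrelevant ideal. Its members have powers in the ideal of the differences, so the Koszul homology
  of the differences vanishes in degree one.\<close>

theorem linear_forms_of_cohen_macaulay:
  assumes cm: "cohen_macaulay_ring (mpoly_ring V Quot (mon_ideal V U :: ('v, 'k::field) mpoly set))"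
    and F: "F \<in> X" "F \<subseteq> V" "card F = d" "F \<noteq> {}"
  shows "linear_forms V U (form :: nat \<Rightarrow> ('v, 'k) mpoly) d"
proof -
  let ?I = "mon_ideal V U :: ('v, 'k) mpoly set"
  have IF: "?I \<subseteq> face_prime V F"
  proof -
    have "U \<subseteq> {m. supp m \<subseteq> V \<and> \<not> supp m \<subseteq> F}" using down[OF F(1)] by (auto simp: U_def)
    then show ?thesis unfolding face_prime_def mon_ideal_def by blast
  qed
  have V: "V \<noteq> {}" using F by blast
  have kz: "koszul (kpoly V) (form :: nat \<Rightarrow> ('v, 'k) mpoly) d"
    by unfold_locales (simp_all add: form_kpoly)
  interpret k: koszul "kpoly V" "form :: nat \<Rightarrow> ('v, 'k) mpoly" d by (rule kz)
  interpret q: quotient_poly V ?I by (rule quotient_poly.intro) (rule U_ideal)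
  have ac: "k.acyclic 1 ?I"
  proof (rule q.cohen_macaulay_regular_sequence[OF cm finite_subset[OF F(2) finV] F(2) IF F(4), unfolded F(3)])
    fix f J
    assume fJ: "\<And>i. i \<le> d \<Longrightarrow> ideal (J i) (mpoly_ring V)" "J 0 = ?I"
      "\<And>i. i < d \<Longrightarrow> f i \<in> face_prime V {}" "\<And>i. i < d \<Longrightarrow> f i \<in> J (Suc i)"
      "\<And>i. i < d \<Longrightarrow> J i \<subseteq> J (Suc i)"
      "\<And>i x. i < d \<Longrightarrow> x \<in> J (Suc i) \<Longrightarrow> \<exists>v\<in>kpoly V. x - f i * v \<in> J i"
      "\<And>i b. i < d \<Longrightarrow> b \<in> kpoly V \<Longrightarrow> f i * b \<in> J i \<Longrightarrow> b \<in> J i"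
    have "k.acyclic 1 (J 0)"
    proof (rule k.koszul_acyclic[where f = f])
      show "k.is_ideal (J i)" if "i \<le> d" for i using fJ(1)[OF that] is_ideal_kpoly[OF kz] by blast
      show "f i \<in> kpoly V" if "i < d" for i using fJ(3)[OF that] by (simp add: face_prime_iff)
      show "\<exists>N r. (\<forall>l<d. r l \<in> kpoly V) \<and> f i ^ N - (\<Sum>l<d. r l * form l) \<in> J 0" if "i < d" for i
      proof -
        have "f i ^ card V \<in> plus_forms V ?I form d" by (rule power_in_forms[OF fJ(3)[OF that] V])
        then obtain r where "\<forall>l<d. r l \<in> kpoly V" "f i ^ card V - (\<Sum>l<d. form l * r l) \<in> ?I"
          unfolding plus_forms_def by blast
        then show ?thesis unfolding fJ(2) by (intro exI[of _ "card V"] exI[of _ r]) (simp add: mult.commute)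
      qed
    qed (use fJ(4-7) in auto)
    then show "k.acyclic 1 ?I" using fJ(2) by simp
  qed
  show ?thesis
  proof
    show "up_closed V U" by (rule U_up)
    show "form l \<in> kpoly V" if "l < d" for l by (rule form_kpoly[OF that])
    show "homog 1 (form l)" for l by (rule form_homog)
    fix m :: "nat \<Rightarrow> ('v, 'k) mpoly"
    assume m: "\<And>l. l < d \<Longrightarrow> m l \<in> kpoly V" "(\<Sum>l<d. form l * m l) \<in> ?I"
    have J: "k.is_ideal ?I" using U_ideal is_ideal_kpoly[OF kz] by blast
    show "\<exists>a. (\<forall>l<d. \<forall>j<d. a l j \<in> kpoly V) \<and> (\<forall>l j. a l j = - a j l) \<and> (\<forall>l. a l l = 0) \<and>
        (\<forall>l<d. m l - (\<Sum>j<d. form j * a l j) \<in> ?I)"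
    proof (rule k.acyclic_one[OF J ac m])
      fix a assume a: "\<And>l j. l < d \<Longrightarrow> j < d \<Longrightarrow> a l j \<in> kpoly V" "\<And>l j. a l j = - a j l" "\<And>l. a l l = 0"
        "\<And>l. l < d \<Longrightarrow> m l - (\<Sum>j<d. form j * a l j) \<in> ?I"
      show ?thesis
        by (rule exI[of _ a]) (intro conjI allI impI a; assumption)
    qed
  qed
qed

text \<open>Gluing identifies the quotient of \<open>kpoly V\<close> by the ideal and the first
  \<open>j\<close> differences with the quotient of \<open>kpoly (vars j)\<close> by the glued
  monomial ideal, so regularity is transported to the ideals that occur in a separation.\<close>

theorem stage_nonzerodivisor:
  assumes lf: "linear_forms V U (form :: nat \<Rightarrow> ('v, 'k::field) mpoly) d"
    and j: "j < d" and g: "g \<in> kpoly (vars j)" and prod: "form j * g \<in> (mon_ideal (vars j) (nonstd j) :: ('v, 'k) mpoly set)"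
  shows "g \<in> mon_ideal (vars j) (nonstd j)"
proof -
  interpret linear_forms V U "form :: nat \<Rightarrow> ('v, 'k) mpoly" d "mon_ideal V U" by (rule lf)
  let ?I = "mon_ideal V U :: ('v, 'k) mpoly set"
  let ?P = "plus_forms V ?I form j"
  have P: "ideal ?P (mpoly_ring V)" "?I \<subseteq> ?P"
    by (rule plus_forms_ideal[OF U_ideal form_kpoly]; use j in simp)+
  have jd: "j \<le> d" using j by simp
  have "mon_ideal V (nonstd j) \<subseteq> ?P"
  proof (rule mon_ideal_least[OF P(1)])
    fix n assume "n \<in> nonstd j"
    then obtain m where m: "m \<in> U" "n = map_monom (glue j) m" by (auto simp: nonstd_def)
    then have mV: "supp m \<subseteq> V" by (simp add: U_def)
    have "monom_of m \<in> ?P" using P(2) m(1) mV by (auto simp: mon_ideal_def monom_of_def)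
    then have "monom_of m - (monom_of m - monom_of n) \<in> ?P"
      using congruence[OF jd U_ideal mV] m(2) ideal_mpolyD(7)[OF P(1)] by blast
    then show "monom_of n \<in> ?P" by simp
  qed
  moreover have "form j * g \<in> mon_ideal V (nonstd j)"
    using prod vars_sub[of j] unfolding mon_ideal_def kpoly_def by blast
  ultimately have "form j * g \<in> ?P" by blast
  moreover have gV: "g \<in> kpoly V" using g vars_sub[of j] unfolding kpoly_def by blast
  ultimately have "g \<in> ?P" using linear_form_nonzerodivisor[OF j gV] by simp
  then obtain r where r: "g - (\<Sum>l<j. form l * r l) \<in> ?I" unfolding plus_forms_def by blast
  let ?h = "g - (\<Sum>l<j. form l * r l)"
  have z: "map_vars (glue j) (form l) = (0 :: ('v, 'k) mpoly)" if l: "l < j" for l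
  proof -
    have "rep (vs l) \<in> vars d" using rep_V[OF vsV[of l]] l j by (simp add: vars_def)
    moreover have "vars d \<subseteq> vars j" using j by (auto simp: vars_def)
    ultimately have "glue j (rep (vs l)) = rep (vs l)" using glue_id by blast
    moreover have "glue j (vs l) = rep (vs l)" using l by (simp add: glue_def)
    ultimately show ?thesis by (simp add: form_def map_vars_diff)
  qed
  \<comment> \<open>Gluing annihilates the earlier differences, fixes \<open>g\<close>, and sends
    the monomials of \<open>?h\<close> into \<open>nonstd j\<close>.\<close>
  have "map_vars (glue j) ?h = map_vars (glue j) g"
    using z by (simp add: map_vars_diff map_vars_sum map_vars_mult)
  also have "\<dots> = g" by (rule map_vars_id) (use g map_glue_id in \<open>auto simp: kpoly_def\<close>)
  finally have gh: "g = map_vars (glue j) ?h" ..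
  have "supp g \<subseteq> map_monom (glue j) ` supp ?h" by (subst gh) (rule supp_map_vars)
  also have "\<dots> \<subseteq> nonstd j" using r unfolding nonstd_def mon_ideal_def by blast
  finally show ?thesis using g by (simp add: mon_ideal_def)
qed

end

section \<open>Counting standard monomials\<close>

text \<open>A counting form of the behaviour of Hilbert functions under a linear nonzerodivisor
  \<open>x - y\<close>. The triple \<open>(u, i, k)\<close> stands for the monomial
  \<open>u x^i y^k\<close>, and \<open>P\<close> for membership in the ideal. A standard monomial of
  degree at most \<open>s\<close> is multiplied by \<open>y\<close> as long as the next antidiagonal
  has not met the ideal up to its position, and by \<open>x\<close> afterwards. An antidiagonal that
  avoids the ideal entirely leaves its end \<open>u x^l\<close> free, for the monomial that remains
  standard when \<open>x\<close> and \<open>y\<close> are identified.\<close>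

lemma diagonal_count:
  fixes P :: "'u \<Rightarrow> nat \<Rightarrow> nat \<Rightarrow> bool" and wt :: "'u \<Rightarrow> nat"
  assumes step: "\<And>u p r t. u \<in> E \<Longrightarrow> P u p (Suc (r + t)) \<Longrightarrow> P u (Suc (p + r)) t \<Longrightarrow> P u (p + r) t"
    and fin: "finite {(u, i, k). u \<in> E \<and> wt u + i + k \<le> Suc s \<and> \<not> P u i k}"
  shows "card {(u, i, k). u \<in> E \<and> wt u + i + k \<le> s \<and> \<not> P u i k} +
    card {(u, l). u \<in> E \<and> wt u + l \<le> Suc s \<and> (\<forall>i\<le>l. \<not> P u i (l - i))} \<le>
    card {(u, i, k). u \<in> E \<and> wt u + i + k \<le> Suc s \<and> \<not> P u i k}"
    (is "card ?S + card ?L \<le> card ?T")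
proof -
  define G where "G u i k \<longleftrightarrow> (\<forall>i'\<le>i. \<not> P u i' (Suc (i + k) - i'))" for u i k
  define f where "f = (\<lambda>(u, i, k). if G u i k then (u, i, Suc k) else (u, Suc i, k))"
  define g where "g = (\<lambda>(u :: 'u, l :: nat). (u, l, 0 :: nat))"
  have fT: "f x \<in> ?T" if "x \<in> ?S" for x
  proof -
    obtain u i k where x: "x = (u, i, k)" by (cases x) auto
    have x': "u \<in> E" "wt u + i + k \<le> s" "\<not> P u i k" using that x by auto
    show ?thesis
    proof (cases "G u i k")
      case True
      then have "\<not> P u i (Suc k)" unfolding G_def by (metis Suc_diff_le add_diff_cancel_left' le_add1 order_refl)
      then show ?thesis using x x' True by (simp add: f_def)
    next
      case False
      then obtain i' where i': "i' \<le> i" "P u i' (Suc (i + k) - i')" unfolding G_def by blast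
      then obtain r where r: "i = i' + r" using le_Suc_ex by blast
      have "Suc (i + k) - i' = Suc (r + k)" using r by simp
      \<comment> \<open>Otherwise \<open>step\<close> would put \<open>(i, k)\<close>, which lies
        below the stretch between two members of the ideal, into the ideal as well.\<close>
      then have "\<not> P u (Suc i) k" using step[of u i' r k] i' x' r by auto
      then show ?thesis using x x' False by (simp add: f_def)
    qed
  qed
  have gT: "g x \<in> ?T" if "x \<in> ?L" for x
  proof -
    obtain u l where x: "x = (u, l)" by (cases x) auto
    then have "\<not> P u l (l - l)" using that by blast
    then show ?thesis using that x by (simp add: g_def)
  qed
  have inj_f: "inj_on f ?S"
  proof (rule inj_onI)
    fix x y assume xy: "x \<in> ?S" "y \<in> ?S" "f x = f y"
    obtain u i k where x: "x = (u, i, k)" by (cases x) auto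
    obtain v j l where y: "y = (v, j, l)" by (cases y) auto
    have no: False if "G w (Suc a) b" "\<not> G w a (Suc b)" for w a b
    proof -
      obtain i' where "i' \<le> a" "P w i' (Suc (a + Suc b) - i')" using \<open>\<not> G w a (Suc b)\<close> unfolding G_def by blast
      then show False using \<open>G w (Suc a) b\<close>[unfolded G_def, rule_format, of i'] by simp
    qed
    consider "G u i k" "G v j l" | "G u i k" "\<not> G v j l" | "\<not> G u i k" "G v j l" | "\<not> G u i k" "\<not> G v j l" by blast
    then show "x = y"
    proof cases
      case 2
      then have "u = v" "i = Suc j" "l = Suc k" using xy(3) by (simp_all add: x y f_def)
      then show ?thesis using 2 no by blast
    next
      case 3
      then have "v = u" "j = Suc i" "k = Suc l" using xy(3) by (simp_all add: x y f_def)
      then show ?thesis using 3 no by blast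
    qed (use xy(3) in \<open>simp_all add: x y f_def\<close>)
  qed
  have inj_g: "inj_on g ?L" unfolding g_def by (rule inj_onI) (simp split: prod.splits)
  have disj: "f ` ?S \<inter> g ` ?L = {}"
  proof -
    have False if x: "x \<in> ?S" and y: "y \<in> ?L" and eq: "f x = g y" for x y
    proof -
      obtain u i k where x': "x = (u, i, k)" by (cases x) auto
      obtain v l where y': "y = (v, l)" by (cases y) auto
      have no: "\<not> G u i k" "v = u" "l = Suc i" "k = 0" using eq unfolding x' y' f_def g_def by (simp_all split: if_splits)
      then obtain i' where i': "i' \<le> i" "P u i' (Suc (i + k) - i')" unfolding G_def by blast
      have "\<forall>i'\<le>l. \<not> P v i' (l - i')" using y unfolding y' by blast
      then show False using i' no by (metis add.right_neutral le_SucI)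
    qed
    then show ?thesis by (intro equals0I) (elim IntE imageE, simp only:)
  qed
  have sub: "f ` ?S \<union> g ` ?L \<subseteq> ?T" by (intro Un_least image_subsetI fT gT)
  have "finite (f ` ?S \<union> g ` ?L)" by (rule finite_subset[OF sub fin])
  then have fin': "finite (f ` ?S)" "finite (g ` ?L)" by (rule rev_finite_subset, intro Un_upper1 Un_upper2)+
  have "card ?S + card ?L = card (f ` ?S) + card (g ` ?L)" using card_image[OF inj_f] card_image[OF inj_g] by simp
  also have "\<dots> = card (f ` ?S \<union> g ` ?L)" by (rule card_Un_disjoint[symmetric, OF fin' disj])
  also have "\<dots> \<le> card ?T" by (rule card_mono[OF fin sub])
  finally show ?thesis .
qed

lemma finite_bounded_monomials:
  assumes "finite V" shows "finite {m :: 'v \<Rightarrow>\<^sub>0 nat. supp m \<subseteq> V \<and> mdeg m \<le> s}"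
proof -
  have "inj_on coef {m :: 'v \<Rightarrow>\<^sub>0 nat. supp m \<subseteq> V \<and> mdeg m \<le> s}"
    by (rule inj_onI) (simp add: poly_mapping_eqI)
  moreover have "coef ` {m :: 'v \<Rightarrow>\<^sub>0 nat. supp m \<subseteq> V \<and> mdeg m \<le> s} \<subseteq>
    {h. \<forall>v. (v \<in> V \<longrightarrow> h v \<in> {..s}) \<and> (v \<notin> V \<longrightarrow> h v = 0)}"
    using coef_le_mdeg by (fastforce simp: in_keys_iff intro: order_trans)
  ultimately show ?thesis
    using finite_set_of_finite_funs[OF assms, of "{..s}" 0] by (meson finite_atMost finite_imageD finite_subset)
qed

text \<open>Division by \<open>v\<close> lowers the degree by one and either keeps \<open>v\<close>
  in the support or removes it, which is the recursion of Pascal's triangle.\<close>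

lemma card_monomials_supp:
  assumes "finite F" shows "card {m :: 'v \<Rightarrow>\<^sub>0 nat. supp m = F \<and> mdeg m \<le> s} \<le> s choose card F"
  using assms
proof (induction F arbitrary: s rule: finite_induct)
  case empty
  have "{m :: 'v \<Rightarrow>\<^sub>0 nat. supp m = {} \<and> mdeg m \<le> s} = {0}" by auto
  then show ?case by simp
next
  case (insert v F)
  let ?M = "\<lambda>F s. {m :: 'v \<Rightarrow>\<^sub>0 nat. supp m = F \<and> mdeg m \<le> s}"
  show ?case
  proof (induction s)
    case 0
    have "?M (insert v F) 0 = {}" by (auto simp: mdeg_eq_0)
    then show ?case by (simp only: card.empty zero_le)
  next
    case (Suc s)
    have fin: "finite (?M G s)" if "finite G" for G
      by (rule finite_subset[OF _ finite_bounded_monomials[OF that, of s]]) auto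
    have "?M (insert v F) (Suc s) \<subseteq> (\<lambda>m. m + mono_term v 1) ` (?M F s \<union> ?M (insert v F) s)"
    proof
      fix m assume m: "m \<in> ?M (insert v F) (Suc s)"
      define m' where "m' = m - mono_term v 1"
      have "v \<in> supp m" using m by simp
      then have v: "coef m v \<noteq> 0" by (simp add: in_keys_iff)
      have eq: "m = m' + mono_term v 1"
        by (rule poly_mapping_eqI) (use v in \<open>auto simp: m'_def lookup_add lookup_minus lookup_single when_def\<close>)
      have "mdeg m' \<le> s" using m unfolding eq by (simp add: mdeg_add)
      moreover have "supp m' = F \<or> supp m' = insert v F"
      proof -
        have "insert v (supp m') = insert v F" using m by (simp add: eq supp_add)
        then show ?thesis using insert.hyps(2) by (metis insert_absorb insert_ident)
      qed
      ultimately show "m \<in> (\<lambda>m. m + mono_term v 1) ` (?M F s \<union> ?M (insert v F) s)"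
        using eq by blast
    qed
    then have "card (?M (insert v F) (Suc s)) \<le> card ((\<lambda>m. m + mono_term v 1) ` (?M F s \<union> ?M (insert v F) s))"
      by (rule card_mono[rotated]) (use fin insert.hyps(1) in auto)
    also have "\<dots> \<le> card (?M F s \<union> ?M (insert v F) s)" by (rule card_image_le) (use fin insert.hyps(1) in auto)
    also have "\<dots> \<le> card (?M F s) + card (?M (insert v F) s)" by (rule card_Un_le)
    also have "\<dots> \<le> (s choose card F) + (s choose card (insert v F))" by (intro add_mono insert.IH Suc.IH)
    also have "\<dots> = Suc s choose card (insert v F)" using insert.hyps by simp
    finally show ?case .
  qed
qed

text \<open>Up to the factor \<open>fact d\<close>, the binomial on the left is at least
  \<open>t ^ d\<close> and the one on the right at most \<open>(s + t) ^ d\<close>. After division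
  by \<open>t ^ d\<close> their ratio tends to 1, and the last term, of lower order, tends to
  0.\<close>

lemma leading_coefficient_le:
  assumes d: "0 < d" and le: "\<And>t. N * ((t + d) choose d) \<le> T * ((s + t) choose d) + C * (s + t) ^ (d - 1)"
  shows "N \<le> (T :: nat)"
proof -
  obtain e where e: "d = Suc e" using d gr0_conv_Suc by blast
  have bound: "real N \<le> real T * (real (s + t) / real t) ^ d + fact d * real C * (real (s + t) / real t) ^ e * (1 / real t)" if t: "t > 0" for t
  proof -
    have "t ^ d \<le> fact d * ((t + d) choose d)" for d
    proof (induction d)
      case (Suc d)
      have "t ^ Suc d \<le> (t + Suc d) * (fact d * ((t + d) choose d))"
        unfolding power_Suc by (rule mult_mono[OF _ Suc]) auto
      also have "\<dots> = fact d * (Suc (t + d) * ((t + d) choose d))" by (simp add: algebra_simps)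
      also have "\<dots> = fact d * ((Suc (t + d) choose Suc d) * Suc d)" by (simp only: Suc_times_binomial_eq)
      also have "\<dots> = fact (Suc d) * ((t + Suc d) choose Suc d)" by (simp only: fact_Suc add_Suc_right mult_ac of_nat_id)
      finally show ?case .
    qed simp
    then have "N * t ^ d \<le> fact d * (N * ((t + d) choose d))" by (simp add: mult.left_commute)
    also have "\<dots> \<le> fact d * (T * ((s + t) choose d) + C * (s + t) ^ e)" using le[of t] e by (intro mult_left_mono) auto
    also have "\<dots> = T * (fact d * ((s + t) choose d)) + fact d * C * (s + t) ^ e" by (simp add: algebra_simps)
    also have "\<dots> \<le> T * (s + t) ^ d + fact d * C * (s + t) ^ e"
      using binomial_fact_pow[of "s + t" d] by (intro add_mono mult_left_mono) (simp_all add: mult.commute)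
    finally have "real (N * t ^ d) \<le> real (T * (s + t) ^ d + fact d * C * (s + t) ^ e)" by (simp only: of_nat_le_iff)
    then have "real N * real t ^ d \<le> real T * real (s + t) ^ d + fact d * real C * real (s + t) ^ e" by simp
    then have "real N \<le> (real T * real (s + t) ^ d + fact d * real C * real (s + t) ^ e) / real t ^ d"
      using t by (simp add: pos_le_divide_eq)
    also have "\<dots> = real T * (real (s + t) / real t) ^ d + fact d * real C * (real (s + t) / real t) ^ e * (1 / real t)"
      unfolding e using t by (simp add: field_simps)
    finally show ?thesis .
  qed
  have lim: "(\<lambda>t. real (s + t) / real t) \<longlonglongrightarrow> 1"
  proof -
    have "(\<lambda>t. real s * (1 / real t) + 1) \<longlonglongrightarrow> real s * 0 + 1" by (intro tendsto_intros lim_1_over_n)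
    moreover have "\<forall>\<^sub>F t in sequentially. real s * (1 / real t) + 1 = real (s + t) / real t"
      using eventually_gt_at_top[of 0] by eventually_elim (simp add: field_simps)
    ultimately show ?thesis using tendsto_cong[of "\<lambda>t. real s * (1 / real t) + 1"] by simp
  qed
  have "(\<lambda>t. real T * (real (s + t) / real t) ^ d + fact d * real C * (real (s + t) / real t) ^ e * (1 / real t)) \<longlonglongrightarrow>
    real T * 1 ^ d + fact d * real C * 1 ^ e * 0" by (intro tendsto_intros lim lim_1_over_n)
  then have "real N \<le> real T * 1 ^ d + fact d * real C * 1 ^ e * 0"
    by (rule tendsto_lowerbound) (rule eventually_mono[OF eventually_gt_at_top[of 0]], rule bound, simp_all)
  then show ?thesis by simp
qed

section \<open>Hilbert functions along the identifications\<close>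

definition split_off :: "'v \<Rightarrow> 'v \<Rightarrow> ('v \<Rightarrow>\<^sub>0 nat) \<times> nat \<times> nat \<Rightarrow> ('v \<Rightarrow>\<^sub>0 nat)" where
  "split_off x y = (\<lambda>(u, i, k). u + mono_term x i + mono_term y k)"

lemma split_off_inj:
  assumes "x \<noteq> y" "x \<notin> supp u" "y \<notin> supp u" "x \<notin> supp u'" "y \<notin> supp u'"
    and eq: "u + mono_term x i + mono_term y k = (u' :: 'v \<Rightarrow>\<^sub>0 nat) + mono_term x i' + mono_term y k'"
  shows "u = u' \<and> i = i' \<and> k = k'"
proof -
  have "coef (u + mono_term x i + mono_term y k) x = coef (u' + mono_term x i' + mono_term y k') x"
    "coef (u + mono_term x i + mono_term y k) y = coef (u' + mono_term x i' + mono_term y k') y" using eq by simp_all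
  then have "i = i'" "k = k'" using assms(1-5) by (simp_all add: lookup_add lookup_single in_keys_iff)
  then show ?thesis using eq by (metis add_right_imp_eq)
qed

lemma split_off_exists:
  fixes m :: "'v \<Rightarrow>\<^sub>0 nat"
  assumes "x \<noteq> y"
  obtains u where "m = u + mono_term x (coef m x) + mono_term y (coef m y)" "supp u = supp m - {x, y}"
proof
  let ?u = "m - mono_term x (coef m x) - mono_term y (coef m y)"
  show "m = ?u + mono_term x (coef m x) + mono_term y (coef m y)"
    by (rule poly_mapping_eqI) (use assms in \<open>auto simp: lookup_add lookup_minus lookup_single when_def\<close>)
  show "supp ?u = supp m - {x, y}"
    by (rule Set.set_eqI) (use assms in \<open>simp add: in_keys_iff lookup_minus lookup_single when_def\<close>)
qed

text \<open>\<open>ty\<close> fixes the coefficient field, which the combinatorial parameters do not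
  mention.\<close>

locale regular_separation = separated_variables V X rep vs d
  for V :: "'v set" and X rep vs d +
  fixes ty :: "'k::field itself"
  assumes lf: "linear_forms V U (form :: nat \<Rightarrow> ('v, 'k) mpoly) d"
begin

lemma nonzerodivisor_stage:
  "j < d \<Longrightarrow> g \<in> kpoly (vars j) \<Longrightarrow> form j * g \<in> (mon_ideal (vars j) (nonstd j) :: ('v, 'k) mpoly set) \<Longrightarrow>
    g \<in> mon_ideal (vars j) (nonstd j)"
  by (rule stage_nonzerodivisor[OF lf])

lemma finite_vars: "finite (vars j)"
  using finite_subset[OF vars_sub finV] .

lemma pair_vars:
  assumes j: "j < d"
  shows "vs j \<in> vars j" "rep (vs j) \<in> vars (Suc j)" "vars (Suc j) = vars j - {vs j}" "vs j \<noteq> rep (vs j)"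
proof -
  show 1: "vars (Suc j) = vars j - {vs j}" by (auto simp: vars_def lessThan_Suc)
  have "vs j \<notin> vs ` {..<j}"
  proof
    assume "vs j \<in> vs ` {..<j}"
    then obtain l where "l < j" "vs j = vs l" by auto
    then show False using inj_onD[OF vs_inj, of j l] j by simp
  qed
  then show "vs j \<in> vars j" using vsV[OF j] by (simp add: vars_def)
  have r: "rep (vs j) \<in> vars d" using rep_V[OF vsV[OF j]] by (simp add: vars_def)
  have "vars d \<subseteq> vars (Suc j)" using j by (auto simp: vars_def)
  then show "rep (vs j) \<in> vars (Suc j)" using r by blast
  then show "vs j \<noteq> rep (vs j)" by (metis 1 DiffD2 singletonI)
qed

text \<open>The product of \<open>x - y\<close> with the sum of the monomials
  \<open>u x^(p+k) y^(r+t-k)\<close> over \<open>k \<le> r\<close> telescopes to the difference of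
  the two given monomials. As \<open>x - y\<close> is regular, the sum belongs to the monomial
  ideal, hence so does each of its terms.\<close>

lemma nonstd_diagonal:
  assumes j: "j < d" and u: "supp u \<subseteq> vars j"
    and P: "u + mono_term (vs j) p + mono_term (rep (vs j)) (Suc (r + t)) \<in> nonstd j"
      "u + mono_term (vs j) (Suc (p + r)) + mono_term (rep (vs j)) t \<in> nonstd j"
    and k: "k \<le> r"
  shows "u + mono_term (vs j) (p + k) + mono_term (rep (vs j)) (r + t - k) \<in> nonstd j"
proof -
  let ?x = "vs j" and ?y = "rep (vs j)"
  note pv = pair_vars[OF j]
  have y: "?y \<in> vars j" using pv by blast
  define h where "h k = (mono_term (u + mono_term ?x (p + k) + mono_term ?y (Suc (r + t) - k)) 1 :: ('v, 'k) mpoly)" for k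
  define e where "e k = u + mono_term ?x (p + k) + mono_term ?y (r + t - k)" for k
  let ?g = "\<Sum>k<Suc r. mono_term (e k) 1 :: ('v, 'k) mpoly"
  have "form j * mono_term (e k) 1 = h (Suc k) - h k" if "k < Suc r" for k
  proof -
    have "mono_term ?x 1 + e k = u + mono_term ?x (p + Suc k) + mono_term ?y (Suc (r + t) - Suc k)"
      unfolding e_def by (simp only: add_Suc_right diff_Suc_Suc) (simp only: Suc_eq_plus1 single_add add_ac)
    moreover have "mono_term ?y 1 + e k = u + mono_term ?x (p + k) + mono_term ?y (Suc (r + t) - k)"
    proof -
      have "Suc (r + t) - k = 1 + (r + t - k)" using that by simp
      then show ?thesis unfolding e_def by (simp only: single_add add_ac)
    qed
    ultimately show ?thesis unfolding h_def by (simp add: form_def mvar_def left_diff_distrib mult_single)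
  qed
  then have "form j * ?g = (\<Sum>k<Suc r. h (Suc k) - h k)" unfolding sum_distrib_left by (intro sum.cong) auto
  also have "\<dots> = h (Suc r) - h 0" by (rule sum_lessThan_telescope)
  finally have prod: "form j * ?g = h (Suc r) - h 0" .
  have N: "ideal (mon_ideal (vars j) (nonstd j) :: ('v, 'k) mpoly set) (mpoly_ring (vars j))"
    using j by (intro mon_ideal_ideal nonstd_up) simp
  have "monom_of (u + mono_term ?x (Suc (p + r)) + mono_term ?y t) \<in> (mon_ideal (vars j) (nonstd j) :: ('v, 'k) mpoly set)"
    "monom_of (u + mono_term ?x p + mono_term ?y (Suc (r + t))) \<in> (mon_ideal (vars j) (nonstd j) :: ('v, 'k) mpoly set)"
    unfolding mon_ideal_monom_iff using P nonstd_supp[of j] j by simp_all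
  then have hN: "h (Suc r) \<in> mon_ideal (vars j) (nonstd j)" "h 0 \<in> mon_ideal (vars j) (nonstd j)"
    unfolding h_def monom_of_def by simp_all
  have ek: "supp (e k) \<subseteq> vars j" for k unfolding e_def using u pv(1) y by (auto simp: supp_add split: if_splits)
  have "?g \<in> mon_ideal (vars j) (nonstd j)"
  proof (rule nonzerodivisor_stage[OF j])
    show "?g \<in> kpoly (vars j)" using ek by (intro kpoly_sum kpoly_term)
    show "form j * ?g \<in> mon_ideal (vars j) (nonstd j)" unfolding prod by (rule ideal_mpolyD(7)[OF N hN])
  qed
  \<comment> \<open>The exponents of \<open>vs j\<close> differ, so no two terms of the sum
    cancel.\<close>
  moreover have "e k \<in> supp ?g"
  proof -
    have "l = k" if "e l = e k" for l
    proof -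
      have "coef (e l) ?x = coef (e k) ?x" using that by simp
      then show ?thesis using pv(4) by (simp add: e_def lookup_add lookup_single when_def)
    qed
    then have "(1 when e l = e k) = (if l = k then 1 else 0 :: 'k)" for l by (auto simp: when_def)
    then have "coef ?g (e k) = (\<Sum>l<Suc r. if l = k then 1 else 0 :: 'k)" unfolding lookup_sum lookup_single by (intro sum.cong) auto
    also have "\<dots> = 1" using k by (subst sum.delta) auto
    finally show ?thesis by (simp add: in_keys_iff)
  qed
  ultimately show ?thesis unfolding e_def mon_ideal_def by blast
qed

definition identify :: "nat \<Rightarrow> 'v \<Rightarrow> 'v" where "identify j = id(vs j := rep (vs j))"

lemma nonstd_Suc: assumes j: "j < d" shows "nonstd (Suc j) = map_monom (identify j) ` nonstd j"
proof -
  have g: "glue (Suc j) v = identify j (glue j v)" if v: "v \<in> V" for v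
  proof (cases "v \<in> vs ` {..<j}")
    case True
    have "rep v \<noteq> vs j" using rep_V[OF v] j by auto
    then show ?thesis using True by (auto simp: glue_def identify_def)
  next
    case False
    then show ?thesis by (auto simp: glue_def identify_def lessThan_Suc)
  qed
  have "map_monom (glue (Suc j)) m = map_monom (identify j) (map_monom (glue j) m)" if "m \<in> U" for m
    unfolding map_monom_comp by (rule map_monom_cong) (use that g in \<open>auto simp: U_def\<close>)
  then show ?thesis unfolding nonstd_def image_image by (intro image_cong) auto
qed

lemma merge_split:
  assumes j: "j < d" and u: "vs j \<notin> supp u"
  shows "map_monom (identify j) (u + mono_term (vs j) i + mono_term (rep (vs j)) k) = u + mono_term (rep (vs j)) (i + k)"
proof -
  have "map_monom (identify j) u = u" by (rule map_monom_id) (use u in \<open>auto simp: identify_def\<close>)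
  then show ?thesis using pair_vars(4)[OF j] by (simp add: map_monom_add identify_def single_add add_ac)
qed

text \<open>The monomials that become equal when \<open>vs j\<close> is replaced by its
  representative make up an antidiagonal.\<close>

lemma nonstd_Suc_iff:
  assumes j: "j < d" and u: "vs j \<notin> supp u" "rep (vs j) \<notin> supp u"
  shows "u + mono_term (rep (vs j)) l \<in> nonstd (Suc j) \<longleftrightarrow>
    (\<exists>i\<le>l. u + mono_term (vs j) i + mono_term (rep (vs j)) (l - i) \<in> nonstd j)"
proof
  assume "u + mono_term (rep (vs j)) l \<in> nonstd (Suc j)"
  then obtain m where m: "m \<in> nonstd j" "u + mono_term (rep (vs j)) l = map_monom (identify j) m"
    unfolding nonstd_Suc[OF j] by blast
  obtain v where v: "m = v + mono_term (vs j) (coef m (vs j)) + mono_term (rep (vs j)) (coef m (rep (vs j)))"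
    "supp v = supp m - {vs j, rep (vs j)}" using split_off_exists[OF pair_vars(4)[OF j]] by blast
  have "u + mono_term (vs j) 0 + mono_term (rep (vs j)) l =
    v + mono_term (vs j) 0 + mono_term (rep (vs j)) (coef m (vs j) + coef m (rep (vs j)))"
    using m(2) merge_split[OF j, of v "coef m (vs j)" "coef m (rep (vs j))"] v by simp
  then have "u = v \<and> (0::nat) = 0 \<and> l = coef m (vs j) + coef m (rep (vs j))"
    by (intro split_off_inj[OF pair_vars(4)[OF j] u]) (use v(2) in auto)
  then show "\<exists>i\<le>l. u + mono_term (vs j) i + mono_term (rep (vs j)) (l - i) \<in> nonstd j"
    using m(1) v(1) by (intro exI[of _ "coef m (vs j)"]) auto
next
  assume "\<exists>i\<le>l. u + mono_term (vs j) i + mono_term (rep (vs j)) (l - i) \<in> nonstd j"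
  then obtain i where i: "i \<le> l" "u + mono_term (vs j) i + mono_term (rep (vs j)) (l - i) \<in> nonstd j" by blast
  show "u + mono_term (rep (vs j)) l \<in> nonstd (Suc j)"
    unfolding nonstd_Suc[OF j] using merge_split[OF j u(1), of i "l - i"] i by (intro image_eqI[OF _ i(2)]) simp
qed

text \<open>The count is cumulative in the degree, so that going back from stage
  \<open>j + 1\<close> to stage \<open>j\<close> amounts to summation.\<close>

definition hilbert :: "nat \<Rightarrow> nat \<Rightarrow> nat" where
  "hilbert j s = card {n. (supp n \<subseteq> vars j \<and> mdeg n \<le> s) \<and> n \<notin> nonstd j}"

lemma finite_std: "finite {n. (supp n \<subseteq> vars j \<and> mdeg n \<le> s) \<and> n \<notin> nonstd j}"
  by (rule finite_subset[OF _ finite_bounded_monomials[OF finite_vars, of j s]]) blast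

lemma hilbert_mono: "s \<le> t \<Longrightarrow> hilbert j s \<le> hilbert j t"
  unfolding hilbert_def by (rule card_mono[OF finite_std]) auto

lemma hilbert_step:
  assumes j: "j < d"
  shows "hilbert j s + hilbert (Suc j) (Suc s) \<le> hilbert j (Suc s)"
proof -
  let ?x = "vs j" and ?y = "rep (vs j)"
  note pv = pair_vars[OF j]
  have y: "?y \<in> vars j" using pv by blast
  define E where "E = {u :: 'v \<Rightarrow>\<^sub>0 nat. supp u \<subseteq> vars j - {?x, ?y}}"
  define P where "P u i k \<longleftrightarrow> u + mono_term ?x i + mono_term ?y k \<in> nonstd j" for u i k
  define S where "S s = {(u, i, k). u \<in> E \<and> mdeg u + i + k \<le> s \<and> \<not> P u i k}" for s
  define L where "L = {(u, l). u \<in> E \<and> mdeg u + l \<le> Suc s \<and> (\<forall>i\<le>l. \<not> P u i (l - i))}"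
  have Ed: "supp u \<subseteq> vars j \<and> ?x \<notin> supp u \<and> ?y \<notin> supp u" if "u \<in> E" for u using that by (auto simp: E_def)
  have bij: "bij_betw (split_off ?x ?y) (S s) {n. (supp n \<subseteq> vars j \<and> mdeg n \<le> s) \<and> n \<notin> nonstd j}" for s
  proof (rule bij_betw_imageI)
    show "inj_on (split_off ?x ?y) (S s)"
    proof (rule inj_onI)
      fix a b assume ab: "a \<in> S s" "b \<in> S s" "split_off ?x ?y a = split_off ?x ?y b"
      obtain u i k where a: "a = (u, i, k)" by (cases a) auto
      obtain u' i' k' where b: "b = (u', i', k')" by (cases b) auto
      have "u \<in> E" "u' \<in> E" using ab(1,2) by (simp_all add: a b S_def)
      then have "u = u' \<and> i = i' \<and> k = k'"
        using ab(3) Ed[of u] Ed[of u'] by (intro split_off_inj[OF pv(4)]) (simp_all add: a b split_off_def)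
      then show "a = b" using a b by simp
    qed
    show "split_off ?x ?y ` S s = {n. (supp n \<subseteq> vars j \<and> mdeg n \<le> s) \<and> n \<notin> nonstd j}"
    proof (intro equalityI subsetI)
      fix n assume "n \<in> split_off ?x ?y ` S s"
      then obtain u i k where n: "n = u + mono_term ?x i + mono_term ?y k" "u \<in> E" "mdeg u + i + k \<le> s" "\<not> P u i k"
        unfolding S_def split_off_def by auto
      have "supp n \<subseteq> vars j" unfolding n(1) supp_add using Ed[OF n(2)] pv(1) y by (auto split: if_splits)
      then show "n \<in> {n. (supp n \<subseteq> vars j \<and> mdeg n \<le> s) \<and> n \<notin> nonstd j}"
        using n by (simp add: P_def mdeg_add)
    next
      fix n assume n: "n \<in> {n. (supp n \<subseteq> vars j \<and> mdeg n \<le> s) \<and> n \<notin> nonstd j}"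
      obtain u where u: "n = u + mono_term ?x (coef n ?x) + mono_term ?y (coef n ?y)" "supp u = supp n - {?x, ?y}"
        using split_off_exists[OF pv(4)] by blast
      have "mdeg n = mdeg u + coef n ?x + coef n ?y"
        using arg_cong[OF u(1), of mdeg] by (simp only: mdeg_add mdeg_single)
      then have "(u, coef n ?x, coef n ?y) \<in> S s"
        using n u unfolding S_def E_def P_def by auto
      moreover have "n = split_off ?x ?y (u, coef n ?x, coef n ?y)" using u(1) by (simp add: split_off_def)
      ultimately show "n \<in> split_off ?x ?y ` S s" by (rule rev_image_eqI)
    qed
  qed
  have bij': "bij_betw (\<lambda>(u, l). u + mono_term ?y l) L {n. (supp n \<subseteq> vars (Suc j) \<and> mdeg n \<le> Suc s) \<and> n \<notin> nonstd (Suc j)}"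
  proof (rule bij_betw_imageI)
    show "inj_on (\<lambda>(u, l). u + mono_term ?y l) L"
    proof (rule inj_onI)
      fix a b assume ab: "a \<in> L" "b \<in> L" "(case a of (u, l) \<Rightarrow> u + mono_term ?y l) = (case b of (u, l) \<Rightarrow> u + mono_term ?y l)"
      obtain u i where a: "a = (u, i)" by (cases a) auto
      obtain u' i' where b: "b = (u', i')" by (cases b) auto
      have "u \<in> E" "u' \<in> E" using ab(1,2) by (simp_all add: a b L_def)
      then have "u = u' \<and> (0::nat) = 0 \<and> i = i'"
        using ab(3) Ed[of u] Ed[of u'] by (intro split_off_inj[OF pv(4)]) (simp_all add: a b)
      then show "a = b" using a b by simp
    qed
    show "(\<lambda>(u, l). u + mono_term ?y l) ` L = {n. (supp n \<subseteq> vars (Suc j) \<and> mdeg n \<le> Suc s) \<and> n \<notin> nonstd (Suc j)}"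
    proof (intro equalityI subsetI)
      fix n assume "n \<in> (\<lambda>(u, l). u + mono_term ?y l) ` L"
      then obtain u l where n: "n = u + mono_term ?y l" "u \<in> E" "mdeg u + l \<le> Suc s" "\<forall>i\<le>l. \<not> P u i (l - i)"
        unfolding L_def by auto
      have "supp n \<subseteq> vars (Suc j)" unfolding n(1) supp_add using Ed[OF n(2)] pv(2,3) by (auto split: if_splits)
      moreover have "n \<notin> nonstd (Suc j)" using nonstd_Suc_iff[OF j, of u l] Ed[OF n(2)] n(4) unfolding n(1) P_def by blast
      moreover have "mdeg n \<le> Suc s" using n(3) by (simp add: n(1) mdeg_add)
      ultimately show "n \<in> {n. (supp n \<subseteq> vars (Suc j) \<and> mdeg n \<le> Suc s) \<and> n \<notin> nonstd (Suc j)}" by simp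
    next
      fix n assume n: "n \<in> {n. (supp n \<subseteq> vars (Suc j) \<and> mdeg n \<le> Suc s) \<and> n \<notin> nonstd (Suc j)}"
      obtain u where u: "n = u + mono_term ?x (coef n ?x) + mono_term ?y (coef n ?y)" "supp u = supp n - {?x, ?y}"
        using split_off_exists[OF pv(4)] by blast
      have "?x \<notin> supp n" using n pv(3) by auto
      then have u': "n = u + mono_term ?y (coef n ?y)" using u(1) by (simp add: in_keys_iff)
      have uE: "u \<in> E" using u(2) n pv(3) by (auto simp: E_def)
      have "mdeg n = mdeg u + coef n ?y"
        using arg_cong[OF u', of mdeg] by (simp only: mdeg_add mdeg_single)
      moreover have "\<forall>i\<le>coef n ?y. \<not> P u i (coef n ?y - i)"
        using nonstd_Suc_iff[OF j, of u "coef n ?y"] Ed[OF uE] n u' unfolding P_def by auto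
      ultimately have "(u, coef n ?y) \<in> L"
        using n uE unfolding L_def by simp
      then show "n \<in> (\<lambda>(u, l). u + mono_term ?y l) ` L" using u' by (intro rev_image_eqI[of "(u, coef n ?y)"]) simp_all
    qed
  qed
  have "finite (S (Suc s))" using bij_betw_finite[OF bij] finite_std by blast
  then have "card (S s) + card L \<le> card (S (Suc s))" unfolding S_def L_def
  proof (intro diagonal_count)
    fix u p r t assume "u \<in> E" "P u p (Suc (r + t))" "P u (Suc (p + r)) t"
    then show "P u (p + r) t" using nonstd_diagonal[OF j, of u p r t r] Ed[of u] by (simp add: P_def)
  qed
  then show ?thesis
    unfolding hilbert_def using bij_betw_same_card[OF bij[of s]] bij_betw_same_card[OF bij[of "Suc s"]] bij_betw_same_card[OF bij']
    by simp
qed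

text \<open>Each step back from stage \<open>d\<close> sums over the degree, and a constant summed
  \<open>r\<close> times grows like the binomial coefficient. The start at \<open>Suc s\<close> fits
  \<open>hilbert_step\<close>, which speaks of positive degree bounds.\<close>

lemma hilbert_lower:
  assumes N: "N \<le> hilbert d (Suc s)" and r: "r \<le> d"
  shows "N * ((t + r) choose r) \<le> hilbert (d - r) (Suc s + t)"
  using r
proof (induction r arbitrary: t)
  case 0
  show ?case using N hilbert_mono[of "Suc s" "Suc s + t" d] by simp
next
  case (Suc r)
  then have j: "d - Suc r < d" "Suc (d - Suc r) = d - r" by simp_all
  show ?case
  proof (induction t)
    case 0
    show ?case using hilbert_step[OF j(1), of s] Suc.IH[of 0] Suc.prems j(2) by simp
  next
    case (Suc t)
    have "N * ((Suc t + Suc r) choose Suc r) = N * ((t + Suc r) choose Suc r) + N * ((Suc t + r) choose r)"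
      by (simp add: algebra_simps)
    also have "\<dots> \<le> hilbert (d - Suc r) (Suc s + t) + hilbert (d - r) (Suc (Suc s + t))"
      using Suc.IH Suc.prems \<open>\<And>t. r \<le> d \<Longrightarrow> N * (t + r choose r) \<le> hilbert (d - r) (Suc s + t)\<close>[of "Suc t"] \<open>Suc r \<le> d\<close>
      by (intro add_mono) simp_all
    also have "\<dots> \<le> hilbert (d - Suc r) (Suc (Suc s + t))" using hilbert_step[OF j(1), of "Suc s + t"] j(2) by simp
    finally show ?case by simp
  qed
qed

text \<open>At stage 0 the standard monomials are those supported on faces of \<open>X\<close>. A
  face with \<open>d\<close> elements carries at most \<open>s choose d\<close> of them, and a
  smaller one at most \<open>s ^ (d - 1)\<close>.\<close>

lemma hilbert_upper:
  assumes X: "X \<subseteq> Pow V" "\<And>F. F \<in> X \<Longrightarrow> card F \<le> d" and s: "0 < s" and d: "0 < d"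
  shows "hilbert 0 s \<le> card {F \<in> X. card F = d} * (s choose d) + card X * s ^ (d - 1)"
proof -
  have finX: "finite X" using X(1) finV finite_subset by blast
  let ?M = "\<lambda>F. {m :: 'v \<Rightarrow>\<^sub>0 nat. supp m = F \<and> mdeg m \<le> s}"
  have "{n. (supp n \<subseteq> vars 0 \<and> mdeg n \<le> s) \<and> n \<notin> nonstd 0} \<subseteq> (\<Union>F\<in>X. ?M F)"
  proof
    fix n assume n: "n \<in> {n. (supp n \<subseteq> vars 0 \<and> mdeg n \<le> s) \<and> n \<notin> nonstd 0}"
    then have nV: "supp n \<subseteq> V" by (simp add: vars_def)
    have "map_monom (glue 0) n = n" by (rule map_monom_id) (simp add: glue_def)
    then have "n \<notin> U" using n unfolding nonstd_def by force
    then have "supp n \<in> X" using nV by (simp add: U_def)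
    then show "n \<in> (\<Union>F\<in>X. ?M F)" using n by blast
  qed
  moreover have "finite (\<Union>F\<in>X. ?M F)"
    using finX X(1) finV by (intro finite_UN_I finite_subset[OF _ finite_bounded_monomials[of V s]]) auto
  ultimately have "hilbert 0 s \<le> card (\<Union>F\<in>X. ?M F)" unfolding hilbert_def by (rule card_mono[rotated])
  also have "\<dots> \<le> (\<Sum>F\<in>X. card (?M F))" by (rule card_UN_le[OF finX])
  also have "\<dots> \<le> (\<Sum>F\<in>X. (if card F = d then s choose d else 0) + s ^ (d - 1))"
  proof (rule sum_mono)
    fix F assume F: "F \<in> X"
    have "finite F" using F X(1) finV finite_subset by blast
    then have c: "card (?M F) \<le> s choose card F" by (rule card_monomials_supp)
    show "card (?M F) \<le> (if card F = d then s choose d else 0) + s ^ (d - 1)"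
    proof (cases "card F = d")
      case False
      then have "card F \<le> d - 1" using X(2)[OF F] by simp
      then have "s ^ card F \<le> s ^ (d - 1)" using s by (intro power_increasing) auto
      moreover have "s choose card F \<le> s ^ card F"
      proof (cases "card F \<le> s")
        case True then show ?thesis by (rule binomial_le_pow)
      qed (simp add: not_le binomial_eq_0)
      ultimately show ?thesis using c False by simp
    qed (use c in simp)
  qed
  also have "\<dots> = card {F \<in> X. card F = d} * (s choose d) + card X * s ^ (d - 1)"
    using finX by (simp add: sum.distrib sum.If_cases Collect_conj_eq)
  finally show ?thesis .
qed

text \<open>Up to the common factor \<open>1 / fact d\<close>, the leading coefficient of the lower
  bound for stage 0 is \<open>hilbert d s\<close>, and that of the upper bound is the number of
  \<open>d\<close>-element faces.\<close>

theorem standard_monomials_le_facets: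
  assumes X: "X \<subseteq> Pow V" "\<And>F. F \<in> X \<Longrightarrow> card F \<le> d" and d: "0 < d"
  shows "hilbert d s \<le> card {F \<in> X. card F = d}"
proof (rule leading_coefficient_le[OF d])
  fix t
  have N: "hilbert d s \<le> hilbert d (Suc s)" by (rule hilbert_mono) simp
  show "hilbert d s * ((t + d) choose d) \<le> card {F \<in> X. card F = d} * ((Suc s + t) choose d) + card X * (Suc s + t) ^ (d - 1)"
    using hilbert_lower[OF N order_refl, of t] hilbert_upper[OF X _ d, of "Suc s + t"] by simp
qed

end

section \<open>Separating variables\<close>

definition mins :: "('v \<Rightarrow>\<^sub>0 nat) set \<Rightarrow> ('v \<Rightarrow>\<^sub>0 nat) set" where
  "mins N = {m \<in> N. \<forall>m' c. m' \<in> N \<and> m = m' + c \<longrightarrow> m' = m}"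

lemma mins_exists:
  assumes "m \<in> N" obtains m0 c where "m0 \<in> mins N" "m = m0 + c"
proof -
  have "\<exists>m0\<in>mins N. \<exists>c. m = m0 + c" using assms
  proof (induction "mdeg m" arbitrary: m rule: less_induct)
    case less
    show ?case
    proof (cases "m \<in> mins N")
      case True
      then show ?thesis by (intro bexI[of _ m] exI[of _ 0]) simp_all
    next
      case False
      then obtain m' c where m': "m' \<in> N" "m = m' + c" "m' \<noteq> m" unfolding mins_def using less.prems by blast
      then have "c \<noteq> 0" by auto
      then have "mdeg m' < mdeg m" using m'(2) mdeg_eq_0[of c] by (simp add: mdeg_add)
      then obtain m0 c' where "m0 \<in> mins N" "m' = m0 + c'" using less.hyps m'(1) by blast
      then show ?thesis using m'(2) by (intro bexI[of _ m0] exI[of _ "c' + c"]) (simp_all add: add.assoc)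
    qed
  qed
  then show thesis using that by blast
qed

lemma minimal_generators_mon_ideal:
  assumes "up_closed W N" shows "mins N \<subseteq> minimal_generators (mon_ideal W N :: ('v, 'k::field) mpoly set)"
  using assms by (auto simp: minimal_generators_def mins_def mon_ideal_monom_iff up_closed_def)

lemma up_closed_image:
  fixes p :: "'v \<Rightarrow> 'w"
  assumes fin: "finite V" and up: "up_closed V U"
  shows "up_closed (p ` V) (map_monom p ` U)"
  unfolding up_closed_def
proof (intro ballI conjI allI impI)
  fix n assume "n \<in> map_monom p ` U"
  then obtain m where m: "m \<in> U" "n = map_monom p m" by blast
  show "supp n \<subseteq> p ` V" using m up by (auto simp: supp_map_monom up_closed_def)
  fix c :: "'w \<Rightarrow>\<^sub>0 nat" assume "supp c \<subseteq> p ` V"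
  then obtain c' where c': "supp c' \<subseteq> V" "map_monom p c' = c" using map_monom_surj_lift[OF fin] by blast
  have "m + c' \<in> U" using up m(1) c'(1) unfolding up_closed_def by blast
  moreover have "n + c = map_monom p (m + c')" using m(2) c'(2) by (simp add: map_monom_add)
  ultimately show "n + c \<in> map_monom p ` U" by blast
qed

context regular_separation begin

text \<open>If the image of \<open>m\<close> is a multiple of the image of \<open>m'\<close>, then
  some multiple of \<open>m'\<close> lies on the antidiagonal of \<open>m\<close>. Were it another
  point of it, \<open>nonstd_diagonal\<close> would put a proper divisor of \<open>m\<close> into
  the ideal. So the exponents of \<open>vs j\<close> agree, and \<open>m'\<close> divides
  \<open>m\<close>. Hence variables keep occurring in minimal generators, as simple separations
  demand.\<close>

lemma mins_merge:
  assumes j: "j < d" and m: "m \<in> mins (nonstd j)"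
  shows "map_monom (identify j) m \<in> mins (nonstd (Suc j))"
proof -
  let ?x = "vs j" and ?y = "rep (vs j)" and ?\<mu> = "map_monom (identify j)"
  note pv = pair_vars[OF j]
  have y: "?y \<in> vars j" using pv by blast
  have mN: "m \<in> nonstd j" and mmin: "\<And>m' c. m' \<in> nonstd j \<Longrightarrow> m = m' + c \<Longrightarrow> m' = m"
    using m unfolding mins_def by blast+
  have up: "n + c \<in> nonstd j" if "n \<in> nonstd j" "supp c \<subseteq> vars j" for n c
    using nonstd_up[of j] j that unfolding up_closed_def by simp
  define a b where "a = coef m ?x" and "b = coef m ?y"
  obtain u where u: "m = u + mono_term ?x a + mono_term ?y b" "supp u = supp m - {?x, ?y}"
    using split_off_exists[OF pv(4), of m] unfolding a_def b_def by blast
  have ux: "?x \<notin> supp u" "?y \<notin> supp u" using u(2) by auto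
  have uV: "supp u \<subseteq> vars j" using u(2) nonstd_supp[of j m] mN j by auto
  have imm: "?\<mu> m = u + mono_term ?y (a + b)" unfolding u(1) by (rule merge_split[OF j ux(1)])
  show ?thesis unfolding mins_def
  proof (intro CollectI conjI allI impI)
    show "?\<mu> m \<in> nonstd (Suc j)" unfolding nonstd_Suc[OF j] using mN by blast
    fix n c0 assume n: "n \<in> nonstd (Suc j) \<and> ?\<mu> m = n + c0"
    then obtain m' where m': "m' \<in> nonstd j" "n = ?\<mu> m'" unfolding nonstd_Suc[OF j] by blast
    define c e where "c = coef m' ?x" and "e = coef m' ?y"
    obtain u' where u': "m' = u' + mono_term ?x c + mono_term ?y e" "supp u' = supp m' - {?x, ?y}"
      using split_off_exists[OF pv(4), of m'] unfolding c_def e_def by blast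
    have u'x: "?x \<notin> supp u'" "?y \<notin> supp u'" using u'(2) by auto
    have n': "n = u' + mono_term ?y (c + e)" unfolding m'(2) u'(1) by (rule merge_split[OF j u'x(1)])
    have eq: "u + mono_term ?y (a + b) = u' + mono_term ?y (c + e) + c0" using n imm n' by simp
    have le: "coef u' v \<le> coef u v" for v
    proof (cases "v = ?y")
      case True then show ?thesis using u'x(2) by (simp add: in_keys_iff)
    next
      case False
      have "coef (u + mono_term ?y (a + b)) v = coef (u' + mono_term ?y (c + e) + c0) v" using eq by simp
      then show ?thesis using False by (simp add: lookup_add lookup_single)
    qed
    have ce: "c + e \<le> a + b"
    proof -
      have "coef (u + mono_term ?y (a + b)) ?y = coef (u' + mono_term ?y (c + e) + c0) ?y" using eq by simp
      then show ?thesis using ux u'x by (simp add: lookup_add in_keys_iff)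
    qed
    have udiff: "u' + (u - u') = u"
      by (rule poly_mapping_eqI) (use le in \<open>simp add: lookup_add lookup_minus\<close>)
    have udV: "supp (u - u') \<subseteq> vars j" using supp_minus[of u u'] uV by blast
    have on_diag: "u + mono_term ?x c + mono_term ?y (a + b - c) \<in> nonstd j"
    proof -
      have "m' + ((u - u') + mono_term ?y (a + b - c - e)) \<in> nonstd j"
        using udV y by (intro up[OF m'(1)]) (auto simp: supp_add split: if_splits)
      moreover have "m' + ((u - u') + mono_term ?y (a + b - c - e)) =
        (u' + (u - u')) + mono_term ?x c + mono_term ?y (e + (a + b - c - e))"
        unfolding u'(1) by (simp only: single_add add_ac)
      moreover have "e + (a + b - c - e) = a + b - c" using ce by simp
      ultimately show ?thesis using udiff by simp
    qed
    have ca: "c = a"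
    proof (rule ccontr)
      assume "c \<noteq> a"
      then consider "c < a" | "a < c" by linarith
      then show False
      proof cases
        case 1
        then obtain r where r: "a = Suc (c + r)" using less_imp_Suc_add by blast
        then have "a + b - c = Suc (r + b)" by simp
        then have mem: "u + mono_term ?x (c + r) + mono_term ?y b \<in> nonstd j"
          using nonstd_diagonal[OF j uV, of c r b r] on_diag mN u(1) r by simp
        have "m = (u + mono_term ?x (c + r) + mono_term ?y b) + mono_term ?x 1"
          unfolding u(1) r by (simp only: Suc_eq_plus1 single_add add_ac)
        with mem have "u + mono_term ?x (c + r) + mono_term ?y b = m" by (rule mmin)
        then have "coef (u + mono_term ?x (c + r) + mono_term ?y b) ?x = a" by (simp add: a_def)
        then show False using r pv(4) ux by (simp add: lookup_add lookup_single in_keys_iff)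
      next
        case 2
        then obtain r where r: "c = Suc (a + r)" using less_imp_Suc_add by blast
        define t where "t = a + b - c"
        have bt: "b = Suc (r + t)" using r ce by (simp add: t_def)
        have "u + mono_term ?x (a + 0) + mono_term ?y (r + t - 0) \<in> nonstd j"
        proof (rule nonstd_diagonal[OF j uV])
          show "u + mono_term ?x a + mono_term ?y (Suc (r + t)) \<in> nonstd j" using mN unfolding u(1) bt .
          show "u + mono_term ?x (Suc (a + r)) + mono_term ?y t \<in> nonstd j" using on_diag unfolding t_def[symmetric] unfolding r .
        qed simp
        then have mem: "u + mono_term ?x a + mono_term ?y (r + t) \<in> nonstd j" by simp
        have "m = (u + mono_term ?x a + mono_term ?y (r + t)) + mono_term ?y 1"
          unfolding u(1) bt by (simp only: Suc_eq_plus1 single_add add_ac)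
        with mem have "u + mono_term ?x a + mono_term ?y (r + t) = m" by (rule mmin)
        then have "coef (u + mono_term ?x a + mono_term ?y (r + t)) ?y = b" by (simp add: b_def)
        then show False using bt pv(4) ux by (simp add: lookup_add lookup_single in_keys_iff)
      qed
    qed
    have "m = m' + ((u - u') + mono_term ?y (b - e))"
    proof -
      have "m' + ((u - u') + mono_term ?y (b - e)) = (u' + (u - u')) + mono_term ?x c + mono_term ?y (e + (b - e))"
        unfolding u'(1) by (simp only: single_add add_ac)
      moreover have "e + (b - e) = b" using ce ca by simp
      ultimately show ?thesis using udiff u(1) ca by simp
    qed
    then have "m' = m" by (rule mmin[OF m'(1)])
    then show "n = ?\<mu> m" using m'(2) by simp
  qed
qed

lemma mins_Suc:
  assumes j: "j < d" shows "mins (nonstd (Suc j)) \<subseteq> map_monom (identify j) ` mins (nonstd j)"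
proof
  fix n assume n: "n \<in> mins (nonstd (Suc j))"
  then obtain m where m: "m \<in> nonstd j" "n = map_monom (identify j) m" unfolding mins_def nonstd_Suc[OF j] by blast
  obtain m0 c where m0: "m0 \<in> mins (nonstd j)" "m = m0 + c" using mins_exists[OF m(1)] .
  have "map_monom (identify j) m0 \<in> nonstd (Suc j)" using m0(1) unfolding nonstd_Suc[OF j] mins_def by blast
  moreover have "n = map_monom (identify j) m0 + map_monom (identify j) c" using m(2) m0(2) by (simp add: map_monom_add)
  ultimately have "map_monom (identify j) m0 = n" using n unfolding mins_def by blast
  then show "n \<in> map_monom (identify j) ` mins (nonstd j)" using m0(1) by blast
qed

text \<open>The variables occurring in minimal generators of the Stanley-Reisner ideal. The others
  cannot take part in a simple separation and enter by the final extension of the polynomial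
  ring.\<close>

definition used :: "'v set" where "used = (\<Union>m\<in>mins U. supp m)"

definition stage_ideal :: "nat \<Rightarrow> ('v, 'k) mpoly set" where
  "stage_ideal j = mon_ideal (vars j \<inter> used) {n \<in> nonstd j. supp n \<subseteq> used}"

lemma used_V: "used \<subseteq> V" by (auto simp: used_def mins_def U_def)

lemma vars_0: "vars 0 = V" by (simp add: vars_def)

lemma nonstd_0: "nonstd 0 = U"
proof -
  have "map_monom (glue 0) n = n" for n by (rule map_monom_id) (simp add: glue_def)
  then show ?thesis by (simp add: nonstd_def)
qed

lemma stage_up: "j \<le> d \<Longrightarrow> up_closed (vars j \<inter> used) {n \<in> nonstd j. supp n \<subseteq> used}"
  using nonstd_up[of j] nonstd_supp[of j] by (auto simp: up_closed_def supp_add)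

text \<open>By \<open>mins_merge\<close> and \<open>mins_Suc\<close> the minimal generators of a
  stage are exactly the images of those of the preceding one. Since representatives are used
  variables, merging does not lead out of \<open>used\<close>.\<close>

lemma used_stage:
  assumes rep: "rep ` V \<subseteq> used" and j: "j \<le> d0" "d0 \<le> d"
  shows "(\<forall>m\<in>mins (nonstd j). supp m \<subseteq> used) \<and> (\<forall>v\<in>vars j \<inter> used. \<exists>m\<in>mins (nonstd j). v \<in> supp m)"
  using j(1)
proof (induction j)
  case 0
  show ?case unfolding nonstd_0 used_def by blast
next
  case (Suc j)
  have jd: "j < d" using Suc.prems j(2) by simp
  note IH = Suc.IH[OF Suc_leD[OF Suc.prems]]
  show ?case
  proof (intro conjI ballI)
    fix n assume "n \<in> mins (nonstd (Suc j))"
    then obtain m where m: "m \<in> mins (nonstd j)" "n = map_monom (identify j) m" using mins_Suc[OF jd] by blast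
    have "identify j v \<in> used" if "v \<in> supp m" for v
      using that IH m(1) rep vsV[OF jd] by (auto simp: identify_def)
    then show "supp n \<subseteq> used" unfolding m(2) supp_map_monom by blast
  next
    fix v assume v: "v \<in> vars (Suc j) \<inter> used"
    then have "v \<in> vars j \<inter> used" "v \<noteq> vs j" using pair_vars(3)[OF jd] by auto
    then obtain m where m: "m \<in> mins (nonstd j)" "v \<in> supp m" using IH by blast
    have "v \<in> supp (map_monom (identify j) m)" unfolding supp_map_monom
      using m(2) \<open>v \<noteq> vs j\<close> by (intro image_eqI[of _ _ v]) (simp_all add: identify_def)
    then show "\<exists>m\<in>mins (nonstd (Suc j)). v \<in> supp m" using mins_merge[OF jd m(1)] by blast
  qed
qed

lemma stage_simple_separation:
  assumes rep: "rep ` V \<subseteq> used" and vs: "vs ` {..<d0} \<subseteq> used" and j: "j < d0" "d0 \<le> d"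
  shows "simple_separation (identify j) (vars j \<inter> used) (stage_ideal j) (vars (Suc j) \<inter> used) (stage_ideal (Suc j))"
proof -
  let ?W = "vars j \<inter> used" and ?N = "{n \<in> nonstd j. supp n \<subseteq> used}"
  let ?W' = "vars (Suc j) \<inter> used" and ?N' = "{n \<in> nonstd (Suc j). supp n \<subseteq> used}"
  let ?x = "vs j" and ?y = "rep (vs j)"
  have jd: "j < d" using j by simp
  note pv = pair_vars[OF jd]
  have x: "?x \<in> ?W" using pv(1) vs j by auto
  have y: "?y \<in> ?W'" using pv(2) rep vsV[OF jd] by blast
  have W': "?W' = ?W - {?x}" using pv(3) by blast
  have fin: "finite ?W" using finite_vars by simp
  have im: "identify j ` ?W = ?W'"
  proof (intro equalityI subsetI)
    fix v assume "v \<in> identify j ` ?W"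
    then obtain w where w: "w \<in> ?W" "v = identify j w" by blast
    show "v \<in> ?W'"
    proof (cases "w = ?x")
      case True then show ?thesis using w y by (simp add: identify_def)
    next
      case False then show ?thesis using w unfolding W' by (simp add: identify_def)
    qed
  next
    fix v assume v: "v \<in> ?W'"
    then have "identify j v = v" unfolding W' by (simp add: identify_def)
    then show "v \<in> identify j ` ?W" using v unfolding W' by (metis DiffD1 imageI)
  qed
  have up: "up_closed ?W ?N" "up_closed ?W' ?N'" using jd by (auto intro: stage_up)
  have map_N: "map_monom (identify j) ` {m \<in> ?N. supp m \<subseteq> ?W} = ?N'"
  proof (intro equalityI subsetI)
    fix n assume "n \<in> map_monom (identify j) ` {m \<in> ?N. supp m \<subseteq> ?W}"
    then obtain m where m: "m \<in> nonstd j" "supp m \<subseteq> ?W" "n = map_monom (identify j) m" by blast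
    have "supp n \<subseteq> ?W'" unfolding m(3) supp_map_monom using im m(2) by blast
    then show "n \<in> ?N'" using m nonstd_Suc[OF jd] by blast
  next
    fix n assume n: "n \<in> ?N'"
    then obtain m where m: "m \<in> nonstd j" "n = map_monom (identify j) m" unfolding nonstd_Suc[OF jd] by blast
    have mu: "supp m \<subseteq> used"
    proof
      fix v assume v: "v \<in> supp m"
      have "supp (map_monom (identify j) m) \<subseteq> used" using n m(2) by blast
      then have "identify j v \<in> used" using v unfolding supp_map_monom by blast
      then show "v \<in> used" using x by (cases "v = ?x") (simp_all add: identify_def)
    qed
    have "supp m \<subseteq> vars j" using m(1) jd by (intro nonstd_supp) simp_all
    then show "n \<in> map_monom (identify j) ` {m \<in> ?N. supp m \<subseteq> ?W}" using m mu by blast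
  qed
  note us = used_stage[OF rep less_imp_le[OF j(1)] j(2)]
  have min: "mins (nonstd j) \<subseteq> minimal_generators (stage_ideal j)"
  proof -
    have "mins (nonstd j) \<subseteq> mins ?N" using us unfolding mins_def by auto
    then show ?thesis using minimal_generators_mon_ideal[OF up(1)] unfolding stage_ideal_def by blast
  qed
  have occurs: "\<exists>m\<in>minimal_generators (stage_ideal j). v \<in> supp m" if "v \<in> ?W" for v
    using us min that by blast
  have nzd: "nonzerodivisor (mpoly_ring ?W Quot stage_ideal j) (stage_ideal j +>\<^bsub>mpoly_ring ?W\<^esub> (mvar ?x - mvar ?y))"
  proof -
    have I: "ideal (stage_ideal j) (mpoly_ring ?W)" unfolding stage_ideal_def by (rule mon_ideal_ideal[OF up(1)])
    have "mvar ?x - mvar ?y \<in> (kpoly ?W :: ('v, 'k) mpoly set)" using x y W' by (intro kpoly_closed(4) kpoly_mvar) auto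
    then have f: "mvar ?x - mvar ?y \<in> carrier (mpoly_ring ?W :: ('v, 'k) mpoly ring)" by simp
    have "g \<in> stage_ideal j" if g: "g \<in> kpoly ?W" "(mvar ?x - mvar ?y) * g \<in> stage_ideal j" for g
    proof -
      have "g \<in> kpoly (vars j)" using g(1) unfolding kpoly_def by blast
      moreover have "form j * g \<in> mon_ideal (vars j) (nonstd j)"
        using g(2) unfolding form_def stage_ideal_def mon_ideal_def kpoly_def by blast
      ultimately have "g \<in> mon_ideal (vars j) (nonstd j)" by (rule nonzerodivisor_stage[OF jd])
      then show ?thesis using g(1) unfolding stage_ideal_def mon_ideal_def kpoly_def by blast
    qed
    then show ?thesis unfolding nonzerodivisor_quot_iff[OF I f] by simp
  qed
  have "\<exists>v1\<in>?W. \<exists>v2\<in>?W. v1 \<noteq> v2 \<and> identify j v1 = identify j v2 \<and>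
      (\<exists>m\<in>minimal_generators (stage_ideal j). v1 \<in> supp m) \<and> (\<exists>m\<in>minimal_generators (stage_ideal j). v2 \<in> supp m) \<and>
      nonzerodivisor (mpoly_ring ?W Quot stage_ideal j) (stage_ideal j +>\<^bsub>mpoly_ring ?W\<^esub> (mvar v1 - mvar v2))"
  proof (rule bexI[of _ ?x], rule bexI[of _ ?y], intro conjI)
    show "?x \<noteq> ?y" by (rule pv(4))
    show "identify j ?x = identify j ?y" by (simp add: identify_def)
    show yW: "?y \<in> ?W" using y W' by blast
    show "\<exists>m\<in>minimal_generators (stage_ideal j). ?x \<in> supp m" "\<exists>m\<in>minimal_generators (stage_ideal j). ?y \<in> supp m"
      by (rule occurs, fact)+
  qed (rule nzd x)+
  then show ?thesis unfolding simple_separation_def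
  proof (intro conjI)
    show "finite ?W" by (rule fin)
    show "identify j ` ?W = ?W'" by (rule im)
    show "card ?W = card ?W' + 1" unfolding W' using card.remove[OF fin x] by simp
    show "monomial_ideal ?W (stage_ideal j)" "monomial_ideal ?W' (stage_ideal (Suc j))"
      unfolding stage_ideal_def by (rule mon_ideal_monomial, rule up)+
    show "stage_ideal (Suc j) = map_vars (identify j) ` stage_ideal j"
      unfolding stage_ideal_def map_vars_mon_ideal[OF im] map_N ..
  qed
qed

text \<open>The succession begins at stage \<open>d0\<close>, where only the representatives are
  left among the used variables and \<open>p\<close> is a bijective renaming, and it runs back to
  stage 0. The list \<open>vs\<close> therefore has the used variables before the others.\<close>

theorem separation_of_image:
  fixes p :: "'v \<Rightarrow> 'w"
  assumes rep: "rep ` V \<subseteq> used" and vs: "vs ` {..<d0} = used - rep ` V" and d0: "d0 \<le> d"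
    and p: "\<And>v. v \<in> V \<Longrightarrow> p (rep v) = p v" and inj: "inj_on p (rep ` V)"
  shows "separation (p ` V) (mon_ideal (p ` V) (map_monom p ` U)) p V (mon_ideal V U :: ('v, 'k) mpoly set)"
proof -
  let ?J = "mon_ideal (p ` V) (map_monom p ` U) :: ('w, 'k) mpoly set"
  have repV: "rep ` V \<subseteq> V" using rep_V by blast
  have W: "vars d0 \<inter> used = rep ` V"
  proof -
    have "rep ` V \<inter> vs ` {..<d0} = {}" using vs by blast
    then show ?thesis using vs rep repV used_V unfolding vars_def by blast
  qed
  have pW: "p ` rep ` V = p ` V" unfolding image_image using p by (intro image_cong) auto
  have bij: "bij_betw p (vars d0 \<inter> used) (p ` V)" unfolding W bij_betw_def using inj pW by blast
  have pglue: "p (glue j v) = p v" if "v \<in> V" for j v using p that by (simp add: glue_def)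
  have pU: "map_monom p (map_monom (glue j) m) = map_monom p m" if "supp m \<subseteq> V" for j m
    unfolding map_monom_comp by (rule map_monom_cong) (use pglue that in auto)
  have img: "map_monom p ` {m \<in> {n \<in> nonstd d0. supp n \<subseteq> used}. supp m \<subseteq> vars d0 \<inter> used} = map_monom p ` U"
  proof (intro equalityI subsetI)
    fix n assume "n \<in> map_monom p ` {m \<in> {n \<in> nonstd d0. supp n \<subseteq> used}. supp m \<subseteq> vars d0 \<inter> used}"
    then obtain m where m: "m \<in> U" "n = map_monom p (map_monom (glue d0) m)" unfolding nonstd_def by blast
    then show "n \<in> map_monom p ` U" using pU[of m d0] by (simp add: U_def)
  next
    fix n assume "n \<in> map_monom p ` U"
    then obtain m where m: "m \<in> U" "n = map_monom p m" by blast
    obtain m0 c where m0: "m0 \<in> mins U" "m = m0 + c" using mins_exists[OF m(1)] .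
    have m0U: "m0 \<in> U" using m0(1) by (simp add: mins_def)
    have cV: "supp c \<subseteq> V" using m(1) m0(2) by (simp add: U_def supp_add)
    \<comment> \<open>The cofactor \<open>c\<close> may involve variables outside
      \<open>used\<close>. Replacing them by representatives leaves the image under \<open>p\<close>
      unchanged.\<close>
    let ?m = "m0 + map_monom rep c"
    have "supp (map_monom rep c) \<subseteq> V" using cV repV unfolding supp_map_monom by blast
    then have mU: "?m \<in> U" using U_up m0U unfolding up_closed_def by blast
    have mV: "supp ?m \<subseteq> V" using mU by (simp add: U_def)
    have mused: "supp ?m \<subseteq> used" using m0(1) rep cV unfolding used_def by (auto simp: supp_add supp_map_monom)
    have "map_monom p (map_monom rep c) = map_monom p c"
      unfolding map_monom_comp by (rule map_monom_cong) (use p cV in auto)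
    then have n: "n = map_monom p (map_monom (glue d0) ?m)" using pU[OF mV] m(2) m0(2) by (simp add: map_monom_add)
    have "glue d0 v \<in> used" if "v \<in> used" for v using that rep used_V by (auto simp: glue_def)
    then have s: "supp (map_monom (glue d0) ?m) \<subseteq> used" using mused unfolding supp_map_monom by blast
    have N: "map_monom (glue d0) ?m \<in> nonstd d0" using mU by (simp add: nonstd_def)
    then show "n \<in> map_monom p ` {m \<in> {n \<in> nonstd d0. supp n \<subseteq> used}. supp m \<subseteq> vars d0 \<inter> used}"
      using n s nonstd_supp[OF d0 N] by blast
  qed
  have upJ: "up_closed (p ` V) (map_monom p ` U)"
    by (rule up_closed_image[OF finV U_up])
  have stages: "proper_separation (p ` V) ?J p (vars (d0 - i) \<inter> used) (stage_ideal (d0 - i))" if "i \<le> d0" for i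
    using that
  proof (induction i)
    case 0
    show ?case
    proof (rule proper_separation.rename)
      show "finite (vars (d0 - 0) \<inter> used)" using finite_vars by simp
      show "bij_betw p (vars (d0 - 0) \<inter> used) (p ` V)" using bij by simp
      show "monomial_ideal (vars (d0 - 0) \<inter> used) (stage_ideal (d0 - 0))"
        unfolding stage_ideal_def by (rule mon_ideal_monomial, rule stage_up) (use d0 in simp)
      show "monomial_ideal (p ` V) ?J" by (rule mon_ideal_monomial[OF upJ])
      have "p ` (vars d0 \<inter> used) = p ` V" using W pW by simp
      from map_vars_mon_ideal[OF this] show "?J = map_vars p ` stage_ideal (d0 - 0)"
        unfolding stage_ideal_def diff_zero img[symmetric] by (rule sym)
    qed
  next
    case (Suc i)
    let ?j = "d0 - Suc i"
    have j: "?j < d0" "Suc ?j = d0 - i" using Suc.prems by simp_all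
    show ?case
    proof (rule proper_separation.step)
      show "proper_separation (p ` V) ?J p (vars (Suc ?j) \<inter> used) (stage_ideal (Suc ?j))"
        unfolding j(2) using Suc by simp
      show "simple_separation (identify ?j) (vars ?j \<inter> used) (stage_ideal ?j) (vars (Suc ?j) \<inter> used) (stage_ideal (Suc ?j))"
        by (rule stage_simple_separation[OF rep _ j(1) d0]) (use vs in blast)
      have "p (identify ?j v) = p v" if "v \<in> V" for v using p[OF that] by (auto simp: identify_def)
      then show "\<forall>v\<in>vars ?j \<inter> used. p v = p (identify ?j v)" using used_V by auto
    qed
  qed
  \<comment> \<open>Minimal generators involve only used variables, so the ideal of stage 0 contains
    generators of the whole ideal.\<close>
  have gen: "mon_ideal V U = Idl\<^bsub>mpoly_ring V\<^esub> (stage_ideal 0)"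
  proof (rule genideal_mpoly_eqI[symmetric, OF U_ideal])
    show "stage_ideal 0 \<subseteq> mon_ideal V U" unfolding stage_ideal_def mon_ideal_def nonstd_0 vars_0 kpoly_def by blast
    fix J' :: "('v, 'k) mpoly set" assume J': "ideal J' (mpoly_ring V)" "stage_ideal 0 \<subseteq> J'"
    show "mon_ideal V U \<subseteq> J'"
    proof (rule mon_ideal_least[OF J'(1)])
      fix m assume m: "m \<in> U"
      obtain m0 c where m0: "m0 \<in> mins U" "m = m0 + c" using mins_exists[OF m] .
      have "supp m0 \<subseteq> used" using m0(1) by (auto simp: used_def)
      then have "monom_of m0 \<in> stage_ideal 0"
        using m0(1) used_V unfolding stage_ideal_def mon_ideal_monom_iff nonstd_0 vars_0 mins_def by blast
      moreover have "monom_of c \<in> (kpoly V :: ('v, 'k) mpoly set)"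
        using m m0(2) by (auto simp: monom_of_def U_def supp_add)
      ultimately have "monom_of c * monom_of m0 \<in> J'"
        using J'(2) by (intro ideal_mpolyD(4)[OF J'(1)]) blast+
      then show "monom_of m \<in> J'" using m0(2) by (simp add: monom_of_def mult_single add.commute)
    qed
  qed
  have "proper_separation (p ` V) ?J p used (stage_ideal 0)"
    using stages[of d0] used_V by (simp add: vars_0 inf_absorb2)
  then show ?thesis unfolding separation_def using finV used_V gen by blast
qed

end

section \<open>Cohen-Macaulay subcomplexes\<close>

text \<open>This provides the list \<open>vs\<close>: first the used variables to be identified,
  then those that occur in no minimal generator.\<close>

lemma enumerate_two:
  assumes A: "finite A" and B: "finite B" and disj: "A \<inter> B = {}"
  obtains vs :: "nat \<Rightarrow> 'a" where "inj_on vs {..<card A + card B}" "vs ` {..<card A} = A" "vs ` {..<card A + card B} = A \<union> B"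
proof -
  obtain f where f: "bij_betw f {0..<card A} A" using ex_bij_betw_nat_finite[OF A] by blast
  obtain g where g: "bij_betw g {0..<card B} B" using ex_bij_betw_nat_finite[OF B] by blast
  define vs where "vs l = (if l < card A then f l else g (l - card A))" for l
  have 1: "vs ` {..<card A} = A"
  proof -
    have "vs ` {..<card A} = f ` {0..<card A}" by (rule image_cong) (auto simp: vs_def)
    then show ?thesis using f by (simp add: bij_betw_def)
  qed
  have 2: "vs ` {card A..<card A + card B} = B"
  proof -
    have "{card A..<card A + card B} = (\<lambda>l. l + card A) ` {0..<card B}"
      by (simp add: add.commute)
    then have "vs ` {card A..<card A + card B} = (\<lambda>l. vs (l + card A)) ` {0..<card B}"
      by (simp only: image_image)
    also have "\<dots> = g ` {0..<card B}" by (rule image_cong) (auto simp: vs_def)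
    finally show ?thesis using g by (simp add: bij_betw_def)
  qed
  have split: "{..<card A + card B} = {..<card A} \<union> {card A..<card A + card B}" by auto
  have 3: "vs ` {..<card A + card B} = A \<union> B" unfolding split image_Un 1 2 ..
  moreover have "inj_on vs {..<card A + card B}"
    by (rule eq_card_imp_inj_on) (use 3 card_Un_disjoint[OF A B disj] in simp_all)
  ultimately show thesis using that 1 by blast
qed

theorem cohen_macaulay_blocks:
  fixes X :: "'v set set" and p :: "'v \<Rightarrow> 'i"
  assumes bl: "blocks I A" and X: "join_subcomplex I A X" and full: "X \<inter> full_faces I A \<noteq> {}"
    and rank: "0 < join_rank I A" and p: "\<And>i a. i \<in> I \<Longrightarrow> a \<in> A i \<Longrightarrow> p a = i"
    and cm: "cohen_macaulay_complex TYPE('k::field) (\<Union>(A ` I)) X"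
  shows "extremal I A X"
    "separation I (mon_ideal I (map_monom p ` {m. supp m \<subseteq> \<Union>(A ` I) \<and> supp m \<notin> X})) p (\<Union>(A ` I))
      (stanley_reisner_ideal (\<Union>(A ` I)) X :: ('v, 'k) mpoly set)"
proof -
  define V where "V = \<Union>(A ` I)"
  define N where "N = {m :: 'v \<Rightarrow>\<^sub>0 nat. supp m \<subseteq> V \<and> supp m \<notin> X}"
  note finI = blocksD(1)[OF bl] and finA = blocksD(2)[OF bl] and finV = blocksD(4)[OF bl, folded V_def]
  note XD = join_subcomplexD[OF X]
  have down: "\<And>F G. F \<in> X \<Longrightarrow> G \<subseteq> F \<Longrightarrow> G \<in> X" using XD(2) by blast
  have empty: "{} \<in> X" using full down by blast
  have AV: "A i \<subseteq> V" if "i \<in> I" for i using that by (auto simp: V_def)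
  have pV: "p v \<in> I \<and> v \<in> A (p v)" if "v \<in> V" for v using that p by (auto simp: V_def)
  define u0 where "u0 = (\<Union>m\<in>mins N. supp m)"
  have u0V: "u0 \<subseteq> V" by (auto simp: u0_def mins_def N_def)
  \<comment> \<open>Representatives must be used variables. The block is a nonface, so a minimal
    generator divides the product of its variables, and this generator is not 1 because the empty
    set is a face.\<close>
  have "\<exists>v. v \<in> A i \<and> v \<in> u0" if i: "i \<in> I" for i
  proof -
    let ?m = "\<Sum>v\<in>A i. mono_term v (1::nat)"
    have s: "supp ?m = A i" by (rule supp_indicator[OF finA[OF i]])
    have "A i \<notin> X" using XD(3)[of "A i" i] i by blast
    then have "?m \<in> N" using s AV[OF i] by (simp add: N_def)
    then obtain m0 c where m0: "m0 \<in> mins N" "?m = m0 + c" by (rule mins_exists)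
    have "supp m0 \<union> supp c = A i" using s m0(2) supp_add[of m0 c] by simp
    moreover have "supp m0 \<noteq> {}" using m0(1) empty unfolding mins_def N_def by force
    ultimately show ?thesis using m0(1) unfolding u0_def by blast
  qed
  then obtain \<rho> where rho: "\<And>i. i \<in> I \<Longrightarrow> \<rho> i \<in> A i \<and> \<rho> i \<in> u0" by metis
  have p_rho: "p (\<rho> i) = i" if "i \<in> I" for i using rho[OF that] p[OF that] by blast
  define rep where "rep v = \<rho> (p v)" for v
  have repV: "rep ` V = \<rho> ` I"
  proof (intro equalityI subsetI)
    fix r assume "r \<in> \<rho> ` I"
    then obtain i where i: "i \<in> I" "r = \<rho> i" by blast
    then have "rep r = r" "r \<in> V" using p_rho rho AV[OF i(1)] by (auto simp: rep_def)
    then show "r \<in> rep ` V" by (metis imageI)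
  qed (use pV in \<open>auto simp: rep_def\<close>)
  have Ru: "\<rho> ` I \<subseteq> u0" using rho by blast
  obtain vs :: "nat \<Rightarrow> 'v" where vs: "inj_on vs {..<card (u0 - \<rho> ` I) + card (V - u0)}"
    "vs ` {..<card (u0 - \<rho> ` I)} = u0 - \<rho> ` I"
    "vs ` {..<card (u0 - \<rho> ` I) + card (V - u0)} = (u0 - \<rho> ` I) \<union> (V - u0)"
    by (rule enumerate_two[of "u0 - \<rho> ` I" "V - u0"]) (use finV finite_subset[OF u0V finV] in auto)
  define d0 where "d0 = card (u0 - \<rho> ` I)"
  define d where "d = card (u0 - \<rho> ` I) + card (V - u0)"
  have vsd: "vs ` {..<d} = V - \<rho> ` I" using vs(3) Ru u0V unfolding d_def by blast
  have inj_rho: "inj_on \<rho> I" by (rule inj_on_inverseI[of _ p]) (rule p_rho)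
  have RV: "\<rho> ` I \<subseteq> V" using Ru u0V by blast
  \<comment> \<open>All variables except one per block are listed, which is the number of vertices
    of a facet.\<close>
  have d_rank: "d = join_rank I A"
  proof -
    have "d = card (V - \<rho> ` I)" using vsd card_image[OF vs(1)] by (simp add: d_def)
    also have "\<dots> = card V - card I" using card_Diff_subset[OF finite_imageI[OF finI] RV] card_image[OF inj_rho] by simp
    also have "card V = (\<Sum>i\<in>I. card (A i))" unfolding V_def
      by (rule card_UN_disjoint) (use finI finA blocksD(5)[OF bl] in auto)
    also have "\<dots> - card I = (\<Sum>i\<in>I. card (A i) - 1)"
    proof -
      have "1 \<le> card (A i)" if "i \<in> I" for i using finA[OF that] blocksD(3)[OF bl that] card_gt_0_iff[of "A i"] by linarith
      then show ?thesis by (subst sum_subtractf_nat) auto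
    qed
    finally show ?thesis by (simp add: join_rank_def)
  qed
  interpret separated_variables V X rep vs d
  proof
    show "finite V" by (rule finV)
    show "\<And>F G. F \<in> X \<Longrightarrow> G \<subseteq> F \<Longrightarrow> G \<in> X" by (rule down)
    show "inj_on vs {..<d}" using vs(1) by (simp add: d_def)
    show "vs ` {..<d} \<subseteq> V" using vsd by blast
    have R: "V - vs ` {..<d} = \<rho> ` I" using vsd RV by blast
    show "rep v \<in> V - vs ` {..<d}" if "v \<in> V" for v unfolding R repV[symmetric] using that by blast
    show "rep v = v" if "v \<in> V - vs ` {..<d}" for v using that p_rho unfolding R by (auto simp: rep_def)
    fix r assume "r \<in> V - vs ` {..<d}"
    then obtain i where i: "i \<in> I" "r = \<rho> i" unfolding R by blast
    have "A i \<subseteq> {v\<in>V. rep v = r}" using AV[OF i(1)] p[OF i(1)] i(2) by (auto simp: rep_def)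
    then show "{v\<in>V. rep v = r} \<notin> X" using XD(3)[OF _ i(1)] by blast
  qed
  have U_eq: "U = N" by (simp add: U_def N_def)
  have SR: "stanley_reisner_ideal V X = (mon_ideal V U :: ('v, 'k) mpoly set)"
    unfolding U_def by (rule stanley_reisner_mon_ideal[OF finV down])
  have XS: "X \<subseteq> join_sphere I A" by (rule join_sphere_sub[OF X])
  obtain F where F: "F \<in> X" "F \<in> full_faces I A" using full by blast
  have cF: "card F = d" using card_sphere_face(2)[OF bl, of F] F XS d_rank by blast
  have lf: "linear_forms V U (form :: nat \<Rightarrow> ('v, 'k) mpoly) d"
  proof (rule linear_forms_of_cohen_macaulay[OF _ F(1) _ cF])
    show "cohen_macaulay_ring (mpoly_ring V Quot (mon_ideal V U :: ('v, 'k) mpoly set))"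
      using cm unfolding cohen_macaulay_complex_def V_def[symmetric] SR .
    show "F \<subseteq> V" using XD(1)[OF F(1)] by (simp add: V_def)
    show "F \<noteq> {}" using cF d_rank rank by auto
  qed
  interpret regular_separation V X rep vs d "TYPE('k)"
    by (intro regular_separation.intro regular_separation_axioms.intro separated_variables_axioms lf)
  have vars_d: "vars d = \<rho> ` I" using vsd RV unfolding vars_def by blast
  \<comment> \<open>The exponent vector \<open>c\<close> carried by the representatives, the
    variables that are left at stage \<open>d\<close>.\<close>
  define \<phi> where "\<phi> c = (\<Sum>i\<in>I. mono_term (\<rho> i) (c i))" for c :: "'i \<Rightarrow> nat"
  have coef_phi: "coef (\<phi> c) (\<rho> i) = c i" if "i \<in> I" for c i
  proof -
    have "coef (\<phi> c) (\<rho> i) = (\<Sum>l\<in>I. if l = i then c l else 0)"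
      unfolding \<phi>_def lookup_sum using that inj_onD[OF inj_rho] by (intro sum.cong) (auto simp: lookup_single when_def)
    then show ?thesis using that finI by simp
  qed
  have supp_phi: "supp (\<phi> c) \<subseteq> \<rho> ` I" for c
    unfolding \<phi>_def using keys_sum[of "\<lambda>i. mono_term (\<rho> i) (c i)" I] by (auto split: if_splits)
  have mdeg_phi: "mdeg (\<phi> c) = (\<Sum>i\<in>I. c i)" for c
  proof -
    have "mdeg (\<phi> c) = (\<Sum>r\<in>\<rho> ` I. coef (\<phi> c) r)" using finI supp_phi by (intro mdeg_superset) auto
    then show ?thesis using coef_phi by (simp add: sum.reindex[OF inj_rho])
  qed
  \<comment> \<open>A monomial of \<open>U\<close> with this image would involve at most
    \<open>c i\<close> variables of block \<open>i\<close>. Its support would thus be contained in a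
    set of type \<open>c\<close>, which is a face.\<close>
  have std: "\<phi> c \<notin> nonstd d" if c: "c \<in> std_types I A X" for c
  proof
    assume "\<phi> c \<in> nonstd d"
    then obtain m where m: "m \<in> U" "\<phi> c = map_monom (glue d) m" unfolding nonstd_def by blast
    have mV: "supp m \<subseteq> V" "supp m \<notin> X" using m(1) by (simp_all add: U_def)
    have "\<exists>B. supp m \<inter> A i \<subseteq> B \<and> B \<subseteq> A i \<and> card B = c i" if i: "i \<in> I" for i
    proof -
      have "c i = (\<Sum>v\<in>V. if glue d v = \<rho> i then coef m v else 0)"
        using coef_phi[OF i, of c] m(2) map_monom_coef[OF finV mV(1), of "glue d" "\<rho> i"] by simp
      moreover have "(\<Sum>v\<in>A i. coef m v) = (\<Sum>v\<in>A i. if glue d v = \<rho> i then coef m v else 0)"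
      proof (rule sum.cong)
        fix v assume v: "v \<in> A i"
        then have "rep v = \<rho> i" using p[OF i] by (simp add: rep_def)
        moreover have "glue d v = rep v"
        proof (cases "v \<in> vs ` {..<d}")
          case False
          then have "rep v = v" using rep_id AV[OF i] v by blast
          then show ?thesis using False by (simp add: glue_def)
        qed (simp add: glue_def)
        ultimately show "coef m v = (if glue d v = \<rho> i then coef m v else 0)" by simp
      qed simp
      moreover have "\<dots> \<le> (\<Sum>v\<in>V. if glue d v = \<rho> i then coef m v else 0)"
        by (rule sum_mono2[OF finV AV[OF i]]) simp
      moreover have "card (supp m \<inter> A i) \<le> (\<Sum>v\<in>A i. coef m v)"
      proof -
        have "card (supp m \<inter> A i) = (\<Sum>v\<in>supp m \<inter> A i. 1)" by simp
        also have "\<dots> \<le> (\<Sum>v\<in>supp m \<inter> A i. coef m v)" by (rule sum_mono) (auto simp: in_keys_iff Suc_le_eq)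
        also have "\<dots> \<le> (\<Sum>v\<in>A i. coef m v)" by (rule sum_mono2) (use finA[OF i] in auto)
        finally show ?thesis .
      qed
      ultimately have "card (supp m \<inter> A i) \<le> c i" by simp
      moreover have "c i \<le> card (A i)" using c i unfolding std_types_def PiE_def Pi_def by auto
      ultimately show ?thesis using exists_subset_between[of "supp m \<inter> A i" "c i" "A i"] finA[OF i] by blast
    qed
    then obtain B where B: "\<And>i. i \<in> I \<Longrightarrow> supp m \<inter> A i \<subseteq> B i \<and> B i \<subseteq> A i \<and> card (B i) = c i" by metis
    have Bi: "\<Union>(B ` I) \<inter> A i = B i" if i: "i \<in> I" for i
    proof
      show "B i \<subseteq> \<Union>(B ` I) \<inter> A i" using B[OF i] i by blast
      show "\<Union>(B ` I) \<inter> A i \<subseteq> B i"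
      proof
        fix v assume v: "v \<in> \<Union>(B ` I) \<inter> A i"
        then obtain l where l: "l \<in> I" "v \<in> B l" by blast
        then have "l = i" using B[OF l(1)] v p[OF l(1)] p[OF i] by blast
        then show "v \<in> B i" using l by simp
      qed
    qed
    have "of_type I A c (\<Union>(B ` I))" unfolding of_type_def using B Bi by fastforce
    then have "\<Union>(B ` I) \<in> X" using c unfolding std_types_def by blast
    moreover have "supp m \<subseteq> \<Union>(B ` I)"
    proof
      fix v assume v: "v \<in> supp m"
      then have "p v \<in> I" "v \<in> A (p v)" using pV mV(1) by auto
      then show "v \<in> \<Union>(B ` I)" using B v by blast
    qed
    ultimately show False using down mV(2) by blast
  qed
  have "card (std_types I A X) = card (\<phi> ` std_types I A X)"
  proof (rule card_image[symmetric], rule inj_onI)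
    fix c c' assume cc: "c \<in> std_types I A X" "c' \<in> std_types I A X" "\<phi> c = \<phi> c'"
    have "c i = c' i" if "i \<in> I" for i using coef_phi[OF that] cc(3) by metis
    then show "c = c'" using cc(1,2) unfolding std_types_def by (intro PiE_ext[of c I _ c']) auto
  qed
  \<comment> \<open>The degree bound only has to be large enough for all standard types.\<close>
  also have "\<dots> \<le> hilbert d (\<Sum>i\<in>I. card (A i))"
    unfolding hilbert_def
  proof (rule card_mono[OF finite_std], rule image_subsetI)
    fix c assume c: "c \<in> std_types I A X"
    have "mdeg (\<phi> c) \<le> (\<Sum>i\<in>I. card (A i))" unfolding mdeg_phi
      by (rule sum_mono) (use c in \<open>auto simp: std_types_def PiE_def Pi_def intro: less_imp_le\<close>)
    then show "\<phi> c \<in> {n. (supp n \<subseteq> vars d \<and> mdeg n \<le> (\<Sum>i\<in>I. card (A i))) \<and> n \<notin> nonstd d}"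
      using supp_phi std[OF c] vars_d by simp
  qed
  also have "\<dots> \<le> card {F \<in> X. card F = d}"
  proof (rule standard_monomials_le_facets)
    show "X \<subseteq> Pow V" using XD(1) by (auto simp: V_def)
    show "card F \<le> d" if "F \<in> X" for F using card_sphere_face(1)[OF bl, of F] that XS d_rank by auto
    show "0 < d" using rank d_rank by simp
  qed
  also have "{F \<in> X. card F = d} = X \<inter> full_faces I A"
    using card_sphere_face(2)[OF bl] XS d_rank by blast
  finally show "extremal I A X" unfolding extremal_def using bl X by simp
  have used_eq: "used = u0" unfolding used_def u0_def U_eq ..
  have pI: "p ` V = I"
  proof (intro equalityI subsetI)
    fix i assume "i \<in> I"
    then show "i \<in> p ` V" using p_rho rho AV by (metis image_eqI subsetD)
  qed (use pV in blast)
  have "separation (p ` V) (mon_ideal (p ` V) (map_monom p ` U)) p V (mon_ideal V U :: ('v, 'k) mpoly set)"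
  proof (rule separation_of_image)
    show "rep ` V \<subseteq> used" unfolding repV used_eq by (rule Ru)
    show "vs ` {..<d0} = used - rep ` V" unfolding repV used_eq d0_def by (rule vs(2))
    show "d0 \<le> d" by (simp add: d0_def d_def)
    show "p (rep v) = p v" if "v \<in> V" for v using pV[OF that] p_rho by (simp add: rep_def)
    show "inj_on p (rep ` V)" unfolding repV by (rule inj_onI) (use p_rho in auto)
  qed
  then show "separation I (mon_ideal I (map_monom p ` {m. supp m \<subseteq> \<Union>(A ` I) \<and> supp m \<notin> X})) p (\<Union>(A ` I))
      (stanley_reisner_ideal (\<Union>(A ` I)) X :: ('v, 'k) mpoly set)"
    unfolding V_def[symmetric] SR pI U_eq unfolding N_def .
qed

section \<open>Squarefreeness and the Artin ideal\<close>

lemma squarefree_stanley_reisner: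
  assumes "finite V" shows "squarefree_monomial_ideal V (stanley_reisner_ideal V X :: ('v, 'k::field) mpoly set)"
proof -
  let ?e = "\<lambda>R. \<Sum>v\<in>R. mono_term v (1::nat)"
  have fin: "finite R" if "R \<subseteq> V" for R using that assms finite_subset by blast
  have "{\<Prod>v\<in>R. mvar v |R. R \<subseteq> V \<and> R \<notin> X} = (monom_of ` {?e R |R. R \<subseteq> V \<and> R \<notin> X} :: ('v, 'k) mpoly set)"
    using prod_mvar[OF fin] by (auto simp: setcompr_eq_image image_image intro!: image_cong)
  moreover have "supp m \<subseteq> V \<and> (\<forall>v. coef m v \<le> 1)" if "m \<in> {?e R |R. R \<subseteq> V \<and> R \<notin> X}" for m
  proof -
    obtain R where R: "m = ?e R" "R \<subseteq> V" using \<open>m \<in> _\<close> by blast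
    then show ?thesis unfolding R(1) supp_indicator[OF fin[OF R(2)]] coef_indicator[OF fin[OF R(2)]] by simp
  qed
  ultimately show ?thesis
    unfolding squarefree_monomial_ideal_def stanley_reisner_ideal_def by (intro exI[of _ "{?e R |R. R \<subseteq> V \<and> R \<notin> X}"]) simp
qed

lemma map_monom_face:
  assumes bl: "blocks I A" and p: "\<And>i a. i \<in> I \<Longrightarrow> a \<in> A i \<Longrightarrow> p a = i" and F: "F \<subseteq> \<Union>(A ` I)" and i: "i \<in> I"
  shows "coef (map_monom p (\<Sum>v\<in>F. mono_term v 1)) i = card (F \<inter> A i)"
proof -
  have fF: "finite F" using F blocksD(4)[OF bl] finite_subset by blast
  have "coef (map_monom p (\<Sum>v\<in>F. mono_term v 1)) i = (\<Sum>v\<in>F. if p v = i then coef (\<Sum>v\<in>F. mono_term v 1) v else 0)"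
    by (rule map_monom_coef[OF fF]) (simp only: supp_indicator[OF fF])
  also have "\<dots> = (\<Sum>v\<in>F. if v \<in> A i then 1 else 0)"
  proof (rule sum.cong)
    fix v assume v: "v \<in> F"
    then obtain l where l: "l \<in> I" "v \<in> A l" using F by blast
    have "p v = i \<longleftrightarrow> v \<in> A i" using l p i by metis
    then show "(if p v = i then coef (\<Sum>v\<in>F. mono_term v (1::nat)) v else 0) = (if v \<in> A i then 1 else 0)"
      using v unfolding coef_indicator[OF fF] by simp
  qed simp
  also have "\<dots> = card (F \<inter> A i)" using fF by (simp add: sum.If_cases)
  finally show ?thesis .
qed

text \<open>The block \<open>A i\<close> is a nonface and maps to the power of \<open>x_i\<close>
  with exponent \<open>card (A i)\<close>. A face of the sphere outside \<open>X\<close> maps to a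
  monomial with smaller exponents throughout, which makes the inclusion strict. The ideal is proper
  because the empty set is a face.\<close>

theorem artin_ideal_of_complex:
  fixes X :: "'v set set" and p :: "'v \<Rightarrow> 'i"
  defines "J \<equiv> \<lambda>A I. mon_ideal I (map_monom p ` {m. supp m \<subseteq> \<Union>(A ` I) \<and> supp m \<notin> X}) :: ('i, 'k::field) mpoly set"
  assumes bl: "blocks I A" and X: "join_subcomplex I A X" "X \<noteq> {}" "join_sphere I A - X \<noteq> {}"
    and p: "\<And>i a. i \<in> I \<Longrightarrow> a \<in> A i \<Longrightarrow> p a = i"
  shows "artin_monomial_ideal I (J A I)" "Idl\<^bsub>mpoly_ring I\<^esub> ((\<lambda>i. mvar i ^ card (A i)) ` I) \<subset> J A I"
proof -
  define V where "V = \<Union>(A ` I)"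
  define U where "U = {m :: 'v \<Rightarrow>\<^sub>0 nat. supp m \<subseteq> V \<and> supp m \<notin> X}"
  have J: "J A I = mon_ideal I (map_monom p ` U)" unfolding J_def U_def V_def ..
  note finV = blocksD(4)[OF bl, folded V_def]
  have down: "\<And>F G. F \<in> X \<Longrightarrow> G \<subseteq> F \<Longrightarrow> G \<in> X" using join_subcomplexD(2)[OF X(1)] by blast
  have empty: "{} \<in> X" using X(2) down by blast
  have AV: "A i \<subseteq> V" if "i \<in> I" for i using that by (auto simp: V_def)
  have pI: "p ` V = I"
  proof (intro equalityI subsetI)
    fix i assume i: "i \<in> I"
    then obtain a where "a \<in> A i" using blocksD(3)[OF bl] by blast
    then show "i \<in> p ` V" using p[OF i] AV[OF i] by (metis image_eqI subsetD)
  qed (use p in \<open>auto simp: V_def\<close>)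
  have upU: "up_closed V U" unfolding up_closed_def U_def using down by (auto simp: supp_add)
  have up: "up_closed I (map_monom p ` U)" using up_closed_image[OF finV upU, of p] unfolding pI .
  have idJ: "ideal (J A I) (mpoly_ring I)" unfolding J by (rule mon_ideal_ideal[OF up])
  have pow: "(mvar i :: ('i, 'k) mpoly) ^ e = monom_of (mono_term i e)" for i e
    by (induction e) (simp_all add: mvar_def monom_of_def mult_single single_add[symmetric])
  have powJ: "mvar i ^ card (A i) \<in> J A I" if i: "i \<in> I" for i
  proof -
    let ?m = "\<Sum>v\<in>A i. mono_term v (1::nat)"
    have s: "supp ?m = A i" by (rule supp_indicator[OF blocksD(2)[OF bl i]])
    have "A i \<notin> X" using join_subcomplexD(3)[OF X(1), of "A i" i] i by blast
    then have U: "?m \<in> U" using s AV[OF i] by (simp add: U_def)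
    have "map_monom p ?m = mono_term i (card (A i))"
    proof (rule poly_mapping_eqI)
      fix l
      show "coef (map_monom p ?m) l = coef (mono_term i (card (A i))) l"
      proof (cases "l = i")
        case True
        then show ?thesis using map_monom_face[OF bl p AV[OF i, unfolded V_def] i] by simp
      next
        case False
        have "supp (map_monom p ?m) \<subseteq> {i}" unfolding supp_map_monom s using p[OF i] by auto
        then have "l \<notin> supp (map_monom p ?m)" using False by blast
        then show ?thesis using False by (simp add: in_keys_iff lookup_single)
      qed
    qed
    then have "mono_term i (card (A i)) \<in> map_monom p ` U" using U by (metis imageI)
    then show ?thesis unfolding pow J mon_ideal_monom_iff using i by auto
  qed
  have "1 \<notin> J A I"
  proof
    assume "1 \<in> J A I"
    then have "monom_of 0 \<in> J A I" by (simp add: monom_of_def)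
    then obtain m where "m \<in> U" "map_monom p m = 0" unfolding J mon_ideal_monom_iff by force
    then have "supp m = {}" using supp_map_monom[of p m] by simp
    then show False using empty \<open>m \<in> U\<close> unfolding U_def by simp
  qed
  moreover have "1 \<in> carrier (mpoly_ring I :: ('i, 'k) mpoly ring)" by simp
  ultimately have proper: "J A I \<noteq> carrier (mpoly_ring I)" by blast
  show "artin_monomial_ideal I (J A I)"
    unfolding artin_monomial_ideal_def
  proof (intro conjI ballI)
    show "monomial_ideal I (J A I)" unfolding J by (rule mon_ideal_monomial[OF up])
    show "J A I \<noteq> carrier (mpoly_ring I)" by (rule proper)
    show "\<exists>e. mvar i ^ e \<in> J A I" if "i \<in> I" for i using powJ[OF that] by blast
  qed
  let ?M = "(\<lambda>i. mono_term i (card (A i))) ` I"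
  have gens: "(\<lambda>i. mvar i ^ card (A i)) ` I = (monom_of ` ?M :: ('i, 'k) mpoly set)"
    unfolding pow image_image ..
  have Idl: "Idl\<^bsub>mpoly_ring I\<^esub> ((\<lambda>i. mvar i ^ card (A i)) ` I) =
    (mon_ideal I {m + c |m c. m \<in> ?M \<and> supp c \<subseteq> I} :: ('i, 'k) mpoly set)"
    unfolding gens by (rule genideal_monomials) (auto split: if_splits)
  have sub: "Idl\<^bsub>mpoly_ring I\<^esub> ((\<lambda>i. mvar i ^ card (A i)) ` I) \<subseteq> J A I"
    by (rule ring.genideal_minimal[OF ring_mpoly idJ]) (use powJ in blast)
  obtain F where F: "F \<in> join_sphere I A" "F \<notin> X" using X(3) by blast
  have FV: "F \<subseteq> V" "\<And>i. i \<in> I \<Longrightarrow> \<not> A i \<subseteq> F" using F(1) by (simp_all add: join_sphere_def V_def)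
  let ?f = "\<Sum>v\<in>F. mono_term v (1::nat)"
  have "supp ?f = F" by (rule supp_indicator) (use FV(1) finV finite_subset in blast)
  then have fU: "?f \<in> U" using FV(1) F(2) by (simp add: U_def)
  then have "supp (map_monom p ?f) \<subseteq> I" using up unfolding up_closed_def by blast
  then have "monom_of (map_monom p ?f) \<in> J A I" unfolding J mon_ideal_monom_iff using fU by blast
  moreover have "(monom_of (map_monom p ?f) :: ('i, 'k) mpoly) \<notin> Idl\<^bsub>mpoly_ring I\<^esub> ((\<lambda>i. mvar i ^ card (A i)) ` I)"
  proof
    assume "(monom_of (map_monom p ?f) :: ('i, 'k) mpoly) \<in> Idl\<^bsub>mpoly_ring I\<^esub> ((\<lambda>i. mvar i ^ card (A i)) ` I)"
    then obtain i c where i: "i \<in> I" "map_monom p ?f = mono_term i (card (A i)) + c"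
      unfolding Idl mon_ideal_monom_iff by blast
    have "coef (map_monom p ?f) i \<ge> card (A i)" unfolding i(2) by (simp add: lookup_add)
    moreover have "coef (map_monom p ?f) i = card (F \<inter> A i)"
      by (rule map_monom_face[OF bl p FV(1)[unfolded V_def] i(1)])
    moreover have "card (F \<inter> A i) < card (A i)"
      by (rule psubset_card_mono) (use blocksD(2)[OF bl i(1)] FV(2)[OF i(1)] in auto)
    ultimately show False by simp
  qed
  ultimately show "Idl\<^bsub>mpoly_ring I\<^esub> ((\<lambda>i. mvar i ^ card (A i)) ` I) \<subset> J A I" using sub by blast
qed

theorem theorem4p3:
  fixes n :: nat
    and A :: "nat \<Rightarrow> 'v set"
    and X :: "'v set set"
    and p :: "'v \<Rightarrow> nat"
  defines "VA \<equiv> (\<Union>i\<in>{1..n}. A i)"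
    and "S \<equiv> complex_join {1..n} (\<lambda>i. simplex_boundary (A i))"
  assumes "\<And>i. i \<in> {1..n} \<Longrightarrow> finite (A i) \<and> A i \<noteq> {}"
    and "disjoint_family_on A {1..n}"
    and "abstract_simplicial_complex VA X"
    and "X \<subset> S"
    and "complex_dim X = complex_dim S"
    and "cohen_macaulay_complex TYPE('k::field) VA X"
    and "\<And>i a. i \<in> {1..n} \<Longrightarrow> a \<in> A i \<Longrightarrow> p a = i"
  shows "constructible (complex_dim X) X
    \<and> geometric_realization X homeomorphic_space closed_nball (nat (complex_dim X))
    \<and> (\<exists>J :: (nat, 'k) mpoly set.
         artin_monomial_ideal {1..n} J
       \<and> Idl\<^bsub>mpoly_ring {1..n}\<^esub> ((\<lambda>i. mvar i ^ card (A i)) ` {1..n}) \<subset> J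
       \<and> polarization {1..n} J p VA (stanley_reisner_ideal VA X))"
proof -
  let ?I = "{1..n}"
  have bl: "blocks ?I A" unfolding blocks_def using assms(3,4) by blast
  have S: "S = join_sphere ?I A" unfolding S_def by (rule complex_join_boundaries[OF bl])
  note asc = assms(5)[unfolded abstract_simplicial_complex_def]
  have XS: "X \<subseteq> join_sphere ?I A" "join_sphere ?I A - X \<noteq> {}" using assms(6) unfolding S by blast+
  have empty: "{} \<in> X" using asc by (elim conjE)
  have X: "join_subcomplex ?I A X"
    unfolding join_subcomplex_def
  proof
    fix F assume F: "F \<in> X"
    then have "F \<in> join_sphere ?I A" using XS(1) by (rule subsetD[rotated])
    moreover have "\<forall>G. G \<subseteq> F \<longrightarrow> G \<in> X" using asc F by blast
    ultimately show "F \<subseteq> \<Union>(A ` ?I) \<and> (\<forall>G. G \<subseteq> F \<longrightarrow> G \<in> X) \<and> (\<forall>i\<in>?I. \<not> A i \<subseteq> F)"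
      unfolding join_sphere_def by simp
  qed
  have ne: "X \<noteq> {}" using empty by blast
  have full: "X \<inter> full_faces ?I A \<noteq> {}"
    by (rule full_dim_has_full_face[OF bl XS(1) ne]) (use assms(7) S in simp)
  have dim: "complex_dim X = int (join_rank ?I A) - 1" by (rule complex_dim_subcomplex[OF bl XS(1) full])
  \<comment> \<open>For rank 0 the sphere is \<open>{{}}\<close>, and no proper subfamily of it
    contains the empty face.\<close>
  have rank: "0 < join_rank ?I A"
  proof (rule ccontr)
    assume "\<not> 0 < join_rank ?I A"
    have "F = {}" if "F \<in> join_sphere ?I A" for F
    proof -
      have "finite F" using that finite_subset[OF _ blocksD(4)[OF bl]] by (simp add: join_sphere_def)
      then show ?thesis using card_sphere_face(1)[OF bl that] \<open>\<not> 0 < join_rank ?I A\<close> by simp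
    qed
    then show False using XS(2) empty by blast
  qed
  note cm = cohen_macaulay_blocks[where p = p, OF bl X full rank assms(9) assms(8)[unfolded VA_def]]
  have ext: "extremal ?I A X" by (rule cm(1))
  \<comment> \<open>If the complement were void, \<open>X\<close> would be the whole sphere.\<close>
  have "facet_complement ?I A X \<noteq> {}"
    using facet_complement_involutive[OF ext] facet_complement_empty[OF bl] XS(2) by auto
  then have "geometric_realization X homeomorphic_space closed_nball (join_rank ?I A - 1)"
    by (rule extremal_ball[OF ext ne])
  moreover have "nat (complex_dim X) = join_rank ?I A - 1" using dim by simp
  moreover have "constructible (complex_dim X) X" unfolding dim by (rule extremal_constructible[OF ext ne])
  moreover have "squarefree_monomial_ideal VA (stanley_reisner_ideal VA X :: ('v, 'k) mpoly set)"
    by (rule squarefree_stanley_reisner) (use asc in \<open>elim conjE\<close>)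
  then have "polarization ?I (mon_ideal ?I (map_monom p ` {m. supp m \<subseteq> \<Union>(A ` ?I) \<and> supp m \<notin> X})) p VA
    (stanley_reisner_ideal VA X :: ('v, 'k) mpoly set)"
    using cm(2) unfolding polarization_def VA_def by blast
  moreover note artin_ideal_of_complex[where p = p and ?'k = 'k, OF bl X ne XS(2) assms(9)]
  ultimately show ?thesis by (intro conjI exI) simp_all
qed

end
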